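(* A finite soluble group $G$ satisfies $\psi(G)=d(G)$ if and only if either $G$ is a finite $p$-group or there exist a finite vector space $V$, a nontrivial irreducible soluble subgroup $H$ of $\mathrm{Aut}(V)$ and an integer $d>d(H)$ such that $$G/\mathrm{Frat}(G)\cong V^{r(d-2)+1}: H,$$ where $r$ is the dimension of $V$ over $\mathrm{End}_H(V)$ and $H$ acts in the same way on each of the $r(d-2)+1$ factors.
   Context: For a finite group $G$, $d(G)$ denotes the minimum number of generators of $G$, and $\mathrm{Frat}(G)$ its Frattini subgroup. For $x,y\in G$, write $x\equiv_{\mathrm m} y$ if $x$ and $y$ lie in exactly the same maximal subgroups of $G$. For any positive integer $r$, write $x\equiv_{\mathrm m}^{(r)}y$ if for all $z_1,\ldots,z_{r-1}\in G$ one has $\langle x,z_1,\ldots,z_{r-1}\rangle=G$ if and only if $\langle y,z_1,\ldots,z_{r-1}\rangle=G$. These equivalence relations become finer as $r$ increases and their limit is $\equiv_{\mathrm m}$; $\psi(G)$ denotes the least $r$ such that $\equiv_{\mathrm m}^{(r)}$ coincides with $\equiv_{\mathrm m}$. The notation $A:B$ denotes a split extension (semidirect product) with normal subgroup $A$ and complement $B$. $\mathrm{Aut}(V)$ is the group of automorphisms (invertible linear maps) of $V$, and $\mathrm{End}_H(V)$ is the field of endomorphisms of $V$ commuting with the action of $H$.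
   Formalization: V is taken over a prime field (with linearity, irreducibility and End_H(V) over it), since over larger fields the "if" part can fail, e.g. V = F_4^2, H = S_3, d = 3; and "finite p-group" means a nontrivial one, since the trivial group has d = 0 but ψ = 1. *)

theory Defs
  imports
    "HOL-Algebra.Algebra"
    "HOL-Number_Theory.Residues"
    "Jordan_Normal_Form.Missing_VectorSpace"
begin

section \<open>Generation and maximal subgroups\<close>

definition maximal_subgroup :: "'a set \<Rightarrow> ('a, 'b) monoid_scheme \<Rightarrow> bool" where
  "maximal_subgroup M G \<longleftrightarrow>
     subgroup M G \<and> M \<noteq> carrier G \<and>
     (\<forall>L. subgroup L G \<and> M \<subseteq> L \<longrightarrow> L = M \<or> L = carrier G)"

text \<open>The intersection with the carrier gives the whole group when there are no maximal
  subgroups, i.e. for the trivial group among the finite ones.\<close>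

definition frattini :: "('a, 'b) monoid_scheme \<Rightarrow> 'a set" where
  "frattini G = carrier G \<inter> \<Inter> {M. maximal_subgroup M G}"

definition min_gens :: "('a, 'b) monoid_scheme \<Rightarrow> nat" where
  "min_gens G =
     (LEAST n. \<exists>S \<subseteq> carrier G. finite S \<and> card S = n \<and> generate G S = carrier G)"

definition max_equiv :: "('a, 'b) monoid_scheme \<Rightarrow> 'a \<Rightarrow> 'a \<Rightarrow> bool" where
  "max_equiv G x y \<longleftrightarrow> (\<forall>M. maximal_subgroup M G \<longrightarrow> (x \<in> M \<longleftrightarrow> y \<in> M))"

text \<open>Only meaningful for \<open>r \<ge> 1\<close>; the elements \<open>z\<^sub>1, \<dots>, z\<^sub>r\<^sub>-\<^sub>1\<close> form a list, so
  repetitions are allowed.\<close>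

definition gen_equiv :: "('a, 'b) monoid_scheme \<Rightarrow> nat \<Rightarrow> 'a \<Rightarrow> 'a \<Rightarrow> bool" where
  "gen_equiv G r x y \<longleftrightarrow>
     (\<forall>zs. set zs \<subseteq> carrier G \<and> length zs = r - 1 \<longrightarrow>
        (generate G (insert x (set zs)) = carrier G \<longleftrightarrow>
         generate G (insert y (set zs)) = carrier G))"

definition psi :: "('a, 'b) monoid_scheme \<Rightarrow> nat" where
  "psi G =
     (LEAST r. r \<ge> 1 \<and>
        (\<forall>x \<in> carrier G. \<forall>y \<in> carrier G. gen_equiv G r x y \<longleftrightarrow> max_equiv G x y))"


section \<open>Linear groups and their endomorphism rings\<close>

text \<open>As in \<^const>\<open>AutoGroup\<close>, maps are extensional on the carrier of \<open>V\<close>, so that each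
  linear map is represented exactly once.\<close>

definition Aut_space :: "('k, 'm) ring_scheme \<Rightarrow> ('k, 'v, 'n) module_scheme \<Rightarrow> ('v \<Rightarrow> 'v) monoid"
  where "Aut_space K V =
     BijGroup (carrier V) \<lparr>carrier := module_hom K V V \<inter> Bij (carrier V)\<rparr>"

definition irreducible_linear ::
    "('k, 'm) ring_scheme \<Rightarrow> ('k, 'v, 'n) module_scheme \<Rightarrow> ('v \<Rightarrow> 'v) set \<Rightarrow> bool" where
  "irreducible_linear K V H \<longleftrightarrow>
     carrier V \<noteq> {\<zero>\<^bsub>V\<^esub>} \<and>
     (\<forall>W. subspace K W V \<and> (\<forall>h \<in> H. h ` W \<subseteq> W) \<longrightarrow> W = {\<zero>\<^bsub>V\<^esub>} \<or> W = carrier V)"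

definition End_ring ::
    "('k, 'm) ring_scheme \<Rightarrow> ('k, 'v, 'n) module_scheme \<Rightarrow> ('v \<Rightarrow> 'v) set \<Rightarrow> ('v \<Rightarrow> 'v) ring" where
  "End_ring K V H =
     \<lparr>carrier = {f \<in> module_hom K V V \<inter> extensional (carrier V).
                   \<forall>h \<in> H. \<forall>v \<in> carrier V. f (h v) = h (f v)},
      monoid.mult = (\<lambda>f g. compose (carrier V) f g),
      monoid.one = (\<lambda>v \<in> carrier V. v),
      ring.zero = (\<lambda>v \<in> carrier V. \<zero>\<^bsub>V\<^esub>),
      ring.add = (\<lambda>f g. \<lambda>v \<in> carrier V. f v \<oplus>\<^bsub>V\<^esub> g v)\<rparr>"

text \<open>\<open>V\<close> as a module over a ring of its own endomorphisms, acting by evaluation.\<close>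

definition eval_module :: "('k, 'v, 'n) module_scheme \<Rightarrow> ('v \<Rightarrow> 'v, 'v) module" where
  "eval_module V =
     \<lparr>carrier = carrier V, monoid.mult = monoid.mult V, one = one V,
      ring.zero = ring.zero V, ring.add = ring.add V, smult = (\<lambda>f v. f v)\<rparr>"

text \<open>If \<open>V\<close> is finite and \<open>H\<close> irreducible, \<open>End_ring K V H\<close> is a field by Schur's lemma and
  Wedderburn's little theorem, so that \<open>V\<close> is a vector space over it in the sense of
  \<^locale>\<open>vectorspace\<close>.\<close>

definition End_dim ::
    "('k, 'm) ring_scheme \<Rightarrow> ('k, 'v, 'n) module_scheme \<Rightarrow> ('v \<Rightarrow> 'v) set \<Rightarrow> nat" where
  "End_dim K V H = vectorspace.dim (End_ring K V H) (eval_module V)"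


section \<open>Split extensions\<close>

definition semidirect ::
    "('n, 'b) monoid_scheme \<Rightarrow> ('h, 'c) monoid_scheme \<Rightarrow> ('h \<Rightarrow> 'n \<Rightarrow> 'n) \<Rightarrow> ('n \<times> 'h) monoid" where
  "semidirect N H \<phi> =
     \<lparr>carrier = carrier N \<times> carrier H,
      monoid.mult = (\<lambda>(n, h) (n', h'). (n \<otimes>\<^bsub>N\<^esub> \<phi> h n', h \<otimes>\<^bsub>H\<^esub> h')),
      monoid.one = (\<one>\<^bsub>N\<^esub>, \<one>\<^bsub>H\<^esub>)\<rparr>"

text \<open>The group \<open>V\<^sup>k : H\<close>, where \<open>H\<close> acts on every factor in its natural way.\<close>

definition power_split ::
    "('k, 'm) ring_scheme \<Rightarrow> ('k, 'v, 'n) module_scheme \<Rightarrow> ('v \<Rightarrow> 'v) set \<Rightarrow> nat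
      \<Rightarrow> ((nat \<Rightarrow> 'v) \<times> ('v \<Rightarrow> 'v)) monoid" where
  "power_split K V H k =
     semidirect
       (product_group {..<k} (\<lambda>_. add_monoid V))
       (Aut_space K V \<lparr>carrier := H\<rparr>)
       (\<lambda>h f. \<lambda>i \<in> {..<k}. h (f i))"

end

theory Submission
  imports
    "HOL-Computational_Algebra.Polynomial_Factorial"
    "HOL-Computational_Algebra.Fundamental_Theorem_Algebra"
    Defs
begin

text \<open>For \<open>\<psi>(G) = d(G) = d\<close> it suffices that whenever \<open>x\<close> lies outside a maximal subgroup \<open>M\<close> there
  are \<open>z\<^sub>2, \<dots>, z\<^sub>d \<in> M\<close> generating \<open>G\<close> together with \<open>x\<close>; this and \<open>d\<close> itself only depend on
  \<open>G / Frat G\<close>.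

  For an irreducible \<open>G\<close>-module \<open>V\<close> let \<open>Z1\<close> be the group of derivations \<open>G \<rightarrow> V\<close>. Complements of a
  minimal normal subgroup \<open>V\<close> are zero sets of derivations, and averaging over the lifts of a
  generating tuple of \<open>G / V\<close> shows that fewer than \<open>|V|^n\<close> derivations can always be made nonzero
  somewhere on a lift of an \<open>n\<close>-tuple. If \<open>G\<close> is the split extension of \<open>V^k\<close> by \<open>H\<close> and
  \<open>F = End V\<close>, then \<open>|Z1| = |F|^k |V|\<close>, because derivations of \<open>H\<close> are inner, and
  \<open>k = r (d - 2) + 1\<close> says exactly that \<open>|Z1| = |F| |V|^(d - 1)\<close>. So the derivations vanishing at a
  given \<open>x\<close> are few enough to be avoided by \<open>d - 1\<close> elements, while \<open>d - 1\<close> elements alone do not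
  generate.

  Conversely, let \<open>Frat G = 1\<close> and let \<open>V\<close> be a minimal normal subgroup. Every \<open>x \<noteq> 1\<close> belongs to a
  generating \<open>d\<close>-tuple. The averaging argument forces \<open>|Z1| = |F| |V|^(d - 1)\<close>, which is too large for
  all derivations to vanish at some \<open>x \<noteq> 1\<close>. Hence \<open>C(V)\<close> embeds in a power of \<open>V\<close>, and a minimal
  separating family of derivations makes it equal to \<open>V^k\<close>. If \<open>C(V) = G\<close>, then \<open>G\<close> is a \<open>p\<close>-group;
  otherwise \<open>G\<close> splits over \<open>V^k\<close> and comparing the two values of \<open>|Z1|\<close> determines \<open>k\<close>.\<close>

section \<open>Cyclotomic values and Wedderburn's little theorem\<close>

text \<open>All estimates compare cardinalities, and the number |F| |V|^(d - 1) is the meeting point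
  of two of them. A derivation is determined by its values on generators, so more than |V|^(d - 1)
  derivations rule out d - 1 generators. Conversely, if some derivation \<delta> is nonzero at x,
  the derivations f \<delta> with f in F take distinct values at x by Schur's lemma, so that
  demanding value zero at x costs at least a factor |F|. At most |V|^(d - 1) derivations remain, and
  since the zero derivation never obstructs generation, strictly fewer have to be avoided. The field
  structure of F enters only through the exponent r: the equation |V| = |F|^r needs a dimension over
  F, hence commutativity of F. This is why Wedderburn's theorem, and with it a cyclotomic value,
  stands at the beginning. If G acts trivially on V, the inner derivations vanish and no complement
  H acts; this is the p-group case, which is settled by exchanging generators modulo the Frattini
  subgroup instead of counting derivations.\<close>

lemma of_int_poly_mult:
  "map_poly of_int (p * q) = (map_poly of_int p * map_poly of_int q :: 'a::comm_ring_1 poly)"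
  by (rule poly_eqI) (simp add: coeff_map_poly coeff_mult)

lemma of_int_poly_at_int: "poly (map_poly of_int p) (of_int z) = (of_int (poly p z) :: 'a::comm_ring_1)"
  by (induction p) (simp_all add: map_poly_pCons)

text \<open>Induction along a prime factorisation in \<open>int poly\<close>: a root of a product is
  a root of one of the factors, and a nonzero constant has no root. The factor found serves as a
  minimal polynomial of \<open>z\<close> over the integers.\<close>

lemma int_poly_prime_factor_with_root:
  fixes p :: "int poly" and z :: complex
  assumes "p \<noteq> 0" and "poly (map_poly of_int p) z = 0"
  shows "\<exists>m. prime_elem m \<and> m dvd p \<and> poly (map_poly of_int m) z = 0"
  using assms
proof (induction p rule: prime_divisors_induct)
  case (unit x)
  then obtain c where c: "x = [:c:]" "c dvd 1" by (auto simp: is_unit_poly_iff)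
  then show ?case using unit by (simp add: map_poly_pCons)
next
  case (factor p x)
  show ?case
  proof (cases "poly (map_poly of_int p) z = 0")
    case True then show ?thesis using factor by (intro exI[of _ p]) auto
  next
    case False
    then have "poly (map_poly of_int x) z = 0" using factor.prems by (simp add: of_int_poly_mult)
    then obtain m where "prime_elem m" "m dvd x" "poly (map_poly of_int m) z = 0"
      using factor by auto
    then show ?thesis by (intro exI[of _ m]) auto
  qed
qed auto

text \<open>On the unit circle only 1 has real part 1, so the real part of \<open>q - z\<close>
  alone already exceeds \<open>q - 1\<close>. The strictness is what finally contradicts the class
  equation.\<close>

lemma norm_int_minus_unit_gt:
  fixes z :: complex
  assumes "norm z = 1" "z \<noteq> 1" "q \<ge> (2::int)"
  shows "norm (of_int q - z) > of_int q - 1"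
proof -
  have "Re z \<noteq> 1"
  proof
    assume "Re z = 1"
    moreover have "(Re z)^2 + (Im z)^2 = 1" using assms(1) by (simp add: cmod_def)
    ultimately show False using assms(2) by (auto simp: complex_eq_iff)
  qed
  moreover have "Re z \<le> 1" using complex_Re_le_cmod[of z] assms by simp
  ultimately have "of_int q - 1 < Re (of_int q - z)" by simp
  also have "\<dots> \<le> norm (of_int q - z)" by (rule complex_Re_le_cmod)
  finally show ?thesis .
qed

text \<open>The witness is the value at \<open>q\<close> of the \<open>n\<close>-th cyclotomic polynomial, obtained as the prime
  factor of \<open>X^n - 1\<close> that vanishes at a primitive \<open>n\<close>-th root of unity.\<close>

lemma cyclotomic_divisor:
  fixes q :: int
  assumes n: "n \<ge> 2" and q: "q \<ge> 2"
  obtains c :: int where "\<bar>c\<bar> > q - 1"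
    "\<And>d. \<lbrakk>d dvd n; 0 < d; d < n\<rbrakk> \<Longrightarrow> c * (q ^ d - 1) dvd q ^ n - 1"
proof -
  define Xp :: "nat \<Rightarrow> int poly" where "Xp = (\<lambda>k. Polynomial.monom 1 k - 1)"
  define \<zeta> :: complex where "\<zeta> = cis (2 * pi / n)"
  have ev: "poly (map_poly of_int (Xp k)) z = z ^ k - 1" for k and z :: complex
  proof -
    have "map_poly of_int (Xp k) = (Polynomial.monom 1 k - 1 :: complex poly)"
      by (rule poly_eqI) (simp add: Xp_def coeff_map_poly)
    then show ?thesis by (simp add: poly_monom)
  qed
  have Xq: "poly (Xp k) q = q ^ k - 1" for k by (simp add: Xp_def poly_monom)
  have Xnz: "Xp k \<noteq> 0" if "k > 0" for k
  proof
    assume "Xp k = 0"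
    then have "poly (Xp k) q = 0" by simp
    moreover have "q ^ k > 1" using that q by (intro one_less_power) auto
    ultimately show False by (simp add: Xq)
  qed
  have z_n: "\<zeta> ^ n = 1" using n by (simp add: \<zeta>_def DeMoivre)
  have z_d: "\<zeta> ^ d \<noteq> 1" if "0 < d" "d < n" for d
  proof
    assume "\<zeta> ^ d = 1"
    then have "cis (2 * pi * (d / n)) = 1" by (simp add: \<zeta>_def DeMoivre mult_ac)
    then have "cos (2 * pi * (d / n)) = 1" by (metis Re_complex_of_real cis.sel(1) one_complex.simps(1))
    then obtain i :: int where "2 * pi * (d / n) = of_int i * 2 * pi"
      using cos_one_2pi_int by auto
    then have "(2 * pi) * (real d / real n) = (2 * pi) * of_int i" by (simp only: mult_ac)
    then have "real d / real n = of_int i" by (simp only: mult_cancel_left) simp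
    then have "real d = of_int i * real n" using n by (simp add: field_simps)
    then have "int d = i * int n" by (metis of_int_eq_iff of_int_mult of_int_of_nat_eq)
    then have "int n dvd int d" by simp
    then show False using that by (simp add: nat_dvd_not_less)
  qed
  obtain m where m: "prime_elem m" "m dvd Xp n" "poly (map_poly of_int m) \<zeta> = 0"
    using int_poly_prime_factor_with_root[of "Xp n" \<zeta>] Xnz[of n] n z_n by (auto simp: ev)
  \<comment> \<open>The cofactor 1 + X^d + ... + X^(d (e - 1)) takes the value \<open>e\<close> at
    every \<open>d\<close>-th root of unity. It absorbs the prime \<open>m\<close>, because X^d - 1
    does not vanish at \<zeta>. The case \<open>d = 1\<close> shows later that 1 is not a root of
    \<open>m\<close>.\<close>
  have fac: "\<exists>P. Xp n = P * Xp d \<and> m dvd P \<and> (\<forall>z::complex. z ^ d = 1 \<longrightarrow> poly (map_poly of_int P) z \<noteq> 0)"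
    if d: "d dvd n" "0 < d" "d < n" for d
  proof -
    obtain e where e: "n = d * e" using d by auto
    define P :: "int poly" where "P = (\<Sum>i<e. Polynomial.monom 1 d ^ i)"
    have P: "Xp n = P * Xp d"
      using power_diff_1_eq[of "Polynomial.monom (1::int) d" e]
      by (simp add: Xp_def P_def e monom_power mult.commute)
    have "\<not> m dvd Xp d"
    proof
      assume "m dvd Xp d"
      then obtain t where "Xp d = m * t" by auto
      then have "poly (map_poly of_int (Xp d)) \<zeta> = 0" using m by (simp add: of_int_poly_mult)
      then show False using z_d d by (simp add: ev)
    qed
    then have "m dvd P" using m P prime_elem_dvd_mult_iff by metis
    moreover have "poly (map_poly of_int P) z \<noteq> 0" if "z ^ d = 1" for z :: complex
    proof -
      have "map_poly of_int P = (\<Sum>i<e. Polynomial.monom 1 d ^ i :: complex poly)"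
        by (rule poly_eqI) (auto simp: P_def coeff_map_poly coeff_sum monom_power intro!: sum.cong)
      then have "poly (map_poly of_int P) z = of_nat e"
        using that by (simp add: poly_sum poly_monom)
      then show ?thesis using e n by (cases e) (auto simp del: of_nat_Suc)
    qed
    ultimately show ?thesis using P by auto
  qed
  define mc :: "complex poly" where "mc = map_poly of_int m"
  have mnz: "m \<noteq> 0" using m by auto
  have lc: "Polynomial.lead_coeff mc = of_int (Polynomial.lead_coeff m)" "m \<noteq> 0" "mc \<noteq> 0"
    using mnz by (auto simp: mc_def coeff_map_poly degree_map_poly map_poly_eq_0_iff)
  have roots: "norm z = 1 \<and> z \<noteq> 1" if "poly mc z = 0" for z
  proof -
    obtain t where "Xp n = m * t" using m by auto
    then have "poly (map_poly of_int (Xp n)) z = 0" using that by (simp add: of_int_poly_mult mc_def)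
    then have zn: "z ^ n = 1" by (simp add: ev)
    have "norm z ^ n = 1 ^ n" using arg_cong[OF zn, of norm] by (simp add: norm_power)
    then have "norm z = 1" using n power_eq_iff_eq_base[of n "norm z" 1] by simp
    moreover have "z \<noteq> 1"
    proof
      assume "z = 1"
      obtain P where P: "m dvd P" "\<forall>z::complex. z ^ 1 = 1 \<longrightarrow> poly (map_poly of_int P) z \<noteq> 0"
        using fac[of 1] n by auto
      then obtain t where "P = m * t" by auto
      then have "poly (map_poly of_int P) z = 0" using that by (simp add: of_int_poly_mult mc_def)
      then show False using P \<open>z = 1\<close> by auto
    qed
    ultimately show ?thesis by auto
  qed
  \<comment> \<open>Over the complex numbers \<open>c\<close> is the lead coefficient times the
    product of all \<open>q - z\<close>. The lead coefficient is a nonzero integer, every factor has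
    norm at least 1 because \<open>q \<ge> 2\<close>, and the factor at \<zeta> alone exceeds
    \<open>q - 1\<close>.\<close>
  define c where "c = poly m q"
  have "of_int c = poly mc (of_int q)" by (simp add: c_def mc_def of_int_poly_at_int)
  also have "\<dots> = poly (Polynomial.smult (Polynomial.lead_coeff mc) (\<Prod>z|poly mc z = 0. [:-z, 1:] ^ Polynomial.order z mc)) (of_int q)"
    by (simp only: complex_poly_decompose)
  also have "\<dots> = Polynomial.lead_coeff mc * (\<Prod>z|poly mc z = 0. (of_int q - z) ^ Polynomial.order z mc)"
    by (simp add: poly_prod)
  finally have cc: "norm (of_int c :: complex) = norm (Polynomial.lead_coeff mc) *
      (\<Prod>z|poly mc z = 0. norm (of_int q - z) ^ Polynomial.order z mc)"
    by (simp add: norm_mult norm_power flip: prod_norm)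
  have fin: "finite {z. poly mc z = 0}" using lc by (simp add: poly_roots_finite)
  have zin: "\<zeta> \<in> {z. poly mc z = 0}" using m by (simp add: mc_def)
  have ge1: "1 \<le> norm (of_int q - z) ^ Polynomial.order z mc" if "poly mc z = 0" for z
    using norm_int_minus_unit_gt[of z q] roots[OF that] q by (intro one_le_power) auto
  have "of_int q - 1 < norm (of_int q - \<zeta>)"
    using norm_int_minus_unit_gt[of \<zeta> q] roots[of \<zeta>] zin q by auto
  also have "\<dots> = norm (of_int q - \<zeta>) ^ 1" by simp
  also have "\<dots> \<le> norm (of_int q - \<zeta>) ^ Polynomial.order \<zeta> mc"
    using norm_int_minus_unit_gt[of \<zeta> q] roots[of \<zeta>] zin q lc
    by (intro power_increasing) (auto simp: order_root Suc_le_eq)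
  also have "\<dots> = norm (of_int q - \<zeta>) ^ Polynomial.order \<zeta> mc * 1" by simp
  also have "\<dots> \<le> norm (of_int q - \<zeta>) ^ Polynomial.order \<zeta> mc *
      (\<Prod>z\<in>{z. poly mc z = 0} - {\<zeta>}. norm (of_int q - z) ^ Polynomial.order z mc)"
    using ge1 by (intro mult_left_mono prod_ge_1) auto
  also have "\<dots> = (\<Prod>z|poly mc z = 0. norm (of_int q - z) ^ Polynomial.order z mc)"
    using prod.remove[OF fin zin, of "\<lambda>z. norm (of_int q - z) ^ Polynomial.order z mc"] by simp
  finally have low: "of_int q - 1 < (\<Prod>z|poly mc z = 0. norm (of_int q - z) ^ Polynomial.order z mc)"
    (is "_ < ?P") .
  have "1 \<le> \<bar>Polynomial.lead_coeff m\<bar>" using mnz leading_coeff_0_iff[of m] by linarith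
  then have "(1::real) \<le> of_int \<bar>Polynomial.lead_coeff m\<bar>" by linarith
  then have "1 \<le> norm (Polynomial.lead_coeff mc)" by (simp add: lc(1))
  moreover have "?P \<ge> 0" by (rule prod_nonneg) simp
  ultimately have "1 * ?P \<le> norm (Polynomial.lead_coeff mc) * ?P" by (rule mult_right_mono)
  then have "of_int q - 1 < norm (of_int c :: complex)" using low cc by linarith
  then have "of_int (q - 1) < (of_int \<bar>c\<bar> :: real)" by simp
  then have c1: "\<bar>c\<bar> > q - 1" by linarith
  have "c * (q ^ d - 1) dvd q ^ n - 1" if dn: "d dvd n" "0 < d" "d < n" for d
  proof -
    obtain P where P: "Xp n = P * Xp d" "m dvd P" using fac[OF dn] by blast
    then obtain t where "Xp n = m * t * Xp d" by auto
    then have "poly (Xp n) q = c * poly t q * poly (Xp d) q" by (simp add: c_def)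
    then show ?thesis by (simp add: Xq)
  qed
  with c1 show ?thesis by (rule that)
qed

hide_const (open) Polynomial.order Polynomial.monom Polynomial.smult

section \<open>Orbit counting and finite division rings\<close>

lemma (in group_action) dvd_card_minus_fixed:
  assumes fin: "finite E"
    and orb: "\<And>x. \<lbrakk>x \<in> E; \<exists>g\<in>carrier G. \<phi> g x \<noteq> x\<rbrakk> \<Longrightarrow> c dvd int (card (orbit G \<phi> x))"
  shows "c dvd int (card E) - int (card {x \<in> E. \<forall>g\<in>carrier G. \<phi> g x = x})"
proof -
  let ?F = "{x \<in> E. \<forall>g\<in>carrier G. \<phi> g x = x}"
  \<comment> \<open>The indicator of the moved points: its sum over an orbit is 0 for a fixed point
    and the size of the orbit otherwise, so the class equation can be read off modulo
    \<open>c\<close>.\<close>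
  let ?f = "\<lambda>x. if x \<in> ?F then 0 else (1::int)"
  interpret GH: group_hom G "BijGroup E" \<phi> by (rule group_hom)
  have oneG: "\<one> \<in> carrier G" "\<And>x. x \<in> E \<Longrightarrow> \<phi> \<one> x = x"
    using fun_cong[OF id_eq_one] by (simp_all del: GH.hom_one) (metis restrict_apply')
  have "int (card E) - int (card ?F) = (\<Sum>x\<in>E. ?f x)"
  proof -
    have "(\<Sum>x\<in>E. ?f x) = (\<Sum>x\<in>E - ?F. ?f x) + (\<Sum>x\<in>?F. ?f x)"
      by (rule sum.subset_diff) (use fin in auto)
    also have "(\<Sum>x\<in>?F. ?f x) = 0" by (rule sum.neutral) auto
    also have "(\<Sum>x\<in>E - ?F. ?f x) = (\<Sum>x\<in>E - ?F. 1)" by (rule sum.cong) auto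
    finally have "(\<Sum>x\<in>E. ?f x) = int (card (E - ?F))" by simp
    also have "card (E - ?F) = card E - card ?F" by (rule card_Diff_subset) (use fin in auto)
    also have "int \<dots> = int (card E) - int (card ?F)" using fin by (simp add: card_mono)
    finally show ?thesis by simp
  qed
  also have "\<dots> = (\<Sum>orb\<in>orbits G E \<phi>. \<Sum>x\<in>orb. ?f x)" by (simp add: disjoint_sum[OF fin])
  also have "c dvd \<dots>"
  proof (rule dvd_sum)
    fix b assume b: "b \<in> orbits G E \<phi>"
    then obtain x where x: "x \<in> E" "b = orbit G \<phi> x" by (auto simp: orbits_def)
    show "c dvd (\<Sum>y\<in>b. ?f y)"
    proof (cases "x \<in> ?F")
      case True
      then have "b = {x}" using x orbit_refl[OF x(1)] by (auto simp: orbit_def)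
      then show ?thesis using True by simp
    next
      case False
      have "y \<notin> ?F" if "y \<in> b" for y
      proof
        assume yF: "y \<in> ?F"
        then have "x \<in> orbit G \<phi> y" using orbit_sym[OF x(1), of y] that x by auto
        then have "x = y" using yF by (auto simp: orbit_def)
        then show False using False yF by simp
      qed
      then have "(\<Sum>y\<in>b. ?f y) = (\<Sum>y\<in>b. 1)" by (intro sum.cong) auto
      then show ?thesis using orb[OF x(1)] False x by auto
    qed
  qed
  finally show ?thesis .
qed

text \<open>Counts coordinate vectors with respect to a basis; a finite basis exists because the
  finite carrier spans itself.\<close>

lemma (in vectorspace) card_eq_power_dim:
  assumes finK: "finite (carrier K)" and finV: "finite (carrier V)"
  shows "card (carrier V) = card (carrier K) ^ dim"
proof -
  have "span (carrier V) = carrier V"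
    using span_is_subset2[of "carrier V"] in_own_span[of "carrier V"] by blast
  then have "fin_dim" unfolding fin_dim_def using finV by blast
  then obtain B where B: "finite B" "basis B" using finite_basis_exists by blast
  then have Bc: "B \<subseteq> carrier V" by (simp add: basis_def)
  have ex: "\<forall>v. v \<in> carrier V \<longrightarrow> (\<exists>!a. a \<in> B \<rightarrow>\<^sub>E carrier K \<and> lincomb a B = v)"
    using basis_criterion[OF B(1) Bc] B by blast
  have cl: "lincomb a B \<in> carrier V" if "a \<in> B \<rightarrow>\<^sub>E carrier K" for a
    using that Bc by (intro lincomb_closed) auto
  have "bij_betw (\<lambda>a. lincomb a B) (B \<rightarrow>\<^sub>E carrier K) (carrier V)"
    unfolding bij_betw_def inj_on_def
  proof (intro conjI ballI impI)
    fix a b assume "a \<in> B \<rightarrow>\<^sub>E carrier K" "b \<in> B \<rightarrow>\<^sub>E carrier K" "lincomb a B = lincomb b B"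
    then show "a = b" using ex cl by metis
  next
    show "(\<lambda>a. lincomb a B) ` (B \<rightarrow>\<^sub>E carrier K) = carrier V"
    proof
      show "(\<lambda>a. lincomb a B) ` (B \<rightarrow>\<^sub>E carrier K) \<subseteq> carrier V" using cl by blast
      show "carrier V \<subseteq> (\<lambda>a. lincomb a B) ` (B \<rightarrow>\<^sub>E carrier K)"
      proof
        fix v assume "v \<in> carrier V"
        then obtain a where "a \<in> B \<rightarrow>\<^sub>E carrier K" "lincomb a B = v" using ex by blast
        then show "v \<in> (\<lambda>a. lincomb a B) ` (B \<rightarrow>\<^sub>E carrier K)" by blast
      qed
    qed
  qed
  then have "card (carrier V) = card (B \<rightarrow>\<^sub>E carrier K)" by (simp add: bij_betw_same_card)
  also have "\<dots> = card (carrier K) ^ card B" using B by (simp add: card_PiE)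
  also have "card B = dim" using dim_basis[OF B] by simp
  finally show ?thesis .
qed

text \<open>Euclid's algorithm carried out in the exponents: modulo \<open>q ^ d - 1\<close>, the
  number \<open>q ^ n - 1\<close> agrees with \<open>q ^ (n - d) - 1\<close>.\<close>

lemma power_minus_one_dvd_imp_dvd:
  fixes q :: nat
  assumes q: "q \<ge> 2" and d: "q ^ d - 1 dvd q ^ n - 1"
  shows "d dvd n"
  using d
proof (induction n rule: less_induct)
  case (less n)
  show ?case
  proof (cases "n < d")
    case True
    show ?thesis
    proof (cases "n = 0")
      case False
      then have "1 < q ^ n" using q by (intro one_less_power) auto
      moreover have "q ^ n < q ^ d" using True q by (intro power_strict_increasing) auto
      ultimately have "0 < q ^ n - 1" "q ^ n - 1 < q ^ d - 1" by auto
      then show ?thesis using less.prems by (meson dvd_imp_le not_le)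
    qed auto
  next
    case False
    show ?thesis
    proof (cases "d = 0")
      case True
      then have "q ^ n = 1" using less.prems q by (cases "q ^ n") auto
      then show ?thesis using q by simp
    next
      case d0: False
      have "q ^ n = q ^ (n - d) * q ^ d" using False by (simp flip: power_add)
      moreover have "q ^ d \<ge> 1" "q ^ (n - d) \<ge> 1" using q by auto
      ultimately have "q ^ n - 1 = q ^ (n - d) * (q ^ d - 1) + (q ^ (n - d) - 1)"
        by (simp add: diff_mult_distrib2)
      then have "q ^ d - 1 dvd q ^ (n - d) - 1"
        using less.prems by (metis dvd_add_right_iff dvd_triv_right)
      then have "d dvd n - d" using less.IH[of "n - d"] False d0 by auto
      then show ?thesis using False by (metis dvd_diffD dvd_refl not_le)
    qed
  qed
qed

text \<open>Wedderburn's little theorem, by Witt's argument: the class equation of the unit group,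
  taken modulo a cyclotomic value.\<close>

lemma (in ring) finite_division_ring_is_field:
  assumes fin: "finite (carrier R)" and one: "\<one> \<noteq> \<zero>"
    and inv_ex: "\<And>x. \<lbrakk>x \<in> carrier R; x \<noteq> \<zero>\<rbrakk> \<Longrightarrow> \<exists>y\<in>carrier R. x \<otimes> y = \<one> \<and> y \<otimes> x = \<one>"
  shows "field R"
proof -
  have Un: "Units R = carrier R - {\<zero>}"
    using inv_ex one by (auto simp: Units_def)
  have "units_of R = mult_of R" by (simp add: units_of_def mult_of_def Un)
  then interpret G: group "mult_of R" using units_group by simp
  define C where "C = (\<lambda>x. {y \<in> carrier R. x \<otimes> y = y \<otimes> x})"
  define Z where "Z = {z \<in> carrier R. \<forall>y\<in>carrier R. z \<otimes> y = y \<otimes> z}"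
  define K where "K = R\<lparr>carrier := Z\<rparr>"
  have Zc: "Z \<subseteq> carrier R" by (auto simp: Z_def)
  have Zm: "a \<otimes> b \<in> Z" if "a \<in> Z" "b \<in> Z" for a b
  proof -
    have "a \<otimes> b \<otimes> y = y \<otimes> (a \<otimes> b)" if y: "y \<in> carrier R" for y
    proof -
      have ab: "a \<in> carrier R" "b \<in> carrier R" "b \<otimes> y = y \<otimes> b" "a \<otimes> y = y \<otimes> a"
        using \<open>a \<in> Z\<close> \<open>b \<in> Z\<close> y by (auto simp: Z_def)
      have "a \<otimes> b \<otimes> y = a \<otimes> (y \<otimes> b)" using ab(1,2) y by (simp add: m_assoc flip: ab(3))
      also have "\<dots> = a \<otimes> y \<otimes> b" using ab(1,2) y by (simp add: m_assoc)
      also have "\<dots> = y \<otimes> a \<otimes> b" by (simp only: ab)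
      also have "\<dots> = y \<otimes> (a \<otimes> b)" using ab(1,2) y by (simp add: m_assoc)
      finally show ?thesis .
    qed
    moreover have "a \<otimes> b \<in> carrier R" using that Zc by blast
    ultimately show ?thesis unfolding Z_def by blast
  qed
  have Zcomm: "a \<otimes> b = b \<otimes> a" if "a \<in> Z" "b \<in> Z" for a b using that unfolding Z_def by blast
  have Za: "a \<oplus> b \<in> Z" if "a \<in> Z" "b \<in> Z" for a b
    using that by (auto simp: Z_def l_distr r_distr)
  have Zn: "\<ominus> a \<in> Z" if "a \<in> Z" for a using that by (auto simp: Z_def l_minus r_minus)
  have Z01: "\<zero> \<in> Z" "\<one> \<in> Z" by (auto simp: Z_def)
  have Kf: "field K"
  proof -
    have "cring K"
    proof (rule cringI)
      show "abelian_group K"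
      proof (rule abelian_groupI)
        fix x assume "x \<in> carrier K"
        then show "\<exists>y\<in>carrier K. y \<oplus>\<^bsub>K\<^esub> x = \<zero>\<^bsub>K\<^esub>"
          using Zn[of x] Zc by (auto simp: K_def intro!: bexI[of _ "\<ominus> x"] l_neg)
      qed (use Za Z01 Zc in \<open>auto simp: K_def a_assoc a_comm a_lcomm subset_iff\<close>)
      show "comm_monoid K"
        by (rule comm_monoidI) (use Zm Z01 Zc in \<open>auto simp: K_def m_assoc subset_iff intro: Zcomm\<close>)
    qed (use Zc in \<open>auto simp: K_def subset_iff l_distr\<close>)
    then show ?thesis
    proof (rule cring.cring_fieldI2)
      show "\<zero>\<^bsub>K\<^esub> \<noteq> \<one>\<^bsub>K\<^esub>" using one by (simp add: K_def)
      fix a assume a: "a \<in> carrier K" "a \<noteq> \<zero>\<^bsub>K\<^esub>"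
      then have aR: "a \<in> Z" "a \<in> carrier R" "a \<noteq> \<zero>" using Zc by (auto simp: K_def)
      then obtain b where b: "b \<in> carrier R" "a \<otimes> b = \<one>" "b \<otimes> a = \<one>" using inv_ex by blast
      have "b \<otimes> y = y \<otimes> b" if y: "y \<in> carrier R" for y
      proof -
        have "b \<otimes> y = b \<otimes> (y \<otimes> a) \<otimes> b" using b y aR by (simp add: m_assoc)
        also have "y \<otimes> a = a \<otimes> y" using aR y by (auto simp: Z_def)
        also have "b \<otimes> (a \<otimes> y) \<otimes> b = (b \<otimes> a) \<otimes> y \<otimes> b" using b(1) y aR(2) by (simp add: m_assoc)
        finally show ?thesis using b y by simp
      qed
      then have "b \<in> Z" using b by (auto simp: Z_def)
      then show "\<exists>b\<in>carrier K. a \<otimes>\<^bsub>K\<^esub> b = \<one>\<^bsub>K\<^esub>" using b by (auto simp: K_def)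
    qed
  qed
  \<comment> \<open>The centraliser of \<open>x\<close> with the centre acting on it by
    multiplication. As a vector space over the centre its size is a power of
    \<open>q\<close>.\<close>
  define M where "M = (\<lambda>x. \<lparr>carrier = C x, monoid.mult = (\<otimes>), one = \<one>, ring.zero = \<zero>, ring.add = (\<oplus>), smult = (\<otimes>)\<rparr>)"
  have Mv: "vectorspace K (M x)" if x: "x \<in> carrier R" for x
  proof (rule vs_criteria[OF Kf])
    have Cn: "\<ominus> v \<in> C x" if "v \<in> C x" for v using that x by (auto simp: C_def l_minus r_minus)
    show "\<forall>v\<in>carrier (M x). \<exists>neg_v\<in>carrier (M x). v \<oplus>\<^bsub>M x\<^esub> neg_v = \<zero>\<^bsub>M x\<^esub>"
      using Cn by (auto simp: M_def C_def intro!: bexI r_neg)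
    show "\<forall>c v. c \<in> carrier K \<and> v \<in> carrier (M x) \<longrightarrow> c \<odot>\<^bsub>M x\<^esub> v \<in> carrier (M x)"
    proof (intro allI impI)
      fix c v assume *: "c \<in> carrier K \<and> v \<in> carrier (M x)"
      then have c: "c \<in> carrier R" "x \<otimes> c = c \<otimes> x" "v \<in> carrier R" "x \<otimes> v = v \<otimes> x" 
        using x by (auto simp: K_def Z_def M_def C_def)
      have "x \<otimes> (c \<otimes> v) = (x \<otimes> c) \<otimes> v" using c(1,3) x by (simp add: m_assoc)
      also have "\<dots> = (c \<otimes> x) \<otimes> v" by (simp only: c(2))
      also have "\<dots> = c \<otimes> (x \<otimes> v)" using c(1,3) x by (simp add: m_assoc)
      also have "\<dots> = c \<otimes> (v \<otimes> x)" by (simp only: c(4))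
      also have "\<dots> = (c \<otimes> v) \<otimes> x" using c(1,3) x by (simp add: m_assoc)
      finally have "x \<otimes> (c \<otimes> v) = (c \<otimes> v) \<otimes> x" .
      then show "c \<odot>\<^bsub>M x\<^esub> v \<in> carrier (M x)" using c by (auto simp: M_def C_def)
    qed
  qed (use x Zc in \<open>auto simp: M_def C_def K_def l_distr r_distr a_comm a_assoc a_lcomm m_assoc subset_iff\<close>)
  define q where "q = card Z"
  have finZ: "finite Z" using fin Zc finite_subset by blast
  have q2: "q \<ge> 2"
    using card_mono[OF finZ, of "{\<zero>, \<one>}"] Z01 one by (auto simp: q_def)
  have dimC: "\<exists>d. card (C x) = q ^ d" if x: "x \<in> carrier R" for x
  proof -
    interpret M: vectorspace K "M x" by (rule Mv[OF x])
    have "card (carrier (M x)) = card (carrier K) ^ M.dim"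
      by (rule M.card_eq_power_dim) (use finZ fin in \<open>auto simp: K_def M_def C_def\<close>)
    then show ?thesis by (auto simp: K_def M_def q_def)
  qed
  have "C \<one> = carrier R" by (auto simp: C_def)
  then obtain n where n: "card (carrier R) = q ^ n" using dimC[of \<one>] by auto
  have "Z = carrier R"
  proof (rule ccontr)
    assume ZR: "Z \<noteq> carrier R"
    then have lt: "q < q ^ n" unfolding q_def n[symmetric, unfolded q_def]
      using psubset_card_mono[OF fin, of Z] Zc by (auto simp: n q_def)
    then have n2: "n \<ge> 2" using q2 by (cases n; cases "n - 1") auto
    interpret A: group_action "mult_of R" "carrier (mult_of R)"
      "\<lambda>g. \<lambda>h\<in>carrier (mult_of R). g \<otimes>\<^bsub>mult_of R\<^esub> h \<otimes>\<^bsub>mult_of R\<^esub> inv\<^bsub>mult_of R\<^esub> g"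
      by (rule G.action_by_conjugation)
    let ?E = "carrier (mult_of R)"
    let ?\<phi> = "\<lambda>g. \<lambda>h\<in>carrier (mult_of R). g \<otimes>\<^bsub>mult_of R\<^esub> h \<otimes>\<^bsub>mult_of R\<^esub> inv\<^bsub>mult_of R\<^esub> g"
    have fix_iff: "?\<phi> g x = x \<longleftrightarrow> x \<otimes> g = g \<otimes> x" if "g \<in> ?E" "x \<in> ?E" for g x
    proof -
      have "?\<phi> g x = x \<longleftrightarrow> g \<otimes>\<^bsub>mult_of R\<^esub> x = x \<otimes>\<^bsub>mult_of R\<^esub> g"
        using that G.inv_solve_right'[of x "g \<otimes>\<^bsub>mult_of R\<^esub> x" g] G.m_closed[OF that] by auto
      then show ?thesis by auto
    qed
    have stab: "stabilizer (mult_of R) ?\<phi> x = C x - {\<zero>}" if "x \<in> ?E" for x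
      using fix_iff[OF _ that] that by (auto simp: stabilizer_def C_def simp del: restrict_apply)
    have Fix: "{x \<in> ?E. \<forall>g\<in>?E. ?\<phi> g x = x} = Z - {\<zero>}"
      using fix_iff by (fastforce simp: Z_def simp del: restrict_apply)
    obtain c :: int where c: "\<bar>c\<bar> > int q - 1"
        "\<And>d. \<lbrakk>d dvd n; 0 < d; d < n\<rbrakk> \<Longrightarrow> c * (int q ^ d - 1) dvd int q ^ n - 1"
      using cyclotomic_divisor[of n "int q"] n2 q2 by auto
    have cardE: "card ?E = q ^ n - 1" using n fin by (simp add: card_Diff_singleton)
    \<comment> \<open>The orbit of a noncentral unit has (q^n - 1) / (q^d - 1) elements for a proper
      divisor \<open>d\<close> of \<open>n\<close>. Since \<open>c * (q ^ d - 1)\<close> still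
      divides \<open>q ^ n - 1\<close>, cancelling \<open>q ^ d - 1\<close> leaves \<open>c\<close>
      as a divisor of the orbit size.\<close>
    have orb: "c dvd int (card (orbit (mult_of R) ?\<phi> x))"
      if x: "x \<in> ?E" and nf: "\<exists>g\<in>carrier (mult_of R). ?\<phi> g x \<noteq> x" for x
    proof -
      obtain d where d: "card (C x) = q ^ d" using dimC x by auto
      have "C x \<subset> carrier R" using nf fix_iff[OF _ x] by (auto simp: C_def)
      then have "q ^ d < q ^ n" using psubset_card_mono[OF fin, of "C x"] d n by simp
      then have dn: "d < n" using q2 power_less_imp_less_exp[of q d n] by auto
      have "\<zero> \<in> C x" using x by (auto simp: C_def)
      then have stc: "card (stabilizer (mult_of R) ?\<phi> x) = q ^ d - 1"
        using stab[OF x] d by (simp add: card_Diff_singleton)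
      have os: "card (orbit (mult_of R) ?\<phi> x) * (q ^ d - 1) = q ^ n - 1"
        using A.orbit_stabilizer_theorem[OF x] unfolding stc by (simp only: Coset.order_def cardE)
      have "q ^ d - 1 dvd q ^ n - 1" unfolding os[symmetric] by (rule dvd_triv_right)
      then have "d dvd n" by (rule power_minus_one_dvd_imp_dvd[OF q2])
      moreover have d0: "d > 0"
      proof (rule ccontr)
        assume "\<not> d > 0"
        then have "q ^ n - 1 = 0" using os by simp
        then show False using lt q2 by linarith
      qed
      ultimately have "c * (int q ^ d - 1) dvd int q ^ n - 1" using c dn by blast
      also have "int q ^ n - 1 = int (q ^ n - 1)" using q2 by (simp add: of_nat_diff)
      also have "\<dots> = int (card (orbit (mult_of R) ?\<phi> x)) * (int q ^ d - 1)"
        unfolding os[symmetric] using q2 by (simp add: of_nat_diff)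
      finally have "c * (int q ^ d - 1) dvd int (card (orbit (mult_of R) ?\<phi> x)) * (int q ^ d - 1)" .
      moreover have "1 < int q ^ d" using q2 d0 by (intro one_less_power) auto
      ultimately show ?thesis by simp
    qed
    \<comment> \<open>The number \<open>q - 1\<close> of central units is the difference of two
      multiples of \<open>c\<close>, which is impossible for
      \<open>\<bar>c\<bar> > q - 1\<close>.\<close>
    have c_diff: "c dvd int (card ?E) - int (card (Z - {\<zero>}))"
      unfolding Fix[symmetric] by (rule A.dvd_card_minus_fixed[OF _ orb]) (use fin in auto)
    have c_E: "c dvd int (card ?E)"
    proof -
      have "c * (int q ^ 1 - 1) dvd int q ^ n - 1" using c(2)[of 1] n2 by auto
      then have "c dvd int q ^ n - 1" by (rule dvd_mult_left)
      then show ?thesis unfolding cardE using q2 by (simp add: of_nat_diff)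
    qed
    have "c dvd int (card (Z - {\<zero>}))" using dvd_diff[OF c_E c_diff] by simp
    moreover have "int (card (Z - {\<zero>})) = int q - 1"
      using Z01 finZ q2 by (simp add: card_Diff_singleton q_def of_nat_diff)
    ultimately have "\<bar>c\<bar> \<le> int q - 1" using q2 dvd_imp_le_int[of "int q - 1" c] by auto
    then show False using c by simp
  qed
  then have "K = R" by (simp add: K_def)
  then show ?thesis using Kf by simp
qed

section \<open>Generating tuples and maximal subgroups\<close>

context group begin

lemma generate_sincl: "S \<subseteq> generate G S"
  by (blast intro: generate.incl)

lemma generate_subgroup_eq: "subgroup H G \<Longrightarrow> generate G H = H"
  using generate_sincl[of H] generate_subgroup_incl[of H H] by blast

lemma ex_maximal_subgroup:
  assumes fin: "finite (carrier G)" and H: "subgroup H G" "H \<noteq> carrier G"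
  shows "\<exists>M. maximal_subgroup M G \<and> H \<subseteq> M"
proof -
  let ?A = "{L. subgroup L G \<and> L \<noteq> carrier G}"
  have "finite ?A"
    by (rule finite_subset[of _ "Pow (carrier G)"]) (use fin subgroup.subset in auto)
  then obtain M where M: "M \<in> ?A" "H \<subseteq> M" "\<forall>L\<in>?A. M \<subseteq> L \<longrightarrow> M = L"
    using finite_has_maximal2[of ?A H] H by blast
  then have "maximal_subgroup M G" unfolding maximal_subgroup_def by blast
  then show ?thesis using M by blast
qed

lemma maximal_subgroup_imp_subset: "maximal_subgroup M G \<Longrightarrow> M \<subseteq> carrier G"
  unfolding maximal_subgroup_def using subgroup.subset by blast

lemma generate_subset_subgroup_ne:
  assumes "maximal_subgroup M G" "S \<subseteq> M"
  shows "generate G S \<noteq> carrier G"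
  using assms generate_subgroup_incl[of S M] maximal_subgroup_imp_subset[of M]
  unfolding maximal_subgroup_def by blast

lemma generate_ne_carrierD:
  assumes "finite (carrier G)" "S \<subseteq> carrier G" "generate G S \<noteq> carrier G"
  shows "\<exists>M. maximal_subgroup M G \<and> S \<subseteq> M"
  using ex_maximal_subgroup[OF assms(1) generate_is_subgroup[OF assms(2)] assms(3)]
    generate_sincl[of S] by blast

text \<open>Replaces minimal generating sets by generating lists of prescribed length: a short list
  may be padded with \<open>\<one>\<close>, and a list of length \<open>n\<close> has at most
  \<open>n\<close> distinct entries. All later counting is done with lists.\<close>

lemma min_gens_le_iff:
  assumes fin: "finite (carrier G)"
  shows "min_gens G \<le> n \<longleftrightarrow>
    (\<exists>zs. set zs \<subseteq> carrier G \<and> length zs = n \<and> generate G (set zs) = carrier G)"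
proof
  let ?P = "\<lambda>n. \<exists>S \<subseteq> carrier G. finite S \<and> card S = n \<and> generate G S = carrier G"
  assume le: "min_gens G \<le> n"
  have "?P (card (carrier G))"
    using fin generate_subgroup_eq[OF subgroup_self] by blast
  then have "?P (min_gens G)" unfolding min_gens_def by (rule LeastI)
  then obtain S where S: "S \<subseteq> carrier G" "finite S" "card S = min_gens G" "generate G S = carrier G"
    by blast
  obtain xs where xs: "set xs = S" "distinct xs" using finite_distinct_list[OF S(2)] by blast
  then have len: "length xs = min_gens G" using S distinct_card[OF xs(2)] by simp
  let ?zs = "xs @ replicate (n - min_gens G) \<one>"
  have sub: "set ?zs \<subseteq> carrier G" using xs S by auto
  moreover have "length ?zs = n" using le len by simp
  moreover have "generate G (set ?zs) = carrier G"
    using mono_generate[of S "set ?zs"] S xs generate_incl[OF sub] by auto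
  ultimately show "\<exists>zs. set zs \<subseteq> carrier G \<and> length zs = n \<and> generate G (set zs) = carrier G"
    by blast
next
  assume "\<exists>zs. set zs \<subseteq> carrier G \<and> length zs = n \<and> generate G (set zs) = carrier G"
  then obtain zs where zs: "set zs \<subseteq> carrier G" "length zs = n" "generate G (set zs) = carrier G"
    by blast
  then have "min_gens G \<le> card (set zs)" unfolding min_gens_def by (intro Least_le) auto
  also have "\<dots> \<le> n" using card_length[of zs] zs by simp
  finally show "min_gens G \<le> n" .
qed

lemma min_gens_eq_0_iff:
  assumes "finite (carrier G)"
  shows "min_gens G = 0 \<longleftrightarrow> carrier G = {\<one>}"
  using min_gens_le_iff[OF assms, of 0] generate_empty by auto

end

section \<open>Reformulating psi(G) = d(G) through maximal subgroups\<close>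

definition gen_over_maximal :: "('a, 'b) monoid_scheme \<Rightarrow> nat \<Rightarrow> bool" where
  "gen_over_maximal G n \<longleftrightarrow>
     (\<forall>M x. maximal_subgroup M G \<and> x \<in> carrier G \<and> x \<notin> M \<longrightarrow>
        (\<exists>zs. set zs \<subseteq> M \<and> length zs = n \<and> generate G (insert x (set zs)) = carrier G))"

context group begin

lemma max_equiv_imp_gen_equiv:
  assumes fin: "finite (carrier G)" and x: "x \<in> carrier G" and y: "y \<in> carrier G"
    and eq: "max_equiv G x y"
  shows "gen_equiv G r x y"
proof -
  have aux: "generate G (insert b (set zs)) = carrier G"
    if asm: "max_equiv G a b" "b \<in> carrier G" "set zs \<subseteq> carrier G"
      "generate G (insert a (set zs)) = carrier G" for a b zs
  proof (rule ccontr)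
    assume "generate G (insert b (set zs)) \<noteq> carrier G"
    then obtain M where M: "maximal_subgroup M G" "insert b (set zs) \<subseteq> M"
      using generate_ne_carrierD[OF fin, of "insert b (set zs)"] asm(2,3) by blast
    then have "insert a (set zs) \<subseteq> M" using asm(1) unfolding max_equiv_def by blast
    then show False using asm(4) generate_subset_subgroup_ne[OF M(1)] by blast
  qed
  have "max_equiv G y x" using eq by (auto simp: max_equiv_def)
  then show ?thesis using aux[OF eq y] aux[of y x] x by (auto simp: gen_equiv_def)
qed

text \<open>Fewer than \<open>min_gens G\<close> elements never generate, so both sides of the
  defining equivalence are false and the relation is total. This is what bounds \<open>psi\<close>
  from below.\<close>

lemma gen_equiv_all_below_min_gens:
  assumes fin: "finite (carrier G)" and r: "1 \<le> r" "r < min_gens G"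
    and x: "x \<in> carrier G" and y: "y \<in> carrier G"
  shows "gen_equiv G r x y"
proof -
  have "generate G (insert a (set zs)) \<noteq> carrier G"
    if "a \<in> carrier G" "set zs \<subseteq> carrier G" "length zs = r - 1" for a zs
  proof
    assume "generate G (insert a (set zs)) = carrier G"
    then have "set (a # zs) \<subseteq> carrier G \<and> length (a # zs) = r \<and> generate G (set (a # zs)) = carrier G"
      using that r by simp
    then have "min_gens G \<le> r" using min_gens_le_iff[OF fin] by blast
    then show False using r by simp
  qed
  then show ?thesis using x y by (auto simp: gen_equiv_def)
qed

text \<open>A tuple inside \<open>M\<close> that completes \<open>a\<close> to a generating set
  cannot complete any \<open>b \<in> M\<close>, so it distinguishes \<open>a\<close> from
  \<open>b\<close> at level \<open>r\<close>. The argument is applied in both directions.\<close>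

lemma gen_equiv_imp_max_equiv:
  assumes gom: "gen_over_maximal G (r - 1)" and x: "x \<in> carrier G" and y: "y \<in> carrier G"
    and eq: "gen_equiv G r x y"
  shows "max_equiv G x y"
proof -
  have aux: "b \<notin> M" if M: "maximal_subgroup M G" and ab: "gen_equiv G r a b" "a \<in> carrier G" "a \<notin> M" for a b M
  proof
    assume b: "b \<in> M"
    obtain zs where zs: "set zs \<subseteq> M" "length zs = r - 1" "generate G (insert a (set zs)) = carrier G"
      using gom M ab(2,3) unfolding gen_over_maximal_def by blast
    moreover have "set zs \<subseteq> carrier G" using zs maximal_subgroup_imp_subset[OF M] by blast
    ultimately have "generate G (insert b (set zs)) = carrier G"
      using ab(1) unfolding gen_equiv_def by blast
    then show False using generate_subset_subgroup_ne[OF M, of "insert b (set zs)"] b zs by blast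
  qed
  have "gen_equiv G r y x" using eq by (auto simp: gen_equiv_def)
  then show ?thesis unfolding max_equiv_def using aux eq x y by blast
qed

text \<open>Listing all of \<open>M\<close> suffices, by maximality. The lemma guarantees that the
  \<open>LEAST\<close> in the definition of \<open>psi\<close> is attained.\<close>

lemma gen_over_maximal_order: 
  assumes fin: "finite (carrier G)"
  shows "gen_over_maximal G (card (carrier G))"
  unfolding gen_over_maximal_def
proof (intro allI impI, elim conjE)
  fix M x assume M: "maximal_subgroup M G" and x: "x \<in> carrier G" "x \<notin> M"
  have sub: "subgroup M G" "M \<subseteq> carrier G"
    using M maximal_subgroup_imp_subset by (auto simp: maximal_subgroup_def)
  then obtain xs where xs: "set xs = M" "distinct xs"
    using finite_distinct_list[of M] fin finite_subset by blast
  have "length xs \<le> card (carrier G)"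
    using xs sub card_mono[OF fin, of M] distinct_card[of xs] by simp
  then have "length (xs @ replicate (card (carrier G) - length xs) \<one>) = card (carrier G)" by simp
  moreover have "set (xs @ replicate (card (carrier G) - length xs) \<one>) = M"
    using xs subgroup.one_closed[OF sub(1)] by auto
  moreover have "generate G (insert x M) = carrier G"
  proof -
    have "insert x M \<subseteq> generate G (insert x M)" by (rule generate_sincl)
    moreover have "subgroup (generate G (insert x M)) G"
      by (rule generate_is_subgroup) (use x sub in auto)
    ultimately show ?thesis using M x unfolding maximal_subgroup_def by blast
  qed
  ultimately show "\<exists>zs. set zs \<subseteq> M \<and> length zs = card (carrier G) \<and>
      generate G (insert x (set zs)) = carrier G"
    by (intro exI[of _ "xs @ replicate (card (carrier G) - length xs) \<one>"]) simp
qed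

text \<open>A maximal subgroup exists, so some element is not equivalent to \<open>\<one>\<close>,
  and no level below \<open>min_gens G\<close> notices this. The trivial group has to be excluded:
  its \<open>min_gens\<close> is 0, while \<open>psi\<close> starts at 1.\<close>

lemma psi_eq_min_gensI:
  assumes fin: "finite (carrier G)" and nt: "carrier G \<noteq> {\<one>}"
    and gom: "gen_over_maximal G (min_gens G - 1)"
  shows "psi G = min_gens G"
  unfolding psi_def
proof (rule Least_equality)
  have "min_gens G \<noteq> 0" using min_gens_eq_0_iff[OF fin] nt by simp
  then show "1 \<le> min_gens G \<and>
    (\<forall>x\<in>carrier G. \<forall>y\<in>carrier G. gen_equiv G (min_gens G) x y = max_equiv G x y)"
    using gen_equiv_imp_max_equiv[OF gom] max_equiv_imp_gen_equiv[OF fin] by auto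
next
  fix r assume r: "1 \<le> r \<and> (\<forall>x\<in>carrier G. \<forall>y\<in>carrier G. gen_equiv G r x y = max_equiv G x y)"
  obtain M where M: "maximal_subgroup M G"
    using ex_maximal_subgroup[OF fin triv_subgroup] nt by auto
  then obtain x where x: "x \<in> carrier G" "x \<notin> M"
    using maximal_subgroup_imp_subset[OF M] unfolding maximal_subgroup_def by blast
  have "\<not> max_equiv G x \<one>"
    using M x subgroup.one_closed[of M G] unfolding max_equiv_def maximal_subgroup_def by blast
  then have "\<not> gen_equiv G r x \<one>" using r x by blast
  then show "min_gens G \<le> r" using gen_equiv_all_below_min_gens[OF fin, of r x \<one>] r x by force
qed

text \<open>An element outside the Frattini subgroup is not equivalent to \<open>\<one>\<close>, so
  some tuple of length \<open>min_gens G - 1\<close> completes exactly one of the two. It cannot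
  complete \<open>\<one>\<close>, since then the tuple would generate by itself.\<close>

lemma psi_eq_min_gensD:
  assumes fin: "finite (carrier G)" and eq: "psi G = min_gens G"
  shows "min_gens G \<ge> 1"
    and "\<And>x. \<lbrakk>x \<in> carrier G; x \<notin> frattini G\<rbrakk> \<Longrightarrow>
      \<exists>zs. set zs \<subseteq> carrier G \<and> length zs = min_gens G - 1 \<and> generate G (insert x (set zs)) = carrier G"
proof -
  let ?P = "\<lambda>r. r \<ge> 1 \<and> (\<forall>x \<in> carrier G. \<forall>y \<in> carrier G. gen_equiv G r x y \<longleftrightarrow> max_equiv G x y)"
  have "?P (Suc (card (carrier G)))"
    using gen_equiv_imp_max_equiv[of "Suc (card (carrier G))"] gen_over_maximal_order[OF fin]
      max_equiv_imp_gen_equiv[OF fin] by auto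
  then have P: "?P (min_gens G)" unfolding eq[symmetric] psi_def by (rule LeastI)
  then show ge1: "min_gens G \<ge> 1" by blast
  fix x assume x: "x \<in> carrier G" "x \<notin> frattini G"
  then obtain M where M: "maximal_subgroup M G" "x \<notin> M" by (auto simp: frattini_def)
  then have "\<not> max_equiv G x \<one>"
    using subgroup.one_closed[of M G] unfolding max_equiv_def maximal_subgroup_def by blast
  then have "\<not> gen_equiv G (min_gens G) x \<one>" using P x by blast
  then obtain zs where zs: "set zs \<subseteq> carrier G" "length zs = min_gens G - 1"
    "(generate G (insert x (set zs)) = carrier G) \<noteq> (generate G (insert \<one> (set zs)) = carrier G)"
    unfolding gen_equiv_def by blast
  have "generate G (insert \<one> (set zs)) \<noteq> carrier G"
  proof
    assume "generate G (insert \<one> (set zs)) = carrier G"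
    moreover have "generate G (insert \<one> (set zs)) \<subseteq> generate G (set zs)"
      by (rule generate_subgroup_incl)
        (use generate_sincl generate.one generate_is_subgroup[OF zs(1)] in blast)+
    ultimately have "generate G (set zs) = carrier G" using generate_incl[OF zs(1)] by blast
    then have "min_gens G \<le> min_gens G - 1" using min_gens_le_iff[OF fin] zs by blast
    then show False using ge1 by simp
  qed
  then show "\<exists>zs. set zs \<subseteq> carrier G \<and> length zs = min_gens G - 1 \<and>
      generate G (insert x (set zs)) = carrier G"
    using zs by blast
qed

end

section \<open>Quotients by subgroups of the Frattini subgroup\<close>

context group_hom begin

text \<open>The nongenerator property of the Frattini subgroup: a maximal subgroup containing
  \<open>S\<close> also contains the kernel, hence is a full preimage, and the images of the
  elements of \<open>S\<close> stay inside a proper subgroup.\<close>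

lemma generate_image_eq_iff:
  assumes fin: "finite (carrier G)" and surj: "h ` carrier G = carrier H"
    and ker: "kernel G H h \<subseteq> frattini G" and S: "S \<subseteq> carrier G"
  shows "generate H (h ` S) = carrier H \<longleftrightarrow> generate G S = carrier G"
proof
  assume "generate G S = carrier G"
  then show "generate H (h ` S) = carrier H" using generate_img[OF S] surj by simp
next
  assume *: "generate H (h ` S) = carrier H"
  show "generate G S = carrier G"
  proof (rule ccontr)
    assume "generate G S \<noteq> carrier G"
    then obtain M where M: "maximal_subgroup M G" "S \<subseteq> M"
      using G.generate_ne_carrierD[OF fin S] by blast
    have sub: "subgroup M G" "M \<noteq> carrier G" using M by (auto simp: maximal_subgroup_def)
    have "carrier G \<subseteq> M"
    proof
      fix g assume g: "g \<in> carrier G"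
      then have "h g \<in> h ` generate G S" using * generate_img[OF S] by auto
      then obtain s where s: "s \<in> generate G S" "h g = h s" by blast
      have sM: "s \<in> M" using s G.generate_subgroup_incl[OF M(2) sub(1)] by blast
      then have sG: "s \<in> carrier G" using sub subgroup.subset by blast
      have "g \<otimes> inv s \<in> kernel G H h" using s g sG by (simp add: kernel_def)
      then have "g \<otimes> inv s \<in> M" using ker M(1) by (auto simp: frattini_def)
      then have "g \<otimes> inv s \<otimes> s \<in> M" using sM subgroup.m_closed[OF sub(1)] by blast
      then show "g \<in> M" using g sG by (simp add: G.m_assoc)
    qed
    then show False using sub subgroup.subset by blast
  qed
qed

lemma list_preimage:
  assumes "set ws \<subseteq> h ` A"
  shows "\<exists>zs. set zs \<subseteq> A \<and> length zs = length ws \<and> h ` set zs = set ws"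
proof -
  have "\<forall>w\<in>set ws. \<exists>z\<in>A. h z = w" using assms by auto
  then obtain f where f: "\<forall>w\<in>set ws. f w \<in> A \<and> h (f w) = w" by metis
  then show ?thesis by (intro exI[of _ "map f ws"]) force
qed

lemma min_gens_image_eq:
  assumes fin: "finite (carrier G)" and surj: "h ` carrier G = carrier H"
    and ker: "kernel G H h \<subseteq> frattini G"
  shows "min_gens H = min_gens G"
proof -
  have finH: "finite (carrier H)" unfolding surj[symmetric] using fin by (rule finite_imageI)
  have "min_gens H \<le> n \<longleftrightarrow> min_gens G \<le> n" for n
  proof
    assume "min_gens H \<le> n"
    then obtain ws where ws: "set ws \<subseteq> carrier H" "length ws = n" "generate H (set ws) = carrier H"
      using H.min_gens_le_iff[OF finH] by blast
    then obtain zs where "set zs \<subseteq> carrier G" "length zs = n" "h ` set zs = set ws"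
      using list_preimage[of ws "carrier G"] surj by auto
    then show "min_gens G \<le> n"
      using G.min_gens_le_iff[OF fin] generate_image_eq_iff[OF fin surj ker, of "set zs"] ws by auto
  next
    assume "min_gens G \<le> n"
    then obtain zs where zs: "set zs \<subseteq> carrier G" "length zs = n" "generate G (set zs) = carrier G"
      using G.min_gens_le_iff[OF fin] by blast
    then have "generate H (set (map h zs)) = carrier H"
      using generate_image_eq_iff[OF fin surj ker, of "set zs"] by auto
    moreover have "set (map h zs) \<subseteq> carrier H" using zs by auto
    ultimately show "min_gens H \<le> n" using H.min_gens_le_iff[OF finH, of n] zs(2) length_map[of h zs] by blast
  qed
  from this[of "min_gens G"] this[of "min_gens H"] show ?thesis by simp
qed

lemma maximal_subgroup_image:
  assumes surj: "h ` carrier G = carrier H" and ker: "kernel G H h \<subseteq> M" and M: "maximal_subgroup M G"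
  shows "maximal_subgroup (h ` M) H" "\<And>g. \<lbrakk>g \<in> carrier G; h g \<in> h ` M\<rbrakk> \<Longrightarrow> g \<in> M"
proof -
  have sub: "subgroup M G" "M \<noteq> carrier G" "M \<subseteq> carrier G"
    using M G.maximal_subgroup_imp_subset by (auto simp: maximal_subgroup_def)
  show pre: "g \<in> M" if g: "g \<in> carrier G" "h g \<in> h ` M" for g
  proof -
    obtain s where s: "s \<in> M" "h g = h s" using g by blast
    then have sG: "s \<in> carrier G" using sub by blast
    have "g \<otimes> inv s \<in> kernel G H h" using s g sG by (simp add: kernel_def)
    then have "g \<otimes> inv s \<otimes> s \<in> M" using ker s subgroup.m_closed[OF sub(1)] by blast
    then show "g \<in> M" using g sG by (simp add: G.m_assoc)
  qed
  show "maximal_subgroup (h ` M) H"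
    unfolding maximal_subgroup_def
  proof (intro conjI allI impI)
    show "subgroup (h ` M) H" by (rule subgroup_img_is_subgroup[OF sub(1)])
    show "h ` M \<noteq> carrier H" using pre sub surj by blast
    fix L assume L: "subgroup L H \<and> h ` M \<subseteq> L"
    let ?L = "{g \<in> carrier G. h g \<in> L}"
    have "subgroup ?L G"
    proof (rule G.subgroupI)
      show "?L \<noteq> {}" using L subgroup.one_closed[of L H] G.one_closed hom_one by fastforce
    qed (use L subgroup.m_closed[of L H] subgroup.m_inv_closed[of L H] in auto)
    moreover have "M \<subseteq> ?L" using L sub by auto
    ultimately have "?L = M \<or> ?L = carrier G" using M unfolding maximal_subgroup_def by blast
    moreover have "L = h ` ?L" using surj L subgroup.subset[of L H] by auto
    ultimately show "L = h ` M \<or> L = carrier H" using surj by auto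
  qed
qed

lemma gen_over_maximal_lift:
  assumes fin: "finite (carrier G)" and surj: "h ` carrier G = carrier H"
    and ker: "kernel G H h \<subseteq> frattini G" and gom: "gen_over_maximal H n"
  shows "gen_over_maximal G n"
  unfolding gen_over_maximal_def
proof (intro allI impI, elim conjE)
  fix M x assume M: "maximal_subgroup M G" and x: "x \<in> carrier G" "x \<notin> M"
  have "kernel G H h \<subseteq> M" using ker M by (auto simp: frattini_def)
  note img = maximal_subgroup_image[OF surj this M]
  have "h x \<in> carrier H" "h x \<notin> h ` M" using x img(2) by auto
  then obtain ws where ws: "set ws \<subseteq> h ` M" "length ws = n"
    "generate H (insert (h x) (set ws)) = carrier H"
    using gom img(1) unfolding gen_over_maximal_def by blast
  obtain zs where zs: "set zs \<subseteq> M" "length zs = n" "h ` set zs = set ws"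
    using list_preimage[OF ws(1)] ws by auto
  then have "generate G (insert x (set zs)) = carrier G"
    using generate_image_eq_iff[OF fin surj ker, of "insert x (set zs)"] ws x
      G.maximal_subgroup_imp_subset[OF M] by auto
  then show "\<exists>zs. set zs \<subseteq> M \<and> length zs = n \<and> generate G (insert x (set zs)) = carrier G"
    using zs by blast
qed

end

section \<open>Derivations\<close>

text \<open>Modules are written multiplicatively, so that chief factors, which arise as groups of
  cosets, are modules without any translation.\<close>

locale gmod = group G + V: comm_group V
  for G :: "('g, 'x) monoid_scheme" (structure) and V :: "('v, 'y) monoid_scheme" +
  fixes act :: "'g \<Rightarrow> 'v \<Rightarrow> 'v"
  assumes finG: "finite (carrier G)" and finV: "finite (carrier V)"
    and act_closed [simp]: "\<lbrakk>g \<in> carrier G; v \<in> carrier V\<rbrakk> \<Longrightarrow> act g v \<in> carrier V"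
    and act_mult: "\<lbrakk>g \<in> carrier G; v \<in> carrier V; w \<in> carrier V\<rbrakk> \<Longrightarrow>
      act g (v \<otimes>\<^bsub>V\<^esub> w) = act g v \<otimes>\<^bsub>V\<^esub> act g w"
    and act_one [simp]: "v \<in> carrier V \<Longrightarrow> act \<one> v = v"
    and act_comp: "\<lbrakk>g \<in> carrier G; h \<in> carrier G; v \<in> carrier V\<rbrakk> \<Longrightarrow>
      act (g \<otimes> h) v = act g (act h v)"
begin

lemma act_hom: "g \<in> carrier G \<Longrightarrow> group_hom V V (act g)"
  by (unfold_locales) (auto simp: hom_def act_mult)

lemma act_V_one [simp]: "g \<in> carrier G \<Longrightarrow> act g \<one>\<^bsub>V\<^esub> = \<one>\<^bsub>V\<^esub>"
  using group_hom.hom_one[OF act_hom] .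

lemma act_V_inv: "\<lbrakk>g \<in> carrier G; v \<in> carrier V\<rbrakk> \<Longrightarrow> act g (inv\<^bsub>V\<^esub> v) = inv\<^bsub>V\<^esub> (act g v)"
  using group_hom.hom_inv[OF act_hom] .

lemma act_inv_act [simp]: "\<lbrakk>g \<in> carrier G; v \<in> carrier V\<rbrakk> \<Longrightarrow> act (inv g) (act g v) = v"
  by (simp flip: act_comp)

lemma act_act_inv [simp]: "\<lbrakk>g \<in> carrier G; v \<in> carrier V\<rbrakk> \<Longrightarrow> act g (act (inv g) v) = v"
  by (simp flip: act_comp)

definition actker :: "'g set" where
  "actker = {g \<in> carrier G. \<forall>v\<in>carrier V. act g v = v}"

lemma actker_normal: "actker \<lhd> G"
proof (rule normal_invI)
  show "subgroup actker G"
  proof (rule subgroupI)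
    fix a assume a: "a \<in> actker"
    then have "act (inv a) v = v" if "v \<in> carrier V" for v
      using act_inv_act[of a v] that by (simp add: actker_def)
    then show "inv a \<in> actker" using a by (simp add: actker_def)
  qed (auto simp: actker_def act_comp)
  fix x h assume "x \<in> carrier G" "h \<in> actker"
  then show "x \<otimes> h \<otimes> inv x \<in> actker" by (auto simp: actker_def act_comp)
qed

text \<open>The crossed homomorphisms, or 1-cocycles. Extensionality makes the set finite and its
  cardinality meaningful.\<close>

definition Z1 :: "('g \<Rightarrow> 'v) set" where
  "Z1 = {\<delta> \<in> carrier G \<rightarrow>\<^sub>E carrier V.
     \<forall>g\<in>carrier G. \<forall>h\<in>carrier G. \<delta> (g \<otimes> h) = \<delta> g \<otimes>\<^bsub>V\<^esub> act g (\<delta> h)}"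

lemma Z1_closed [simp]: "\<lbrakk>\<delta> \<in> Z1; g \<in> carrier G\<rbrakk> \<Longrightarrow> \<delta> g \<in> carrier V"
  by (auto simp: Z1_def)

lemma Z1_mult: "\<lbrakk>\<delta> \<in> Z1; g \<in> carrier G; h \<in> carrier G\<rbrakk> \<Longrightarrow> \<delta> (g \<otimes> h) = \<delta> g \<otimes>\<^bsub>V\<^esub> act g (\<delta> h)"
  by (auto simp: Z1_def)

lemma Z1_ext: "\<lbrakk>\<delta> \<in> Z1; \<epsilon> \<in> Z1; \<And>g. g \<in> carrier G \<Longrightarrow> \<delta> g = \<epsilon> g\<rbrakk> \<Longrightarrow> \<delta> = \<epsilon>"
  unfolding Z1_def by (auto intro: PiE_ext)

lemma Z1I:
  assumes "\<And>g. g \<in> carrier G \<Longrightarrow> f g \<in> carrier V"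
    and "\<And>g h. \<lbrakk>g \<in> carrier G; h \<in> carrier G\<rbrakk> \<Longrightarrow> f (g \<otimes> h) = f g \<otimes>\<^bsub>V\<^esub> act g (f h)"
  shows "(\<lambda>g\<in>carrier G. f g) \<in> Z1"
  using assms by (auto simp: Z1_def)

lemma Z1_one [simp]:
  assumes d: "\<delta> \<in> Z1" shows "\<delta> \<one> = \<one>\<^bsub>V\<^esub>"
proof -
  have "\<delta> \<one> \<otimes>\<^bsub>V\<^esub> \<delta> \<one> = \<delta> \<one> \<otimes>\<^bsub>V\<^esub> \<one>\<^bsub>V\<^esub>" using Z1_mult[OF d, of \<one> \<one>] d by simp
  then show ?thesis using d V.l_cancel[of "\<delta> \<one>" "\<delta> \<one>" "\<one>\<^bsub>V\<^esub>"] by simp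
qed

lemma Z1_inv:
  assumes d: "\<delta> \<in> Z1" and g: "g \<in> carrier G"
  shows "\<delta> (inv g) = inv\<^bsub>V\<^esub> (act (inv g) (\<delta> g))"
proof -
  have "\<delta> (inv g) \<otimes>\<^bsub>V\<^esub> act (inv g) (\<delta> g) = \<one>\<^bsub>V\<^esub>"
    using Z1_mult[OF d, of "inv g" g] d g by simp
  then show ?thesis using d g V.inv_equality[of "\<delta> (inv g)" "act (inv g) (\<delta> g)"] by simp
qed

lemma finite_Z1: "finite Z1"
  by (rule finite_subset[of _ "carrier G \<rightarrow>\<^sub>E carrier V"]) (auto simp: Z1_def finG finV finite_PiE)

lemma Z1_trivial: "(\<lambda>g\<in>carrier G. \<one>\<^bsub>V\<^esub>) \<in> Z1"
  by (rule Z1I) auto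

lemma Z1_add:
  assumes "\<delta> \<in> Z1" "\<epsilon> \<in> Z1"
  shows "(\<lambda>g\<in>carrier G. \<delta> g \<otimes>\<^bsub>V\<^esub> \<epsilon> g) \<in> Z1"
  by (rule Z1I) (use assms in \<open>auto simp: Z1_mult act_mult V.m_ac\<close>)

lemma Z1_diff:
  assumes "\<delta> \<in> Z1" "\<epsilon> \<in> Z1"
  shows "(\<lambda>g\<in>carrier G. \<delta> g \<otimes>\<^bsub>V\<^esub> inv\<^bsub>V\<^esub> \<epsilon> g) \<in> Z1"
  by (rule Z1I) (use assms in \<open>auto simp: Z1_mult act_mult act_V_inv V.m_ac V.inv_mult\<close>)

lemma Z1_agree_subgroup:
  assumes d: "\<delta> \<in> Z1" and e: "\<epsilon> \<in> Z1"
  shows "subgroup {g \<in> carrier G. \<delta> g = \<epsilon> g} G"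
  by (rule subgroupI) (use d e in \<open>auto simp: Z1_mult Z1_inv\<close>)

lemma Z1_ker_subgroup:
  assumes d: "\<delta> \<in> Z1" shows "subgroup {g \<in> carrier G. \<delta> g = \<one>\<^bsub>V\<^esub>} G"
  by (rule subgroupI) (use d in \<open>auto simp: Z1_mult Z1_inv\<close>)

lemma Z1_eq_if_agree_on_generators:
  assumes d: "\<delta> \<in> Z1" and e: "\<epsilon> \<in> Z1" and S: "generate G S = carrier G" "S \<subseteq> carrier G"
    and eq: "\<And>s. s \<in> S \<Longrightarrow> \<delta> s = \<epsilon> s"
  shows "\<delta> = \<epsilon>"
proof (rule Z1_ext[OF d e])
  have "generate G S \<subseteq> {g \<in> carrier G. \<delta> g = \<epsilon> g}"
    by (rule generate_subgroup_incl[OF _ Z1_agree_subgroup[OF d e]]) (use S eq in auto)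
  then show "\<delta> g = \<epsilon> g" if "g \<in> carrier G" for g using that S by blast
qed

text \<open>A derivation is determined by its values on generators. The values on \<open>A\<close>
  are prescribed, so only those on \<open>zs\<close> are free.\<close>

lemma card_Z1_le_power:
  assumes D: "D \<subseteq> Z1" and A: "A \<subseteq> carrier G" "\<And>\<delta> a. \<lbrakk>\<delta> \<in> D; a \<in> A\<rbrakk> \<Longrightarrow> \<delta> a = \<one>\<^bsub>V\<^esub>"
    and zs: "set zs \<subseteq> carrier G" "generate G (set zs \<union> A) = carrier G"
  shows "card D \<le> card (carrier V) ^ length zs"
proof -
  have "inj_on (\<lambda>\<delta>. map \<delta> zs) D"
  proof (rule inj_onI)
    fix \<delta> \<epsilon> assume de: "\<delta> \<in> D" "\<epsilon> \<in> D" and eq: "map \<delta> zs = map \<epsilon> zs"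
    show "\<delta> = \<epsilon>"
    proof (rule Z1_eq_if_agree_on_generators[OF _ _ zs(2)])
      show "\<delta> \<in> Z1" "\<epsilon> \<in> Z1" using de D by auto
      show "set zs \<union> A \<subseteq> carrier G" using zs A by auto
      show "\<delta> s = \<epsilon> s" if "s \<in> set zs \<union> A" for s
        using that eq A(2)[OF de(1)] A(2)[OF de(2)] by auto
    qed
  qed
  moreover have "(\<lambda>\<delta>. map \<delta> zs) ` D \<subseteq> {xs. set xs \<subseteq> carrier V \<and> length xs = length zs}"
    using D zs(1) by (auto simp: subset_iff)
  ultimately have "card D \<le> card {xs. set xs \<subseteq> carrier V \<and> length xs = length zs}"
    by (intro card_inj_on_le[of "\<lambda>\<delta>. map \<delta> zs"]) (auto simp: finV finite_lists_length_eq)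
  then show ?thesis by (simp add: card_lists_length_eq finV)
qed

text \<open>All fibres are translates of the kernel and hence have the same size.\<close>

lemma card_fibre_hom:
  assumes B: "subgroup B G" and f: "f ` B = carrier V"
    and hom: "\<And>a b. \<lbrakk>a \<in> B; b \<in> B\<rbrakk> \<Longrightarrow> f (a \<otimes> b) = f a \<otimes>\<^bsub>V\<^esub> f b" and w: "w \<in> carrier V"
  shows "card {b \<in> B. f b = w} * card (carrier V) = card B"
proof -
  have Bc: "B \<subseteq> carrier G" using subgroup.subset[OF B] .
  then have finB: "finite B" using finG finite_subset by blast
  have Bm: "b \<in> carrier G" if "b \<in> B" for b using Bc that by blast
  have fib: "card {b \<in> B. f b = u} = card {b \<in> B. f b = \<one>\<^bsub>V\<^esub>}" if u: "u \<in> carrier V" for u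
  proof -
    have "u \<in> f ` B" using u f by simp
    then obtain c where c: "c \<in> B" "f c = u" by blast
    have cl: "f b \<in> carrier V" if "b \<in> B" for b using f that by blast
    have "bij_betw (\<lambda>b. b \<otimes> c) {b \<in> B. f b = \<one>\<^bsub>V\<^esub>} {b \<in> B. f b = u}"
    proof (rule bij_betw_byWitness[where f' = "\<lambda>b. b \<otimes> inv c"])
      have ic: "inv c \<in> B" using c subgroup.m_inv_closed[OF B] by blast
      have "f c \<otimes>\<^bsub>V\<^esub> f (inv c) = f \<one>" using hom[OF c(1) ic] c Bc by auto
      moreover have "f \<one> = \<one>\<^bsub>V\<^esub>"
        using hom[of \<one> \<one>] subgroup.one_closed[OF B] cl V.l_cancel_one'[of "f \<one>" "f \<one>"] by auto
      ultimately have fi: "u \<otimes>\<^bsub>V\<^esub> f (inv c) = \<one>\<^bsub>V\<^esub>" using c by simp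
      show "\<forall>a\<in>{b \<in> B. f b = \<one>\<^bsub>V\<^esub>}. a \<otimes> c \<otimes> inv c = a" using c by (auto simp: m_assoc Bm)
      show "\<forall>a'\<in>{b \<in> B. f b = u}. a' \<otimes> inv c \<otimes> c = a'" using c by (auto simp: m_assoc Bm)
      show "(\<lambda>b. b \<otimes> c) ` {b \<in> B. f b = \<one>\<^bsub>V\<^esub>} \<subseteq> {b \<in> B. f b = u}"
        using c hom subgroup.m_closed[OF B] u by auto
      show "(\<lambda>b. b \<otimes> inv c) ` {b \<in> B. f b = u} \<subseteq> {b \<in> B. f b = \<one>\<^bsub>V\<^esub>}"
        using ic hom subgroup.m_closed[OF B] fi by auto
    qed
    then show ?thesis by (simp add: bij_betw_same_card)
  qed
  have "card B = (\<Sum>b\<in>B. 1)" by simp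
  also have "\<dots> = (\<Sum>u\<in>carrier V. \<Sum>b\<in>{b \<in> B. f b = u}. 1)"
    by (rule sum.group[symmetric]) (use finB finV f in auto)
  also have "\<dots> = (\<Sum>u\<in>carrier V. card {b \<in> B. f b = w})"
  proof (rule sum.cong[OF refl])
    show "(\<Sum>b\<in>{b \<in> B. f b = u}. 1) = card {b \<in> B. f b = w}" if "u \<in> carrier V" for u
      using fib[OF that] fib[OF w] by simp
  qed
  finally show ?thesis by simp
qed

text \<open>The averaging step behind Gaschuetz's lemma: multiplying the entries of a list by elements
  of \<open>B\<close>, fewer than \<open>card V ^ n\<close> derivations cannot meet every choice.\<close>

lemma avoid_derivations:
  assumes B: "subgroup B G" "B \<subseteq> actker"
    and "finite D" "D \<subseteq> Z1" "\<And>\<delta>. \<delta> \<in> D \<Longrightarrow> \<delta> ` B = carrier V"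
    and "card D < card (carrier V) ^ length ys" "set ys \<subseteq> carrier G"
  shows "\<exists>zs. list_all2 (\<lambda>y z. \<exists>b\<in>B. z = b \<otimes> y) ys zs \<and> (\<forall>\<delta>\<in>D. \<exists>z\<in>set zs. \<delta> z \<noteq> \<one>\<^bsub>V\<^esub>)"
  using assms(3-)
proof (induction ys arbitrary: D)
  case Nil
  then have "D = {}" by simp
  then show ?case by simp
next
  case (Cons y ys)
  have Bc: "B \<subseteq> carrier G" using subgroup.subset[OF B(1)] .
  then have finB: "finite B" using finG finite_subset by blast
  have Bne: "\<one> \<in> B" using subgroup.one_closed[OF B(1)] .
  have yG: "y \<in> carrier G" using Cons.prems by simp
  let ?c = "\<lambda>b. card {\<delta> \<in> D. \<delta> (b \<otimes> y) = \<one>\<^bsub>V\<^esub>}"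
  \<comment> \<open>Because \<open>B\<close> acts trivially, \<delta> is a homomorphism on
    \<open>B\<close>, and \<open>\<delta> (b \<otimes> y)\<close> runs evenly through
    \<open>V\<close>. It is therefore trivial for one in \<open>card V\<close> choices of
    \<open>b\<close>.\<close>
  have fib: "card {b \<in> B. \<delta> (b \<otimes> y) = \<one>\<^bsub>V\<^esub>} * card (carrier V) = card B" if d: "\<delta> \<in> D" for \<delta>
  proof -
    have dZ: "\<delta> \<in> Z1" using d Cons.prems by blast
    have h: "\<delta> (a \<otimes> g) = \<delta> a \<otimes>\<^bsub>V\<^esub> \<delta> g" if "a \<in> B" "g \<in> carrier G" for a g
    proof -
      have "a \<in> carrier G" "act a (\<delta> g) = \<delta> g" using that B(2) dZ by (auto simp: actker_def)
      then show ?thesis using Z1_mult[OF dZ, of a g] that by simp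
    qed
    have "{b \<in> B. \<delta> (b \<otimes> y) = \<one>\<^bsub>V\<^esub>} = {b \<in> B. \<delta> b = inv\<^bsub>V\<^esub> (\<delta> y)}"
    proof (rule Collect_cong, rule conj_cong[OF refl])
      fix b assume b: "b \<in> B"
      then have "\<delta> b \<in> carrier V" "\<delta> y \<in> carrier V" using dZ Bc yG by auto
      then show "\<delta> (b \<otimes> y) = \<one>\<^bsub>V\<^esub> \<longleftrightarrow> \<delta> b = inv\<^bsub>V\<^esub> (\<delta> y)"
        unfolding h[OF b yG] using V.inv_equality[of "\<delta> b" "\<delta> y"] V.l_inv[of "\<delta> y"]
        by (metis (no_types))
    qed
    moreover have "card {b \<in> B. \<delta> b = inv\<^bsub>V\<^esub> (\<delta> y)} * card (carrier V) = card B"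
    proof (rule card_fibre_hom[OF B(1) Cons.prems(3)[OF d]])
      show "\<delta> (a \<otimes> b) = \<delta> a \<otimes>\<^bsub>V\<^esub> \<delta> b" if "a \<in> B" "b \<in> B" for a b using h that Bc by blast
      show "inv\<^bsub>V\<^esub> (\<delta> y) \<in> carrier V" using dZ yG by simp
    qed
    ultimately show ?thesis by simp
  qed
  \<comment> \<open>Double counting of the pairs of \<open>b\<close> and \<delta> with trivial
    value: some \<open>b\<close> does at least as well as the average and leaves at most one in
    \<open>card V\<close> of the derivations. These are handed over to the rest of the list.\<close>
  have "\<exists>b\<in>B. ?c b * card (carrier V) \<le> card D"
  proof (rule ccontr)
    assume "\<not> ?thesis"
    then have "(\<Sum>b\<in>B. card D) < (\<Sum>b\<in>B. ?c b * card (carrier V))"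
      by (intro sum_strict_mono) (use finB Bne in auto)
    also have "\<dots> = (\<Sum>b\<in>B. \<Sum>\<delta>\<in>D. if \<delta> (b \<otimes> y) = \<one>\<^bsub>V\<^esub> then 1 else 0) * card (carrier V)"
      by (simp only: card_as_sums[OF refl Cons.prems(1)] sum_distrib_right)
    also have "(\<Sum>b\<in>B. \<Sum>\<delta>\<in>D. if \<delta> (b \<otimes> y) = \<one>\<^bsub>V\<^esub> then 1 else 0) =
        (\<Sum>\<delta>\<in>D. \<Sum>b\<in>B. if \<delta> (b \<otimes> y) = \<one>\<^bsub>V\<^esub> then 1 else (0::nat))" by (rule sum.swap)
    also have "\<dots> * card (carrier V) = (\<Sum>\<delta>\<in>D. card {b \<in> B. \<delta> (b \<otimes> y) = \<one>\<^bsub>V\<^esub>} * card (carrier V))"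
      by (simp only: card_as_sums[OF refl finB] sum_distrib_right)
    also have "\<dots> = (\<Sum>\<delta>\<in>D. card B)" by (rule sum.cong) (use fib in auto)
    finally show False by (simp add: mult.commute)
  qed
  then obtain b where b: "b \<in> B" "?c b * card (carrier V) \<le> card D" by blast
  let ?D = "{\<delta> \<in> D. \<delta> (b \<otimes> y) = \<one>\<^bsub>V\<^esub>}"
  have "card ?D < card (carrier V) ^ length ys"
  proof (rule ccontr)
    assume "\<not> ?thesis"
    then have "card (carrier V) ^ length ys * card (carrier V) \<le> card ?D * card (carrier V)"
      by (intro mult_le_mono1) simp
    moreover have "card D < card (carrier V) ^ length ys * card (carrier V)"
      using Cons.prems(4) by (simp add: mult.commute)
    ultimately show False using b(2) by linarith
  qed
  then have "\<exists>zs. list_all2 (\<lambda>y z. \<exists>b\<in>B. z = b \<otimes> y) ys zs \<and> (\<forall>\<delta>\<in>?D. \<exists>z\<in>set zs. \<delta> z \<noteq> \<one>\<^bsub>V\<^esub>)"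
    by (intro Cons.IH) (use Cons.prems in auto)
  then obtain zs where "list_all2 (\<lambda>y z. \<exists>b\<in>B. z = b \<otimes> y) ys zs" "\<forall>\<delta>\<in>?D. \<exists>z\<in>set zs. \<delta> z \<noteq> \<one>\<^bsub>V\<^esub>"
    by blast
  then show ?case using b(1) by (intro exI[of _ "(b \<otimes> y) # zs"]) auto
qed

end

section \<open>Irreducible modules, chief factors and their supplements\<close>

locale irr_gmod = gmod +
  assumes V_nontriv: "carrier V \<noteq> {\<one>\<^bsub>V\<^esub>}"
    and irreducible: "\<lbrakk>subgroup W V; \<And>g w. \<lbrakk>g \<in> carrier G; w \<in> W\<rbrakk> \<Longrightarrow> act g w \<in> W\<rbrakk> \<Longrightarrow>
      W = {\<one>\<^bsub>V\<^esub>} \<or> W = carrier V"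

text \<open>A normal section of \<open>G\<close> isomorphic to \<open>V\<close>, given by a
  surjection \<pi> on \<open>K\<close> instead of a quotient group. In this form it covers coset
  maps of chief factors as well as derivations restricted to normal subgroups.\<close>

locale gmod_chief = gmod +
  fixes K :: "'a set" and \<pi> :: "'a \<Rightarrow> 'c"
  assumes K_normal: "K \<lhd> G"
    and pi_mult: "\<lbrakk>a \<in> K; b \<in> K\<rbrakk> \<Longrightarrow> \<pi> (a \<otimes> b) = \<pi> a \<otimes>\<^bsub>V\<^esub> \<pi> b"
    and pi_surj: "\<pi> ` K = carrier V"
    and pi_conj: "\<lbrakk>g \<in> carrier G; k \<in> K\<rbrakk> \<Longrightarrow> \<pi> (g \<otimes> k \<otimes> inv g) = act g (\<pi> k)"
begin

lemma K_subgroup: "subgroup K G" using K_normal normal_imp_subgroup by blast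

lemma K_carrier: "k \<in> K \<Longrightarrow> k \<in> carrier G" by (rule subgroup.mem_carrier[OF K_subgroup])

lemma K_closed: "\<lbrakk>a \<in> K; b \<in> K\<rbrakk> \<Longrightarrow> a \<otimes> b \<in> K" "a \<in> K \<Longrightarrow> inv a \<in> K" "\<one> \<in> K"
  by (simp_all add: subgroup.m_closed[OF K_subgroup] subgroup.m_inv_closed[OF K_subgroup]
      subgroup.one_closed[OF K_subgroup])

lemma K_conj: "\<lbrakk>g \<in> carrier G; k \<in> K\<rbrakk> \<Longrightarrow> g \<otimes> k \<otimes> inv g \<in> K"
  using K_normal normal_inv_iff by blast

lemma pi_closed [simp]: "k \<in> K \<Longrightarrow> \<pi> k \<in> carrier V" using pi_surj by blast

lemma pi_one: "\<pi> \<one> = \<one>\<^bsub>V\<^esub>"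
proof -
  have "\<pi> \<one> \<otimes>\<^bsub>V\<^esub> \<pi> \<one> = \<pi> \<one> \<otimes>\<^bsub>V\<^esub> \<one>\<^bsub>V\<^esub>" using pi_mult[of \<one> \<one>] K_closed(3) by simp
  then show ?thesis using K_closed(3) V.l_cancel[of "\<pi> \<one>" "\<pi> \<one>" "\<one>\<^bsub>V\<^esub>"] by simp
qed

lemma pi_inv: assumes k: "k \<in> K" shows "\<pi> (inv k) = inv\<^bsub>V\<^esub> (\<pi> k)"
proof -
  have "\<pi> (inv k) \<otimes>\<^bsub>V\<^esub> \<pi> k = \<one>\<^bsub>V\<^esub>"
    using pi_mult[OF K_closed(2)[OF k] k] K_carrier[OF k] pi_one by simp
  then show ?thesis using V.inv_equality K_closed(2)[OF k] k by simp
qed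

text \<open>Conjugation by \<open>k\<close> on \<open>K\<close> becomes trivial after applying
  \<pi>, because \<open>V\<close> is commutative.\<close>

lemma K_act: assumes k: "k \<in> K" and v: "v \<in> carrier V" shows "act k v = v"
proof -
  have "v \<in> \<pi> ` K" using v pi_surj by simp
  then obtain x where x: "x \<in> K" "v = \<pi> x" by blast
  have "act k v = \<pi> (k \<otimes> x \<otimes> inv k)" using pi_conj[OF K_carrier[OF k] x(1)] x by simp
  also have "\<dots> = \<pi> k \<otimes>\<^bsub>V\<^esub> \<pi> x \<otimes>\<^bsub>V\<^esub> inv\<^bsub>V\<^esub> \<pi> k"
    using k x K_closed by (simp add: pi_mult pi_inv)
  also have "\<dots> = \<pi> x"
    using k x V.inv_solve_right[of "\<pi> x" "\<pi> k \<otimes>\<^bsub>V\<^esub> \<pi> x" "\<pi> k"] by (simp add: V.m_comm)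
  finally show ?thesis using x by simp
qed

text \<open>The derivation is the projection along \<open>L\<close>, sending
  \<open>k \<otimes> l\<close> to \<open>\<pi> k\<close>. Two factorisations of one element differ
  by an element of the intersection of \<open>L\<close> and \<open>K\<close>, on which \<pi> is
  trivial, so the value is well defined.\<close>

lemma supplement_derivation:
  assumes L: "subgroup L G" and sup: "\<And>g. g \<in> carrier G \<Longrightarrow> \<exists>k\<in>K. \<exists>l\<in>L. g = k \<otimes> l"
    and triv: "\<And>x. \<lbrakk>x \<in> L; x \<in> K\<rbrakk> \<Longrightarrow> \<pi> x = \<one>\<^bsub>V\<^esub>"
  shows "\<exists>\<delta>\<in>Z1. (\<forall>l\<in>L. \<delta> l = \<one>\<^bsub>V\<^esub>) \<and> (\<forall>k\<in>K. \<delta> k = \<pi> k)"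
proof -
  have Lc: "l \<in> carrier G" if "l \<in> L" for l by (rule subgroup.mem_carrier[OF L that])
  define f where "f = (\<lambda>g. \<pi> (SOME k. k \<in> K \<and> (\<exists>l\<in>L. g = k \<otimes> l)))"
  have f: "f (k \<otimes> l) = \<pi> k" if kl: "k \<in> K" "l \<in> L" for k l
  proof -
    let ?k = "SOME k'. k' \<in> K \<and> (\<exists>l'\<in>L. k \<otimes> l = k' \<otimes> l')"
    have "?k \<in> K \<and> (\<exists>l'\<in>L. k \<otimes> l = ?k \<otimes> l')" by (rule someI_ex) (use kl in blast)
    then obtain l' where l': "?k \<in> K" "l' \<in> L" "k \<otimes> l = ?k \<otimes> l'" by blast
    note c = K_carrier[OF kl(1)] Lc[OF kl(2)] K_carrier[OF l'(1)] Lc[OF l'(2)]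
    have "inv ?k \<otimes> k = l' \<otimes> inv l"
    proof -
      have "inv ?k \<otimes> k = inv ?k \<otimes> (k \<otimes> l) \<otimes> inv l" using c by (simp add: m_assoc)
      also have "\<dots> = inv ?k \<otimes> (?k \<otimes> l') \<otimes> inv l" using l'(3) by simp
      also have "\<dots> = l' \<otimes> inv l" using c by (simp add: m_assoc[symmetric])
      finally show ?thesis .
    qed
    then have "inv ?k \<otimes> k \<in> L" using l' kl L by (simp add: subgroup.m_closed subgroup.m_inv_closed)
    moreover have "inv ?k \<otimes> k \<in> K" using l' kl K_closed by blast
    ultimately have "\<pi> (inv ?k \<otimes> k) = \<one>\<^bsub>V\<^esub>" using triv by blast
    then have "inv\<^bsub>V\<^esub> \<pi> ?k \<otimes>\<^bsub>V\<^esub> \<pi> k = \<one>\<^bsub>V\<^esub>" using l' kl K_closed by (simp add: pi_mult pi_inv)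
    then have "\<pi> k = \<pi> ?k" using l'(1) kl(1) V.inv_solve_left'[of "\<one>\<^bsub>V\<^esub>" "\<pi> ?k" "\<pi> k"] by simp
    then show ?thesis by (simp add: f_def)
  qed
  have "(\<lambda>g\<in>carrier G. f g) \<in> Z1"
  proof (rule Z1I)
    fix g assume "g \<in> carrier G"
    then obtain k l where "k \<in> K" "l \<in> L" "g = k \<otimes> l" using sup by blast
    then show "f g \<in> carrier V" using f by simp
  next
    fix g g' assume "g \<in> carrier G" "g' \<in> carrier G"
    then obtain k l k' l' where *: "k \<in> K" "l \<in> L" "g = k \<otimes> l" "k' \<in> K" "l' \<in> L" "g' = k' \<otimes> l'"
      using sup by meson
    note c = K_carrier[OF *(1)] Lc[OF *(2)] K_carrier[OF *(4)] Lc[OF *(5)]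
    have "g \<otimes> g' = (k \<otimes> (l \<otimes> k' \<otimes> inv l)) \<otimes> (l \<otimes> l')"
      using c by (simp add: * m_assoc inv_solve_left)
    moreover have kk: "l \<otimes> k' \<otimes> inv l \<in> K" using K_conj c * by blast
    ultimately have "f (g \<otimes> g') = \<pi> (k \<otimes> (l \<otimes> k' \<otimes> inv l))"
      using * K_closed L by (simp add: f subgroup.m_closed)
    also have "\<dots> = \<pi> k \<otimes>\<^bsub>V\<^esub> act l (\<pi> k')" using * c kk by (simp add: pi_mult pi_conj)
    also have "act l (\<pi> k') = act g (\<pi> k')" using * c K_act[OF *(1)] by (simp add: act_comp)
    finally show "f (g \<otimes> g') = f g \<otimes>\<^bsub>V\<^esub> act g (f g')" using * by (simp add: f)
  qed
  moreover have "f l = \<one>\<^bsub>V\<^esub>" if "l \<in> L" for l using f[OF K_closed(3) that] Lc[OF that] pi_one by simp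
  moreover have "f k = \<pi> k" if "k \<in> K" for k
    using f[OF that subgroup.one_closed[OF L]] K_carrier[OF that] by simp
  ultimately show ?thesis
    using Lc K_carrier by (intro bexI[of _ "\<lambda>g\<in>carrier G. f g"]) auto
qed

end

locale irr_gmod_chief = irr_gmod + gmod_chief
begin

text \<open>The image under \<pi> of the intersection of \<open>L\<close> and \<open>K\<close> is a
  submodule, because \<open>K\<close> acts trivially and \<open>G\<close> therefore acts through
  \<open>L\<close>. If it is trivial, projection along \<open>L\<close> is a derivation; if it is
  all of \<open>V\<close>, the factor in \<open>K\<close> can be corrected by an element of
  \<open>L\<close> until \<pi> kills it.\<close>

lemma supplement_dichotomy:
  assumes L: "subgroup L G" and sup: "\<And>g. g \<in> carrier G \<Longrightarrow> \<exists>k\<in>K. \<exists>l\<in>L. g = k \<otimes> l"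
  shows "(\<forall>g\<in>carrier G. \<exists>k\<in>K. \<exists>l\<in>L. \<pi> k = \<one>\<^bsub>V\<^esub> \<and> g = k \<otimes> l) \<or>
    (\<exists>\<delta>\<in>Z1. (\<forall>l\<in>L. \<delta> l = \<one>\<^bsub>V\<^esub>) \<and> (\<forall>k\<in>K. \<delta> k = \<pi> k))"
proof -
  have Lc: "l \<in> carrier G" if "l \<in> L" for l by (rule subgroup.mem_carrier[OF L that])
  note Lcl = subgroup.m_closed[OF L] subgroup.m_inv_closed[OF L] subgroup.one_closed[OF L]
  let ?W = "\<pi> ` (L \<inter> K)"
  have "subgroup ?W V"
  proof (rule V.subgroupI)
    show "?W \<subseteq> carrier V" by auto
    show "?W \<noteq> {}" using Lcl K_closed by blast
    show "inv\<^bsub>V\<^esub> a \<in> ?W" if "a \<in> ?W" for a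
    proof -
      from that obtain x where x: "x \<in> L" "x \<in> K" "a = \<pi> x" by blast
      then have "inv\<^bsub>V\<^esub> a = \<pi> (inv x)" by (simp add: pi_inv)
      then show ?thesis using x Lcl K_closed by blast
    qed
    show "a \<otimes>\<^bsub>V\<^esub> b \<in> ?W" if "a \<in> ?W" "b \<in> ?W" for a b
    proof -
      from that obtain x y where x: "x \<in> L" "x \<in> K" "a = \<pi> x" "y \<in> L" "y \<in> K" "b = \<pi> y" by blast
      then have "a \<otimes>\<^bsub>V\<^esub> b = \<pi> (x \<otimes> y)" by (simp add: pi_mult)
      then show ?thesis using x Lcl K_closed by blast
    qed
  qed
  moreover have "act g w \<in> ?W" if gw: "g \<in> carrier G" "w \<in> ?W" for g w
  proof -
    obtain k l where kl: "k \<in> K" "l \<in> L" "g = k \<otimes> l" using sup gw(1) by blast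
    obtain x where x: "x \<in> L" "x \<in> K" "w = \<pi> x" using gw(2) by blast
    have "act g w = \<pi> (l \<otimes> x \<otimes> inv l)"
      using kl x Lc K_carrier K_act[OF kl(1)] by (simp add: act_comp pi_conj)
    moreover have "l \<otimes> x \<otimes> inv l \<in> L \<inter> K" using kl x Lcl Lc K_conj[of l x] by simp
    ultimately show ?thesis by blast
  qed
  ultimately have "?W = {\<one>\<^bsub>V\<^esub>} \<or> ?W = carrier V" by (rule irreducible)
  then show ?thesis
  proof
    assume "?W = {\<one>\<^bsub>V\<^esub>}"
    then have "\<pi> x = \<one>\<^bsub>V\<^esub>" if "x \<in> L" "x \<in> K" for x using that by blast
    then show ?thesis using supplement_derivation[OF L sup] by blast
  next
    assume W: "?W = carrier V"
    have *: "\<exists>k\<in>K. \<exists>l\<in>L. \<pi> k = \<one>\<^bsub>V\<^esub> \<and> g = k \<otimes> l" if g: "g \<in> carrier G" for g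
    proof -
      obtain k l where kl: "k \<in> K" "l \<in> L" "g = k \<otimes> l" using sup g by blast
      have "\<pi> k \<in> ?W" using kl W by simp
      then obtain x where x: "x \<in> L" "x \<in> K" "\<pi> k = \<pi> x" by blast
      have "g = (k \<otimes> inv x) \<otimes> (x \<otimes> l)" using kl x Lc K_carrier by (simp add: m_assoc inv_solve_left)
      moreover have "\<pi> (k \<otimes> inv x) = \<one>\<^bsub>V\<^esub>" using kl x K_closed by (simp add: pi_mult pi_inv)
      moreover have "k \<otimes> inv x \<in> K" "x \<otimes> l \<in> L" using kl x Lcl K_closed by simp_all
      ultimately show ?thesis by blast
    qed
    show ?thesis by (rule disjI1, rule ballI, rule *)
  qed
qed

end

section \<open>Chief factors of soluble groups and lifting of generators\<close>

context group begin

lemma normal_supplement_subgroup: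
  assumes K: "K \<lhd> G" and L: "subgroup L G"
  shows "subgroup {g. \<exists>k\<in>K. \<exists>l\<in>L. g = k \<otimes> l} G" (is "subgroup ?S G")
proof -
  have Ks: "subgroup K G" using K normal_imp_subgroup by blast
  note c [simp] = subgroup.mem_carrier[OF Ks] subgroup.mem_carrier[OF L]
  note cl = subgroup.m_closed[OF Ks] subgroup.m_closed[OF L] subgroup.m_inv_closed[OF Ks]
    subgroup.m_inv_closed[OF L] subgroup.one_closed[OF Ks] subgroup.one_closed[OF L]
  have conj: "l \<otimes> k \<otimes> inv l \<in> K" if "k \<in> K" "l \<in> carrier G" for k l
    using K that normal_inv_iff by blast
  show ?thesis
  proof (rule subgroupI)
    show "?S \<subseteq> carrier G" by auto
    show "?S \<noteq> {}" using cl by blast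
    fix a assume "a \<in> ?S"
    then obtain k l where a: "k \<in> K" "l \<in> L" "a = k \<otimes> l" by blast
    have "inv a = (inv l \<otimes> inv k \<otimes> inv (inv l)) \<otimes> inv l"
      using a by (simp add: inv_mult_group m_assoc)
    moreover have "inv l \<otimes> inv k \<otimes> inv (inv l) \<in> K" using a by (intro conj) (simp_all add: cl)
    moreover have "inv l \<in> L" using a by (simp add: cl)
    ultimately show "inv a \<in> ?S" by blast
  next
    fix a b assume "a \<in> ?S" "b \<in> ?S"
    then obtain k l k' l' where a: "k \<in> K" "l \<in> L" "a = k \<otimes> l" "k' \<in> K" "l' \<in> L" "b = k' \<otimes> l'"
      by blast
    have "a \<otimes> b = (k \<otimes> (l \<otimes> k' \<otimes> inv l)) \<otimes> (l \<otimes> l')" using a by (simp add: m_assoc inv_solve_left)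
    moreover have "l \<otimes> k' \<otimes> inv l \<in> K" using a by (intro conj) simp_all
    then have "k \<otimes> (l \<otimes> k' \<otimes> inv l) \<in> K" using a by (simp add: cl)
    moreover have "l \<otimes> l' \<in> L" using a by (simp add: cl)
    ultimately show "a \<otimes> b \<in> ?S" by blast
  qed
qed

lemma normal_supplementI:
  assumes K: "K \<lhd> G" and L: "subgroup L G" and gen: "generate G S = carrier G"
    and S: "\<And>s. s \<in> S \<Longrightarrow> \<exists>k\<in>K. \<exists>l\<in>L. s = k \<otimes> l" and g: "g \<in> carrier G"
  shows "\<exists>k\<in>K. \<exists>l\<in>L. g = k \<otimes> l"
  using generate_subgroup_incl[OF _ normal_supplement_subgroup[OF K L], of S] gen S g by blast

lemma exp_of_derived_self_is_normal: "(derived G ^^ n) (carrier G) \<lhd> G"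
  by (induction n) (simp_all add: normal_self derived_is_normal)

lemma r_coset_eq_iff:
  assumes N: "subgroup N G" and a: "a \<in> carrier G" and b: "b \<in> carrier G"
  shows "N #> a = N #> b \<longleftrightarrow> a \<otimes> inv b \<in> N"
proof
  assume "N #> a = N #> b"
  then have "a \<in> N #> b" using rcos_self[OF a N] by simp
  then show "a \<otimes> inv b \<in> N" using subgroup.rcos_module_imp[OF N group_axioms b] by blast
next
  assume "a \<otimes> inv b \<in> N"
  then have "a \<in> N #> b" using subgroup.rcos_module_rev[OF N group_axioms b a] by blast
  then show "N #> a = N #> b" using repr_independence[OF _ b N] by simp
qed

lemma r_coset_group_hom: "N \<lhd> G \<Longrightarrow> group_hom G (G Mod N) (\<lambda>a. N #> a)"
  using normal.factorgroup_is_group normal.r_coset_hom_Mod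
  by (intro group_hom.intro) (auto simp: group_hom_axioms_def)

text \<open>The last member of the derived series not contained in \<open>N\<close> has its derived
  subgroup inside \<open>N\<close>, so its product with \<open>N\<close> is abelian modulo
  \<open>N\<close>. A minimal normal subgroup with this property strictly above \<open>N\<close> is
  the desired \<open>K\<close>.\<close>

lemma exists_abelian_chief_factor:
  assumes fin: "finite (carrier G)" and sol: "solvable G" and N: "N \<lhd> G" "N \<noteq> carrier G"
  shows "\<exists>K. K \<lhd> G \<and> N \<subset> K \<and> (\<forall>a\<in>K. \<forall>b\<in>K. N #> (a \<otimes> b) = N #> (b \<otimes> a)) \<and>
    (\<forall>K'. K' \<lhd> G \<and> N \<subseteq> K' \<and> K' \<subseteq> K \<longrightarrow> K' = N \<or> K' = K)"
proof -
  interpret NG: group_hom G "G Mod N" "\<lambda>a. N #> a" by (rule r_coset_group_hom[OF N(1)])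
  have Ns: "subgroup N G" using N(1) normal_imp_subgroup by blast
  have Nc: "N \<subseteq> carrier G" using subgroup.subset[OF Ns] .
  let ?D = "\<lambda>i. (derived G ^^ i) (carrier G)"
  obtain n where "?D n = {\<one>}" using sol solvable_iff_trivial_derived_seq by blast
  then have "?D n \<subseteq> N" using subgroup.one_closed[OF Ns] by simp
  then obtain m where m: "?D m \<subseteq> N" "\<And>i. i < m \<Longrightarrow> \<not> ?D i \<subseteq> N"
    using ex_least_nat_le[of "\<lambda>i. ?D i \<subseteq> N" n] by blast
  have "m \<noteq> 0" using m(1) N(2) Nc by auto
  then obtain i where i: "m = Suc i" by (cases m) auto
  define J where "J = ?D i"
  have J: "\<not> J \<subseteq> N" "J \<lhd> G" "derived G J \<subseteq> N"
    using m i exp_of_derived_self_is_normal by (auto simp: J_def)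
  have Js: "subgroup J G" using J(2) normal_imp_subgroup by blast
  have Jc: "j \<in> carrier G" if "j \<in> J" for j by (rule subgroup.mem_carrier[OF Js that])
  have Jcomm: "N #> (a \<otimes> b) = N #> (b \<otimes> a)" if a: "a \<in> J" and b: "b \<in> J" for a b
  proof -
    have "a \<otimes> b \<otimes> inv a \<otimes> inv b \<in> derived G J"
      unfolding derived_def by (rule generate.incl) (use a b in auto)
    then have "(a \<otimes> b) \<otimes> inv (b \<otimes> a) \<in> N"
      using J(3) Jc[OF a] Jc[OF b] by (auto simp: inv_mult_group m_assoc)
    then show ?thesis
      using r_coset_eq_iff[OF Ns, of "a \<otimes> b" "b \<otimes> a"] Jc[OF a] Jc[OF b] by (simp del: NG.hom_mult)
  qed
  define P where "P = (\<lambda>K. K \<lhd> G \<and> N \<subset> K \<and> (\<forall>a\<in>K. \<forall>b\<in>K. N #> (a \<otimes> b) = N #> (b \<otimes> a)))"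
  have "P {g. \<exists>k\<in>N. \<exists>l\<in>J. g = k \<otimes> l}" (is "P ?K")
    unfolding P_def
  proof (intro conjI ballI)
    have rep: "\<exists>j\<in>J. N #> a = N #> j \<and> a \<in> carrier G" if a: "a \<in> ?K" for a
    proof -
      from a obtain k l where kl: "k \<in> N" "l \<in> J" "a = k \<otimes> l" by blast
      have "k \<in> carrier G" using kl Nc by blast
      then have "N #> a = N #> l" using r_coset_eq_iff[OF Ns, of a l] kl Jc by (simp add: m_assoc del: NG.hom_mult)
      then show ?thesis using kl Jc \<open>k \<in> carrier G\<close> by auto
    qed
    show "?K \<lhd> G"
    proof (rule normal_invI[OF normal_supplement_subgroup[OF N(1) Js]])
      fix x h assume x: "x \<in> carrier G" and "h \<in> ?K"
      then obtain k l where kl: "k \<in> N" "l \<in> J" "h = k \<otimes> l" by blast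
      have kc: "k \<in> carrier G" using kl Nc by blast
      have "x \<otimes> h \<otimes> inv x = (x \<otimes> k \<otimes> inv x) \<otimes> (x \<otimes> l \<otimes> inv x)"
        using x kc Jc[OF kl(2)] kl(3) by (simp add: m_assoc inv_solve_left)
      moreover have "x \<otimes> k \<otimes> inv x \<in> N" using N(1) x kl(1) normal_inv_iff by blast
      moreover have "x \<otimes> l \<otimes> inv x \<in> J" using J(2) x kl(2) normal_inv_iff by blast
      ultimately show "x \<otimes> h \<otimes> inv x \<in> ?K" by blast
    qed
    show "N \<subset> ?K"
    proof
      show "N \<subseteq> ?K"
      proof
        fix k assume "k \<in> N"
        then have "k = k \<otimes> \<one>" "k \<in> N" using Nc by auto
        then show "k \<in> ?K" using subgroup.one_closed[OF Js] by blast
      qed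
      obtain j where j: "j \<in> J" "j \<notin> N" using J(1) by blast
      then have "j = \<one> \<otimes> j" using Jc by simp
      then have "j \<in> ?K" using j subgroup.one_closed[OF Ns] by blast
      then show "N \<noteq> ?K" using j by blast
    qed
    fix a b assume ab: "a \<in> ?K" "b \<in> ?K"
    obtain j where j: "j \<in> J" "N #> a = N #> j" "a \<in> carrier G" using rep[OF ab(1)] by blast
    obtain j' where j': "j' \<in> J" "N #> b = N #> j'" "b \<in> carrier G" using rep[OF ab(2)] by blast
    note * = j j'
    have "N #> (a \<otimes> b) = N #> (j \<otimes> j')" using * Jc NG.hom_mult by (metis)
    also have "\<dots> = N #> (j' \<otimes> j)" by (rule Jcomm[OF *(1,4)])
    also have "\<dots> = N #> (b \<otimes> a)" using * Jc NG.hom_mult by (metis)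
    finally show "N #> (a \<otimes> b) = N #> (b \<otimes> a)" .
  qed
  moreover have "finite {K. P K}"
  proof (rule finite_subset)
    show "{K. P K} \<subseteq> Pow (carrier G)"
    proof
      fix K assume "K \<in> {K. P K}"
      then have "K \<lhd> G" unfolding P_def by simp
      then have "subgroup K G" by (rule normal_imp_subgroup)
      then show "K \<in> Pow (carrier G)" using subgroup.subset by (intro PowI)
    qed
    show "finite (Pow (carrier G))" using fin by simp
  qed
  ultimately obtain K where K: "P K" "\<And>K'. P K' \<Longrightarrow> K' \<subseteq> K \<Longrightarrow> K' = K"
    using finite_has_minimal[of "{K. P K}"] by blast
  have "K' = N \<or> K' = K" if "K' \<lhd> G" "N \<subseteq> K'" "K' \<subseteq> K" for K'
    using K(2)[OF _ that(3)] K(1) that unfolding P_def by blast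
  then show ?thesis using K(1) unfolding P_def by blast
qed

text \<open>The module is the chief factor \<open>K / N\<close> with \<open>G\<close> acting by conjugation.\<close>

lemma chief_factor_module:
  assumes fin: "finite (carrier G)" and N: "N \<lhd> G" and K: "K \<lhd> G" "N \<subset> K"
    and comm: "\<And>a b. \<lbrakk>a \<in> K; b \<in> K\<rbrakk> \<Longrightarrow> N #> (a \<otimes> b) = N #> (b \<otimes> a)"
    and min: "\<And>K'. \<lbrakk>K' \<lhd> G; N \<subseteq> K'; K' \<subseteq> K\<rbrakk> \<Longrightarrow> K' = N \<or> K' = K"
  shows "\<exists>(V :: 'a set monoid) act. irr_gmod_chief G V act K (\<lambda>a. N #> a) \<and>
    (\<forall>k\<in>K. N #> k = \<one>\<^bsub>V\<^esub> \<longleftrightarrow> k \<in> N)"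
proof -
  define \<phi> where "\<phi> = (\<lambda>a. N #> a)"
  have hom: "group_hom G (G Mod N) \<phi>" unfolding \<phi>_def by (rule r_coset_group_hom[OF N])
  have \<phi>_mult: "\<phi> (a \<otimes> b) = \<phi> a \<otimes>\<^bsub>G Mod N\<^esub> \<phi> b" if "a \<in> carrier G" "b \<in> carrier G" for a b
    using group_hom.hom_mult[OF hom] that by blast
  have Ns: "subgroup N G" and Ks: "subgroup K G" using N K normal_imp_subgroup by blast+
  have Kc [simp]: "k \<in> carrier G" if "k \<in> K" for k by (rule subgroup.mem_carrier[OF Ks that])
  have Kconj: "g \<otimes> k \<otimes> inv g \<in> K" if "g \<in> carrier G" "k \<in> K" for g k
    using K(1) that normal_inv_iff by blast
  define V where "V = (G Mod N)\<lparr>carrier := \<phi> ` K\<rparr>"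
  define act where "act = (\<lambda>g v. \<phi> g \<otimes>\<^bsub>G Mod N\<^esub> v \<otimes>\<^bsub>G Mod N\<^esub> \<phi> (inv g))"
  have act: "act g (\<phi> k) = \<phi> (g \<otimes> k \<otimes> inv g)" if "g \<in> carrier G" "k \<in> K" for g k
    unfolding act_def using that by (simp del: mult_FactGroup add: \<phi>_mult)
  have sub: "subgroup (\<phi> ` K) (G Mod N)" by (rule group_hom.subgroup_img_is_subgroup[OF hom Ks])
  then have Vgrp: "group V" unfolding V_def
    by (rule group.subgroup_imp_group[OF group_hom.axioms(2)[OF hom]])
  have Vcomm: "comm_group V"
  proof (rule group.group_comm_groupI[OF Vgrp])
    fix v w assume "v \<in> carrier V" "w \<in> carrier V"
    then obtain a b where ab: "a \<in> K" "b \<in> K" "v = \<phi> a" "w = \<phi> b" by (auto simp: V_def)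
    then show "v \<otimes>\<^bsub>V\<^esub> w = w \<otimes>\<^bsub>V\<^esub> v"
      using comm[OF ab(1,2), folded \<phi>_def] \<phi>_mult[of a b] \<phi>_mult[of b a] by (simp add: V_def)
  qed
  have one_iff: "\<phi> k = \<one>\<^bsub>V\<^esub> \<longleftrightarrow> k \<in> N" if "k \<in> K" for k
    using r_coset_eq_iff[OF Ns, of k \<one>] that coset_mult_one[OF subgroup.subset[OF Ns]]
    by (simp add: V_def \<phi>_def)
  interpret V: comm_group V by (rule Vcomm)
  have Vel: "\<exists>k\<in>K. v = \<phi> k" if "v \<in> carrier V" for v using that by (auto simp: V_def)
  have Vin: "\<phi> k \<in> carrier V" if "k \<in> K" for k using that by (auto simp: V_def)
  have Vmult: "\<phi> a \<otimes>\<^bsub>V\<^esub> \<phi> b = \<phi> (a \<otimes> b)" if "a \<in> K" "b \<in> K" for a b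
    using \<phi>_mult[of a b] that by (simp add: V_def)
  interpret M: gmod G V act
  proof (unfold_locales)
    show "finite (carrier G)" by (rule fin)
    show "finite (carrier V)"
      using fin subgroup.subset[OF Ks] by (auto simp: V_def intro: finite_subset)
    fix g v assume g: "g \<in> carrier G" and v: "v \<in> carrier V"
    then obtain k where k: "k \<in> K" "v = \<phi> k" using Vel by blast
    show "act g v \<in> carrier V" using act[OF g k(1)] Kconj[OF g k(1)] Vin k by simp
    fix w assume "w \<in> carrier V"
    then obtain l where l: "l \<in> K" "w = \<phi> l" using Vel by blast
    have kl: "k \<otimes> l \<in> K" using k l subgroup.m_closed[OF Ks] by blast
    have "act g (v \<otimes>\<^bsub>V\<^esub> w) = \<phi> (g \<otimes> (k \<otimes> l) \<otimes> inv g)"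
      using k l kl by (simp add: Vmult act[OF g])
    also have "g \<otimes> (k \<otimes> l) \<otimes> inv g = (g \<otimes> k \<otimes> inv g) \<otimes> (g \<otimes> l \<otimes> inv g)"
      using g k l by (simp add: m_assoc inv_solve_left)
    also have "\<phi> \<dots> = act g v \<otimes>\<^bsub>V\<^esub> act g w"
      using Kconj[OF g] k l by (simp add: Vmult act[OF g])
    finally show "act g (v \<otimes>\<^bsub>V\<^esub> w) = act g v \<otimes>\<^bsub>V\<^esub> act g w" .
  next
    fix v assume "v \<in> carrier V"
    then obtain k where k: "k \<in> K" "v = \<phi> k" using Vel by blast
    then show "act \<one> v = v" by (simp add: act)
  next
    fix g h v assume g: "g \<in> carrier G" and h: "h \<in> carrier G" and "v \<in> carrier V"
    then obtain k where k: "k \<in> K" "v = \<phi> k" using Vel by blast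
    show "act (g \<otimes> h) v = act g (act h v)"
      using g h k Kconj[OF h k(1)] by (simp add: act inv_mult_group m_assoc)
  qed
  have "irr_gmod_chief G V act K \<phi>"
  proof (intro irr_gmod_chief.intro irr_gmod.intro gmod_chief.intro M.gmod_axioms
      irr_gmod_axioms.intro gmod_chief_axioms.intro)
    obtain k where "k \<in> K" "k \<notin> N" using K(2) by blast
    then show "carrier V \<noteq> {\<one>\<^bsub>V\<^esub>}" using one_iff[of k] Vin[of k] by auto
  next
    fix W assume W: "subgroup W V" and inv: "\<And>g w. \<lbrakk>g \<in> carrier G; w \<in> W\<rbrakk> \<Longrightarrow> act g w \<in> W"
    \<comment> \<open>The preimage of a submodule is a normal subgroup between \<open>N\<close> and
      \<open>K\<close>, so the minimality of \<open>K\<close> gives irreducibility.\<close>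
    let ?K = "{k \<in> K. \<phi> k \<in> W}"
    have Wc: "W \<subseteq> carrier V" by (rule subgroup.subset[OF W])
    have "?K \<lhd> G"
    proof (rule normal_invI)
      show "subgroup ?K G"
      proof (rule subgroupI)
        show "?K \<subseteq> carrier G" by auto
        have "\<phi> \<one> = \<one>\<^bsub>V\<^esub>"
          using one_iff[OF subgroup.one_closed[OF Ks]] subgroup.one_closed[OF Ns] by blast
        then have "\<phi> \<one> \<in> W" using subgroup.one_closed[OF W] by simp
        then show "?K \<noteq> {}" using subgroup.one_closed[OF Ks] by blast
        fix a assume a: "a \<in> ?K"
        have "inv\<^bsub>V\<^esub> \<phi> a = \<phi> (inv a)"
        proof (rule V.inv_equality)
          have "\<phi> (inv a) \<otimes>\<^bsub>V\<^esub> \<phi> a = \<phi> \<one>"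
            using Vmult[of "inv a" a] a subgroup.m_inv_closed[OF Ks] by simp
          also have "\<dots> = \<one>\<^bsub>V\<^esub>"
            using one_iff[OF subgroup.one_closed[OF Ks]] subgroup.one_closed[OF Ns] by blast
          finally show "\<phi> (inv a) \<otimes>\<^bsub>V\<^esub> \<phi> a = \<one>\<^bsub>V\<^esub>" .
        qed (use a Vin subgroup.m_inv_closed[OF Ks] in auto)
        then show "inv a \<in> ?K"
          using a subgroup.m_inv_closed[OF Ks] subgroup.m_inv_closed[OF W, of "\<phi> a"] by simp
        fix b assume b: "b \<in> ?K"
        then show "a \<otimes> b \<in> ?K"
          using a Vmult[of a b] subgroup.m_closed[OF Ks, of a b] subgroup.m_closed[OF W, of "\<phi> a" "\<phi> b"]
          by simp
      qed
      fix x h assume x: "x \<in> carrier G" and h: "h \<in> ?K"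
      then show "x \<otimes> h \<otimes> inv x \<in> ?K" using Kconj[OF x] inv[OF x, of "\<phi> h"] act[OF x] by simp
    qed
    moreover have "N \<subseteq> ?K"
    proof
      fix k assume k: "k \<in> N"
      then have "k \<in> K" using K(2) by blast
      then show "k \<in> ?K" using one_iff[of k] k subgroup.one_closed[OF W] by simp
    qed
    ultimately have "?K = N \<or> ?K = K" using min by blast
    then show "W = {\<one>\<^bsub>V\<^esub>} \<or> W = carrier V"
    proof
      assume "?K = N"
      then have "w = \<one>\<^bsub>V\<^esub>" if w: "w \<in> W" for w
      proof -
        obtain k where k: "k \<in> K" "w = \<phi> k" using Vel Wc w by blast
        then have "k \<in> N" using \<open>?K = N\<close> w by blast
        then show ?thesis using one_iff k by blast
      qed
      then show ?thesis using subgroup.one_closed[OF W] by blast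
    next
      assume "?K = K"
      then have "carrier V \<subseteq> W" using Vel by blast
      then show ?thesis using Wc by blast
    qed
  next
    show "K \<lhd> G" by (rule K(1))
    show "\<phi> (a \<otimes> b) = \<phi> a \<otimes>\<^bsub>V\<^esub> \<phi> b" if "a \<in> K" "b \<in> K" for a b using Vmult that by simp
    show "\<phi> ` K = carrier V" by (simp add: V_def)
    show "\<phi> (g \<otimes> k \<otimes> inv g) = act g (\<phi> k)" if "g \<in> carrier G" "k \<in> K" for g k
      using act that by simp
  qed
  then show ?thesis using one_iff unfolding \<phi>_def by blast
qed

text \<open>A version of Gaschuetz's lemma with one entry fixed and the others confined to
  \<open>M\<close>, proved along a chief factor \<open>K / N\<close>. If
  \<open>K \<subseteq> M\<close>, a tuple that works modulo \<open>K\<close> may be multiplied by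
  elements of \<open>K\<close> without leaving \<open>M\<close>, and the averaging lemma makes it
  work modulo \<open>N\<close>. If not, \<open>M\<close> is a complement of \<open>K / N\<close>:
  the \<open>M\<close>-parts of \<open>ys\<close> generate \<open>M\<close> modulo \<open>N\<close>,
  and \<open>x\<close> supplies the rest.\<close>

theorem solvable_gen_over_maximal_mod:
  assumes fin: "finite (carrier G)" and sol: "solvable G" and A: "A \<lhd> G"
    and ys: "set ys \<subseteq> carrier G" "generate G (set ys \<union> A) = carrier G"
    and M: "maximal_subgroup M G" and x: "x \<in> carrier G" "x \<notin> M"
    and N: "N \<lhd> G" "A \<subseteq> N" "N \<subseteq> M"
  shows "\<exists>zs. set zs \<subseteq> M \<and> length zs = length ys \<and> generate G (insert x (set zs) \<union> N) = carrier G"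
  using N
proof (induction "card (carrier G) - card N" arbitrary: N rule: less_induct)
  case less
  note N = less.prems
  have Ms: "subgroup M G" "M \<noteq> carrier G" and Mc: "M \<subseteq> carrier G"
    using M maximal_subgroup_imp_subset unfolding maximal_subgroup_def by blast+
  note Mcl = subgroup.m_closed[OF Ms(1)] subgroup.m_inv_closed[OF Ms(1)]
  have Ns: "subgroup N G" using N(1) normal_imp_subgroup by blast
  have Nc: "N \<subseteq> carrier G" by (rule subgroup.subset[OF Ns])
  have "N \<noteq> carrier G" using N(3) Ms(2) Mc by blast
  then obtain K where K: "K \<lhd> G" "N \<subset> K" "\<forall>a\<in>K. \<forall>b\<in>K. N #> (a \<otimes> b) = N #> (b \<otimes> a)"
      "\<forall>K'. K' \<lhd> G \<and> N \<subseteq> K' \<and> K' \<subseteq> K \<longrightarrow> K' = N \<or> K' = K"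
    using exists_abelian_chief_factor[OF fin sol N(1)] by blast
  obtain V :: "'a set monoid" and act where irr: "irr_gmod_chief G V act K (\<lambda>a. N #> a)"
      and one: "\<forall>k\<in>K. N #> k = \<one>\<^bsub>V\<^esub> \<longleftrightarrow> k \<in> N"
    using chief_factor_module[OF fin N(1) K(1,2)] K(3,4) by blast
  interpret irr_gmod_chief G V act K "\<lambda>a. N #> a" by (rule irr)
  show ?case
  proof (cases "K \<subseteq> M")
    case True
    have Kc: "K \<subseteq> carrier G" by (rule subgroup.subset[OF K_subgroup])
    have "card N < card K" using K(2) Kc fin by (meson finite_subset psubset_card_mono)
    moreover have "card K \<le> card (carrier G)" using Kc fin card_mono by blast
    ultimately have "card (carrier G) - card K < card (carrier G) - card N" by linarith
    moreover have "A \<subseteq> K" using N(2) K(2) by blast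
    ultimately have "\<exists>zs. set zs \<subseteq> M \<and> length zs = length ys \<and>
        generate G (insert x (set zs) \<union> K) = carrier G"
      by (rule less.hyps[OF _ K(1) _ True])
    then obtain zs where zs: "set zs \<subseteq> M" "length zs = length ys"
        "generate G (insert x (set zs) \<union> K) = carrier G" by blast
    \<comment> \<open>An obstruction to lifting is a derivation that vanishes at \<open>x\<close>
      and is the coset map on \<open>K\<close>; the dichotomy leaves no other. All of these vanish
      on \<open>A\<close> and so lie in \<open>D0\<close>, which has at most
      \<open>card V ^ length ys\<close> members. The trivial derivation belongs to \<open>D0\<close>
      but is no obstruction, hence the strict inequality.\<close>
    define D0 where "D0 = {\<delta> \<in> Z1. \<forall>a\<in>A. \<delta> a = \<one>\<^bsub>V\<^esub>}"
    define D where "D = {\<delta> \<in> Z1. \<delta> x = \<one>\<^bsub>V\<^esub> \<and> (\<forall>k\<in>K. \<delta> k = N #> k)}"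
    have "card D0 \<le> card (carrier V) ^ length ys"
      by (rule card_Z1_le_power[OF _ _ _ ys]) (use N(2) Nc in \<open>auto simp: D0_def\<close>)
    moreover have "card D < card D0"
    proof (rule psubset_card_mono)
      show "finite D0" using finite_Z1 by (simp add: D0_def)
      have "D \<subseteq> D0"
      proof
        fix \<delta> assume d: "\<delta> \<in> D"
        have "\<delta> a = \<one>\<^bsub>V\<^esub>" if a: "a \<in> A" for a
        proof -
          have "a \<in> N" "a \<in> K" using a N(2) K(2) by blast+
          then show ?thesis using d one unfolding D_def by simp
        qed
        then show "\<delta> \<in> D0" using d by (simp add: D_def D0_def)
      qed
      moreover have "(\<lambda>g\<in>carrier G. \<one>\<^bsub>V\<^esub>) \<in> D0" using Z1_trivial N(2) Nc by (auto simp: D0_def)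
      moreover obtain k where k: "k \<in> K" "k \<notin> N" using K(2) by blast
      have "(\<lambda>g\<in>carrier G. \<one>\<^bsub>V\<^esub>) \<notin> D"
      proof
        assume "(\<lambda>g\<in>carrier G. \<one>\<^bsub>V\<^esub>) \<in> D"
        then have "\<one>\<^bsub>V\<^esub> = N #> k" using k(1) K_carrier[OF k(1)] by (auto simp: D_def)
        then show False using one k by metis
      qed
      ultimately show "D \<subset> D0" by blast
    qed
    ultimately have cardD: "card D < card (carrier V) ^ length zs" using zs(2) by simp
    have DZ: "D \<subseteq> Z1" by (auto simp: D_def)
    have Dsurj: "\<delta> ` K = carrier V" if d: "\<delta> \<in> D" for \<delta>
    proof -
      have "\<delta> ` K = (\<lambda>k. N #> k) ` K" by (rule image_cong[OF refl]) (use d in \<open>simp add: D_def\<close>)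
      then show ?thesis using pi_surj by simp
    qed
    have Kact: "K \<subseteq> actker" using K_act K_carrier by (auto simp: actker_def)
    have zsc: "set zs \<subseteq> carrier G" using zs(1) Mc by blast
    have "\<exists>ws. list_all2 (\<lambda>y z. \<exists>b\<in>K. z = b \<otimes> y) zs ws \<and>
        (\<forall>\<delta>\<in>D. \<exists>z\<in>set ws. \<delta> z \<noteq> \<one>\<^bsub>V\<^esub>)"
      by (rule avoid_derivations[OF K_subgroup Kact finite_subset[OF DZ finite_Z1] DZ _ cardD zsc])
        (rule Dsurj)
    then obtain ws where ws: "list_all2 (\<lambda>y z. \<exists>b\<in>K. z = b \<otimes> y) zs ws"
        "\<forall>\<delta>\<in>D. \<exists>z\<in>set ws. \<delta> z \<noteq> \<one>\<^bsub>V\<^esub>" by blast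
    have len: "length ws = length ys" using ws(1) zs(2) by (simp add: list_all2_lengthD)
    have wM: "set ws \<subseteq> M"
    proof
      fix w assume "w \<in> set ws"
      then obtain i where i: "i < length ws" "w = ws ! i" by (auto simp: in_set_conv_nth)
      then obtain b where b: "b \<in> K" "w = b \<otimes> zs ! i" using list_all2_nthD2[OF ws(1) i(1)] by auto
      have "i < length zs" using i ws(1) by (simp add: list_all2_lengthD)
      then have "zs ! i \<in> M" using zs(1) nth_mem by blast
      then show "w \<in> M" using b True Mcl(1)[of b "zs ! i"] by auto
    qed
    let ?S = "insert x (set ws) \<union> N"
    have Sc: "?S \<subseteq> carrier G" using x wM Mc Nc by blast
    let ?L = "generate G ?S"
    have L: "subgroup ?L G" by (rule generate_is_subgroup[OF Sc])
    have SL: "s \<in> ?L" if "s \<in> ?S" for s by (rule subsetD[OF generate_sincl that])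
    note Lone = subgroup.one_closed[OF L]
    have sup: "\<exists>k\<in>K. \<exists>l\<in>?L. g = k \<otimes> l" if g: "g \<in> carrier G" for g
    proof (rule normal_supplementI[OF K(1) L zs(3) _ g])
      fix s assume "s \<in> insert x (set zs) \<union> K"
      then consider "s = x" | "s \<in> set zs" | "s \<in> K" by blast
      then show "\<exists>k\<in>K. \<exists>l\<in>?L. s = k \<otimes> l"
      proof cases
        case 1
        then show ?thesis using SL[of x] K_closed(3) x(1) by (intro bexI[of _ \<one>] bexI[of _ x]) auto
      next
        case 2
        then obtain i where i: "i < length zs" "s = zs ! i" by (auto simp: in_set_conv_nth)
        then obtain b where b: "b \<in> K" "ws ! i = b \<otimes> s" using list_all2_nthD[OF ws(1) i(1)] by auto
        have "ws ! i \<in> set ws" using i len zs(2) by simp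
        moreover have "s = inv b \<otimes> (ws ! i)"
          using b 2 zsc K_carrier[OF b(1)] by (auto simp: m_assoc[symmetric])
        ultimately show ?thesis using SL[of "ws ! i"] K_closed(2)[OF b(1)] by blast
      next
        case 3
        then show ?thesis using Lone K_carrier by (intro bexI[of _ s] bexI[of _ \<one>]) auto
      qed
    qed
    from supplement_dichotomy[OF L sup] have "carrier G \<subseteq> ?L"
    proof
      assume *: "\<forall>g\<in>carrier G. \<exists>k\<in>K. \<exists>l\<in>?L. N #> k = \<one>\<^bsub>V\<^esub> \<and> g = k \<otimes> l"
      show ?thesis
      proof
        fix g assume "g \<in> carrier G"
        then obtain k l where kl: "k \<in> K" "l \<in> ?L" "N #> k = \<one>\<^bsub>V\<^esub>" "g = k \<otimes> l" using * by blast
        then have "k \<in> N" using one by blast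
        then have "k \<in> ?L" using SL by blast
        then show "g \<in> ?L" using kl subgroup.m_closed[OF L] by blast
      qed
    next
      assume "\<exists>\<delta>\<in>Z1. (\<forall>l\<in>?L. \<delta> l = \<one>\<^bsub>V\<^esub>) \<and> (\<forall>k\<in>K. \<delta> k = N #> k)"
      then obtain \<delta> where d: "\<delta> \<in> Z1" "\<forall>l\<in>?L. \<delta> l = \<one>\<^bsub>V\<^esub>" "\<forall>k\<in>K. \<delta> k = N #> k" by blast
      then have "\<delta> \<in> D" using SL[of x] by (simp add: D_def)
      then obtain z where "z \<in> set ws" "\<delta> z \<noteq> \<one>\<^bsub>V\<^esub>" using ws(2) by blast
      then show ?thesis using d(2) SL[of z] by blast
    qed
    then have "?L = carrier G" using subgroup.subset[OF L] by blast
    then show ?thesis using wM len by blast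
  next
    case False
    have supM: "\<exists>k\<in>K. \<exists>l\<in>M. g = k \<otimes> l" if g: "g \<in> carrier G" for g
    proof -
      let ?T = "{g. \<exists>k\<in>K. \<exists>l\<in>M. g = k \<otimes> l}"
      have T: "subgroup ?T G" by (rule normal_supplement_subgroup[OF K(1) Ms(1)])
      have "m \<in> ?T" if "m \<in> M" for m
        using that K_closed(3) Mc by (intro CollectI bexI[of _ \<one>] bexI[of _ m]) auto
      moreover have "k \<in> ?T" if "k \<in> K" for k
        using that subgroup.one_closed[OF Ms(1)] K_carrier
        by (intro CollectI bexI[of _ k] bexI[of _ \<one>]) auto
      ultimately have "M \<subseteq> ?T" "?T \<noteq> M" using False by blast+
      then have "?T = carrier G" using M T unfolding maximal_subgroup_def by blast
      then show ?thesis using g by blast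
    qed
    \<comment> \<open>The dichotomy is applied to \<open>M\<close> itself. Its first alternative
      would give \<open>M = carrier G\<close>, so some derivation vanishes on \<open>M\<close> and
      is the coset map on \<open>K\<close>.\<close>
    have MK: "k \<in> N" if k: "k \<in> K" "k \<in> M" for k
      using supplement_dichotomy[OF Ms(1) supM]
    proof
      assume *: "\<forall>g\<in>carrier G. \<exists>k\<in>K. \<exists>l\<in>M. N #> k = \<one>\<^bsub>V\<^esub> \<and> g = k \<otimes> l"
      have "carrier G \<subseteq> M"
      proof
        fix g assume "g \<in> carrier G"
        then obtain k l where kl: "k \<in> K" "l \<in> M" "N #> k = \<one>\<^bsub>V\<^esub>" "g = k \<otimes> l" using * by blast
        then have "k \<in> M" using one N(3) by blast
        then show "g \<in> M" using kl Mcl(1) by blast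
      qed
      then show ?thesis using Ms(2) Mc by blast
    next
      assume "\<exists>\<delta>\<in>Z1. (\<forall>l\<in>M. \<delta> l = \<one>\<^bsub>V\<^esub>) \<and> (\<forall>k\<in>K. \<delta> k = N #> k)"
      then have "N #> k = \<one>\<^bsub>V\<^esub>" using k by metis
      then show ?thesis using one k(1) by blast
    qed
    \<comment> \<open>Each generator is replaced by its component in \<open>M\<close>. Since
      \<open>K\<close> and \<open>M\<close> meet inside \<open>N\<close>, these components generate
      all of \<open>M\<close> together with \<open>N\<close>.\<close>
    have "\<forall>y\<in>set ys. \<exists>m. m \<in> M \<and> (\<exists>k\<in>K. y = k \<otimes> m)" using supM ys(1) by blast
    then obtain f where f: "\<forall>y\<in>set ys. f y \<in> M \<and> (\<exists>k\<in>K. y = k \<otimes> f y)" by metis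
    let ?zs = "map f ys"
    have zM: "set ?zs \<subseteq> M" using f by auto
    let ?S = "set ?zs \<union> N"
    have Sc: "?S \<subseteq> carrier G" using zM Mc Nc by blast
    let ?L = "generate G ?S"
    have L: "subgroup ?L G" by (rule generate_is_subgroup[OF Sc])
    have LM: "?L \<subseteq> M" by (rule generate_subgroup_incl[OF _ Ms(1)]) (use zM N(3) in blast)
    have sup: "\<exists>k\<in>K. \<exists>l\<in>?L. g = k \<otimes> l" if g: "g \<in> carrier G" for g
    proof (rule normal_supplementI[OF K(1) L ys(2) _ g])
      fix s assume "s \<in> set ys \<union> A"
      then show "\<exists>k\<in>K. \<exists>l\<in>?L. s = k \<otimes> l"
      proof
        assume s: "s \<in> set ys"
        then have "f s \<in> ?L" using generate_sincl[of ?S] by auto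
        then show ?thesis using f s by blast
      next
        assume "s \<in> A"
        then have "s \<in> K" using N(2) K(2) by blast
        then show ?thesis using subgroup.one_closed[OF L] K_carrier
          by (intro bexI[of _ s] bexI[of _ \<one>]) auto
      qed
    qed
    have M_le_L: "M \<subseteq> ?L"
    proof
      fix m assume m: "m \<in> M"
      then obtain k l where kl: "k \<in> K" "l \<in> ?L" "m = k \<otimes> l" using sup Mc by blast
      have lM: "l \<in> M" using kl LM by blast
      have "k = m \<otimes> inv l" using kl lM Mc K_carrier[OF kl(1)] by (auto simp: m_assoc)
      then have "k \<in> M" using m lM Mcl by simp
      then have "k \<in> N" using MK kl(1) by blast
      then have "k \<in> ?L" using generate_sincl[of ?S] by blast
      then show "m \<in> ?L" using kl subgroup.m_closed[OF L] by blast
    qed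
    let ?L' = "generate G (insert x (set ?zs) \<union> N)"
    have L': "subgroup ?L' G" by (rule generate_is_subgroup) (use Sc x in blast)
    have "?L \<subseteq> ?L'" by (rule mono_generate) blast
    moreover have "x \<in> ?L'" using generate_sincl[of "insert x (set ?zs) \<union> N"] by blast
    ultimately have "M \<subseteq> ?L'" "?L' \<noteq> M" using M_le_L x(2) by blast+
    then have "?L' = carrier G" using M L' unfolding maximal_subgroup_def by blast
    then show ?thesis using zM by (intro exI[of _ ?zs]) simp
  qed
qed

end

section \<open>Crowns\<close>

context gmod begin

lemma actker_subgroup: "subgroup actker G"
  using actker_normal normal_imp_subgroup by blast

lemma actker_carrier: "a \<in> actker \<Longrightarrow> a \<in> carrier G"
  by (simp add: actker_def)

lemma actker_act: "\<lbrakk>a \<in> actker; v \<in> carrier V\<rbrakk> \<Longrightarrow> act a v = v"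
  by (simp add: actker_def)

lemma actker_closed: "\<lbrakk>a \<in> actker; b \<in> actker\<rbrakk> \<Longrightarrow> a \<otimes> b \<in> actker" "a \<in> actker \<Longrightarrow> inv a \<in> actker"
  "\<one> \<in> actker"
  by (simp_all add: subgroup.m_closed[OF actker_subgroup] subgroup.m_inv_closed[OF actker_subgroup]
      subgroup.one_closed[OF actker_subgroup])

lemma actker_conj: "\<lbrakk>g \<in> carrier G; a \<in> actker\<rbrakk> \<Longrightarrow> g \<otimes> a \<otimes> inv g \<in> actker"
  using actker_normal normal_inv_iff by blast

lemma Z1_actker_mult: "\<lbrakk>\<delta> \<in> Z1; a \<in> actker; g \<in> carrier G\<rbrakk> \<Longrightarrow> \<delta> (a \<otimes> g) = \<delta> a \<otimes>\<^bsub>V\<^esub> \<delta> g"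
  by (simp add: Z1_mult actker_act actker_carrier)

lemma Z1_actker_conj:
  assumes d: "\<delta> \<in> Z1" and g: "g \<in> carrier G" and a: "a \<in> actker"
  shows "\<delta> (g \<otimes> a \<otimes> inv g) = act g (\<delta> a)"
proof -
  note ac = actker_carrier[OF a]
  have "\<delta> (g \<otimes> a \<otimes> inv g) \<otimes>\<^bsub>V\<^esub> \<delta> g = \<delta> (g \<otimes> a \<otimes> inv g \<otimes> g)"
    by (rule Z1_actker_mult[OF d actker_conj[OF g a] g, symmetric])
  also have "\<dots> = \<delta> (g \<otimes> a)" using g ac by (simp add: m_assoc)
  also have "\<dots> = act g (\<delta> a) \<otimes>\<^bsub>V\<^esub> \<delta> g" using g ac d by (simp add: Z1_mult V.m_comm)
  finally show ?thesis using g ac d V.r_cancel by simp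
qed

lemma inner_derivation: "v \<in> carrier V \<Longrightarrow> (\<lambda>g\<in>carrier G. v \<otimes>\<^bsub>V\<^esub> inv\<^bsub>V\<^esub> act g v) \<in> Z1"
proof (rule Z1I)
  fix g h assume v: "v \<in> carrier V" and g: "g \<in> carrier G" and h: "h \<in> carrier G"
  have cancel: "inv\<^bsub>V\<^esub> a \<otimes>\<^bsub>V\<^esub> (a \<otimes>\<^bsub>V\<^esub> b) = b" if "a \<in> carrier V" "b \<in> carrier V" for a b
    using that by (simp flip: V.m_assoc)
  have "v \<otimes>\<^bsub>V\<^esub> inv\<^bsub>V\<^esub> act g v \<otimes>\<^bsub>V\<^esub> (act g v \<otimes>\<^bsub>V\<^esub> inv\<^bsub>V\<^esub> act g (act h v)) =
      v \<otimes>\<^bsub>V\<^esub> (inv\<^bsub>V\<^esub> act g v \<otimes>\<^bsub>V\<^esub> act g v) \<otimes>\<^bsub>V\<^esub> inv\<^bsub>V\<^esub> act g (act h v)"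
    using v g h by (simp add: V.m_assoc cancel)
  then show "v \<otimes>\<^bsub>V\<^esub> inv\<^bsub>V\<^esub> act (g \<otimes> h) v =
      v \<otimes>\<^bsub>V\<^esub> inv\<^bsub>V\<^esub> act g v \<otimes>\<^bsub>V\<^esub> act g (v \<otimes>\<^bsub>V\<^esub> inv\<^bsub>V\<^esub> act h v)"
    using v g h by (simp add: act_mult act_V_inv act_comp)
qed simp

text \<open>Additive equivariant maps. Over a prime field they are automatically linear, and this
  set becomes the carrier of \<open>End_ring\<close>.\<close>

definition Endo :: "('v \<Rightarrow> 'v) set" where
  "Endo = {f \<in> carrier V \<rightarrow>\<^sub>E carrier V.
     (\<forall>v\<in>carrier V. \<forall>w\<in>carrier V. f (v \<otimes>\<^bsub>V\<^esub> w) = f v \<otimes>\<^bsub>V\<^esub> f w) \<and>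
     (\<forall>g\<in>carrier G. \<forall>v\<in>carrier V. f (act g v) = act g (f v))}"

lemma Endo_closed [simp]: "\<lbrakk>f \<in> Endo; v \<in> carrier V\<rbrakk> \<Longrightarrow> f v \<in> carrier V"
  by (auto simp: Endo_def)

lemma Endo_mult: "\<lbrakk>f \<in> Endo; v \<in> carrier V; w \<in> carrier V\<rbrakk> \<Longrightarrow> f (v \<otimes>\<^bsub>V\<^esub> w) = f v \<otimes>\<^bsub>V\<^esub> f w"
  by (simp add: Endo_def)

lemma Endo_act: "\<lbrakk>f \<in> Endo; g \<in> carrier G; v \<in> carrier V\<rbrakk> \<Longrightarrow> f (act g v) = act g (f v)"
  by (simp add: Endo_def)

lemma Endo_hom: "f \<in> Endo \<Longrightarrow> group_hom V V f"
  by (unfold_locales) (auto simp: hom_def Endo_mult)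

lemma Endo_one [simp]: "f \<in> Endo \<Longrightarrow> f \<one>\<^bsub>V\<^esub> = \<one>\<^bsub>V\<^esub>"
  using group_hom.hom_one[OF Endo_hom] .

lemma Endo_inv: "\<lbrakk>f \<in> Endo; v \<in> carrier V\<rbrakk> \<Longrightarrow> f (inv\<^bsub>V\<^esub> v) = inv\<^bsub>V\<^esub> (f v)"
  using group_hom.hom_inv[OF Endo_hom] .

lemma EndoI:
  assumes "\<And>v. v \<in> carrier V \<Longrightarrow> f v \<in> carrier V"
    and "\<And>v w. \<lbrakk>v \<in> carrier V; w \<in> carrier V\<rbrakk> \<Longrightarrow> f (v \<otimes>\<^bsub>V\<^esub> w) = f v \<otimes>\<^bsub>V\<^esub> f w"
    and "\<And>g v. \<lbrakk>g \<in> carrier G; v \<in> carrier V\<rbrakk> \<Longrightarrow> f (act g v) = act g (f v)"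
  shows "(\<lambda>v\<in>carrier V. f v) \<in> Endo"
  using assms by (auto simp: Endo_def)

lemma Endo_ext: "\<lbrakk>f \<in> Endo; h \<in> Endo; \<And>v. v \<in> carrier V \<Longrightarrow> f v = h v\<rbrakk> \<Longrightarrow> f = h"
  unfolding Endo_def by (auto intro: PiE_ext)

lemma finite_Endo: "finite Endo"
  by (rule finite_subset[of _ "carrier V \<rightarrow>\<^sub>E carrier V"]) (auto simp: Endo_def finV finite_PiE)

lemma Endo_id: "(\<lambda>v\<in>carrier V. v) \<in> Endo"
  by (rule EndoI) auto

lemma Endo_zero: "(\<lambda>v\<in>carrier V. \<one>\<^bsub>V\<^esub>) \<in> Endo"
  by (rule EndoI) auto

lemma Endo_Z1: "\<lbrakk>f \<in> Endo; \<delta> \<in> Z1\<rbrakk> \<Longrightarrow> (\<lambda>g\<in>carrier G. f (\<delta> g)) \<in> Z1"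
  by (rule Z1I) (auto simp: Z1_mult Endo_mult Endo_act)

end

context irr_gmod begin

lemma fixed_vector_trivial:
  assumes nt: "actker \<noteq> carrier G" and v: "v \<in> carrier V" and fixed: "\<And>g. g \<in> carrier G \<Longrightarrow> act g v = v"
  shows "v = \<one>\<^bsub>V\<^esub>"
proof -
  let ?W = "{v \<in> carrier V. \<forall>g\<in>carrier G. act g v = v}"
  have "subgroup ?W V" by (rule V.subgroupI) (auto simp: act_V_inv act_mult intro: exI[of _ "\<one>\<^bsub>V\<^esub>"])
  then have "?W = {\<one>\<^bsub>V\<^esub>} \<or> ?W = carrier V" by (rule irreducible) auto
  moreover have "?W \<noteq> carrier V"
  proof
    assume "?W = carrier V"
    then have "actker = carrier G" by (auto simp: actker_def)
    then show False using nt by simp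
  qed
  ultimately show ?thesis using v fixed by blast
qed

text \<open>On a normal subgroup acting trivially a derivation is an equivariant homomorphism, so
  its image is a submodule.\<close>

lemma Z1_image_full:
  assumes B: "B \<lhd> G" "B \<subseteq> actker" and d: "\<delta> \<in> Z1" and b: "b \<in> B" "\<delta> b \<noteq> \<one>\<^bsub>V\<^esub>"
  shows "\<delta> ` B = carrier V"
proof -
  have Bs: "subgroup B G" using B(1) normal_imp_subgroup by blast
  note Bc = subgroup.mem_carrier[OF Bs]
  have "subgroup (\<delta> ` B) V"
  proof (rule V.subgroupI)
    show "\<delta> ` B \<subseteq> carrier V" using d Bc by auto
    show "\<delta> ` B \<noteq> {}" using b by blast
    fix u assume "u \<in> \<delta> ` B"
    then obtain x where x: "x \<in> B" "u = \<delta> x" by blast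
    have "inv\<^bsub>V\<^esub> u = \<delta> (inv x)"
      using Z1_inv[OF d Bc[OF x(1)]] actker_act[of "inv x" "\<delta> x"] B(2) x d Bc
        subgroup.m_inv_closed[OF Bs x(1)] by auto
    then show "inv\<^bsub>V\<^esub> u \<in> \<delta> ` B" using subgroup.m_inv_closed[OF Bs x(1)] by blast
    fix w assume "w \<in> \<delta> ` B"
    then obtain y where y: "y \<in> B" "w = \<delta> y" by blast
    have "u \<otimes>\<^bsub>V\<^esub> w = \<delta> (x \<otimes> y)" using Z1_actker_mult[OF d _ Bc[OF y(1)], of x] B(2) x y by auto
    then show "u \<otimes>\<^bsub>V\<^esub> w \<in> \<delta> ` B" using subgroup.m_closed[OF Bs x(1) y(1)] by blast
  qed
  moreover have "act g w \<in> \<delta> ` B" if gw: "g \<in> carrier G" "w \<in> \<delta> ` B" for g w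
  proof -
    obtain x where x: "x \<in> B" "w = \<delta> x" using gw(2) by blast
    have "g \<otimes> x \<otimes> inv g \<in> B" using B(1) gw(1) x(1) normal_inv_iff by blast
    moreover have "\<delta> (g \<otimes> x \<otimes> inv g) = act g w" using Z1_actker_conj[OF d gw(1)] x B(2) by blast
    ultimately show ?thesis by (metis imageI)
  qed
  ultimately have "\<delta> ` B = {\<one>\<^bsub>V\<^esub>} \<or> \<delta> ` B = carrier V" by (rule irreducible)
  then show ?thesis using b by blast
qed

text \<open>Schur's lemma: the vectors on which two endomorphisms agree form a submodule.\<close>

lemma Endo_eq_if_agree:
  assumes f: "f \<in> Endo" and h: "h \<in> Endo" and v: "v \<in> carrier V" "v \<noteq> \<one>\<^bsub>V\<^esub>" "f v = h v"
  shows "f = h"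
proof -
  let ?W = "{v \<in> carrier V. f v = h v}"
  have "subgroup ?W V" by (rule V.subgroupI) (use f h in \<open>auto simp: Endo_inv Endo_mult\<close>)
  then have "?W = {\<one>\<^bsub>V\<^esub>} \<or> ?W = carrier V" by (rule irreducible) (use f h in \<open>auto simp: Endo_act\<close>)
  moreover have "v \<in> ?W" using v by simp
  ultimately have "?W = carrier V" using v(2) by blast
  then show ?thesis using f h by (intro Endo_ext) auto
qed

lemma card_Endo_ge_2: "card Endo \<ge> 2"
proof -
  let ?i = "\<lambda>v\<in>carrier V. v" and ?o = "\<lambda>v\<in>carrier V. \<one>\<^bsub>V\<^esub>"
  obtain v where "v \<in> carrier V" "v \<noteq> \<one>\<^bsub>V\<^esub>" using V_nontriv by blast
  then have "?i \<noteq> ?o" by (metis restrict_apply')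
  then have "card {?i, ?o} = 2" by simp
  then show ?thesis using card_mono[OF finite_Endo, of "{?i, ?o}"] Endo_id Endo_zero by simp
qed

text \<open>Adding \<open>f (\<delta> g)\<close> to a derivation that vanishes at \<open>x\<close>
  gives pairwise distinct derivations: the value at \<open>x\<close> recovers \<open>f\<close> by
  Schur's lemma, and then the rest. This is the factor that fixing one entry of a generating tuple
  costs.\<close>

lemma card_Z1_vanishing:
  assumes x: "x \<in> carrier G" and d: "\<delta> \<in> Z1" "\<delta> x \<noteq> \<one>\<^bsub>V\<^esub>"
  shows "card {\<epsilon> \<in> Z1. \<epsilon> x = \<one>\<^bsub>V\<^esub>} * card Endo \<le> card Z1"
proof -
  let ?Zx = "{\<epsilon> \<in> Z1. \<epsilon> x = \<one>\<^bsub>V\<^esub>}"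
  let ?F = "\<lambda>(\<epsilon>, f). \<lambda>g\<in>carrier G. \<epsilon> g \<otimes>\<^bsub>V\<^esub> f (\<delta> g)"
  have "inj_on ?F (?Zx \<times> Endo)"
  proof (rule inj_onI, clarify)
    fix \<epsilon> f \<epsilon>' f'
    assume e: "\<epsilon> \<in> Z1" "\<epsilon> x = \<one>\<^bsub>V\<^esub>" "\<epsilon>' \<in> Z1" "\<epsilon>' x = \<one>\<^bsub>V\<^esub>" and f: "f \<in> Endo" "f' \<in> Endo"
      and eq: "(\<lambda>g\<in>carrier G. \<epsilon> g \<otimes>\<^bsub>V\<^esub> f (\<delta> g)) = (\<lambda>g\<in>carrier G. \<epsilon>' g \<otimes>\<^bsub>V\<^esub> f' (\<delta> g))"
    have eq': "\<epsilon> g \<otimes>\<^bsub>V\<^esub> f (\<delta> g) = \<epsilon>' g \<otimes>\<^bsub>V\<^esub> f' (\<delta> g)" if "g \<in> carrier G" for g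
      using fun_cong[OF eq, of g] that by simp
    have "f (\<delta> x) = f' (\<delta> x)" using eq'[OF x] e x f d by simp
    then have ff: "f = f'" using Endo_eq_if_agree[OF f, of "\<delta> x"] x d by simp
    moreover have "\<epsilon> = \<epsilon>'"
      by (rule Z1_ext[OF e(1,3)]) (use eq' ff e f d V.r_cancel in simp)
    ultimately show "\<epsilon> = \<epsilon>' \<and> f = f'" by simp
  qed
  moreover have "?F ` (?Zx \<times> Endo) \<subseteq> Z1"
  proof clarify
    fix \<epsilon> f assume e: "\<epsilon> \<in> Z1" "f \<in> Endo"
    have "(\<lambda>g\<in>carrier G. \<epsilon> g \<otimes>\<^bsub>V\<^esub> (\<lambda>g\<in>carrier G. f (\<delta> g)) g) \<in> Z1"
      by (rule Z1_add[OF e(1) Endo_Z1[OF e(2) d(1)]])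
    moreover have "(\<lambda>g\<in>carrier G. \<epsilon> g \<otimes>\<^bsub>V\<^esub> (\<lambda>g\<in>carrier G. f (\<delta> g)) g) =
        (\<lambda>g\<in>carrier G. \<epsilon> g \<otimes>\<^bsub>V\<^esub> f (\<delta> g))" by (rule restrict_ext) simp
    ultimately show "(\<lambda>g\<in>carrier G. \<epsilon> g \<otimes>\<^bsub>V\<^esub> f (\<delta> g)) \<in> Z1" by simp
  qed
  ultimately have "card (?Zx \<times> Endo) \<le> card Z1" by (rule card_inj_on_le[OF _ _ finite_Z1])
  then show ?thesis by (simp add: card_cartesian_product)
qed

end

section \<open>Coordinates on the normal factor and the number of derivations\<close>

primrec (in gmod) lincomb :: "(nat \<Rightarrow> 'v \<Rightarrow> 'v) \<Rightarrow> (nat \<Rightarrow> 'g \<Rightarrow> 'v) \<Rightarrow> nat \<Rightarrow> 'g \<Rightarrow> 'v" where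
  "lincomb c D 0 g = \<one>\<^bsub>V\<^esub>"
| "lincomb c D (Suc m) g = lincomb c D m g \<otimes>\<^bsub>V\<^esub> c m (D m g)"

lemma (in gmod) lincomb_cong:
  "(\<And>i. i < m \<Longrightarrow> c i (D i g) = c' i (D' i h)) \<Longrightarrow> lincomb c D m g = lincomb c' D' m h"
  by (induction m) auto

text \<open>The group is the semidirect product of \<open>V ^ k\<close> and its image in the automorphism group of
  \<open>V\<close>: the derivations \<open>D i\<close> are the coordinates of the normal factor.\<close>

locale crown = irr_gmod +
  fixes k :: nat and D :: "nat \<Rightarrow> 'a \<Rightarrow> 'c"
  assumes D_Z1: "i < k \<Longrightarrow> D i \<in> Z1"
    and D_inj: "\<lbrakk>a \<in> actker; \<And>i. i < k \<Longrightarrow> D i a = \<one>\<^bsub>V\<^esub>\<rbrakk> \<Longrightarrow> a = \<one>"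
    and D_surj: "(\<And>i. i < k \<Longrightarrow> u i \<in> carrier V) \<Longrightarrow> \<exists>a\<in>actker. \<forall>i<k. D i a = u i"
    and act_nontriv: "actker \<noteq> carrier G"
    and H1_trivial: "\<lbrakk>\<delta> \<in> Z1; \<And>a. a \<in> actker \<Longrightarrow> \<delta> a = \<one>\<^bsub>V\<^esub>\<rbrakk> \<Longrightarrow>
      \<exists>v\<in>carrier V. \<forall>g\<in>carrier G. \<delta> g = v \<otimes>\<^bsub>V\<^esub> inv\<^bsub>V\<^esub> act g v"
begin

lemma D_closed [simp]: "\<lbrakk>i < k; g \<in> carrier G\<rbrakk> \<Longrightarrow> D i g \<in> carrier V"
  using Z1_closed[OF D_Z1] .

lemma lincomb_Z1:
  assumes c: "\<And>i. i < k \<Longrightarrow> c i \<in> Endo" and m: "m \<le> k"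
  shows "(\<lambda>g\<in>carrier G. lincomb c D m g) \<in> Z1"
  using m
proof (induction m)
  case 0
  show ?case using Z1_trivial by (simp only: lincomb.simps)
next
  case (Suc m)
  have "(\<lambda>g\<in>carrier G. (\<lambda>g\<in>carrier G. lincomb c D m g) g \<otimes>\<^bsub>V\<^esub> (\<lambda>g\<in>carrier G. c m (D m g)) g) \<in> Z1"
    by (rule Z1_add[OF Suc.IH Endo_Z1]) (use Suc.prems c D_Z1 in auto)
  moreover have "(\<lambda>g\<in>carrier G. (\<lambda>g\<in>carrier G. lincomb c D m g) g \<otimes>\<^bsub>V\<^esub> (\<lambda>g\<in>carrier G. c m (D m g)) g) =
      (\<lambda>g\<in>carrier G. lincomb c D (Suc m) g)" by (rule restrict_ext) simp
  ultimately show ?case by (simp only:)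
qed

lemma lincomb_closed:
  "\<lbrakk>\<And>i. i < k \<Longrightarrow> c i \<in> Endo; m \<le> k; g \<in> carrier G\<rbrakk> \<Longrightarrow> lincomb c D m g \<in> carrier V"
  using Z1_closed[OF lincomb_Z1, of c m g] by simp

text \<open>The \<open>j\<close>-th coordinate embedding of \<open>V\<close> into
  \<open>actker\<close>. The choice is unique by \<open>D_inj\<close>.\<close>

definition coord :: "nat \<Rightarrow> 'c \<Rightarrow> 'a" where
  "coord j v = (SOME a. a \<in> actker \<and> (\<forall>i<k. D i a = (if i = j then v else \<one>\<^bsub>V\<^esub>)))"

lemma coord:
  assumes v: "v \<in> carrier V"
  shows "coord j v \<in> actker" "i < k \<Longrightarrow> D i (coord j v) = (if i = j then v else \<one>\<^bsub>V\<^esub>)"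
proof -
  have "\<exists>a\<in>actker. \<forall>i<k. D i a = (if i = j then v else \<one>\<^bsub>V\<^esub>)"
    by (rule D_surj) (use v in simp)
  then have "\<exists>a. a \<in> actker \<and> (\<forall>i<k. D i a = (if i = j then v else \<one>\<^bsub>V\<^esub>))" by blast
  then have "coord j v \<in> actker \<and> (\<forall>i<k. D i (coord j v) = (if i = j then v else \<one>\<^bsub>V\<^esub>))"
    unfolding coord_def by (rule someI_ex)
  then show "coord j v \<in> actker" "i < k \<Longrightarrow> D i (coord j v) = (if i = j then v else \<one>\<^bsub>V\<^esub>)" by auto
qed

lemma actker_eqI:
  assumes a: "a \<in> actker" and b: "b \<in> actker" and eq: "\<And>i. i < k \<Longrightarrow> D i a = D i b"
  shows "a = b"
proof -
  have "a \<otimes> inv b = \<one>"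
  proof (rule D_inj)
    show "a \<otimes> inv b \<in> actker" using a b actker_closed by simp
    fix i assume i: "i < k"
    have "D i (a \<otimes> inv b) \<otimes>\<^bsub>V\<^esub> D i b = D i (a \<otimes> inv b \<otimes> b)"
      by (rule Z1_actker_mult[OF D_Z1[OF i], symmetric]) (use a b actker_closed actker_carrier in auto)
    also have "\<dots> = \<one>\<^bsub>V\<^esub> \<otimes>\<^bsub>V\<^esub> D i b" using a b eq[OF i] i actker_carrier by (simp add: m_assoc)
    finally show "D i (a \<otimes> inv b) = \<one>\<^bsub>V\<^esub>" using a b i actker_carrier by (simp add: V.r_cancel)
  qed
  then show ?thesis using a b actker_carrier inv_solve_right'[of \<one> a b] by simp
qed

text \<open>Elements of \<open>actker\<close> are determined by their coordinates, so
  \<open>coord j\<close> is itself additive and equivariant. Composition with a derivation thus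
  yields its coefficient at the \<open>j\<close>-th coordinate.\<close>

lemma coord_Endo:
  assumes d: "\<delta> \<in> Z1"
  shows "(\<lambda>v\<in>carrier V. \<delta> (coord j v)) \<in> Endo"
proof (rule EndoI)
  fix v assume v: "v \<in> carrier V"
  then show "\<delta> (coord j v) \<in> carrier V" using coord(1) actker_carrier d by simp
  fix w assume w: "w \<in> carrier V"
  note cv = coord[OF v] and cw = coord[OF w]
  have "coord j (v \<otimes>\<^bsub>V\<^esub> w) = coord j v \<otimes> coord j w"
  proof (rule actker_eqI)
    fix i assume i: "i < k"
    show "D i (coord j (v \<otimes>\<^bsub>V\<^esub> w)) = D i (coord j v \<otimes> coord j w)"
      using v w i coord(2)[of "v \<otimes>\<^bsub>V\<^esub> w" i j] cv cw actker_carrier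
      by (simp add: Z1_actker_mult[OF D_Z1[OF i]])
  qed (use v w coord(1) actker_closed in simp_all)
  then show "\<delta> (coord j (v \<otimes>\<^bsub>V\<^esub> w)) = \<delta> (coord j v) \<otimes>\<^bsub>V\<^esub> \<delta> (coord j w)"
    using Z1_actker_mult[OF d] cv(1) cw(1) actker_carrier by simp
next
  fix g v assume g: "g \<in> carrier G" and v: "v \<in> carrier V"
  have "coord j (act g v) = g \<otimes> coord j v \<otimes> inv g"
  proof (rule actker_eqI)
    fix i assume i: "i < k"
    show "D i (coord j (act g v)) = D i (g \<otimes> coord j v \<otimes> inv g)"
      using g v i coord(2)[of "act g v" i j] coord[OF v] by (simp add: Z1_actker_conj[OF D_Z1[OF i]])
  qed (use g v coord(1) actker_conj in simp_all)
  then show "\<delta> (coord j (act g v)) = act g (\<delta> (coord j v))"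
    using Z1_actker_conj[OF d g coord(1)[OF v]] by simp
qed

text \<open>Induction on the number of coordinates that may be nontrivial: the last one is split off
  as an element in the image of \<open>coord\<close>.\<close>

lemma Z1_on_actker:
  assumes d: "\<delta> \<in> Z1" and a: "a \<in> actker" and m: "m \<le> k" "\<And>i. \<lbrakk>m \<le> i; i < k\<rbrakk> \<Longrightarrow> D i a = \<one>\<^bsub>V\<^esub>"
  shows "\<delta> a = lincomb (\<lambda>j. \<lambda>v\<in>carrier V. \<delta> (coord j v)) D m a"
  using a m
proof (induction m arbitrary: a)
  case 0
  then have "a = \<one>" using D_inj by simp
  then show ?case using d by simp
next
  case (Suc m)
  let ?c = "\<lambda>j. \<lambda>v\<in>carrier V. \<delta> (coord j v)"
  note a = Suc.prems(1) and ac = actker_carrier[OF Suc.prems(1)]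
  have mk: "m < k" using Suc.prems by simp
  have v: "D m a \<in> carrier V" using mk ac by simp
  define b where "b = coord m (D m a)"
  have b: "b \<in> actker" "\<And>i. i < k \<Longrightarrow> D i b = (if i = m then D m a else \<one>\<^bsub>V\<^esub>)"
    using coord[OF v] by (auto simp: b_def)
  note bc = actker_carrier[OF b(1)]
  define a' where "a' = a \<otimes> inv b"
  have a': "a' \<in> actker" using a b actker_closed by (simp add: a'_def)
  have ab: "a = a' \<otimes> b" using ac bc by (simp add: a'_def m_assoc)
  have D: "D i a = D i a' \<otimes>\<^bsub>V\<^esub> D i b" if "i < k" for i
    unfolding ab by (rule Z1_actker_mult[OF D_Z1[OF that] a' bc])
  note a'c = actker_carrier[OF a']
  have D1: "D i a' = \<one>\<^bsub>V\<^esub>" if i: "m \<le> i" "i < k" for i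
  proof (cases "i = m")
    case True
    then have "D i a' \<otimes>\<^bsub>V\<^esub> D i b = \<one>\<^bsub>V\<^esub> \<otimes>\<^bsub>V\<^esub> D i b" using D[OF i(2)] b(2)[OF i(2)] v by simp
    then show ?thesis using V.r_cancel i(2) a'c bc by simp
  next
    case False
    then have "D i a = \<one>\<^bsub>V\<^esub>" using Suc.prems(3) i by simp
    then show ?thesis using D[OF i(2)] b(2)[OF i(2)] False i(2) a'c by simp
  qed
  have D2: "D i a' = D i a" if i: "i < m" for i
    using D[of i] b(2)[of i] i mk a'c by simp
  have "\<delta> a = \<delta> a' \<otimes>\<^bsub>V\<^esub> \<delta> b" using Z1_actker_mult[OF d a' bc] ab by simp
  also have "\<delta> a' = lincomb ?c D m a'" by (rule Suc.IH[OF a' _ D1]) (use mk in simp)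
  also have "\<dots> = lincomb ?c D m a" by (rule lincomb_cong) (use D2 in simp)
  also have "\<delta> b = ?c m (D m a)" using v by (simp add: b_def)
  finally show ?case by (simp only: lincomb.simps)
qed

text \<open>Restricted to \<open>actker\<close>, a derivation is an arbitrary combination of the
  \<open>k\<close> coordinates with coefficients in \<open>Endo\<close>. What remains vanishes on
  \<open>actker\<close> and is inner by \<open>H1_trivial\<close>; the inner derivations correspond
  to the vectors of \<open>V\<close>, since no nontrivial vector is fixed.\<close>

lemma card_Z1: "card Z1 = card Endo ^ k * card (carrier V)"
proof -
  let ?X = "({..<k} \<rightarrow>\<^sub>E Endo) \<times> carrier V"
  let ?\<Phi> = "\<lambda>(c, v). \<lambda>g\<in>carrier G. lincomb c D k g \<otimes>\<^bsub>V\<^esub> (v \<otimes>\<^bsub>V\<^esub> inv\<^bsub>V\<^esub> act g v)"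
  have Z: "?\<Phi> (c, v) \<in> Z1" if c: "c \<in> {..<k} \<rightarrow>\<^sub>E Endo" and v: "v \<in> carrier V" for c v
  proof -
    have "(\<lambda>g\<in>carrier G. (\<lambda>g\<in>carrier G. lincomb c D k g) g \<otimes>\<^bsub>V\<^esub>
        (\<lambda>g\<in>carrier G. v \<otimes>\<^bsub>V\<^esub> inv\<^bsub>V\<^esub> act g v) g) \<in> Z1"
      by (rule Z1_add[OF lincomb_Z1 inner_derivation[OF v]]) (use c in auto)
    moreover have "(\<lambda>g\<in>carrier G. (\<lambda>g\<in>carrier G. lincomb c D k g) g \<otimes>\<^bsub>V\<^esub>
        (\<lambda>g\<in>carrier G. v \<otimes>\<^bsub>V\<^esub> inv\<^bsub>V\<^esub> act g v) g) = ?\<Phi> (c, v)"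
      unfolding prod.case by (rule restrict_ext) simp
    ultimately show ?thesis by simp
  qed
  \<comment> \<open>On an element with a single nontrivial coordinate \<open>j\<close> the
    combination collapses to its \<open>j\<close>-th term, from which the coefficient can be read
    off.\<close>
  have lc1: "lincomb c D m g = (if j < m then c j (D j g) else \<one>\<^bsub>V\<^esub>)"
    if c: "\<And>i. i < k \<Longrightarrow> c i \<in> Endo" and g: "g \<in> carrier G" and j: "j < k"
      and D: "\<And>i. \<lbrakk>i < k; i \<noteq> j\<rbrakk> \<Longrightarrow> D i g = \<one>\<^bsub>V\<^esub>" and m: "m \<le> k" for c m g j
    using m
  proof (induction m)
    case (Suc m)
    then show ?case using c D[of m] g j by (cases "m = j") auto
  qed simp
  have inj: "inj_on ?\<Phi> ?X"
  proof (rule inj_onI, clarify)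
    fix c v c' v'
    assume c: "c \<in> {..<k} \<rightarrow>\<^sub>E Endo" and c': "c' \<in> {..<k} \<rightarrow>\<^sub>E Endo"
      and v: "v \<in> carrier V" and v': "v' \<in> carrier V"
      and eq: "(\<lambda>g\<in>carrier G. lincomb c D k g \<otimes>\<^bsub>V\<^esub> (v \<otimes>\<^bsub>V\<^esub> inv\<^bsub>V\<^esub> act g v)) =
        (\<lambda>g\<in>carrier G. lincomb c' D k g \<otimes>\<^bsub>V\<^esub> (v' \<otimes>\<^bsub>V\<^esub> inv\<^bsub>V\<^esub> act g v'))"
    have eq': "lincomb c D k g \<otimes>\<^bsub>V\<^esub> (v \<otimes>\<^bsub>V\<^esub> inv\<^bsub>V\<^esub> act g v) =
        lincomb c' D k g \<otimes>\<^bsub>V\<^esub> (v' \<otimes>\<^bsub>V\<^esub> inv\<^bsub>V\<^esub> act g v')" if "g \<in> carrier G" for g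
      using fun_cong[OF eq, of g] that by simp
    have cE: "c i \<in> Endo" "c' i \<in> Endo" if "i < k" for i using c c' that by auto
    have cj: "c j = c' j" if j: "j < k" for j
    proof (rule Endo_ext[OF cE[OF j]])
      fix w assume w: "w \<in> carrier V"
      let ?a = "coord j w"
      note cw = coord[OF w, where j = j] and ac = actker_carrier[OF coord(1)[OF w, of j]]
      have "lincomb c D k ?a = c j w"
        using lc1[of c ?a j k] cE(1) ac j cw(2) by simp
      moreover have "lincomb c' D k ?a = c' j w"
        using lc1[of c' ?a j k] cE(2) ac j cw(2) by simp
      ultimately show "c j w = c' j w"
        using eq'[OF ac] actker_act[OF cw(1)] v v' w cE[OF j] by simp
    qed
    have cc: "c = c'" by (rule PiE_ext[OF c c']) (simp add: cj)
    have vv: "v \<otimes>\<^bsub>V\<^esub> inv\<^bsub>V\<^esub> act g v = v' \<otimes>\<^bsub>V\<^esub> inv\<^bsub>V\<^esub> act g v'" if g: "g \<in> carrier G" for g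
    proof -
      have "lincomb c' D k g \<in> carrier V" by (rule lincomb_closed) (use cE g in auto)
      from V.l_cancel[OF eq'[OF g, unfolded cc] _ _ this] show ?thesis using g v v' by simp
    qed
    \<comment> \<open>Two vectors with the same inner derivation differ by a fixed vector, which a
      nontrivial irreducible action forces to be trivial.\<close>
    let ?w = "v \<otimes>\<^bsub>V\<^esub> inv\<^bsub>V\<^esub> v'"
    have swap: "(a \<otimes>\<^bsub>V\<^esub> b \<otimes>\<^bsub>V\<^esub> c) \<otimes>\<^bsub>V\<^esub> d = c \<otimes>\<^bsub>V\<^esub> b \<otimes>\<^bsub>V\<^esub> (a \<otimes>\<^bsub>V\<^esub> d)"
      if "a \<in> carrier V" "b \<in> carrier V" "c \<in> carrier V" "d \<in> carrier V" for a b c d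
      using that by (simp add: V.m_ac)
    have "act g ?w = ?w" if g: "g \<in> carrier G" for g
    proof -
      have "v = v' \<otimes>\<^bsub>V\<^esub> inv\<^bsub>V\<^esub> act g v' \<otimes>\<^bsub>V\<^esub> act g v"
        using vv[OF g] v v' g V.inv_solve_right'[of "v' \<otimes>\<^bsub>V\<^esub> inv\<^bsub>V\<^esub> act g v'" v "act g v"] by simp
      then have "?w = (v' \<otimes>\<^bsub>V\<^esub> inv\<^bsub>V\<^esub> act g v' \<otimes>\<^bsub>V\<^esub> act g v) \<otimes>\<^bsub>V\<^esub> inv\<^bsub>V\<^esub> v'" by simp
      also have "\<dots> = act g v \<otimes>\<^bsub>V\<^esub> inv\<^bsub>V\<^esub> act g v' \<otimes>\<^bsub>V\<^esub> (v' \<otimes>\<^bsub>V\<^esub> inv\<^bsub>V\<^esub> v')"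
        by (rule swap) (use v v' g in simp_all)
      also have "\<dots> = act g ?w" using v v' g by (simp add: act_mult act_V_inv)
      finally show ?thesis by (rule sym)
    qed
    then have "?w = \<one>\<^bsub>V\<^esub>" using fixed_vector_trivial[OF act_nontriv, of ?w] v v' by simp
    then have "v = v'" using v v' V.inv_solve_right'[of "\<one>\<^bsub>V\<^esub>" v v'] by simp
    then show "c = c' \<and> v = v'" using cc by simp
  qed
  have img: "?\<Phi> ` ?X = Z1"
  proof
    show "?\<Phi> ` ?X \<subseteq> Z1" using Z by blast
    show "Z1 \<subseteq> ?\<Phi> ` ?X"
    proof
      fix \<delta> assume d: "\<delta> \<in> Z1"
      define c where "c = (\<lambda>j\<in>{..<k}. \<lambda>v\<in>carrier V. \<delta> (coord j v))"
      have cX: "c \<in> {..<k} \<rightarrow>\<^sub>E Endo" using coord_Endo[OF d] by (auto simp: c_def)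
      let ?e = "\<lambda>g\<in>carrier G. lincomb c D k g"
      have e: "?e \<in> Z1" by (rule lincomb_Z1) (use cX in auto)
      have "\<exists>v\<in>carrier V. \<forall>g\<in>carrier G.
          (\<lambda>g\<in>carrier G. \<delta> g \<otimes>\<^bsub>V\<^esub> inv\<^bsub>V\<^esub> ?e g) g = v \<otimes>\<^bsub>V\<^esub> inv\<^bsub>V\<^esub> act g v"
      proof (rule H1_trivial[OF Z1_diff[OF d e]])
        fix a assume a: "a \<in> actker"
        have "lincomb c D k a = lincomb (\<lambda>j. \<lambda>v\<in>carrier V. \<delta> (coord j v)) D k a"
          by (rule lincomb_cong) (simp add: c_def)
        then have "\<delta> a = lincomb c D k a" using Z1_on_actker[OF d a, of k] by simp
        moreover have "\<delta> a \<in> carrier V" using d actker_carrier[OF a] by simp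
        ultimately show "(\<lambda>g\<in>carrier G. \<delta> g \<otimes>\<^bsub>V\<^esub> inv\<^bsub>V\<^esub> ?e g) a = \<one>\<^bsub>V\<^esub>"
          using actker_carrier[OF a] by simp
      qed
      then obtain v where v: "v \<in> carrier V"
        "\<And>g. g \<in> carrier G \<Longrightarrow> \<delta> g \<otimes>\<^bsub>V\<^esub> inv\<^bsub>V\<^esub> lincomb c D k g = v \<otimes>\<^bsub>V\<^esub> inv\<^bsub>V\<^esub> act g v"
        by auto
      have "\<delta> = ?\<Phi> (c, v)"
      proof (rule Z1_ext[OF d Z[OF cX v(1)]])
        fix g assume g: "g \<in> carrier G"
        have lc: "lincomb c D k g \<in> carrier V" using Z1_closed[OF e g] g by simp
        have "\<delta> g = v \<otimes>\<^bsub>V\<^esub> inv\<^bsub>V\<^esub> act g v \<otimes>\<^bsub>V\<^esub> lincomb c D k g"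
          using v(2)[OF g] V.inv_solve_right'[of "v \<otimes>\<^bsub>V\<^esub> inv\<^bsub>V\<^esub> act g v" "\<delta> g" "lincomb c D k g"]
            lc v(1) g d by simp
        then show "\<delta> g = ?\<Phi> (c, v) g" using g lc v(1) by (simp add: V.m_comm)
      qed
      then show "\<delta> \<in> ?\<Phi> ` ?X" using cX v(1) by blast
    qed
  qed
  have "card ?X = card Z1" using card_image[OF inj] unfolding img by simp
  then show ?thesis by (simp add: card_cartesian_product card_PiE)
qed

end

section \<open>Generating a crown over a maximal subgroup\<close>

lemma (in group) list_all2_left_mult_closed:
  assumes M: "subgroup M G" and B: "B \<subseteq> M" and zs: "set zs \<subseteq> M"
    and ws: "list_all2 (\<lambda>y z. \<exists>b\<in>B. z = b \<otimes> y) zs ws"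
  shows "set ws \<subseteq> M"
  using ws zs
proof (induction rule: list_all2_induct)
  case (Cons y ys z zs)
  then obtain b where "b \<in> B" "z = b \<otimes> y" by blast
  then have "z \<in> M" using B Cons.prems subgroup.m_closed[OF M, of b y] by auto
  then show ?case using Cons by simp
qed simp

lemma (in group) list_all2_left_mult_supplement:
  assumes B: "subgroup B G" and zs: "set zs \<subseteq> carrier G"
    and ws: "list_all2 (\<lambda>y z. \<exists>b\<in>B. z = b \<otimes> y) zs ws" and s: "s \<in> set zs"
  shows "\<exists>b\<in>B. \<exists>w\<in>set ws. s = b \<otimes> w"
  using ws zs s
proof (induction rule: list_all2_induct)
  case (Cons y ys z zs)
  show ?case
  proof (cases "s = y")
    case True
    obtain b where b: "b \<in> B" "z = b \<otimes> y" using Cons by blast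
    have "y = inv b \<otimes> z"
      using b Cons.prems subgroup.mem_carrier[OF B b(1)] by (simp flip: m_assoc)
    then show ?thesis using True subgroup.m_inv_closed[OF B b(1)] by auto
  next
    case False
    then have "s \<in> set ys" using Cons.prems by simp
    then show ?thesis using Cons.IH Cons.prems by auto
  qed
qed simp

context crown begin

text \<open>A descending chain of normal subgroups from \<open>actker\<close> to the trivial group,
  with \<open>D m\<close> identifying the factor of \<open>layer m\<close> by
  \<open>layer (Suc m)\<close> with \<open>V\<close>.\<close>

definition layer :: "nat \<Rightarrow> 'a set" where
  "layer m = {a \<in> actker. \<forall>i<m. D i a = \<one>\<^bsub>V\<^esub>}"

lemma layer_normal:
  assumes m: "m \<le> k" shows "layer m \<lhd> G"
proof (rule normal_invI)
  have Z: "D i \<in> Z1" if "i < m" for i using D_Z1 m that by simp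
  show "subgroup (layer m) G"
  proof (rule subgroupI)
    show "layer m \<subseteq> carrier G" using actker_carrier by (auto simp: layer_def)
    have "\<one> \<in> layer m" using Z actker_closed by (simp add: layer_def)
    then show "layer m \<noteq> {}" by blast
    fix a assume a: "a \<in> layer m"
    then show "inv a \<in> layer m"
      using Z actker_closed actker_carrier by (simp add: layer_def Z1_inv)
    fix b assume "b \<in> layer m"
    then show "a \<otimes> b \<in> layer m"
      using a Z actker_closed actker_carrier by (simp add: layer_def Z1_mult)
  qed
  fix x h assume x: "x \<in> carrier G" and h: "h \<in> layer m"
  then show "x \<otimes> h \<otimes> inv x \<in> layer m"
    using Z by (simp add: layer_def Z1_actker_conj actker_conj)
qed

lemma layer_chief:
  assumes m: "m < k" shows "irr_gmod_chief G V act (layer m) (D m)"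
proof (intro irr_gmod_chief.intro irr_gmod_axioms gmod_chief.intro gmod_axioms gmod_chief_axioms.intro)
  show "layer m \<lhd> G" by (rule layer_normal) (use m in simp)
  have la: "a \<in> actker" if "a \<in> layer m" for a using that by (simp add: layer_def)
  show "D m (a \<otimes> b) = D m a \<otimes>\<^bsub>V\<^esub> D m b" if "a \<in> layer m" "b \<in> layer m" for a b
    using Z1_actker_mult[OF D_Z1[OF m]] la that actker_carrier by simp
  show "D m (g \<otimes> a \<otimes> inv g) = act g (D m a)" if "g \<in> carrier G" "a \<in> layer m" for g a
    using Z1_actker_conj[OF D_Z1[OF m]] la that by simp
  show "D m ` layer m = carrier V"
  proof
    show "D m ` layer m \<subseteq> carrier V" using la actker_carrier m by auto
    show "carrier V \<subseteq> D m ` layer m"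
    proof
      fix v assume v: "v \<in> carrier V"
      have "coord m v \<in> layer m" using coord[OF v, where j = m] m by (simp add: layer_def)
      moreover have "D m (coord m v) = v" using coord(2)[OF v m, of m] by simp
      ultimately show "v \<in> D m ` layer m" by (metis imageI)
    qed
  qed
qed

text \<open>Descends through the layers. At each of them the dichotomy either makes \<open>L\<close>
  a supplement of the next layer or produces a derivation vanishing on \<open>L\<close> but not on
  \<open>actker\<close>; a supplement of the trivial last layer is the whole group.\<close>

lemma supplement_of_actker:
  assumes L: "subgroup L G" and sup: "\<And>g. g \<in> carrier G \<Longrightarrow> \<exists>a\<in>actker. \<exists>l\<in>L. g = a \<otimes> l"
  shows "L = carrier G \<or> (\<exists>\<delta>\<in>Z1. (\<forall>l\<in>L. \<delta> l = \<one>\<^bsub>V\<^esub>) \<and> (\<exists>a\<in>actker. \<delta> a \<noteq> \<one>\<^bsub>V\<^esub>))"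
proof (rule disjCI)
  assume nex: "\<not> (\<exists>\<delta>\<in>Z1. (\<forall>l\<in>L. \<delta> l = \<one>\<^bsub>V\<^esub>) \<and> (\<exists>a\<in>actker. \<delta> a \<noteq> \<one>\<^bsub>V\<^esub>))"
  have "\<forall>g\<in>carrier G. \<exists>a\<in>layer m. \<exists>l\<in>L. g = a \<otimes> l" if "m \<le> k" for m
    using that
  proof (induction m)
    case 0
    then show ?case using sup by (simp add: layer_def)
  next
    case (Suc m)
    then have m: "m < k" by simp
    interpret C: irr_gmod_chief G V act "layer m" "D m" by (rule layer_chief[OF m])
    have IH: "\<exists>a\<in>layer m. \<exists>l\<in>L. g = a \<otimes> l" if "g \<in> carrier G" for g using Suc that by simp
    have nd: "\<not> (\<exists>\<delta>\<in>Z1. (\<forall>l\<in>L. \<delta> l = \<one>\<^bsub>V\<^esub>) \<and> (\<forall>a\<in>layer m. \<delta> a = D m a))"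
    proof
      assume "\<exists>\<delta>\<in>Z1. (\<forall>l\<in>L. \<delta> l = \<one>\<^bsub>V\<^esub>) \<and> (\<forall>a\<in>layer m. \<delta> a = D m a)"
      then obtain \<delta> where d: "\<delta> \<in> Z1" "\<forall>l\<in>L. \<delta> l = \<one>\<^bsub>V\<^esub>" "\<forall>a\<in>layer m. \<delta> a = D m a" by blast
      obtain v where v: "v \<in> carrier V" "v \<noteq> \<one>\<^bsub>V\<^esub>" using V_nontriv by blast
      then obtain a where a: "a \<in> layer m" "v = D m a" using C.pi_surj by blast
      then have "\<delta> a \<noteq> \<one>\<^bsub>V\<^esub>" "a \<in> actker" using d v by (auto simp: layer_def)
      then show False using nex d by blast
    qed
    then have *: "\<forall>g\<in>carrier G. \<exists>a\<in>layer m. \<exists>l\<in>L. D m a = \<one>\<^bsub>V\<^esub> \<and> g = a \<otimes> l"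
    proof -
      have "(\<forall>g\<in>carrier G. \<exists>a\<in>layer m. \<exists>l\<in>L. D m a = \<one>\<^bsub>V\<^esub> \<and> g = a \<otimes> l) \<or>
          (\<exists>\<delta>\<in>Z1. (\<forall>l\<in>L. \<delta> l = \<one>\<^bsub>V\<^esub>) \<and> (\<forall>a\<in>layer m. \<delta> a = D m a))"
        by (rule C.supplement_dichotomy[OF L]) (rule IH)
      then show ?thesis using nd by (simp only: simp_thms)
    qed
    have "a \<in> layer (Suc m)" if "a \<in> layer m" "D m a = \<one>\<^bsub>V\<^esub>" for a
      using that by (auto simp: layer_def less_Suc_eq)
    then show ?case using * by meson
  qed
  from this[of k] have *: "\<forall>g\<in>carrier G. \<exists>a\<in>layer k. \<exists>l\<in>L. g = a \<otimes> l" by simp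
  have one: "a = \<one>" if "a \<in> layer k" for a using D_inj that by (simp add: layer_def)
  have "carrier G \<subseteq> L"
  proof
    fix g assume "g \<in> carrier G"
    then obtain a l where al: "a \<in> layer k" "l \<in> L" "g = a \<otimes> l" using * by blast
    then show "g \<in> L" using one[of a] subgroup.mem_carrier[OF L, of l] by simp
  qed
  then show "L = carrier G" using subgroup.subset[OF L] by blast
qed

lemma ex_derivation_nontrivial_at:
  assumes x: "x \<in> carrier G" "x \<noteq> \<one>"
  shows "\<exists>\<delta>\<in>Z1. \<delta> x \<noteq> \<one>\<^bsub>V\<^esub>"
proof (cases "x \<in> actker")
  case True
  then obtain i where "i < k" "D i x \<noteq> \<one>\<^bsub>V\<^esub>" using D_inj x by blast
  then show ?thesis using D_Z1 by blast
next
  case False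
  then obtain v where v: "v \<in> carrier V" "act x v \<noteq> v" using x by (auto simp: actker_def)
  have "v \<otimes>\<^bsub>V\<^esub> inv\<^bsub>V\<^esub> act x v \<noteq> \<one>\<^bsub>V\<^esub>"
    using V.inv_solve_right'[of "\<one>\<^bsub>V\<^esub>" v "act x v"] v x by auto
  then show ?thesis using inner_derivation[OF v(1)] x by (intro bexI) auto
qed

text \<open>On \<open>actker\<close> both are homomorphisms and the first maps onto
  \<open>V\<close>. The inclusion of kernels lets the second factor through the first, and the
  induced map of \<open>V\<close> is equivariant.\<close>

lemma derivations_proportional:
  assumes d0: "\<delta>\<^sub>0 \<in> Z1" "a\<^sub>0 \<in> actker" "\<delta>\<^sub>0 a\<^sub>0 \<noteq> \<one>\<^bsub>V\<^esub>" and d: "\<delta> \<in> Z1"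
    and ker: "\<And>a. \<lbrakk>a \<in> actker; \<delta>\<^sub>0 a = \<one>\<^bsub>V\<^esub>\<rbrakk> \<Longrightarrow> \<delta> a = \<one>\<^bsub>V\<^esub>"
  shows "\<exists>c\<in>Endo. \<forall>a\<in>actker. \<delta> a = c (\<delta>\<^sub>0 a)"
proof -
  have surj: "\<delta>\<^sub>0 ` actker = carrier V"
    by (rule Z1_image_full[OF actker_normal _ d0]) simp
  have eq: "\<delta> a = \<delta> b" if ab: "a \<in> actker" "b \<in> actker" "\<delta>\<^sub>0 a = \<delta>\<^sub>0 b" for a b
  proof -
    have c: "a \<otimes> inv b \<in> actker" using ab actker_closed by simp
    have ac: "a \<in> carrier G" "b \<in> carrier G" using ab actker_carrier by blast+
    have m: "\<epsilon> a = \<epsilon> (a \<otimes> inv b) \<otimes>\<^bsub>V\<^esub> \<epsilon> b" if e: "\<epsilon> \<in> Z1" for \<epsilon>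
      using Z1_actker_mult[OF e c ac(2)] ac by (simp add: m_assoc)
    have "\<delta>\<^sub>0 (a \<otimes> inv b) \<otimes>\<^bsub>V\<^esub> \<delta>\<^sub>0 b = \<one>\<^bsub>V\<^esub> \<otimes>\<^bsub>V\<^esub> \<delta>\<^sub>0 b" using m[OF d0(1)] ab ac d0 by simp
    then have "\<delta>\<^sub>0 (a \<otimes> inv b) = \<one>\<^bsub>V\<^esub>" using V.r_cancel ac d0 by simp
    then have "\<delta> (a \<otimes> inv b) = \<one>\<^bsub>V\<^esub>" by (rule ker[OF c])
    then show ?thesis using m[OF d] ac d by simp
  qed
  define s where "s = (\<lambda>v. SOME a. a \<in> actker \<and> \<delta>\<^sub>0 a = v)"
  have s: "s v \<in> actker" "\<delta>\<^sub>0 (s v) = v" if v: "v \<in> carrier V" for v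
  proof -
    have "v \<in> \<delta>\<^sub>0 ` actker" using surj v by simp
    then have "\<exists>a. a \<in> actker \<and> \<delta>\<^sub>0 a = v" by auto
    then have "s v \<in> actker \<and> \<delta>\<^sub>0 (s v) = v" unfolding s_def by (rule someI_ex)
    then show "s v \<in> actker" "\<delta>\<^sub>0 (s v) = v" by auto
  qed
  have "(\<lambda>v\<in>carrier V. \<delta> (s v)) \<in> Endo"
  proof (rule EndoI)
    fix v w assume v: "v \<in> carrier V" and w: "w \<in> carrier V"
    have "\<delta> (s (v \<otimes>\<^bsub>V\<^esub> w)) = \<delta> (s v \<otimes> s w)"
      by (rule eq) (use v w s actker_closed actker_carrier in \<open>simp_all add: Z1_actker_mult[OF d0(1)]\<close>)
    then show "\<delta> (s (v \<otimes>\<^bsub>V\<^esub> w)) = \<delta> (s v) \<otimes>\<^bsub>V\<^esub> \<delta> (s w)"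
      using v w s actker_carrier by (simp add: Z1_actker_mult[OF d])
  next
    fix g v assume g: "g \<in> carrier G" and v: "v \<in> carrier V"
    have "\<delta> (s (act g v)) = \<delta> (g \<otimes> s v \<otimes> inv g)"
      by (rule eq) (use g v s actker_conj in \<open>simp_all add: Z1_actker_conj[OF d0(1)]\<close>)
    then show "\<delta> (s (act g v)) = act g (\<delta> (s v))" using g v s by (simp add: Z1_actker_conj[OF d])
  qed (use s actker_carrier d in simp)
  moreover have "\<delta> a = (\<lambda>v\<in>carrier V. \<delta> (s v)) (\<delta>\<^sub>0 a)" if a: "a \<in> actker" for a
  proof -
    have "\<delta>\<^sub>0 a \<in> carrier V" using d0 actker_carrier[OF a] by simp
    then show ?thesis using eq[OF a s(1)] s(2) by simp
  qed
  ultimately show ?thesis by blast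
qed

text \<open>Vanishing at \<open>x\<close> divides the bound on \<open>card Z1\<close> by
  \<open>card Endo\<close>. The inequality is strict because the trivial derivation vanishes at
  \<open>x\<close> without being counted.\<close>

lemma card_derivations_avoiding:
  assumes cardZ: "card Z1 \<le> card (carrier V) ^ n * card Endo"
    and x: "x \<in> carrier G" "x \<noteq> \<one>" and B: "\<one> \<in> B"
  shows "card {\<delta> \<in> Z1. \<delta> x = \<one>\<^bsub>V\<^esub> \<and> (\<exists>b\<in>B. b \<in> carrier G \<and> \<delta> b \<noteq> \<one>\<^bsub>V\<^esub>)} < card (carrier V) ^ n"
    (is "card ?D < _")
proof -
  let ?Zx = "{\<delta> \<in> Z1. \<delta> x = \<one>\<^bsub>V\<^esub>}"
  obtain \<delta> where d: "\<delta> \<in> Z1" "\<delta> x \<noteq> \<one>\<^bsub>V\<^esub>" using ex_derivation_nontrivial_at[OF x] by blast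
  have "card ?Zx * card Endo \<le> card (carrier V) ^ n * card Endo"
    using card_Z1_vanishing[OF x(1) d] cardZ by linarith
  then have "card ?Zx \<le> card (carrier V) ^ n" using card_Endo_ge_2 by simp
  moreover have "card ?D < card ?Zx"
  proof (rule psubset_card_mono)
    show "finite ?Zx" using finite_Z1 by simp
    have "(\<lambda>g\<in>carrier G. \<one>\<^bsub>V\<^esub>) \<in> ?Zx" "(\<lambda>g\<in>carrier G. \<one>\<^bsub>V\<^esub>) \<notin> ?D" using Z1_trivial x by auto
    then show "?D \<subset> ?Zx" by blast
  qed
  ultimately show ?thesis by simp
qed

theorem crown_gen_over_maximal:
  assumes sol: "solvable G" and cardZ: "card Z1 \<le> card (carrier V) ^ n * card Endo"
    and ys: "set ys \<subseteq> carrier G" "length ys = n" "generate G (set ys \<union> actker) = carrier G"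
  shows "gen_over_maximal G n"
  unfolding gen_over_maximal_def
proof (intro allI impI, elim conjE)
  fix M x assume M: "maximal_subgroup M G" and x: "x \<in> carrier G" "x \<notin> M"
  have Ms: "subgroup M G" "M \<noteq> carrier G" and Mc: "M \<subseteq> carrier G"
    using M maximal_subgroup_imp_subset unfolding maximal_subgroup_def by blast+
  have x1: "x \<noteq> \<one>" using x(2) subgroup.one_closed[OF Ms(1)] by blast
  \<comment> \<open>The common end of both cases. The assumption \<open>bad\<close> says that an
    obstruction is nontrivial on \<open>B\<close>, so that averaging over \<open>B\<close> can
    remove it. The set \<open>S\<close> stays abstract because \<open>x\<close> is required modulo
    \<open>actker\<close> in the first case only.\<close>
  have finish: "\<exists>zs. set zs \<subseteq> M \<and> length zs = n \<and> generate G (insert x (set zs)) = carrier G"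
    if B: "B \<lhd> G" "B \<subseteq> actker" "B \<subseteq> M" and zs: "set zs \<subseteq> M" "length zs = n"
      and S: "generate G S = carrier G" "S \<subseteq> insert x (set zs) \<union> actker"
      and bad: "\<And>\<delta> ws. \<lbrakk>\<delta> \<in> Z1; \<delta> x = \<one>\<^bsub>V\<^esub>; set ws \<subseteq> M; \<And>w. w \<in> set ws \<Longrightarrow> \<delta> w = \<one>\<^bsub>V\<^esub>;
        list_all2 (\<lambda>y z. \<exists>b\<in>B. z = b \<otimes> y) zs ws; \<exists>a\<in>actker. \<delta> a \<noteq> \<one>\<^bsub>V\<^esub>\<rbrakk> \<Longrightarrow> \<exists>b\<in>B. \<delta> b \<noteq> \<one>\<^bsub>V\<^esub>"
    for B zs S
  proof -
    have Bs: "subgroup B G" using B(1) normal_imp_subgroup by blast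
    let ?D = "{\<delta> \<in> Z1. \<delta> x = \<one>\<^bsub>V\<^esub> \<and> (\<exists>b\<in>B. b \<in> carrier G \<and> \<delta> b \<noteq> \<one>\<^bsub>V\<^esub>)}"
    have zsc: "set zs \<subseteq> carrier G" using zs(1) Mc by blast
    have "\<exists>ws. list_all2 (\<lambda>y z. \<exists>b\<in>B. z = b \<otimes> y) zs ws \<and> (\<forall>\<delta>\<in>?D. \<exists>z\<in>set ws. \<delta> z \<noteq> \<one>\<^bsub>V\<^esub>)"
    proof (rule avoid_derivations[OF Bs B(2)])
      show "finite ?D" using finite_Z1 by simp
      show "?D \<subseteq> Z1" by blast
      show "\<delta> ` B = carrier V" if "\<delta> \<in> ?D" for \<delta>
        using that Z1_image_full[OF B(1,2)] by blast
      show "card ?D < card (carrier V) ^ length zs"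
        using card_derivations_avoiding[OF cardZ x(1) x1 subgroup.one_closed[OF Bs]] zs(2) by simp
    qed (rule zsc)
    then obtain ws where ws: "list_all2 (\<lambda>y z. \<exists>b\<in>B. z = b \<otimes> y) zs ws"
        "\<forall>\<delta>\<in>?D. \<exists>z\<in>set ws. \<delta> z \<noteq> \<one>\<^bsub>V\<^esub>" by blast
    have wM: "set ws \<subseteq> M" by (rule list_all2_left_mult_closed[OF Ms(1) B(3) zs(1) ws(1)])
    let ?L = "generate G (insert x (set ws))"
    have Lc: "insert x (set ws) \<subseteq> carrier G" using x(1) wM Mc by blast
    have L: "subgroup ?L G" by (rule generate_is_subgroup[OF Lc])
    have SL: "s \<in> ?L" if "s \<in> insert x (set ws)" for s by (rule subsetD[OF generate_sincl that])
    have sup: "\<exists>a\<in>actker. \<exists>l\<in>?L. g = a \<otimes> l" if g: "g \<in> carrier G" for g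
    proof (rule normal_supplementI[OF actker_normal L S(1) _ g])
      fix s assume "s \<in> S"
      then consider "s = x" | "s \<in> set zs" | "s \<in> actker" using S(2) by blast
      then show "\<exists>a\<in>actker. \<exists>l\<in>?L. s = a \<otimes> l"
      proof cases
        case 1
        then show ?thesis using SL[of x] actker_closed(3) x(1) by (intro bexI[of _ \<one>] bexI[of _ x]) auto
      next
        case 2
        then show ?thesis using list_all2_left_mult_supplement[OF Bs zsc ws(1)] B(2) SL by blast
      next
        case 3
        then show ?thesis using subgroup.one_closed[OF L] actker_carrier
          by (intro bexI[of _ s] bexI[of _ \<one>]) auto
      qed
    qed
    from supplement_of_actker[OF L sup] have "?L = carrier G"
    proof
      assume "\<exists>\<delta>\<in>Z1. (\<forall>l\<in>?L. \<delta> l = \<one>\<^bsub>V\<^esub>) \<and> (\<exists>a\<in>actker. \<delta> a \<noteq> \<one>\<^bsub>V\<^esub>)"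
      then obtain \<delta> where d: "\<delta> \<in> Z1" "\<And>l. l \<in> ?L \<Longrightarrow> \<delta> l = \<one>\<^bsub>V\<^esub>" "\<exists>a\<in>actker. \<delta> a \<noteq> \<one>\<^bsub>V\<^esub>" by blast
      have d1: "\<delta> s = \<one>\<^bsub>V\<^esub>" if "s \<in> insert x (set ws)" for s by (rule d(2)[OF SL[OF that]])
      have "\<exists>b\<in>B. \<delta> b \<noteq> \<one>\<^bsub>V\<^esub>" by (rule bad[OF d(1) _ wM _ ws(1) d(3)]) (use d1 in simp_all)
      then have "\<delta> \<in> ?D" using d(1) d1 subgroup.mem_carrier[OF Bs] by blast
      then obtain z where "z \<in> set ws" "\<delta> z \<noteq> \<one>\<^bsub>V\<^esub>" using ws(2) by blast
      then show ?thesis using d1 by blast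
    qed
    moreover have "length ws = n" using ws(1) zs(2) by (simp add: list_all2_lengthD)
    ultimately show ?thesis using wM by blast
  qed
  show "\<exists>zs. set zs \<subseteq> M \<and> length zs = n \<and> generate G (insert x (set zs)) = carrier G"
  proof (cases "actker \<subseteq> M")
    case True
    obtain zs where zs: "set zs \<subseteq> M" "length zs = n" "generate G (insert x (set zs) \<union> actker) = carrier G"
      using solvable_gen_over_maximal_mod[OF finG sol actker_normal ys(1,3) M x actker_normal _ True] ys(2)
      by auto
    show ?thesis by (rule finish[OF actker_normal _ True zs]) auto
  next
    case False
    have supM: "\<exists>a\<in>actker. \<exists>l\<in>M. g = a \<otimes> l" if g: "g \<in> carrier G" for g
    proof -
      let ?T = "{g. \<exists>a\<in>actker. \<exists>l\<in>M. g = a \<otimes> l}"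
      have T: "subgroup ?T G" by (rule normal_supplement_subgroup[OF actker_normal Ms(1)])
      have "m \<in> ?T" if "m \<in> M" for m
        using that actker_closed(3) Mc by (intro CollectI bexI[of _ \<one>] bexI[of _ m]) auto
      moreover have "a \<in> ?T" if "a \<in> actker" for a
        using that subgroup.one_closed[OF Ms(1)] actker_carrier
        by (intro CollectI bexI[of _ a] bexI[of _ \<one>]) auto
      ultimately have "M \<subseteq> ?T" "?T \<noteq> M" using False by blast+
      then have "?T = carrier G" using M T unfolding maximal_subgroup_def by blast
      then show ?thesis using g by blast
    qed
    then obtain \<delta>\<^sub>0 a\<^sub>0 where d0: "\<delta>\<^sub>0 \<in> Z1" "\<And>m. m \<in> M \<Longrightarrow> \<delta>\<^sub>0 m = \<one>\<^bsub>V\<^esub>" "a\<^sub>0 \<in> actker" "\<delta>\<^sub>0 a\<^sub>0 \<noteq> \<one>\<^bsub>V\<^esub>"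
      using supplement_of_actker[OF Ms(1)] Ms(2) by blast
    let ?k = "{g \<in> carrier G. \<delta>\<^sub>0 g = \<one>\<^bsub>V\<^esub>}"
    have "subgroup ?k G" by (rule Z1_ker_subgroup[OF d0(1)])
    moreover have "M \<subseteq> ?k" using d0(2) Mc by blast
    moreover have "?k \<noteq> carrier G" using d0(3,4) actker_carrier by blast
    ultimately have Mk: "M = ?k" using M unfolding maximal_subgroup_def by blast
    then have d0x: "\<delta>\<^sub>0 x \<noteq> \<one>\<^bsub>V\<^esub>" using x by blast
    \<comment> \<open>Multiplication by arbitrary elements of \<open>actker\<close> would leave
      \<open>M\<close>; since \<open>M\<close> is the zero set of \<open>\<delta>\<^sub>0\<close>,
      exactly the kernel of \<open>\<delta>\<^sub>0\<close> on \<open>actker\<close> is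
      admissible.\<close>
    let ?B = "{a \<in> actker. \<delta>\<^sub>0 a = \<one>\<^bsub>V\<^esub>}"
    have BM: "?B \<subseteq> M" using Mk actker_carrier by blast
    have Bn: "?B \<lhd> G"
    proof (rule normal_invI)
      have "?B = actker \<inter> M" using Mk actker_carrier by blast
      then show "subgroup ?B G" using subgroups_Inter_pair[OF actker_subgroup Ms(1)] by simp
      fix g h assume "g \<in> carrier G" "h \<in> ?B"
      then show "g \<otimes> h \<otimes> inv g \<in> ?B" using actker_conj by (simp add: Z1_actker_conj[OF d0(1)])
    qed
    have "\<forall>y\<in>set ys. \<exists>m. m \<in> M \<and> (\<exists>a\<in>actker. y = a \<otimes> m)" using supM ys(1) by blast
    then obtain f where f: "\<forall>y\<in>set ys. f y \<in> M \<and> (\<exists>a\<in>actker. y = a \<otimes> f y)" by metis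
    let ?zs = "map f ys"
    have zM: "set ?zs \<subseteq> M" using f by auto
    have zsc: "set ?zs \<subseteq> carrier G" using zM Mc by blast
    have gen_act: "generate G (set ws \<union> actker) = carrier G"
      if wsc: "set ws \<subseteq> carrier G" and yw: "\<And>y. y \<in> set ys \<Longrightarrow> \<exists>a\<in>actker. \<exists>w\<in>set ws. y = a \<otimes> w" for ws
    proof -
      have T: "subgroup (generate G (set ws \<union> actker)) G"
        by (rule generate_is_subgroup) (use wsc actker_carrier in blast)
      have "generate G (set ys \<union> actker) \<subseteq> generate G (set ws \<union> actker)"
      proof (rule generate_subgroup_incl[OF _ T], rule subsetI)
        fix s assume "s \<in> set ys \<union> actker"
        then show "s \<in> generate G (set ws \<union> actker)"
        proof
          assume "s \<in> set ys"
          then obtain a w where aw: "a \<in> actker" "w \<in> set ws" "s = a \<otimes> w" using yw by blast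
          have "a \<in> generate G (set ws \<union> actker)" "w \<in> generate G (set ws \<union> actker)"
            using aw by (auto intro: generate.incl)
          then show ?thesis using aw(3) subgroup.m_closed[OF T] by simp
        next
          assume "s \<in> actker"
          then show ?thesis by (auto intro: generate.incl)
        qed
      qed
      then show ?thesis using ys(3) subgroup.subset[OF T] by blast
    qed
    have zgen: "generate G (set ?zs \<union> actker) = carrier G"
    proof (rule gen_act[OF zsc])
      fix y assume y: "y \<in> set ys"
      then obtain a where "a \<in> actker" "y = a \<otimes> f y" using f by blast
      moreover have "f y \<in> set ?zs" using y by simp
      ultimately show "\<exists>a\<in>actker. \<exists>w\<in>set ?zs. y = a \<otimes> w" by blast
    qed
    show ?thesis
    proof (rule finish[OF Bn _ BM zM _ zgen])
      show "length ?zs = n" using ys(2) by simp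
      fix \<delta> ws
      assume d: "\<delta> \<in> Z1" "\<delta> x = \<one>\<^bsub>V\<^esub>" "set ws \<subseteq> M" "\<And>w. w \<in> set ws \<Longrightarrow> \<delta> w = \<one>\<^bsub>V\<^esub>"
        and zw: "list_all2 (\<lambda>y z. \<exists>b\<in>?B. z = b \<otimes> y) ?zs ws" and nz: "\<exists>a\<in>actker. \<delta> a \<noteq> \<one>\<^bsub>V\<^esub>"
      show "\<exists>b\<in>?B. \<delta> b \<noteq> \<one>\<^bsub>V\<^esub>"
      proof (rule ccontr)
        assume "\<not> ?thesis"
        then have "\<delta> a = \<one>\<^bsub>V\<^esub>" if "a \<in> actker" "\<delta>\<^sub>0 a = \<one>\<^bsub>V\<^esub>" for a using that by blast
        then obtain c where c: "c \<in> Endo" "\<forall>a\<in>actker. \<delta> a = c (\<delta>\<^sub>0 a)"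
          using derivations_proportional[OF d0(1,3,4) d(1)] by blast
        let ?e = "\<lambda>g\<in>carrier G. c (\<delta>\<^sub>0 g)"
        have wsc: "set ws \<subseteq> carrier G" using d(3) Mc by blast
        have wgen: "generate G (set ws \<union> actker) = carrier G"
        proof (rule gen_act[OF wsc])
          fix y assume y: "y \<in> set ys"
          then obtain a where a: "a \<in> actker" "y = a \<otimes> f y" using f by blast
          have "f y \<in> set ?zs" using y by simp
          then obtain b w where b: "b \<in> ?B" "w \<in> set ws" "f y = b \<otimes> w"
            using list_all2_left_mult_supplement[OF normal_imp_subgroup[OF Bn] zsc zw] by blast
          have "y = (a \<otimes> b) \<otimes> w" using a b wsc actker_carrier by (simp add: m_assoc subset_iff)
          moreover have "a \<otimes> b \<in> actker" using a b actker_closed by simp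
          ultimately show "\<exists>a\<in>actker. \<exists>w\<in>set ws. y = a \<otimes> w" using b(2) by blast
        qed
        \<comment> \<open>Both derivations vanish on \<open>ws\<close> and agree on
          \<open>actker\<close>, and these generate \<open>G\<close>. At \<open>x\<close>, however,
          \<delta> vanishes while \<open>\<delta>\<^sub>0\<close> does not, so \<open>c\<close> is
          zero and \<delta> is trivial on \<open>actker\<close>.\<close>
        have "\<delta> = ?e"
        proof (rule Z1_eq_if_agree_on_generators[OF d(1) Endo_Z1[OF c(1) d0(1)] wgen])
          show "set ws \<union> actker \<subseteq> carrier G" using wsc actker_carrier by blast
          fix s assume "s \<in> set ws \<union> actker"
          then show "\<delta> s = ?e s"
          proof
            assume s: "s \<in> set ws"
            then have "s \<in> M" "s \<in> carrier G" using d(3) wsc by blast+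
            then show ?thesis using d(4)[OF s] d0(2) c(1) by simp
          next
            assume "s \<in> actker"
            then show ?thesis using c(2) actker_carrier by simp
          qed
        qed
        then have "c (\<delta>\<^sub>0 x) = (\<lambda>v\<in>carrier V. \<one>\<^bsub>V\<^esub>) (\<delta>\<^sub>0 x)"
          using d(2) x(1) d0(1) by (metis Z1_closed restrict_apply')
        then have "c = (\<lambda>v\<in>carrier V. \<one>\<^bsub>V\<^esub>)"
          using Endo_eq_if_agree[OF c(1) Endo_zero _ d0x] x(1) d0(1) by simp
        then show False using c(2) nz actker_carrier d0(1) by auto
      qed
    qed auto
  qed
qed

text \<open>With \<open>n\<close> generators there would be at most \<open>card V ^ n\<close>
  derivations, and \<open>card Endo \<ge> 2\<close> makes the assumed number larger. One element
  outside a maximal subgroup and \<open>n\<close> inside it do generate.\<close>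

theorem crown_min_gens:
  assumes sol: "solvable G" and cardZ: "card Z1 = card (carrier V) ^ n * card Endo"
    and ys: "set ys \<subseteq> carrier G" "length ys = n" "generate G (set ys \<union> actker) = carrier G"
  shows "min_gens G = Suc n"
proof -
  have gom: "gen_over_maximal G n" by (rule crown_gen_over_maximal[OF sol _ ys]) (simp add: cardZ)
  have "carrier G \<noteq> {\<one>}" using act_nontriv actker_closed(3) by (auto simp: actker_def)
  then obtain M where M: "maximal_subgroup M G" using ex_maximal_subgroup[OF finG triv_subgroup] by auto
  then obtain x where x: "x \<in> carrier G" "x \<notin> M"
    using maximal_subgroup_imp_subset[OF M] unfolding maximal_subgroup_def by blast
  then obtain zs where zs: "set zs \<subseteq> M" "length zs = n" "generate G (insert x (set zs)) = carrier G"
    using gom M unfolding gen_over_maximal_def by blast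
  have "set (x # zs) \<subseteq> carrier G \<and> length (x # zs) = Suc n \<and> generate G (set (x # zs)) = carrier G"
    using zs x maximal_subgroup_imp_subset[OF M] by auto
  then have "min_gens G \<le> Suc n" using min_gens_le_iff[OF finG] by blast
  moreover have "\<not> min_gens G \<le> n"
  proof
    assume "min_gens G \<le> n"
    then obtain ws where ws: "set ws \<subseteq> carrier G" "length ws = n" "generate G (set ws) = carrier G"
      using min_gens_le_iff[OF finG] by blast
    have "card Z1 \<le> card (carrier V) ^ length ws"
      by (rule card_Z1_le_power[of Z1 "{}"]) (use ws in auto)
    moreover have "card (carrier V) ^ n > 0" using finV V.one_closed by (auto simp: card_gt_0_iff)
    ultimately show False using cardZ ws(2) card_Endo_ge_2 by simp
  qed
  ultimately show ?thesis by simp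
qed

end

section \<open>Derivations vanishing on the kernel of the action\<close>

lemma prime_power_if_unique_prime_divisor:
  fixes n p :: nat
  assumes p: "Factorial_Ring.prime p" and n: "n > 0"
    and uniq: "\<And>q. \<lbrakk>Factorial_Ring.prime q; q dvd n\<rbrakk> \<Longrightarrow> q = p"
  shows "\<exists>m. n = p ^ m"
proof -
  obtain r where r: "n = p ^ multiplicity p n * r" "\<not> p dvd r"
    using multiplicity_decompose'[of n p] n p by (auto simp: prime_nat_iff)
  have "r = 1"
  proof (rule ccontr)
    assume "r \<noteq> 1"
    then obtain q where q: "Factorial_Ring.prime q" "q dvd r" using prime_factor_nat by blast
    then have "q dvd n" using r(1) by (metis dvd_mult)
    then show False using uniq q r(2) by blast
  qed
  then show ?thesis using r(1) by auto
qed

section \<open>Elements of prime order and fixed points of p-groups\<close>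

context group begin

lemma cauchy_prime_order:
  fixes p :: nat
  assumes fin: "finite (carrier G)" and p: "Factorial_Ring.prime p" "p dvd order G"
  shows "\<exists>x\<in>carrier G. x \<noteq> \<one> \<and> x [^] p = \<one>"
proof -
  obtain m where "order G = p ^ 1 * m" using p(2) by auto
  then obtain H where H: "subgroup H G" "card H = p ^ 1" using sylow_thm[OF p(1) is_group _ fin] by blast
  interpret H: group "G\<lparr>carrier := H\<rparr>" using subgroup_imp_group[OF H(1)] .
  have "card H > 1" using H(2) p(1) prime_gt_1_nat by simp
  then obtain x where x: "x \<in> H" "x \<noteq> \<one>"
    by (metis One_nat_def card_1_singleton_iff empty_iff insertI1 is_singletonI is_singleton_def
        less_irrefl subgroup.one_closed[OF H(1)] subset_antisym subsetI singletonD card.empty not_less_zero)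
  have "x [^]\<^bsub>G\<lparr>carrier := H\<rparr>\<^esub> order (G\<lparr>carrier := H\<rparr>) = \<one>"
    using H.pow_order_eq_1[of x] x by simp
  then have "x [^] p = \<one>" using H(2) by (simp add: Coset.order_def nat_pow_def)
  then show ?thesis using x subgroup.mem_carrier[OF H(1)] by blast
qed

lemma order_prime_power_if_exponent:
  fixes p :: nat
  assumes fin: "finite (carrier G)" and p: "Factorial_Ring.prime p"
    and exp: "\<And>x. x \<in> carrier G \<Longrightarrow> x [^] p = \<one>"
  shows "\<exists>m. order G = p ^ m"
proof (rule prime_power_if_unique_prime_divisor[OF p])
  show "order G > 0" using fin order_gt_0_iff_finite by blast
  fix q assume q: "Factorial_Ring.prime q" "q dvd order G"
  then obtain x where x: "x \<in> carrier G" "x \<noteq> \<one>" "x [^] q = \<one>"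
    using cauchy_prime_order[OF fin] by blast
  then have "ord x dvd q" "ord x dvd p" "ord x \<noteq> 1"
    using exp pow_eq_id ord_eq_1 by auto
  then show "q = p" using q(1) p by (metis prime_nat_iff)
qed

end

lemma (in group_action) p_group_card_fixed:
  fixes p :: nat
  assumes fin: "finite (carrier G)" "finite E" and p: "Factorial_Ring.prime p" "order G = p ^ m"
  shows "int p dvd int (card E) - int (card {x \<in> E. \<forall>g\<in>carrier G. \<phi> g x = x})"
proof (rule dvd_card_minus_fixed[OF fin(2)])
  fix x assume x: "x \<in> E" and nf: "\<exists>g\<in>carrier G. \<phi> g x \<noteq> x"
  have "card (orbit G \<phi> x) dvd p ^ m" using orbit_stabilizer_theorem[OF x] p(2) by (metis dvd_triv_left)
  then obtain i where i: "card (orbit G \<phi> x) = p ^ i" using divides_primepow_nat[OF p(1)] by blast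
  have "i \<noteq> 0"
  proof
    assume "i = 0"
    then have "card (orbit G \<phi> x) = 1" using i by simp
    then obtain y where y: "orbit G \<phi> x = {y}" by (rule card_1_singletonE)
    obtain g where g: "g \<in> carrier G" "\<phi> g x \<noteq> x" using nf by blast
    have "\<phi> g x \<in> orbit G \<phi> x" using g by (auto simp: orbit_def)
    moreover have "x \<in> orbit G \<phi> x" by (rule orbit_refl[OF x])
    ultimately show False using y g by simp
  qed
  then show "int p dvd int (card (orbit G \<phi> x))" using i by (cases i) auto
qed

section \<open>Vanishing of the first cohomology of soluble groups\<close>

context irr_gmod begin

lemma act_finprod:
  assumes g: "g \<in> carrier G" and f: "finite B" "f \<in> B \<rightarrow> carrier V"
  shows "act g (finprod V f B) = finprod V (\<lambda>b. act g (f b)) B"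
  using f
proof (induction B rule: finite_induct)
  case (insert b B)
  then have "f \<in> B \<rightarrow> carrier V" "f b \<in> carrier V" "(\<lambda>b. act g (f b)) \<in> B \<rightarrow> carrier V"
    using g by (auto simp: Pi_iff)
  then show ?case using insert g by (simp add: V.finprod_insert act_mult V.finprod_closed)
qed (use g in simp)

lemma prime_exponent_imp_dvd_card:
  fixes p :: nat
  assumes p: "Factorial_Ring.prime p" and exp: "\<And>v. v \<in> carrier V \<Longrightarrow> v [^]\<^bsub>V\<^esub> p = \<one>\<^bsub>V\<^esub>"
  shows "p dvd card (carrier V)"
proof -
  obtain m where m: "order V = p ^ m" using V.order_prime_power_if_exponent[OF finV p exp] by blast
  have "m \<noteq> 0"
  proof
    assume "m = 0"
    then have "card (carrier V) = 1" using m by (simp add: Coset.order_def)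
    then show False using V_nontriv V.one_closed by (metis card_1_singletonE singletonD)
  qed
  then show ?thesis using m by (simp add: Coset.order_def)
qed

text \<open>A minimal normal subgroup \<open>K\<close> is abelian and fixes no nontrivial vector,
  which forces its order to be prime to \<open>p\<close>. Averaging over \<open>K\<close> makes
  \<delta> inner on \<open>K\<close>; after subtracting that inner derivation, all values are fixed
  by \<open>K\<close> and hence trivial.\<close>

lemma derivation_inner_if_faithful:
  fixes p :: nat
  assumes sol: "solvable G" and p: "Factorial_Ring.prime p"
    and exp: "\<And>v. v \<in> carrier V \<Longrightarrow> v [^]\<^bsub>V\<^esub> p = \<one>\<^bsub>V\<^esub>"
    and faithful: "actker = {\<one>}" and nt: "carrier G \<noteq> {\<one>}" and d: "\<delta> \<in> Z1"
  shows "\<exists>v\<in>carrier V. \<forall>g\<in>carrier G. \<delta> g = v \<otimes>\<^bsub>V\<^esub> inv\<^bsub>V\<^esub> act g v"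
proof -
  obtain K where K: "K \<lhd> G" "{\<one>} \<subset> K" "\<forall>a\<in>K. \<forall>b\<in>K. {\<one>} #> (a \<otimes> b) = {\<one>} #> (b \<otimes> a)"
      "\<forall>K'. K' \<lhd> G \<and> {\<one>} \<subseteq> K' \<and> K' \<subseteq> K \<longrightarrow> K' = {\<one>} \<or> K' = K"
    using exists_abelian_chief_factor[OF finG sol one_is_normal nt[symmetric]] by blast
  have Ks: "subgroup K G" using K(1) normal_imp_subgroup by blast
  have Kc: "k \<in> carrier G" if "k \<in> K" for k by (rule subgroup.mem_carrier[OF Ks that])
  have Kcomm: "a \<otimes> b = b \<otimes> a" if "a \<in> K" "b \<in> K" for a b
    using K(3) that Kc by (auto simp: r_coset_def)
  have Kconj: "g \<otimes> k \<otimes> inv g \<in> K" if "g \<in> carrier G" "k \<in> K" for g k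
    using K(1) that normal_inv_iff by blast
  have finK: "finite K" using finite_subset[OF subgroup.subset[OF Ks] finG] .
  interpret KG: group "G\<lparr>carrier := K\<rparr>" by (rule subgroup_imp_group[OF Ks])
  have fixK: "v = \<one>\<^bsub>V\<^esub>" if v: "v \<in> carrier V" "\<And>k. k \<in> K \<Longrightarrow> act k v = v" for v
  proof -
    let ?W = "{v \<in> carrier V. \<forall>k\<in>K. act k v = v}"
    have "subgroup ?W V"
      by (rule V.subgroupI) (use Kc in \<open>auto simp: act_V_inv act_mult intro: exI[of _ "\<one>\<^bsub>V\<^esub>"]\<close>)
    then have "?W = {\<one>\<^bsub>V\<^esub>} \<or> ?W = carrier V"
    proof (rule irreducible)
      fix g w assume g: "g \<in> carrier G" and w: "w \<in> ?W"
      have "act k (act g w) = act g w" if k: "k \<in> K" for k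
      proof -
        have c: "inv g \<otimes> k \<otimes> g \<in> K" using Kconj[of "inv g" k] g k by simp
        have "act k (act g w) = act (k \<otimes> g) w" using g Kc[OF k] w by (simp add: act_comp)
        also have "k \<otimes> g = g \<otimes> (inv g \<otimes> k \<otimes> g)" using g Kc[OF k] by (simp flip: m_assoc)
        also have "act \<dots> w = act g (act (inv g \<otimes> k \<otimes> g) w)"
          using g Kc[OF c] w by (intro act_comp) auto
        also have "\<dots> = act g w" using c w by simp
        finally show ?thesis .
      qed
      then show "act g w \<in> ?W" using g w by simp
    qed
    moreover have "?W \<noteq> carrier V"
    proof
      assume "?W = carrier V"
      then have "K \<subseteq> actker" using Kc by (auto simp: actker_def)
      then show False using faithful K(2) by blast
    qed
    ultimately show ?thesis using v by blast
  qed
  \<comment> \<open>Otherwise minimality makes \<open>K\<close> an elementary abelian p-group, and a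
    p-group acting on the p-group \<open>V\<close> has a number of fixed points divisible by
    \<open>p\<close>, contrary to \<open>fixK\<close>.\<close>
  have "coprime (card K) p"
  proof (rule ccontr)
    assume "\<not> coprime (card K) p"
    then have pK: "p dvd order (G\<lparr>carrier := K\<rparr>)"
      using p prime_imp_coprime[of p "card K"] by (auto simp: Coset.order_def coprime_commute)
    obtain x where x: "x \<in> K" "x \<noteq> \<one>" "x [^] p = \<one>"
      using KG.cauchy_prime_order[OF _ p pK] finK by (auto simp: nat_pow_def)
    let ?T = "{k \<in> K. k [^] p = \<one>}"
    have "?T \<lhd> G"
    proof (rule normal_invI)
      have pm: "(a \<otimes> b) [^] p = a [^] p \<otimes> b [^] p" if "a \<in> K" "b \<in> K" for a b
        using pow_mult_distrib[OF Kcomm[OF that]] that Kc by simp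
      show "subgroup ?T G"
      proof (rule subgroupI)
        show "?T \<noteq> {}" using x by blast
        show "inv a \<in> ?T" if "a \<in> ?T" for a
          using that Kc subgroup.m_inv_closed[OF Ks] nat_pow_inv[of a p] by simp
        show "a \<otimes> b \<in> ?T" if "a \<in> ?T" "b \<in> ?T" for a b
          using that pm subgroup.m_closed[OF Ks] by simp
      qed (use Kc in auto)
      fix g h assume g: "g \<in> carrier G" and h: "h \<in> ?T"
      have "(g \<otimes> h \<otimes> inv g) [^] n = g \<otimes> h [^] n \<otimes> inv g" for n :: nat
      proof (induction n)
        case (Suc n)
        have "inv g \<otimes> (g \<otimes> (h \<otimes> inv g)) = h \<otimes> inv g"
          using g h Kc[of h] by (simp flip: m_assoc)
        then show ?case using Suc g h Kc[of h] by (simp add: m_assoc)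
      qed (use g in simp)
      then show "g \<otimes> h \<otimes> inv g \<in> ?T" using g h Kconj by simp
    qed
    moreover have "{\<one>} \<subseteq> ?T" "?T \<subseteq> K" using subgroup.one_closed[OF Ks] by auto
    ultimately have "?T = {\<one>} \<or> ?T = K" using K(4) by blast
    then have "?T = K" using x by blast
    then obtain m where m: "order (G\<lparr>carrier := K\<rparr>) = p ^ m"
      using KG.order_prime_power_if_exponent[OF _ p] finK by (auto simp: nat_pow_def)
    interpret A: group_action "G\<lparr>carrier := K\<rparr>" "carrier V" "\<lambda>k. \<lambda>v\<in>carrier V. act k v"
    proof (unfold group_action_def, rule group_hom.intro[OF KG.is_group group_BijGroup], unfold group_hom_axioms_def, rule homI)
      fix k assume "k \<in> carrier (G\<lparr>carrier := K\<rparr>)"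
      then have k: "k \<in> carrier G" using Kc by simp
      have "bij_betw (act k) (carrier V) (carrier V)"
        by (rule bij_betw_byWitness[where f' = "act (inv k)"]) (use k in auto)
      then show "(\<lambda>v\<in>carrier V. act k v) \<in> carrier (BijGroup (carrier V))"
        by (simp add: BijGroup_def Bij_def bij_betw_cong[of "carrier V" "restrict (act k) (carrier V)" "act k"])
      fix l assume "l \<in> carrier (G\<lparr>carrier := K\<rparr>)"
      then have l: "l \<in> carrier G" using Kc by simp
      have lb: "bij_betw (act l) (carrier V) (carrier V)"
        by (rule bij_betw_byWitness[where f' = "act (inv l)"]) (use l in auto)
      have "(\<lambda>v\<in>carrier V. act k v) \<in> Bij (carrier V)" "(\<lambda>v\<in>carrier V. act l v) \<in> Bij (carrier V)"
        using \<open>bij_betw (act k) (carrier V) (carrier V)\<close> lb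
        by (simp_all add: Bij_def bij_betw_cong[of "carrier V" "restrict (act k) (carrier V)" "act k"]
            bij_betw_cong[of "carrier V" "restrict (act l) (carrier V)" "act l"])
      then show "(\<lambda>v\<in>carrier V. act (k \<otimes>\<^bsub>G\<lparr>carrier := K\<rparr>\<^esub> l) v) =
          (\<lambda>v\<in>carrier V. act k v) \<otimes>\<^bsub>BijGroup (carrier V)\<^esub> (\<lambda>v\<in>carrier V. act l v)"
        using k l by (auto simp: BijGroup_def compose_def act_comp fun_eq_iff)
    qed
    have "{v \<in> carrier V. \<forall>k\<in>carrier (G\<lparr>carrier := K\<rparr>). (\<lambda>v\<in>carrier V. act k v) v = v} = {\<one>\<^bsub>V\<^esub>}"
      using fixK Kc by auto
    then have "int p dvd int (card (carrier V)) - 1"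
      using A.p_group_card_fixed[OF _ finV p m] finK by simp
    moreover have "int p dvd int (card (carrier V))" using prime_exponent_imp_dvd_card[OF p exp] by simp
    ultimately have "int p dvd 1" by (metis dvd_diff_right_iff)
    then show False using p prime_gt_1_nat[OF p] by simp
  qed
  \<comment> \<open>\<open>t\<close> inverts \<open>card K\<close> modulo \<open>p\<close>. The
    surplus multiple of \<open>p\<close> is invisible in \<open>V\<close>, which has exponent
    \<open>p\<close>.\<close>
  then obtain t where "[card K * t = Suc 0] (mod p)" using cong_solve_coprime_nat by blast
  then obtain j where t: "card K * t = 1 + j * p" using cong_to_1'_nat p prime_gt_1_nat[OF p] by auto
  have dK: "\<delta> \<in> K \<rightarrow> carrier V" using d Kc by auto
  define s where "s = finprod V \<delta> K"
  have s: "s \<in> carrier V" unfolding s_def by (rule V.finprod_closed[OF dK])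
  \<comment> \<open>The identity for \<open>\<delta> (m \<otimes> k)\<close> is multiplied over all
    \<open>k \<in> K\<close>. Translation by \<open>m\<close> permutes \<open>K\<close>, so the left
    side is again \<open>s\<close>.\<close>
  have powK: "\<delta> m [^]\<^bsub>V\<^esub> card K = s \<otimes>\<^bsub>V\<^esub> inv\<^bsub>V\<^esub> act m s" if m: "m \<in> K" for m
  proof -
    have inj: "inj_on ((\<otimes>) m) K" by (rule inj_onI) (use m Kc in \<open>simp add: l_cancel\<close>)
    have img: "(\<otimes>) m ` K = K"
      by (rule endo_inj_surj[OF finK _ inj]) (use m subgroup.m_closed[OF Ks] in auto)
    have "s = finprod V \<delta> ((\<otimes>) m ` K)" by (simp add: s_def img)
    also have "\<dots> = finprod V (\<lambda>k. \<delta> (m \<otimes> k)) K"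
      by (rule V.finprod_reindex[OF _ inj]) (use dK img in auto)
    also have "\<dots> = finprod V (\<lambda>k. \<delta> m \<otimes>\<^bsub>V\<^esub> act m (\<delta> k)) K"
      by (rule V.finprod_cong') (use m Kc d in \<open>auto simp: Z1_mult\<close>)
    also have "\<dots> = finprod V (\<lambda>k. \<delta> m) K \<otimes>\<^bsub>V\<^esub> finprod V (\<lambda>k. act m (\<delta> k)) K"
      by (rule V.finprod_multf) (use m Kc d in auto)
    also have "finprod V (\<lambda>k. \<delta> m) K = \<delta> m [^]\<^bsub>V\<^esub> card K" by (rule V.finprod_const) (use m Kc d in simp)
    also have "finprod V (\<lambda>k. act m (\<delta> k)) K = act m s"
      unfolding s_def by (rule act_finprod[OF Kc[OF m] finK dK, symmetric])
    finally show ?thesis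
      using V.inv_solve_right[of "\<delta> m [^]\<^bsub>V\<^esub> card K" s "act m s"] s m Kc d by simp
  qed
  have act_pow: "act g (v [^]\<^bsub>V\<^esub> n) = act g v [^]\<^bsub>V\<^esub> n" if "g \<in> carrier G" "v \<in> carrier V" for g v and n :: nat
    using that by (induction n) (simp_all add: act_mult)
  define v where "v = s [^]\<^bsub>V\<^esub> t"
  have v: "v \<in> carrier V" using s by (simp add: v_def)
  have dv: "\<delta> m = v \<otimes>\<^bsub>V\<^esub> inv\<^bsub>V\<^esub> act m v" if m: "m \<in> K" for m
  proof -
    have dm: "\<delta> m \<in> carrier V" using m Kc d by simp
    have "v \<otimes>\<^bsub>V\<^esub> inv\<^bsub>V\<^esub> act m v = (s \<otimes>\<^bsub>V\<^esub> inv\<^bsub>V\<^esub> act m s) [^]\<^bsub>V\<^esub> t"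
      using s Kc[OF m] by (simp add: v_def act_pow V.nat_pow_distrib V.nat_pow_inv)
    also have "\<dots> = \<delta> m [^]\<^bsub>V\<^esub> (card K * t)" using dm by (simp add: powK[OF m, symmetric] V.nat_pow_pow)
    also have "\<dots> = \<delta> m \<otimes>\<^bsub>V\<^esub> (\<delta> m [^]\<^bsub>V\<^esub> p) [^]\<^bsub>V\<^esub> j"
      unfolding t using dm by (simp add: V.nat_pow_pow mult.commute V.m_comm flip: V.nat_pow_mult)
    also have "\<dots> = \<delta> m" using exp[OF dm] dm by simp
    finally show ?thesis by (rule sym)
  qed
  let ?i = "\<lambda>g\<in>carrier G. v \<otimes>\<^bsub>V\<^esub> inv\<^bsub>V\<^esub> act g v"
  define \<epsilon> where "\<epsilon> = (\<lambda>g\<in>carrier G. \<delta> g \<otimes>\<^bsub>V\<^esub> inv\<^bsub>V\<^esub> ?i g)"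
  have e: "\<epsilon> \<in> Z1" unfolding \<epsilon>_def by (rule Z1_diff[OF d inner_derivation[OF v]])
  have eK: "\<epsilon> k = \<one>\<^bsub>V\<^esub>" if k: "k \<in> K" for k
  proof -
    have "?i k = \<delta> k" using dv[OF k] Kc[OF k] by simp
    then show ?thesis using d Kc[OF k] by (simp add: \<epsilon>_def)
  qed
  have "\<delta> g = v \<otimes>\<^bsub>V\<^esub> inv\<^bsub>V\<^esub> act g v" if g: "g \<in> carrier G" for g
  proof -
    \<comment> \<open>The value at
      \<open>k \<otimes> g = g \<otimes> (inv g \<otimes> k \<otimes> g)\<close> is computed in two
      ways. As \<epsilon> is trivial on the normal subgroup \<open>K\<close>, the result is that
      \<open>k\<close> fixes \<open>\<epsilon> g\<close>.\<close>
    have "\<epsilon> g = \<one>\<^bsub>V\<^esub>"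
    proof (rule fixK)
      fix k assume k: "k \<in> K"
      have c: "inv g \<otimes> k \<otimes> g \<in> K" using Kconj[of "inv g" k] g k by simp
      have "act k (\<epsilon> g) = \<epsilon> (k \<otimes> g)" using e g k Kc[OF k] eK[OF k] by (simp add: Z1_mult)
      also have "k \<otimes> g = g \<otimes> (inv g \<otimes> k \<otimes> g)" using g Kc[OF k] by (simp flip: m_assoc)
      also have "\<epsilon> \<dots> = \<epsilon> g \<otimes>\<^bsub>V\<^esub> act g (\<epsilon> (inv g \<otimes> k \<otimes> g))" by (rule Z1_mult[OF e g Kc[OF c]])
      also have "\<dots> = \<epsilon> g" using eK[OF c] e g by simp
      finally show "act k (\<epsilon> g) = \<epsilon> g" .
    qed (use e g in simp)
    then have "\<delta> g \<otimes>\<^bsub>V\<^esub> inv\<^bsub>V\<^esub> (v \<otimes>\<^bsub>V\<^esub> inv\<^bsub>V\<^esub> act g v) = \<one>\<^bsub>V\<^esub>" using g by (simp add: \<epsilon>_def)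
    then show ?thesis
      using V.inv_solve_right'[of "\<one>\<^bsub>V\<^esub>" "\<delta> g" "v \<otimes>\<^bsub>V\<^esub> inv\<^bsub>V\<^esub> act g v"] g d v by simp
  qed
  then show ?thesis using v by blast
qed

text \<open>Both the action and \<delta> factor through \<open>G Mod actker\<close>, where the
  action is faithful. They are defined there through chosen representatives; a different choice
  differs by an element of \<open>actker\<close>, which affects neither.\<close>

theorem derivation_inner_if_trivial_on_actker:
  fixes p :: nat
  assumes sol: "solvable G" and p: "Factorial_Ring.prime p"
    and exp: "\<And>v. v \<in> carrier V \<Longrightarrow> v [^]\<^bsub>V\<^esub> p = \<one>\<^bsub>V\<^esub>"
    and nt: "actker \<noteq> carrier G" and d: "\<delta> \<in> Z1" "\<And>a. a \<in> actker \<Longrightarrow> \<delta> a = \<one>\<^bsub>V\<^esub>"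
  shows "\<exists>v\<in>carrier V. \<forall>g\<in>carrier G. \<delta> g = v \<otimes>\<^bsub>V\<^esub> inv\<^bsub>V\<^esub> act g v"
proof -
  let ?Q = "G Mod actker"
  let ?\<phi> = "\<lambda>g. actker #> g"
  interpret h: group_hom G ?Q ?\<phi> by (rule r_coset_group_hom[OF actker_normal])
  have Qc: "carrier ?Q = ?\<phi> ` carrier G" by (rule carrier_FactGroup)
  have Qel: "\<exists>g\<in>carrier G. u = ?\<phi> g" if "u \<in> carrier ?Q" for u using that unfolding Qc by blast
  have Qin: "?\<phi> g \<in> carrier ?Q" if "g \<in> carrier G" for g using that unfolding Qc by blast
  define r where "r = (\<lambda>u. SOME g. g \<in> carrier G \<and> ?\<phi> g = u)"
  have r: "r u \<in> carrier G" "?\<phi> (r u) = u" if "u \<in> carrier ?Q" for u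
  proof -
    have "\<exists>g. g \<in> carrier G \<and> ?\<phi> g = u" using Qel[OF that] by auto
    then have "r u \<in> carrier G \<and> ?\<phi> (r u) = u" unfolding r_def by (rule someI_ex)
    then show "r u \<in> carrier G" "?\<phi> (r u) = u" by auto
  qed
  have rep: "\<exists>a\<in>actker. r (?\<phi> g) = a \<otimes> g" if g: "g \<in> carrier G" for g
  proof -
    note c = r[of "?\<phi> g"]
    have "?\<phi> g \<in> carrier ?Q" by (rule Qin[OF g])
    then have "r (?\<phi> g) \<otimes> inv g \<in> actker" "r (?\<phi> g) \<in> carrier G"
      using c r_coset_eq_iff[OF actker_subgroup _ g] by auto
    moreover have "r (?\<phi> g) = (r (?\<phi> g) \<otimes> inv g) \<otimes> g" using calculation(2) g by (simp add: m_assoc)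
    ultimately show ?thesis by blast
  qed
  define act' where "act' = (\<lambda>u. act (r u))"
  define \<delta>' where "\<delta>' = (\<lambda>u\<in>carrier ?Q. \<delta> (r u))"
  have act': "act' (?\<phi> g) v = act g v" if g: "g \<in> carrier G" and v: "v \<in> carrier V" for g v
  proof -
    obtain a where "a \<in> actker" "r (?\<phi> g) = a \<otimes> g" using rep[OF g] by blast
    then show ?thesis using g v by (simp add: act'_def act_comp actker_act actker_carrier)
  qed
  have \<delta>': "\<delta>' (?\<phi> g) = \<delta> g" if g: "g \<in> carrier G" for g
  proof -
    obtain a where a: "a \<in> actker" "r (?\<phi> g) = a \<otimes> g" using rep[OF g] by blast
    have "?\<phi> g \<in> carrier ?Q" by (rule Qin[OF g])
    then show ?thesis using a g d Z1_actker_mult[OF d(1) a(1) g] by (simp add: \<delta>'_def)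
  qed
  have mQ: "?\<phi> g \<otimes>\<^bsub>?Q\<^esub> ?\<phi> h = ?\<phi> (g \<otimes> h)" if "g \<in> carrier G" "h \<in> carrier G" for g h
    using h.hom_mult that by simp
  interpret Q: irr_gmod ?Q V act'
  proof (intro irr_gmod.intro gmod.intro gmod_axioms.intro irr_gmod_axioms.intro)
    show "group ?Q" "comm_group V" by unfold_locales
    show "finite (carrier ?Q)" unfolding Qc using finG by simp
    show "act' u v \<in> carrier V" if "u \<in> carrier ?Q" "v \<in> carrier V" for u v
      using that r by (simp add: act'_def)
    show "act' u (v \<otimes>\<^bsub>V\<^esub> w) = act' u v \<otimes>\<^bsub>V\<^esub> act' u w"
      if "u \<in> carrier ?Q" "v \<in> carrier V" "w \<in> carrier V" for u v w
      using that r by (simp add: act'_def act_mult)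
    show "act' \<one>\<^bsub>?Q\<^esub> v = v" if "v \<in> carrier V" for v
      using act'[of \<one> v] that h.hom_one by simp
    show "act' (u \<otimes>\<^bsub>?Q\<^esub> w) v = act' u (act' w v)"
      if uw: "u \<in> carrier ?Q" "w \<in> carrier ?Q" and v: "v \<in> carrier V" for u w v
    proof -
      obtain g where g: "g \<in> carrier G" "u = ?\<phi> g" using Qel[OF uw(1)] by blast
      obtain h where h: "h \<in> carrier G" "w = ?\<phi> h" using Qel[OF uw(2)] by blast
      have "act' (?\<phi> (g \<otimes> h)) v = act' (?\<phi> g) (act' (?\<phi> h) v)"
        using g(1) h(1) v by (simp add: act' act_comp del: h.hom_mult)
      then show ?thesis unfolding g(2) h(2) mQ[OF g(1) h(1)] .
    qed
    show "W = {\<one>\<^bsub>V\<^esub>} \<or> W = carrier V"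
      if W: "subgroup W V" and inv: "\<And>u w. \<lbrakk>u \<in> carrier ?Q; w \<in> W\<rbrakk> \<Longrightarrow> act' u w \<in> W" for W
    proof (rule irreducible[OF W])
      fix g w assume g: "g \<in> carrier G" and w: "w \<in> W"
      have "?\<phi> g \<in> carrier ?Q" by (rule Qin[OF g])
      then show "act g w \<in> W" using inv[of "?\<phi> g" w] act'[OF g subgroup.mem_carrier[OF W w]] w by simp
    qed
  qed (fact finV V_nontriv)+
  have "solvable ?Q"
    using h.solvable_imp_solvable_img[of "carrier G"] sol unfolding solvable_def Qc by simp
  moreover have "Q.actker = {\<one>\<^bsub>?Q\<^esub>}"
  proof
    show "Q.actker \<subseteq> {\<one>\<^bsub>?Q\<^esub>}"
    proof
      fix u assume uQ: "u \<in> Q.actker"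
      then obtain g where g: "g \<in> carrier G" "u = ?\<phi> g" using Qel[OF Q.actker_carrier[OF uQ]] by blast
      then have "g \<in> actker" using uQ act'[OF g(1)] Q.actker_act[OF uQ] by (simp add: actker_def)
      then show "u \<in> {\<one>\<^bsub>?Q\<^esub>}" using coset_join2[OF g(1) actker_subgroup] g by simp
    qed
  qed (use Q.actker_closed(3) in simp)
  moreover have "carrier ?Q \<noteq> {\<one>\<^bsub>?Q\<^esub>}"
  proof
    assume Q1: "carrier ?Q = {\<one>\<^bsub>?Q\<^esub>}"
    have "g \<in> actker" if g: "g \<in> carrier G" for g
    proof -
      have "?\<phi> g = actker" using g Qc Q1 by auto
      then show ?thesis using rcos_self[OF g actker_subgroup] by simp
    qed
    then show False using nt actker_carrier by blast
  qed
  moreover have "\<delta>' \<in> Q.Z1"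
    unfolding \<delta>'_def
  proof (rule Q.Z1I)
    fix u w assume uw: "u \<in> carrier ?Q" "w \<in> carrier ?Q"
    obtain g where g: "g \<in> carrier G" "u = ?\<phi> g" using Qel[OF uw(1)] by blast
    obtain h where h: "h \<in> carrier G" "w = ?\<phi> h" using Qel[OF uw(2)] by blast
    have 1: "\<delta> (r (?\<phi> g)) = \<delta> g" if "g \<in> carrier G" for g
      using \<delta>'[OF that] that Qc by (auto simp: \<delta>'_def)
    show "\<delta> (r (u \<otimes>\<^bsub>?Q\<^esub> w)) = \<delta> (r u) \<otimes>\<^bsub>V\<^esub> act' u (\<delta> (r w))"
      unfolding g(2) h(2) mQ[OF g(1) h(1)] using g(1) h(1) d
      by (simp add: 1 act' Z1_mult del: h.hom_mult)
  qed (use r d in simp)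
  ultimately obtain v where v: "v \<in> carrier V" "\<forall>u\<in>carrier ?Q. \<delta>' u = v \<otimes>\<^bsub>V\<^esub> inv\<^bsub>V\<^esub> act' u v"
    using Q.derivation_inner_if_faithful[OF _ p exp] by blast
  have "\<delta> g = v \<otimes>\<^bsub>V\<^esub> inv\<^bsub>V\<^esub> act g v" if g: "g \<in> carrier G" for g
  proof -
    have "?\<phi> g \<in> carrier ?Q" by (rule Qin[OF g])
    then show ?thesis using v \<delta>'[OF g] act'[OF g v(1)] by simp
  qed
  then show ?thesis using v(1) by blast
qed

end

section \<open>Finite p-groups\<close>

context group begin

lemma mult_inv_cancel_left: "\<lbrakk>x \<in> carrier G; y \<in> carrier G\<rbrakk> \<Longrightarrow> x \<otimes> (inv x \<otimes> y) = y"
  by (simp flip: m_assoc)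

lemma inv_mult_cancel_left: "\<lbrakk>x \<in> carrier G; y \<in> carrier G\<rbrakk> \<Longrightarrow> inv x \<otimes> (x \<otimes> y) = y"
  by (simp flip: m_assoc)

lemma frattini_subgroup: "subgroup (frattini G) G"
  unfolding frattini_def maximal_subgroup_def
  by (rule subgroupI) (auto dest: subgroup.m_closed subgroup.m_inv_closed subgroup.one_closed)

text \<open>An inner automorphism carries maximal subgroups to maximal subgroups, by the image lemma
  for homomorphisms with trivial kernel.\<close>

lemma frattini_normal: "frattini G \<lhd> G"
proof (rule normal_invI[OF frattini_subgroup])
  fix x h assume x: "x \<in> carrier G" and h: "h \<in> frattini G"
  then have hc: "h \<in> carrier G" by (simp add: frattini_def)
  let ?c = "\<lambda>g. inv x \<otimes> g \<otimes> x"
  interpret c: group_hom G G ?c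
    by (unfold_locales, rule homI) (use x in \<open>auto simp: m_assoc mult_inv_cancel_left\<close>)
  have surj: "?c ` carrier G = carrier G"
  proof
    show "carrier G \<subseteq> ?c ` carrier G"
    proof
      fix g assume g: "g \<in> carrier G"
      then have "g = ?c (x \<otimes> g \<otimes> inv x)" using x by (simp add: m_assoc mult_inv_cancel_left inv_mult_cancel_left)
      then show "g \<in> ?c ` carrier G" using x g by blast
    qed
  qed (use x in auto)
  have "x \<otimes> h \<otimes> inv x \<in> M" if M: "maximal_subgroup M G" for M
  proof -
    have Ms: "subgroup M G" using M by (simp add: maximal_subgroup_def)
    have ker: "kernel G G ?c \<subseteq> M"
    proof
      fix g assume "g \<in> kernel G G ?c"
      then have g: "g \<in> carrier G" "inv x \<otimes> g \<otimes> x = \<one>" by (auto simp: kernel_def)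
      have "g = x \<otimes> (inv x \<otimes> g \<otimes> x) \<otimes> inv x" using g(1) x by (simp add: m_assoc mult_inv_cancel_left inv_mult_cancel_left)
      then have "g = \<one>" using g x by simp
      then show "g \<in> M" using subgroup.one_closed[OF Ms] by simp
    qed
    note img = c.maximal_subgroup_image[OF surj ker M]
    have "h \<in> ?c ` M" using img(1) h by (auto simp: frattini_def)
    moreover have "h = ?c (x \<otimes> h \<otimes> inv x)" using x hc by (simp add: m_assoc mult_inv_cancel_left inv_mult_cancel_left)
    ultimately show ?thesis using img(2)[of "x \<otimes> h \<otimes> inv x"] x hc by simp
  qed
  then show "x \<otimes> h \<otimes> inv x \<in> frattini G" using x hc by (simp add: frattini_def)
qed

lemma finite_closed_imp_subgroup:
  assumes fin: "finite (carrier G)" and H: "H \<subseteq> carrier G" "\<one> \<in> H"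
    and cl: "\<And>a b. \<lbrakk>a \<in> H; b \<in> H\<rbrakk> \<Longrightarrow> a \<otimes> b \<in> H"
  shows "subgroup H G"
proof (rule subgroupI)
  fix a assume a: "a \<in> H"
  then have ac: "a \<in> carrier G" using H by blast
  have pow: "a [^] n \<in> H" for n :: nat by (induction n) (use a H cl in auto)
  have "order G > 0" using fin order_gt_0_iff_finite by blast
  then have "a [^] (order G - 1) \<otimes> a = a [^] order G"
    using ac by (metis Suc_diff_1 nat_pow_Suc)
  then have "a [^] (order G - 1) \<otimes> a = \<one>" using pow_order_eq_1[OF ac] by simp
  then have "inv a = a [^] (order G - 1)" using ac by (intro inv_equality) auto
  then show "inv a \<in> H" using pow by simp
qed (use H cl in auto)

text \<open>Normalisers grow in p-groups. \<open>M\<close> acts on its cosets, whose number is a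
  proper power of \<open>p\<close>; so the number of fixed cosets is divisible by \<open>p\<close>,
  and besides \<open>M\<close> there is a fixed coset \<open>M #> a\<close>. Then \<open>a\<close>
  normalises \<open>M\<close>, and by maximality the normaliser is the whole group.\<close>

lemma p_group_maximal_subgroup_normal:
  assumes p: "Factorial_Ring.prime (p::nat)" and ord: "order G = p ^ n" and M: "maximal_subgroup M G"
  shows "M \<lhd> G"
proof -
  have fin: "finite (carrier G)" using ord p by (simp add: prime_gt_0_nat flip: order_gt_0_iff_finite)
  have Ms: "subgroup M G" "M \<noteq> carrier G" using M by (auto simp: maximal_subgroup_def)
  have Mc: "M \<subseteq> carrier G" by (rule subgroup.subset[OF Ms(1)])
  have finM: "finite M" using finite_subset[OF Mc fin] .
  let ?E = "rcosets M"
  let ?M = "G\<lparr>carrier := M\<rparr>"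
  have Ec: "?E = (\<lambda>a. M #> a) ` carrier G" by (auto simp: RCOSETS_def)
  have lag: "card ?E * card M = p ^ n" using lagrange[OF Ms(1)] ord by simp
  obtain j where j: "card M = p ^ j" using lag divides_primepow_nat[OF p, of "card M" n] by (metis dvd_triv_right)
  obtain i where i: "card ?E = p ^ i" using lag divides_primepow_nat[OF p, of "card ?E" n] by (metis dvd_triv_left)
  have "i \<noteq> 0"
  proof
    assume "i = 0"
    then have "card M = order G" using lag i ord by simp
    then show False using Ms(2) card_subset_eq[OF fin Mc] by (simp add: Coset.order_def)
  qed
  then have pE: "int p dvd int (card ?E)" using i by (cases i) auto
  have finE: "finite ?E" unfolding Ec using fin by simp
  interpret MG: group ?M by (rule subgroup_imp_group[OF Ms(1)])
  \<comment> \<open>The inverse turns right multiplication of cosets into a left action.\<close>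
  let ?\<phi> = "\<lambda>m. \<lambda>u\<in>?E. u #> inv m"
  have act: "(M #> a) #> inv m = M #> (a \<otimes> inv m)" if "a \<in> carrier G" "m \<in> M" for a m
    by (rule coset_mult_assoc[OF Mc]) (use that Mc in auto)
  have actE: "u #> inv m \<in> ?E" if "u \<in> ?E" "m \<in> M" for u m
    using that act Mc by (auto simp: Ec)
  have comp: "(u #> inv m) #> inv l = u #> inv (l \<otimes> m)" if uml: "u \<in> ?E" "m \<in> M" "l \<in> M" for u m l
  proof -
    have ml: "m \<in> carrier G" "l \<in> carrier G" using uml Mc by auto
    obtain a where a: "a \<in> carrier G" "u = M #> a" using uml(1) by (auto simp: Ec)
    show ?thesis using a ml coset_mult_assoc[OF Mc] by (simp add: m_assoc inv_mult_group)
  qed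
  have one: "u #> \<one> = u" if "u \<in> ?E" for u
    using that coset_mult_assoc[OF Mc, of _ \<one>] by (auto simp: Ec)
  have Mcl: "inv m \<in> M" if "m \<in> M" for m using subgroup.m_inv_closed[OF Ms(1) that] .
  have bij: "?\<phi> m \<in> Bij ?E" if m: "m \<in> M" for m
  proof -
    have "bij_betw (\<lambda>u. u #> inv m) ?E ?E"
    proof (rule bij_betw_byWitness[where f' = "\<lambda>u. u #> inv (inv m)"])
      have mc: "m \<in> carrier G" using m Mc by blast
      show "\<forall>a\<in>?E. a #> inv m #> inv (inv m) = a"
        using comp[OF _ m Mcl[OF m]] one mc by simp
      show "\<forall>a\<in>?E. a #> inv (inv m) #> inv m = a"
        using comp[OF _ Mcl[OF m] m] one mc by simp
    qed (use actE m Mcl in blast)+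
    then show ?thesis by (simp add: Bij_def bij_betw_cong[of ?E "?\<phi> m" "\<lambda>u. u #> inv m"])
  qed
  interpret A: group_action ?M ?E ?\<phi>
  proof (unfold group_action_def, rule group_hom.intro[OF MG.is_group group_BijGroup], unfold group_hom_axioms_def, rule homI)
    fix m l assume ml: "m \<in> carrier ?M" "l \<in> carrier ?M"
    then show "?\<phi> (m \<otimes>\<^bsub>?M\<^esub> l) = ?\<phi> m \<otimes>\<^bsub>BijGroup ?E\<^esub> ?\<phi> l"
      using bij[of m] bij[of l] actE comp by (auto simp: BijGroup_def compose_def fun_eq_iff)
  qed (use bij in \<open>simp add: BijGroup_def\<close>)
  let ?F = "{u \<in> ?E. \<forall>m\<in>carrier ?M. ?\<phi> m u = u}"
  have "int p dvd int (card ?E) - int (card ?F)"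
    by (rule A.p_group_card_fixed[OF _ finE p]) (use finM j in \<open>auto simp: Coset.order_def\<close>)
  then have "int p dvd int (card ?E) - (int (card ?E) - int (card ?F))" using pE by (rule dvd_diff[rotated])
  then have pF: "p dvd card ?F" by simp
  have MF: "M \<in> ?F"
  proof -
    have "M = M #> \<one>" using coset_mult_one[OF Mc] by simp
    then have "M \<in> ?E" unfolding Ec by blast
    moreover have "M #> inv m = M" if "m \<in> M" for m
      using coset_join2[OF _ Ms(1) Mcl[OF that]] that Mc by blast
    ultimately show ?thesis by simp
  qed
  have "?F \<noteq> {M}"
  proof
    assume "?F = {M}"
    then show False using pF p prime_gt_1_nat[OF p] by simp
  qed
  then obtain u where u: "u \<in> ?F" "u \<noteq> M" using MF by blast
  then obtain a where a: "a \<in> carrier G" "u = M #> a" by (auto simp: Ec)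
  have aM: "a \<notin> M" using u(2) a coset_join2[OF a(1) Ms(1)] by blast
  \<comment> \<open>The normaliser, written with one inclusion only: it is closed under products,
    and in a finite group that makes it a subgroup.\<close>
  let ?N = "{g \<in> carrier G. \<forall>m\<in>M. g \<otimes> m \<otimes> inv g \<in> M}"
  have "subgroup ?N G"
  proof (rule finite_closed_imp_subgroup[OF fin])
    fix g h assume gh: "g \<in> ?N" "h \<in> ?N"
    have "g \<otimes> h \<otimes> m \<otimes> inv (g \<otimes> h) \<in> M" if m: "m \<in> M" for m
    proof -
      have "g \<otimes> h \<otimes> m \<otimes> inv (g \<otimes> h) = g \<otimes> (h \<otimes> m \<otimes> inv h) \<otimes> inv g"
        using gh m Mc by (auto simp: m_assoc inv_mult_group subset_iff)
      then show ?thesis using gh m by simp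
    qed
    then show "g \<otimes> h \<in> ?N" using gh by simp
  qed (use Mc in auto)
  moreover have "M \<subseteq> ?N" using Mc Mcl subgroup.m_closed[OF Ms(1)] by auto
  moreover have "a \<in> ?N"
  proof -
    have "a \<otimes> m \<otimes> inv a \<in> M" if m: "m \<in> M" for m
    proof -
      have "M #> (a \<otimes> m) = M #> a"
      proof -
        have "\<forall>m\<in>M. u #> inv m = u" using u(1) by auto
        then have "u #> inv (inv m) = u" using Mcl[OF m] by blast
        then show ?thesis using act[OF a(1) Mcl[OF m]] a(2) m Mc by auto
      qed
      then show ?thesis using r_coset_eq_iff[OF Ms(1), of "a \<otimes> m" a] a m Mc by auto
    qed
    then show ?thesis using a(1) by simp
  qed
  ultimately have "?N = carrier G" using M aM unfolding maximal_subgroup_def by blast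
  then have "g \<otimes> m \<otimes> inv g \<in> M" if "g \<in> carrier G" "m \<in> M" for g m using that by blast
  then show ?thesis by (rule normal_invI[OF Ms(1)])
qed

text \<open>Four consequences of one fact, that \<open>G Mod M\<close> is cyclic of order
  \<open>p\<close>: nothing lies between \<open>M\<close> and \<open>G\<close>, so each element
  outside \<open>M\<close> generates \<open>G\<close> modulo \<open>M\<close>.\<close>

lemma p_group_maximal_subgroup_quotient:
  assumes p: "Factorial_Ring.prime (p::nat)" and ord: "order G = p ^ n" and M: "maximal_subgroup M G"
  shows "\<And>g y. \<lbrakk>g \<in> carrier G; g \<notin> M; y \<in> carrier G\<rbrakk> \<Longrightarrow> \<exists>m\<in>M. \<exists>j::nat. y = m \<otimes> g [^] j"
    and "\<And>g. g \<in> carrier G \<Longrightarrow> g [^] p \<in> M"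
    and "\<And>a b. \<lbrakk>a \<in> carrier G; b \<in> carrier G\<rbrakk> \<Longrightarrow> a \<otimes> b \<otimes> inv a \<otimes> inv b \<in> M"
    and "\<And>g j. \<lbrakk>g \<in> carrier G; g \<notin> M; g [^] (j::nat) \<in> M\<rbrakk> \<Longrightarrow> p dvd j"
proof -
  have fin: "finite (carrier G)" using ord p by (simp add: prime_gt_0_nat flip: order_gt_0_iff_finite)
  have Mn: "M \<lhd> G" by (rule p_group_maximal_subgroup_normal[OF assms])
  have Ms: "subgroup M G" "M \<noteq> carrier G" using M by (auto simp: maximal_subgroup_def)
  have Mc: "m \<in> carrier G" if "m \<in> M" for m by (rule subgroup.mem_carrier[OF Ms(1) that])
  show ex: "\<exists>m\<in>M. \<exists>j::nat. y = m \<otimes> g [^] j" if g: "g \<in> carrier G" "g \<notin> M" "y \<in> carrier G" for g y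
  proof -
    have gs: "subgroup (generate G {g}) G" by (rule generate_is_subgroup) (use g in simp)
    let ?T = "{y. \<exists>m\<in>M. \<exists>l\<in>generate G {g}. y = m \<otimes> l}"
    have T: "subgroup ?T G" by (rule normal_supplement_subgroup[OF Mn gs])
    have mT: "m \<in> ?T" if "m \<in> M" for m
      using that Mc generate.one[of G "{g}"] by (intro CollectI bexI[of _ m] bexI[of _ \<one>]) auto
    have gT: "g \<in> ?T"
      using g subgroup.one_closed[OF Ms(1)] generate.incl[of g "{g}" G]
      by (intro CollectI bexI[of _ \<one>] bexI[of _ g]) auto
    have "M \<subseteq> ?T" using mT by (rule subsetI)
    then have "?T = M \<or> ?T = carrier G" using T M unfolding maximal_subgroup_def by simp
    moreover have "?T \<noteq> M" using gT g(2) by (rule_tac notI) (simp only:)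
    ultimately have "?T = carrier G" by (simp only: simp_thms)
    then have "y \<in> ?T" using g(3) by (simp only:)
    then obtain m l where ml: "m \<in> M" "l \<in> generate G {g}" "y = m \<otimes> l" by blast
    then obtain j :: nat where "l = g [^] j" using generate_pow_on_finite_carrier[OF fin g(1)] by blast
    then show ?thesis using ml by blast
  qed
  let ?Q = "G Mod M" and ?\<phi> = "\<lambda>g. M #> g"
  interpret h: group_hom G ?Q ?\<phi> by (rule r_coset_group_hom[OF Mn])
  have one: "?\<phi> g = \<one>\<^bsub>?Q\<^esub> \<longleftrightarrow> g \<in> M" if "g \<in> carrier G" for g
    using r_coset_eq_iff[OF Ms(1) that, of \<one>] coset_mult_one[of M] subgroup.subset[OF Ms(1)] that by simp
  have Mone: "?\<phi> m = \<one>\<^bsub>?Q\<^esub>" if "m \<in> M" for m using one[OF Mc[OF that]] that by simp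
  have pw: "?\<phi> (g [^] j) = ?\<phi> g [^]\<^bsub>?Q\<^esub> j" if "g \<in> carrier G" for g and j :: nat
    using h.hom_nat_pow[OF that] .
  have ex\<phi>: "\<exists>j::nat. ?\<phi> y = ?\<phi> g [^]\<^bsub>?Q\<^esub> j" if g: "g \<in> carrier G" "g \<notin> M" "y \<in> carrier G" for g y
  proof -
    obtain m j where mj: "m \<in> M" "y = m \<otimes> g [^] (j::nat)" using ex[OF g] by blast
    then have "?\<phi> y = ?\<phi> m \<otimes>\<^bsub>?Q\<^esub> ?\<phi> (g [^] j)" using h.hom_mult[of m "g [^] j"] Mc g by simp
    also have "\<dots> = ?\<phi> (g [^] j)"
      unfolding Mone[OF mj(1)] by (rule h.H.l_one[OF h.hom_closed]) (use g in simp)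
    finally show ?thesis using pw g by auto
  qed
  show powp: "g [^] p \<in> M" if g: "g \<in> carrier G" for g
  proof (rule ccontr)
    assume np: "g [^] p \<notin> M"
    let ?x = "?\<phi> g"
    have xc: "?x \<in> carrier ?Q" using g by simp
    \<comment> \<open>Modulo \<open>M\<close>, if \<open>g [^] p\<close> lay outside
      \<open>M\<close>, then \<open>g\<close> would be a power of it. Iterating \<open>n\<close>
      times writes \<open>g\<close> as a power with exponent divisible by \<open>p ^ n\<close>, the
      order of the group, so that \<open>g\<close> would lie in \<open>M\<close>.\<close>
    obtain j :: nat where "?x = ?\<phi> (g [^] p) [^]\<^bsub>?Q\<^esub> j" using ex\<phi>[of "g [^] p" g] np g by auto
    then have xj: "?x = ?x [^]\<^bsub>?Q\<^esub> (p * j)" using pw g h.H.nat_pow_pow[OF xc] by simp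
    have "?x = ?x [^]\<^bsub>?Q\<^esub> ((p * j) ^ i)" for i :: nat
    proof (induction i)
      case 0
      show ?case by (simp only: power_0 h.H.nat_pow_eone[OF xc])
    next
      case (Suc i)
      have "?x = (?x [^]\<^bsub>?Q\<^esub> (p * j)) [^]\<^bsub>?Q\<^esub> ((p * j) ^ i)" using Suc xj by simp
      then show ?case using h.H.nat_pow_pow[OF xc] by simp
    qed
    from this[of n] have "?x = ?x [^]\<^bsub>?Q\<^esub> (p ^ n * j ^ n)" by (simp add: power_mult_distrib)
    also have "\<dots> = (?x [^]\<^bsub>?Q\<^esub> (p ^ n)) [^]\<^bsub>?Q\<^esub> (j ^ n)" using h.H.nat_pow_pow[OF xc] by simp
    also have "?x [^]\<^bsub>?Q\<^esub> (p ^ n) = ?\<phi> (g [^] order G)" using pw[OF g] ord by simp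
    also have "\<dots> = \<one>\<^bsub>?Q\<^esub>" using pow_order_eq_1[OF g] h.hom_one by simp
    also have "\<dots> [^]\<^bsub>?Q\<^esub> (j ^ n) = \<one>\<^bsub>?Q\<^esub>" by (rule h.H.nat_pow_one)
    finally have "g \<in> M" using one g by blast
    then have "g [^] p \<in> M" using subgroup_int_pow_closed[OF Ms(1), of g "int p"] g by (simp add: int_pow_int)
    then show False using np by simp
  qed
  show "a \<otimes> b \<otimes> inv a \<otimes> inv b \<in> M" if ab: "a \<in> carrier G" "b \<in> carrier G" for a b
  proof (cases "a \<in> M")
    case True
    have "b \<otimes> inv a \<otimes> inv b \<in> M"
      using Mn ab True subgroup.m_inv_closed[OF Ms(1)] normal_inv_iff by blast
    then show ?thesis using True subgroup.m_closed[OF Ms(1), of a] ab by (simp add: m_assoc)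
  next
    case False
    obtain j :: nat where j: "?\<phi> b = ?\<phi> a [^]\<^bsub>?Q\<^esub> j" using ex\<phi>[OF ab(1) False ab(2)] by blast
    have "?\<phi> (a \<otimes> b) = ?\<phi> a \<otimes>\<^bsub>?Q\<^esub> ?\<phi> a [^]\<^bsub>?Q\<^esub> j" using ab j h.hom_mult[OF ab] by simp
    also have "\<dots> = ?\<phi> a [^]\<^bsub>?Q\<^esub> j \<otimes>\<^bsub>?Q\<^esub> ?\<phi> a"
      by (rule h.H.nat_pow_Suc2[of "?\<phi> a", symmetric, simplified h.H.nat_pow_Suc, THEN sym, THEN sym]) (use ab in simp)
    also have "\<dots> = ?\<phi> (b \<otimes> a)" using ab j h.hom_mult[of b a] by simp
    finally have "(a \<otimes> b) \<otimes> inv (b \<otimes> a) \<in> M"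
      using r_coset_eq_iff[OF Ms(1), of "a \<otimes> b" "b \<otimes> a"] ab by simp
    then show ?thesis using ab by (simp add: inv_mult_group m_assoc)
  qed
  show "p dvd j" if g: "g \<in> carrier G" "g \<notin> M" "g [^] j \<in> M" for g and j :: nat
  proof (rule ccontr)
    assume "\<not> p dvd j"
    then have cop: "coprime p j" using p by (simp add: prime_imp_coprime)
    have xc: "?\<phi> g \<in> carrier ?Q" using g by simp
    have "h.H.ord (?\<phi> g) dvd j" using h.H.pow_eq_id[OF xc] Mone[OF g(3)] pw[OF g(1)] by simp
    moreover have "h.H.ord (?\<phi> g) dvd p" using h.H.pow_eq_id[OF xc] Mone[OF powp[OF g(1)]] pw[OF g(1)] by simp
    ultimately have "h.H.ord (?\<phi> g) = 1" using cop coprime_common_divisor_nat by blast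
    then have "?\<phi> g = \<one>\<^bsub>?Q\<^esub>" using h.H.ord_eq_1[OF xc] by blast
    then show False using one g by blast
  qed
qed

text \<open>Exchange of generators as in Burnside's basis theorem. Some generator \<open>y\<close>
  lies outside \<open>M\<close>, and since \<open>G Mod M\<close> is cyclic, the others can be moved
  into \<open>M\<close> by powers of \<open>y\<close>. They then generate \<open>M\<close> modulo
  the Frattini subgroup, and any \<open>x\<close> outside \<open>M\<close> may take the place of
  \<open>y\<close>.\<close>

theorem p_group_gen_over_maximal:
  assumes p: "Factorial_Ring.prime (p::nat)" and ord: "order G = p ^ n"
  shows "gen_over_maximal G (min_gens G - 1)"
  unfolding gen_over_maximal_def
proof (intro allI impI, elim conjE)
  fix M x assume M: "maximal_subgroup M G" and x: "x \<in> carrier G" "x \<notin> M"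
  have fin: "finite (carrier G)" using ord p by (simp add: prime_gt_0_nat flip: order_gt_0_iff_finite)
  have Ms: "subgroup M G" "M \<noteq> carrier G" using M by (auto simp: maximal_subgroup_def)
  have Mc: "m \<in> carrier G" if "m \<in> M" for m by (rule subgroup.mem_carrier[OF Ms(1) that])
  note quot = p_group_maximal_subgroup_quotient[OF p ord]
  obtain ys where ys: "set ys \<subseteq> carrier G" "length ys = min_gens G" "generate G (set ys) = carrier G"
    using min_gens_le_iff[OF fin, of "min_gens G"] by blast
  obtain y where y: "y \<in> set ys" "y \<notin> M"
    using generate_subset_subgroup_ne[OF M, of "set ys"] ys(3) by blast
  then have yc: "y \<in> carrier G" using ys(1) by blast
  have "\<forall>w\<in>set ys. \<exists>m. m \<in> M \<and> (\<exists>j::nat. w = m \<otimes> y [^] j)"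
    using quot(1)[OF M yc y(2)] ys(1) by blast
  then obtain f where f: "\<forall>w\<in>set ys. f w \<in> M \<and> (\<exists>j::nat. w = f w \<otimes> y [^] j)" by metis
  let ?zs = "map f (remove1 y ys)"
  have zM: "set ?zs \<subseteq> M" using f set_remove1_subset[of y ys] by auto
  have len: "length ?zs = min_gens G - 1" using y(1) ys(2) by (simp add: length_remove1)
  have FM: "frattini G \<subseteq> N" if "maximal_subgroup N G" for N using that by (auto simp: frattini_def)
  let ?S = "set ?zs \<union> frattini G"
  let ?L = "generate G ?S"
  have Sc: "?S \<subseteq> carrier G" using zM Mc by (auto simp: frattini_def)
  have L: "subgroup ?L G" by (rule generate_is_subgroup[OF Sc])
  have LM: "?L \<subseteq> M" by (rule generate_subgroup_incl[OF _ Ms(1)]) (use zM FM[OF M] in blast)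
  have FL: "frattini G \<subseteq> ?L" using generate_sincl[of ?S] by blast
  \<comment> \<open>Commutators lie in every maximal subgroup, so every subgroup above the Frattini
    subgroup is normal.\<close>
  have Ln: "?L \<lhd> G"
  proof (rule normal_invI[OF L])
    fix g l assume g: "g \<in> carrier G" and l: "l \<in> ?L"
    have lc: "l \<in> carrier G" by (rule subgroup.mem_carrier[OF L l])
    have "g \<otimes> l \<otimes> inv g \<otimes> inv l \<in> frattini G"
      using quot(3)[OF _ g lc] g lc by (auto simp: frattini_def)
    then have "g \<otimes> l \<otimes> inv g \<otimes> inv l \<otimes> l \<in> ?L" using FL l subgroup.m_closed[OF L] by blast
    then show "g \<otimes> l \<otimes> inv g \<in> ?L" using g lc by (simp add: m_assoc)
  qed
  have ygen: "subgroup (generate G {y}) G" by (rule generate_is_subgroup) (use yc in simp)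
  have sup: "\<exists>l\<in>?L. \<exists>w\<in>generate G {y}. g = l \<otimes> w" if g: "g \<in> carrier G" for g
  proof (rule normal_supplementI[OF Ln ygen ys(3) _ g])
    fix s assume s: "s \<in> set ys"
    show "\<exists>l\<in>?L. \<exists>w\<in>generate G {y}. s = l \<otimes> w"
    proof (cases "s = y")
      case True
      then show ?thesis using subgroup.one_closed[OF L] yc generate.incl[of y "{y}" G]
        by (intro bexI[of _ \<one>] bexI[of _ y]) auto
    next
      case False
      then have "s \<in> set (remove1 y ys)" using s by (simp add: in_set_remove1)
      then have "f s \<in> ?L" using generate_sincl[of ?S] by auto
      moreover obtain j :: nat where "s = f s \<otimes> y [^] j" using f s by blast
      moreover have "y [^] j \<in> generate G {y}"
        using generate_pow_on_finite_carrier[OF fin yc] by blast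
      ultimately show ?thesis by blast
    qed
  qed
  \<comment> \<open>An element of \<open>M\<close> is a product of some \<open>l \<in> ?L\<close>
    and a power of \<open>y\<close> that lies in \<open>M\<close>. Its exponent is then divisible by
    \<open>p\<close>, and \<open>y [^] p\<close> belongs to the Frattini subgroup.\<close>
  have M_le: "M \<subseteq> ?L"
  proof
    fix m assume m: "m \<in> M"
    then obtain l w where lw: "l \<in> ?L" "w \<in> generate G {y}" "m = l \<otimes> w" using sup Mc by blast
    obtain j :: nat where j: "w = y [^] j" using lw(2) generate_pow_on_finite_carrier[OF fin yc] by blast
    have lM: "l \<in> M" using lw(1) LM by blast
    have "w = inv l \<otimes> m" using lw(3) Mc[OF lM] j yc by (simp flip: m_assoc)
    then have "y [^] j \<in> M" using j m lM subgroup.m_closed[OF Ms(1)] subgroup.m_inv_closed[OF Ms(1)] by simp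
    then have "p dvd j" using quot(4)[OF M yc y(2)] by blast
    then obtain i where "j = p * i" by auto
    then have wi: "w = (y [^] p) [^] i" using j yc by (simp add: nat_pow_pow)
    have "y [^] p \<in> frattini G" using quot(2)[OF _ yc] yc by (auto simp: frattini_def)
    then have "y [^] p \<in> ?L" using FL by blast
    then have "w \<in> ?L" unfolding wi using subgroup_int_pow_closed[OF L, of "y [^] p" "int i"] by (simp add: int_pow_int)
    then show "m \<in> ?L" using lw subgroup.m_closed[OF L] by blast
  qed
  have "generate G (insert x (set ?zs)) = carrier G"
  proof (rule ccontr)
    assume "generate G (insert x (set ?zs)) \<noteq> carrier G"
    then obtain N where N: "maximal_subgroup N G" "insert x (set ?zs) \<subseteq> N"
      using generate_ne_carrierD[OF fin, of "insert x (set ?zs)"] x zM Mc by blast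
    have Ns: "subgroup N G" "N \<noteq> carrier G" using N(1) by (auto simp: maximal_subgroup_def)
    have "?L \<subseteq> N" by (rule generate_subgroup_incl[OF _ Ns(1)]) (use N(2) FM[OF N(1)] in blast)
    then have "M \<subseteq> N" using M_le by blast
    then have "N = M" using M Ns unfolding maximal_subgroup_def by blast
    then show False using N(2) x(2) by blast
  qed
  then show "\<exists>zs. set zs \<subseteq> M \<and> length zs = min_gens G - 1 \<and> generate G (insert x (set zs)) = carrier G"
    using zM len by blast
qed

text \<open>A proper Sylow p-subgroup would lie in a maximal subgroup \<open>M\<close>, whose index
  is then prime to \<open>p\<close>. But \<open>M\<close> contains the Frattini subgroup, so its
  index divides the order of the quotient, a power of \<open>p\<close>, and is not 1.\<close>

lemma p_group_if_frattini_quotient: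
  assumes fin: "finite (carrier G)" and p: "Factorial_Ring.prime (p::nat)"
    and ord: "order (G Mod frattini G) = p ^ m"
  shows "\<exists>n. order G = p ^ n"
proof -
  have Fs: "subgroup (frattini G) G" by (rule frattini_subgroup)
  have "order G > 0" using fin order_gt_0_iff_finite by blast
  then obtain r where r: "order G = p ^ multiplicity p (order G) * r" "\<not> p dvd r"
    using multiplicity_decompose'[of "order G" p] p by (auto simp: prime_nat_iff)
  define a where "a = multiplicity p (order G)"
  obtain P where P: "subgroup P G" "card P = p ^ a"
    using sylow_thm[OF p is_group r(1) fin] unfolding a_def by blast
  have "P = carrier G"
  proof (rule ccontr)
    assume "P \<noteq> carrier G"
    then obtain M where M: "maximal_subgroup M G" "P \<subseteq> M" using ex_maximal_subgroup[OF fin P(1)] by blast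
    have Ms: "subgroup M G" "M \<noteq> carrier G" using M by (auto simp: maximal_subgroup_def)
    have Mc: "M \<subseteq> carrier G" by (rule subgroup.subset[OF Ms(1)])
    interpret MG: group "G\<lparr>carrier := M\<rparr>" by (rule subgroup_imp_group[OF Ms(1)])
    have FM: "frattini G \<subseteq> M" using M by (auto simp: frattini_def)
    have dvd: "card B dvd card M" if B: "subgroup B G" "B \<subseteq> M" for B
    proof -
      have "subgroup B (G\<lparr>carrier := M\<rparr>)" by (rule subgroup_incl[OF B(1) Ms(1) B(2)])
      then have "card (rcosets\<^bsub>G\<lparr>carrier := M\<rparr>\<^esub> B) * card B = card M"
        using MG.lagrange by (simp add: Coset.order_def)
      then show ?thesis using dvd_triv_right[of "card B"] by metis
    qed
    obtain c where c: "card M = card (frattini G) * c" using dvd[OF Fs FM] by auto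
    have "card (rcosets (frattini G)) = p ^ m" using ord by (simp add: Coset.order_def FactGroup_def)
    then have G1: "order G = p ^ m * card (frattini G)" using lagrange[OF Fs] by simp
    have G2: "order G = card (rcosets M) * card M" using lagrange[OF Ms(1)] by simp
    have Fpos: "card (frattini G) > 0"
      using \<open>order G > 0\<close> G1 by (cases "card (frattini G)") auto
    have "card (frattini G) * p ^ m = card (frattini G) * (card (rcosets M) * c)"
      using G1 G2 unfolding c by (simp only: mult_ac)
    then have "p ^ m = card (rcosets M) * c" using Fpos by simp
    then have "card (rcosets M) dvd p ^ m" by simp
    then obtain i where i: "card (rcosets M) = p ^ i" using divides_primepow_nat[OF p] by blast
    have "i \<noteq> 0"
    proof
      assume "i = 0"
      then have "card M = card (carrier G)" using G2 i by (simp add: Coset.order_def)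
      then show False using Ms(2) card_subset_eq[OF fin Mc] by simp
    qed
    then have "p dvd card (rcosets M)" using i by (cases i) auto
    moreover have "p ^ a dvd card M" using dvd[OF P(1) M(2)] P(2) by simp
    ultimately have "p * p ^ a dvd order G" unfolding G2 by (rule mult_dvd_mono)
    then have "p ^ a * p dvd p ^ a * r" using r(1) unfolding a_def by (simp add: mult.commute)
    then have "p dvd r" using p prime_gt_0_nat[OF p] by simp
    then show False using r(2) by simp
  qed
  then show ?thesis using P(2) by (auto simp: Coset.order_def)
qed

end

section \<open>Linear groups over prime fields\<close>

definition linear_bij :: "('k, 'm) ring_scheme \<Rightarrow> ('k, 'v, 'n) module_scheme \<Rightarrow> ('v \<Rightarrow> 'v) set" where
  "linear_bij K V = module_hom K V V \<inter> Bij (carrier V)"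

lemma Aut_space_eq: "Aut_space K V = BijGroup (carrier V)\<lparr>carrier := linear_bij K V\<rparr>"
  by (simp add: Aut_space_def linear_bij_def)

lemma BijGroup_simps:
  "carrier (BijGroup S) = Bij S" "\<one>\<^bsub>BijGroup S\<^esub> = (\<lambda>x\<in>S. x)"
  "\<lbrakk>f \<in> Bij S; g \<in> Bij S\<rbrakk> \<Longrightarrow> f \<otimes>\<^bsub>BijGroup S\<^esub> g = compose S f g"
  by (simp_all add: BijGroup_def)

lemma finite_BijGroup:
  assumes "finite S" shows "finite (carrier (BijGroup S))"
proof (rule finite_subset)
  show "carrier (BijGroup S) \<subseteq> S \<rightarrow>\<^sub>E S"
    by (auto simp: BijGroup_def Bij_def bij_betw_def PiE_def)
  show "finite (S \<rightarrow>\<^sub>E S)" using assms by (simp add: finite_PiE)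
qed

lemma (in module) linear_bij_subgroup:
  assumes fin: "finite (carrier M)"
  shows "subgroup (linear_bij R M) (BijGroup (carrier M))"
proof -
  interpret B: group "BijGroup (carrier M)" by (rule group_BijGroup)
  show ?thesis
  proof (rule B.finite_closed_imp_subgroup[OF finite_BijGroup[OF fin]])
    show "linear_bij R M \<subseteq> carrier (BijGroup (carrier M))" by (auto simp: linear_bij_def BijGroup_simps)
    show "\<one>\<^bsub>BijGroup (carrier M)\<^esub> \<in> linear_bij R M"
      using B.one_closed by (auto simp: linear_bij_def BijGroup_simps module_hom_def)
    fix f g assume fg: "f \<in> linear_bij R M" "g \<in> linear_bij R M"
    then have "compose (carrier M) f g \<in> Bij (carrier M)"
      using B.m_closed[of f g] by (simp add: linear_bij_def BijGroup_simps)
    moreover have "compose (carrier M) f g \<in> module_hom R M M"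
      using fg by (auto simp: linear_bij_def module_hom_def compose_def Pi_iff)
    ultimately show "f \<otimes>\<^bsub>BijGroup (carrier M)\<^esub> g \<in> linear_bij R M"
      using fg by (simp add: linear_bij_def BijGroup_simps)
  qed
qed

locale prime_space =
  fixes p :: nat and V :: "(int, 'v, 'e) module_scheme"
  assumes prime: "Factorial_Ring.prime p"
    and vs: "vectorspace (residue_ring (int p)) V" and fin: "finite (carrier V)"
begin

abbreviation "K \<equiv> residue_ring (int p)"
abbreviation "A \<equiv> add_monoid V"

sublocale vectorspace K V by (rule vs)

lemma A_comm_group: "comm_group A" using M.a_comm_group .

text \<open>The bound on \<open>n\<close> keeps the sums in the residue ring free of wrap-around, so
  that adding the residue 1 is the ordinary successor.\<close>

lemma int_smult:
  assumes v: "v \<in> carrier V" and n: "n < p"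
  shows "int n \<odot>\<^bsub>V\<^esub> v = v [^]\<^bsub>A\<^esub> n"
  using n
proof (induction n)
  case 0
  have "\<zero>\<^bsub>K\<^esub> \<odot>\<^bsub>V\<^esub> v = \<zero>\<^bsub>V\<^esub>" by (rule smult_l_null[OF v])
  then show ?case by (simp add: residue_ring_def)
next
  case (Suc n)
  have p1: "1 < p" using prime_gt_1_nat[OF prime] .
  have "(int n \<oplus>\<^bsub>K\<^esub> \<one>\<^bsub>K\<^esub>) \<odot>\<^bsub>V\<^esub> v = int n \<odot>\<^bsub>V\<^esub> v \<oplus>\<^bsub>V\<^esub> \<one>\<^bsub>K\<^esub> \<odot>\<^bsub>V\<^esub> v"
    by (rule smult_l_distr) (use Suc.prems p1 v in \<open>auto simp: residue_ring_def\<close>)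
  moreover have "int n \<oplus>\<^bsub>K\<^esub> \<one>\<^bsub>K\<^esub> = int (Suc n)" using Suc.prems by (simp add: residue_ring_def)
  moreover have "\<one>\<^bsub>K\<^esub> \<odot>\<^bsub>V\<^esub> v = v" by (rule smult_one[OF v])
  ultimately show ?case using Suc by (simp add: nat_pow_def)
qed

lemma smult_eq:
  assumes v: "v \<in> carrier V" and r: "r \<in> carrier K"
  shows "r \<odot>\<^bsub>V\<^esub> v = v [^]\<^bsub>A\<^esub> nat r"
  using int_smult[OF v, of "nat r"] r by (auto simp: residue_ring_def)

lemma exponent_p: assumes v: "v \<in> carrier V" shows "v [^]\<^bsub>A\<^esub> p = \<zero>\<^bsub>V\<^esub>"
proof -
  have p1: "1 < p" using prime_gt_1_nat[OF prime] .
  have "(int (p - 1) \<oplus>\<^bsub>K\<^esub> \<one>\<^bsub>K\<^esub>) \<odot>\<^bsub>V\<^esub> v = int (p - 1) \<odot>\<^bsub>V\<^esub> v \<oplus>\<^bsub>V\<^esub> \<one>\<^bsub>K\<^esub> \<odot>\<^bsub>V\<^esub> v"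
    by (rule smult_l_distr) (use p1 v in \<open>auto simp: residue_ring_def\<close>)
  moreover have "int (p - 1) \<oplus>\<^bsub>K\<^esub> \<one>\<^bsub>K\<^esub> = \<zero>\<^bsub>K\<^esub>" using p1 by (simp add: residue_ring_def of_nat_diff)
  moreover have "\<one>\<^bsub>K\<^esub> \<odot>\<^bsub>V\<^esub> v = v" by (rule smult_one[OF v])
  ultimately have "v [^]\<^bsub>A\<^esub> (p - 1) \<oplus>\<^bsub>V\<^esub> v = \<zero>\<^bsub>V\<^esub>"
    using int_smult[OF v, of "p - 1"] p1 smult_l_null[OF v] by simp
  moreover have "v [^]\<^bsub>A\<^esub> p = v [^]\<^bsub>A\<^esub> (p - 1) \<oplus>\<^bsub>V\<^esub> v" using p1 by (cases p) (simp_all add: nat_pow_def)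
  ultimately show ?thesis by simp
qed

text \<open>Scalars from a prime field act as repeated addition, which every additive map respects.
  Hence the module notions of the previous sections and the linear notions of the theorem
  coincide.\<close>

lemma additive_imp_linear:
  assumes f: "\<And>v. v \<in> carrier V \<Longrightarrow> f v \<in> carrier V"
    and add: "\<And>v w. \<lbrakk>v \<in> carrier V; w \<in> carrier V\<rbrakk> \<Longrightarrow> f (v \<oplus>\<^bsub>V\<^esub> w) = f v \<oplus>\<^bsub>V\<^esub> f w"
  shows "f \<in> module_hom K V V"
proof -
  have "f (r \<odot>\<^bsub>V\<^esub> v) = r \<odot>\<^bsub>V\<^esub> f v" if rv: "r \<in> carrier K" "v \<in> carrier V" for r v
  proof -
    have "group_hom A A f"
      by (unfold_locales) (use f add in \<open>auto simp: hom_def\<close>)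
    then have "f (v [^]\<^bsub>A\<^esub> nat r) = f v [^]\<^bsub>A\<^esub> nat r"
      using group_hom.hom_nat_pow[of A A f v "nat r"] rv(2) by simp
    then show ?thesis using smult_eq rv f by simp
  qed
  then show ?thesis using f add by (simp add: module_hom_def)
qed

lemma subspaceI:
  assumes W: "subgroup W A" shows "VectorSpace.subspace K W V"
  unfolding VectorSpace.subspace_def LinearCombinations.submodule_def
proof (intro conjI allI impI)
  have Wc: "W \<subseteq> carrier V" using subgroup.subset[OF W] by simp
  have pow: "w [^]\<^bsub>A\<^esub> n \<in> W" if "w \<in> W" for w and n :: nat
    using that subgroup.one_closed[OF W] subgroup.m_closed[OF W] by (induction n) (auto simp: nat_pow_def)
  show "r \<odot>\<^bsub>V\<^esub> w \<in> W" if "r \<in> carrier K" "w \<in> W" for r w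
    using that pow smult_eq Wc by auto
qed (use subgroup.subset[OF W] subgroup.m_closed[OF W] subgroup.one_closed[OF W] vs module_axioms
    in \<open>auto intro: vectorspace.axioms\<close>)

end

text \<open>The bridge between the two descriptions: an abstract group acting on the additive group
  of \<open>V\<close>, and the linear group \<open>H\<close> that is the image of this
  action.\<close>

locale linear_action = prime_space p V + irr_gmod G "add_monoid V" act
  for p :: nat and V :: "(int, 'v, 'e) module_scheme"
    and G :: "('g, 'x) monoid_scheme" (structure) and act :: "'g \<Rightarrow> 'v \<Rightarrow> 'v" +
  fixes H :: "('v \<Rightarrow> 'v) set"
  assumes H_eq: "H = (\<lambda>g. \<lambda>v\<in>carrier V. act g v) ` carrier G"
begin

lemma carrier_End_ring: "carrier (End_ring K V H) = Endo"
proof -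
  have lin: "f \<in> module_hom K V V" if "f \<in> Endo" for f
    by (rule additive_imp_linear) (use that Endo_closed Endo_mult in auto)
  have comm: "(\<forall>h\<in>H. \<forall>v\<in>carrier V. f (h v) = h (f v)) \<longleftrightarrow>
      (\<forall>g\<in>carrier G. \<forall>v\<in>carrier V. f (act g v) = act g (f v))"
    if "\<And>v. v \<in> carrier V \<Longrightarrow> f v \<in> carrier V" for f
    using that by (simp add: H_eq)
  show ?thesis
  proof (intro subset_antisym subsetI)
    fix f assume "f \<in> carrier (End_ring K V H)"
    then have f: "f \<in> module_hom K V V" "f \<in> extensional (carrier V)"
      "\<forall>h\<in>H. \<forall>v\<in>carrier V. f (h v) = h (f v)" by (auto simp: End_ring_def)
    then show "f \<in> Endo" using comm[of f] by (auto simp: Endo_def module_hom_def PiE_def)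
  next
    fix f assume f: "f \<in> Endo"
    then show "f \<in> carrier (End_ring K V H)"
      using lin[OF f] comm[of f] by (auto simp: Endo_def End_ring_def PiE_def)
  qed
qed

lemma Endo_ring: "ring (End_ring K V H)"
proof (rule ringI)
  have cl: "f v \<in> carrier V" if "f \<in> Endo" "v \<in> carrier V" for f v using Endo_closed that by simp
  have addE: "(\<lambda>v\<in>carrier V. f v \<oplus>\<^bsub>V\<^esub> g v) \<in> Endo" if "f \<in> Endo" "g \<in> Endo" for f g
    using EndoI[of "\<lambda>v. f v \<oplus>\<^bsub>V\<^esub> g v"] that Endo_mult[OF that(1)] Endo_mult[OF that(2)] cl
      Endo_act[OF that(1)] Endo_act[OF that(2)] act_mult
    by (simp add: M.add.m_ac)
  have negE: "(\<lambda>v\<in>carrier V. inv\<^bsub>A\<^esub> f v) \<in> Endo" if "f \<in> Endo" for f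
    using EndoI[of "\<lambda>v. inv\<^bsub>A\<^esub> f v"] that Endo_mult[OF that] cl Endo_act[OF that] act_V_inv
    by (simp add: M.add.inv_mult[unfolded a_inv_def])
  have compE: "compose (carrier V) f g \<in> Endo" if "f \<in> Endo" "g \<in> Endo" for f g
    using EndoI[of "\<lambda>v. f (g v)"] that Endo_mult[OF that(1)] Endo_mult[OF that(2)] cl
      Endo_act[OF that(1)] Endo_act[OF that(2)]
    by (simp add: compose_def)
  have ext: "restrict f (carrier V) = f" if "f \<in> Endo" for f
    using that by (auto simp: Endo_def intro: extensional_restrict)
  note E = End_ring_def
  have simps: "f \<oplus>\<^bsub>End_ring K V H\<^esub> g = (\<lambda>v\<in>carrier V. f v \<oplus>\<^bsub>V\<^esub> g v)"
    "f \<otimes>\<^bsub>End_ring K V H\<^esub> g = compose (carrier V) f g"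
    "\<zero>\<^bsub>End_ring K V H\<^esub> = (\<lambda>v\<in>carrier V. \<zero>\<^bsub>V\<^esub>)" "\<one>\<^bsub>End_ring K V H\<^esub> = (\<lambda>v\<in>carrier V. v)" for f g
    by (simp_all add: End_ring_def)
  show "abelian_group (End_ring K V H)"
  proof (rule abelian_groupI, unfold carrier_End_ring simps)
    show "\<exists>g\<in>Endo. (\<lambda>v\<in>carrier V. g v \<oplus>\<^bsub>V\<^esub> f v) = (\<lambda>v\<in>carrier V. \<zero>\<^bsub>V\<^esub>)" if "f \<in> Endo" for f
      by (intro bexI[OF _ negE[OF that]] restrict_ext) (use that cl in simp)
    show "(\<lambda>v\<in>carrier V. (\<lambda>v\<in>carrier V. \<zero>\<^bsub>V\<^esub>) v \<oplus>\<^bsub>V\<^esub> f v) = f" if f: "f \<in> Endo" for f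
    proof -
      have "(\<lambda>v\<in>carrier V. (\<lambda>v\<in>carrier V. \<zero>\<^bsub>V\<^esub>) v \<oplus>\<^bsub>V\<^esub> f v) = restrict f (carrier V)"
        by (rule restrict_ext) (use f cl in simp)
      then show ?thesis using ext[OF f] by simp
    qed
    show "(\<lambda>v\<in>carrier V. \<zero>\<^bsub>V\<^esub>) \<in> Endo" using Endo_zero by simp
    show "(\<lambda>v\<in>carrier V. (\<lambda>v\<in>carrier V. f v \<oplus>\<^bsub>V\<^esub> g v) v \<oplus>\<^bsub>V\<^esub> h v) =
        (\<lambda>v\<in>carrier V. f v \<oplus>\<^bsub>V\<^esub> (\<lambda>v\<in>carrier V. g v \<oplus>\<^bsub>V\<^esub> h v) v)"
      if "f \<in> Endo" "g \<in> Endo" "h \<in> Endo" for f g h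
      by (rule restrict_ext) (use that cl in \<open>simp add: M.add.m_assoc\<close>)
    show "(\<lambda>v\<in>carrier V. f v \<oplus>\<^bsub>V\<^esub> g v) = (\<lambda>v\<in>carrier V. g v \<oplus>\<^bsub>V\<^esub> f v)"
      if "f \<in> Endo" "g \<in> Endo" for f g
      by (rule restrict_ext) (use that cl in \<open>simp add: M.add.m_comm\<close>)
  qed (rule addE)
  show "Group.monoid (End_ring K V H)"
  proof (rule monoidI, unfold carrier_End_ring simps)
    show "compose (carrier V) (compose (carrier V) f g) h = compose (carrier V) f (compose (carrier V) g h)"
      if "f \<in> Endo" "g \<in> Endo" "h \<in> Endo" for f g h
      unfolding compose_def by (rule restrict_ext) (use that cl in simp)
    show "compose (carrier V) (\<lambda>v\<in>carrier V. v) f = f" if f: "f \<in> Endo" for f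
    proof -
      have "compose (carrier V) (\<lambda>v\<in>carrier V. v) f = restrict f (carrier V)"
        unfolding compose_def by (rule restrict_ext) (use f cl in simp)
      then show ?thesis using ext[OF f] by simp
    qed
    show "compose (carrier V) f (\<lambda>v\<in>carrier V. v) = f" if f: "f \<in> Endo" for f
    proof -
      have "compose (carrier V) f (\<lambda>v\<in>carrier V. v) = restrict f (carrier V)"
        unfolding compose_def by (rule restrict_ext) (use f cl in simp)
      then show ?thesis using ext[OF f] by simp
    qed
    show "(\<lambda>v\<in>carrier V. v) \<in> Endo" using Endo_id by simp
  qed (rule compE)
  fix f g h assume "f \<in> carrier (End_ring K V H)" "g \<in> carrier (End_ring K V H)" "h \<in> carrier (End_ring K V H)"
  then have fgh: "f \<in> Endo" "g \<in> Endo" "h \<in> Endo" by (simp_all add: carrier_End_ring)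
  show "(f \<oplus>\<^bsub>End_ring K V H\<^esub> g) \<otimes>\<^bsub>End_ring K V H\<^esub> h =
      f \<otimes>\<^bsub>End_ring K V H\<^esub> h \<oplus>\<^bsub>End_ring K V H\<^esub> g \<otimes>\<^bsub>End_ring K V H\<^esub> h"
    unfolding simps compose_def by (rule restrict_ext) (use fgh cl in simp)
  show "h \<otimes>\<^bsub>End_ring K V H\<^esub> (f \<oplus>\<^bsub>End_ring K V H\<^esub> g) =
      h \<otimes>\<^bsub>End_ring K V H\<^esub> f \<oplus>\<^bsub>End_ring K V H\<^esub> h \<otimes>\<^bsub>End_ring K V H\<^esub> g"
    unfolding simps compose_def by (rule restrict_ext) (use fgh cl Endo_mult[OF fgh(3)] in simp)
qed

text \<open>Schur's lemma: a nonzero endomorphism vanishes at no nonzero vector, so it is injective,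
  and bijective by finiteness.\<close>

lemma Endo_inverse:
  assumes f: "f \<in> Endo" "f \<noteq> (\<lambda>v\<in>carrier V. \<zero>\<^bsub>V\<^esub>)"
  shows "\<exists>g\<in>Endo. compose (carrier V) f g = (\<lambda>v\<in>carrier V. v) \<and> compose (carrier V) g f = (\<lambda>v\<in>carrier V. v)"
proof -
  have cl: "f v \<in> carrier V" if "v \<in> carrier V" for v using Endo_closed[OF f(1)] that by simp
  interpret f: group_hom A A f by (rule Endo_hom[OF f(1)])
  have inj: "inj_on f (carrier V)"
  proof (rule inj_onI)
    fix v w assume vw: "v \<in> carrier V" "w \<in> carrier V" "f v = f w"
    let ?x = "v \<oplus>\<^bsub>V\<^esub> inv\<^bsub>A\<^esub> w"
    have x: "?x \<in> carrier V" using vw by simp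
    have "f ?x = \<zero>\<^bsub>V\<^esub>"
      using Endo_mult[OF f(1), of v "inv\<^bsub>A\<^esub> w"] Endo_inv[OF f(1), of w] vw cl by simp
    then have "?x = \<zero>\<^bsub>V\<^esub>"
      using Endo_eq_if_agree[OF f(1) Endo_zero, of ?x] f(2) x by auto
    then show "v = w" using M.add.inv_solve_right'[of "\<zero>\<^bsub>V\<^esub>" v w, unfolded a_inv_def] vw by simp
  qed
  then have img: "f ` carrier V = carrier V" using endo_inj_surj[OF fin _ inj] cl by blast
  let ?i = "inv_into (carrier V) f"
  have i: "?i v \<in> carrier V" "f (?i v) = v" if "v \<in> carrier V" for v
    using that img inv_into_into[of v f "carrier V"] f_inv_into_f[of v f "carrier V"] by auto
  have i': "?i (f v) = v" if "v \<in> carrier V" for v using inv_into_f_f[OF inj that] .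
  have eqI: "v = w" if "v \<in> carrier V" "w \<in> carrier V" "f v = f w" for v w
    using inj that by (rule_tac inj_onD[OF inj])
  have "(\<lambda>v\<in>carrier A. ?i v) \<in> Endo"
  proof (rule EndoI)
    show "?i v \<in> carrier A" if "v \<in> carrier A" for v using i that by simp
    show "?i (v \<otimes>\<^bsub>A\<^esub> w) = ?i v \<otimes>\<^bsub>A\<^esub> ?i w" if "v \<in> carrier A" "w \<in> carrier A" for v w
      by (rule eqI) (use that i Endo_mult[OF f(1), of "?i v" "?i w"] in simp_all)
    show "?i (act g v) = act g (?i v)" if "g \<in> carrier G" "v \<in> carrier A" for g v
      by (rule eqI) (use that i Endo_act[OF f(1), of g "?i v"] act_closed in simp_all)
  qed
  then have "(\<lambda>v\<in>carrier V. ?i v) \<in> Endo" by simp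
  moreover have "compose (carrier V) f (\<lambda>v\<in>carrier V. ?i v) = (\<lambda>v\<in>carrier V. v)"
    "compose (carrier V) (\<lambda>v\<in>carrier V. ?i v) f = (\<lambda>v\<in>carrier V. v)"
    unfolding compose_def by (rule restrict_ext, use i i' cl in simp)+
  ultimately show ?thesis by blast
qed

text \<open>Schur's lemma gives a division ring, and Wedderburn's theorem makes it commutative. This
  is what allows \<open>End_dim\<close> to be treated as a dimension over a field.\<close>

lemma End_ring_field: "field (End_ring K V H)"
proof (rule ring.finite_division_ring_is_field[OF Endo_ring])
  show "finite (carrier (End_ring K V H))" using finite_Endo by (simp add: carrier_End_ring)
  obtain v where v: "v \<in> carrier V" "v \<noteq> \<zero>\<^bsub>V\<^esub>" using V_nontriv M.add.one_closed by auto
  show "\<one>\<^bsub>End_ring K V H\<^esub> \<noteq> \<zero>\<^bsub>End_ring K V H\<^esub>"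
  proof
    assume "\<one>\<^bsub>End_ring K V H\<^esub> = \<zero>\<^bsub>End_ring K V H\<^esub>"
    then have "(\<lambda>v\<in>carrier V. v) v = (\<lambda>v\<in>carrier V. \<zero>\<^bsub>V\<^esub>) v" by (simp add: End_ring_def)
    then show False using v by simp
  qed
  show "\<exists>g\<in>carrier (End_ring K V H). f \<otimes>\<^bsub>End_ring K V H\<^esub> g = \<one>\<^bsub>End_ring K V H\<^esub> \<and>
      g \<otimes>\<^bsub>End_ring K V H\<^esub> f = \<one>\<^bsub>End_ring K V H\<^esub>"
    if "f \<in> carrier (End_ring K V H)" "f \<noteq> \<zero>\<^bsub>End_ring K V H\<^esub>" for f
    using Endo_inverse[of f] that unfolding carrier_End_ring by (simp add: End_ring_def)
qed

lemma card_eq_power_End_dim: "card (carrier V) = card Endo ^ End_dim K V H"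
proof -
  have cl: "f v \<in> carrier V" if "f \<in> Endo" "v \<in> carrier V" for f v using Endo_closed that by simp
  have madd: "f (v \<oplus>\<^bsub>V\<^esub> w) = f v \<oplus>\<^bsub>V\<^esub> f w" if "f \<in> Endo" "v \<in> carrier V" "w \<in> carrier V" for f v w
    using Endo_mult that by simp
  have "vectorspace (End_ring K V H) (eval_module V)"
  proof (rule vs_criteria[OF End_ring_field], unfold carrier_End_ring)
    show "\<forall>v\<in>carrier (eval_module V). \<exists>w\<in>carrier (eval_module V). v \<oplus>\<^bsub>eval_module V\<^esub> w = \<zero>\<^bsub>eval_module V\<^esub>"
      using M.add.r_inv M.add.inv_closed by (auto simp: eval_module_def)
  qed (use cl madd in \<open>auto simp: eval_module_def End_ring_def compose_def M.add.m_ac\<close>)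
  then interpret E: vectorspace "End_ring K V H" "eval_module V" .
  have "card (carrier (eval_module V)) = card (carrier (End_ring K V H)) ^ E.dim"
    by (rule E.card_eq_power_dim) (use fin finite_Endo in \<open>simp_all add: carrier_End_ring eval_module_def\<close>)
  then show ?thesis by (simp add: carrier_End_ring End_dim_def eval_module_def)
qed

end

section \<open>Split extensions satisfy psi = d\<close>

lemma (in group_hom) generate_Un_kernel:
  assumes S: "S \<subseteq> carrier G" and surj: "h ` carrier G = carrier H"
    and gen: "generate H (h ` S) = carrier H"
  shows "generate G (S \<union> kernel G H h) = carrier G"
proof -
  have kc: "kernel G H h \<subseteq> carrier G" by (auto simp: kernel_def)
  have L: "subgroup (generate G (S \<union> kernel G H h)) G" (is "subgroup ?L G")
    by (rule G.generate_is_subgroup) (use S kc in blast)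
  have "carrier G \<subseteq> ?L"
  proof
    fix g assume g: "g \<in> carrier G"
    then have "h g \<in> h ` generate G S" using gen generate_img[OF S] by simp
    then obtain s where s: "s \<in> generate G S" "h g = h s" by blast
    have sc: "s \<in> carrier G" using G.generate_in_carrier[OF S s(1)] .
    have "g \<otimes> inv s \<in> kernel G H h" using g sc s(2) by (simp add: kernel_def)
    then have "g \<otimes> inv s \<in> ?L" by (blast intro: generate.incl)
    moreover have "s \<in> ?L" using s(1) G.mono_generate[of S "S \<union> kernel G H h"] by blast
    ultimately have "g \<otimes> inv s \<otimes> s \<in> ?L" using subgroup.m_closed[OF L] by blast
    then show "g \<in> ?L" using g sc by (simp add: G.m_assoc)
  qed
  then show ?thesis using subgroup.subset[OF L] by blast
qed

section \<open>The split extension V^k : H as a crown\<close>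

locale irreducible_linear_group = prime_space p V
  for p :: nat and V :: "(int, 'v, 'e) module_scheme" +
  fixes H :: "('v \<Rightarrow> 'v) set"
  assumes H_subgroup: "subgroup H (Aut_space (residue_ring (int p)) V)"
    and H_nontriv: "H \<noteq> {\<one>\<^bsub>Aut_space (residue_ring (int p)) V\<^esub>}"
    and H_irr: "irreducible_linear (residue_ring (int p)) V H"
begin

abbreviation "HG \<equiv> Aut_space K V\<lparr>carrier := H\<rparr>"

lemma H_subgroup_Bij: "subgroup H (BijGroup (carrier V))"
  using group.incl_subgroup[OF group_BijGroup linear_bij_subgroup[OF fin]] H_subgroup
  unfolding Aut_space_eq by blast

lemma H_Bij: "h \<in> H \<Longrightarrow> h \<in> Bij (carrier V)"
  using subgroup.subset[OF H_subgroup_Bij] by (auto simp: BijGroup_simps)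

lemma H_linear: "h \<in> H \<Longrightarrow> h \<in> module_hom K V V"
  using subgroup.subset[OF H_subgroup] by (auto simp: Aut_space_eq linear_bij_def)

lemma H_closed: "\<lbrakk>h \<in> H; v \<in> carrier V\<rbrakk> \<Longrightarrow> h v \<in> carrier V"
  using H_linear[of h] by (simp add: module_hom_def Pi_iff)

lemma H_add: "\<lbrakk>h \<in> H; v \<in> carrier V; w \<in> carrier V\<rbrakk> \<Longrightarrow> h (v \<oplus>\<^bsub>V\<^esub> w) = h v \<oplus>\<^bsub>V\<^esub> h w"
  using H_linear[of h] by (simp add: module_hom_def)

lemma H_compose: "\<lbrakk>h \<in> H; h' \<in> H\<rbrakk> \<Longrightarrow> compose (carrier V) h h' \<in> H"
  using subgroup.m_closed[OF H_subgroup_Bij, of h h'] by (simp add: BijGroup_simps H_Bij)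

lemma H_id: "(\<lambda>v\<in>carrier V. v) \<in> H"
  using subgroup.one_closed[OF H_subgroup_Bij] by (simp add: BijGroup_simps)

lemma H_inverse: "h \<in> H \<Longrightarrow> \<exists>h'\<in>H. compose (carrier V) h' h = (\<lambda>v\<in>carrier V. v)"
  using subgroup.m_inv_closed[OF H_subgroup_Bij, of h]
    group.l_inv[OF group_BijGroup, of h "carrier V"] subgroup.mem_carrier[OF H_subgroup_Bij, of h]
  by (intro bexI[of _ "inv\<^bsub>BijGroup (carrier V)\<^esub> h"]) (auto simp: BijGroup_simps H_Bij)

lemma H_ext: "h \<in> H \<Longrightarrow> (\<lambda>v\<in>carrier V. h v) = h"
  using H_Bij by (auto simp: Bij_def intro: extensional_restrict)

lemma HG_group: "group HG"
proof -
  have "HG = BijGroup (carrier V)\<lparr>carrier := H\<rparr>" by (simp add: Aut_space_eq)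
  then show ?thesis using group.subgroup_imp_group[OF group_BijGroup H_subgroup_Bij] by simp
qed

lemma HG_simps: "carrier HG = H" "\<one>\<^bsub>HG\<^esub> = (\<lambda>v\<in>carrier V. v)"
  "\<lbrakk>h \<in> H; h' \<in> H\<rbrakk> \<Longrightarrow> h \<otimes>\<^bsub>HG\<^esub> h' = compose (carrier V) h h'"
  using BijGroup_simps(3)[OF H_Bij H_Bij] by (simp_all add: Aut_space_eq BijGroup_simps)

lemma finite_H: "finite H"
  using finite_subset[OF subgroup.subset[OF H_subgroup_Bij] finite_BijGroup[OF fin]] .

abbreviation "P k \<equiv> power_split K V H k"

lemma P_carrier: "carrier (P k) = ({..<k} \<rightarrow>\<^sub>E carrier V) \<times> H"
  by (simp add: power_split_def semidirect_def product_group_def)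

lemma P_one: "\<one>\<^bsub>P k\<^esub> = (\<lambda>i\<in>{..<k}. \<zero>\<^bsub>V\<^esub>, \<lambda>v\<in>carrier V. v)"
  by (simp add: power_split_def semidirect_def product_group_def Aut_space_eq BijGroup_simps)

lemma P_mult:
  assumes "h \<in> H" "h' \<in> H"
  shows "(n, h) \<otimes>\<^bsub>P k\<^esub> (n', h') = (\<lambda>i\<in>{..<k}. n i \<oplus>\<^bsub>V\<^esub> h (n' i), compose (carrier V) h h')"
  using BijGroup_simps(3)[OF H_Bij[OF assms(1)] H_Bij[OF assms(2)]]
  by (auto simp: power_split_def semidirect_def product_group_def Aut_space_eq cong: restrict_cong)

lemma P_snd: "x \<in> carrier (P k) \<Longrightarrow> snd x \<in> H"
  by (cases x) (simp add: P_carrier)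

lemma P_fst: "\<lbrakk>x \<in> carrier (P k); i < k\<rbrakk> \<Longrightarrow> fst x i \<in> carrier V"
  by (cases x) (auto simp: P_carrier PiE_iff)

lemma P_mult_snd:
  assumes "x \<in> carrier (P k)" "y \<in> carrier (P k)"
  shows "snd (x \<otimes>\<^bsub>P k\<^esub> y) = compose (carrier V) (snd x) (snd y)"
  using P_mult[OF P_snd[OF assms(1)] P_snd[OF assms(2)], of k "fst x" "fst y"] by simp

lemma P_mult_fst:
  assumes "x \<in> carrier (P k)" "y \<in> carrier (P k)" "i < k"
  shows "fst (x \<otimes>\<^bsub>P k\<^esub> y) i = fst x i \<oplus>\<^bsub>V\<^esub> snd x (fst y i)"
  using P_mult[OF P_snd[OF assms(1)] P_snd[OF assms(2)], of k "fst x" "fst y"] assms(3) by simp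

lemma P_group: "group (P k)"
proof (rule groupI)
  have PE: "n i \<in> carrier V" if "n \<in> {..<k} \<rightarrow>\<^sub>E carrier V" "i < k" for n i using that by auto
  fix x y assume x: "x \<in> carrier (P k)" and y: "y \<in> carrier (P k)"
  obtain n h where nh: "x = (n, h)" "n \<in> {..<k} \<rightarrow>\<^sub>E carrier V" "h \<in> H" using x P_carrier by auto
  obtain n' h' where nh': "y = (n', h')" "n' \<in> {..<k} \<rightarrow>\<^sub>E carrier V" "h' \<in> H" using y P_carrier by auto
  show "x \<otimes>\<^bsub>P k\<^esub> y \<in> carrier (P k)"
    using nh nh' H_closed H_compose PE by (auto simp: P_mult P_carrier)
  fix z assume z: "z \<in> carrier (P k)"
  obtain m l where ml: "z = (m, l)" "m \<in> {..<k} \<rightarrow>\<^sub>E carrier V" "l \<in> H" using z P_carrier by auto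
  have "compose (carrier V) (compose (carrier V) h h') l = compose (carrier V) h (compose (carrier V) h' l)"
    unfolding compose_def by (rule restrict_ext) (use ml H_closed in simp)
  moreover have "(\<lambda>i\<in>{..<k}. (\<lambda>i\<in>{..<k}. n i \<oplus>\<^bsub>V\<^esub> h (n' i)) i \<oplus>\<^bsub>V\<^esub> compose (carrier V) h h' (m i)) =
      (\<lambda>i\<in>{..<k}. n i \<oplus>\<^bsub>V\<^esub> h ((\<lambda>i\<in>{..<k}. n' i \<oplus>\<^bsub>V\<^esub> h' (m i)) i))"
    by (rule restrict_ext)
      (use nh nh' ml PE H_closed H_add in \<open>simp add: compose_def M.add.m_assoc\<close>)
  ultimately show "x \<otimes>\<^bsub>P k\<^esub> y \<otimes>\<^bsub>P k\<^esub> z = x \<otimes>\<^bsub>P k\<^esub> (y \<otimes>\<^bsub>P k\<^esub> z)"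
    using nh nh' ml H_compose by (simp add: P_mult)
next
  show "\<one>\<^bsub>P k\<^esub> \<in> carrier (P k)" using H_id by (simp add: P_one P_carrier)
next
  fix x assume x: "x \<in> carrier (P k)"
  obtain n h where nh: "x = (n, h)" "n \<in> {..<k} \<rightarrow>\<^sub>E carrier V" "h \<in> H" using x P_carrier by auto
  have PE: "n i \<in> carrier V" if "i < k" for i using that nh by auto
  have n_eq: "(\<lambda>i\<in>{..<k}. n i) = n" by (rule PiE_restrict[OF nh(2)])
  have "(\<lambda>i\<in>{..<k}. (\<lambda>i\<in>{..<k}. \<zero>\<^bsub>V\<^esub>) i \<oplus>\<^bsub>V\<^esub> (\<lambda>v\<in>carrier V. v) (n i)) = (\<lambda>i\<in>{..<k}. n i)"
    by (rule restrict_ext) (use PE in simp)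
  moreover have "compose (carrier V) (\<lambda>v\<in>carrier V. v) h = (\<lambda>v\<in>carrier V. h v)"
    unfolding compose_def by (rule restrict_ext) (use nh H_closed in simp)
  ultimately show "\<one>\<^bsub>P k\<^esub> \<otimes>\<^bsub>P k\<^esub> x = x" using nh H_id n_eq H_ext by (simp add: P_one P_mult)
  obtain h' where h': "h' \<in> H" "compose (carrier V) h' h = (\<lambda>v\<in>carrier V. v)" using H_inverse nh by blast
  let ?n = "\<lambda>i\<in>{..<k}. \<ominus>\<^bsub>V\<^esub> h' (n i)"
  have "(\<lambda>i\<in>{..<k}. ?n i \<oplus>\<^bsub>V\<^esub> h' (n i)) = (\<lambda>i\<in>{..<k}. \<zero>\<^bsub>V\<^esub>)"
    by (rule restrict_ext) (use PE h' H_closed in \<open>simp add: M.add.l_inv\<close>)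
  then have "(?n, h') \<otimes>\<^bsub>P k\<^esub> x = \<one>\<^bsub>P k\<^esub>" using nh h' by (simp add: P_mult P_one)
  moreover have "(?n, h') \<in> carrier (P k)" using h' PE H_closed by (auto simp: P_carrier)
  ultimately show "\<exists>y\<in>carrier (P k). y \<otimes>\<^bsub>P k\<^esub> x = \<one>\<^bsub>P k\<^esub>" by blast
qed

lemma P_finite: "finite (carrier (P k))"
  using finite_H fin by (simp add: P_carrier finite_PiE)

lemma zero_PiE: "(\<lambda>i\<in>{..<k}. \<zero>\<^bsub>V\<^esub>) \<in> {..<k} \<rightarrow>\<^sub>E carrier V" by auto

text \<open>The group acts on \<open>V\<close> through its projection to \<open>H\<close>.
  Irreducibility is transferred from subspaces to subgroups by \<open>subspaceI\<close>.\<close>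

lemma P_linear_action: "linear_action p V (P k) (\<lambda>x. snd x) H"
proof (intro linear_action.intro prime_space_axioms irr_gmod.intro gmod.intro gmod_axioms.intro
    irr_gmod_axioms.intro linear_action_axioms.intro P_group A_comm_group P_finite)
  show "finite (carrier A)" using fin by simp
  show "snd g v \<in> carrier A" if "g \<in> carrier (P k)" "v \<in> carrier A" for g v
    using H_closed[OF P_snd] that by simp
  show "snd g (v \<otimes>\<^bsub>A\<^esub> w) = snd g v \<otimes>\<^bsub>A\<^esub> snd g w"
    if "g \<in> carrier (P k)" "v \<in> carrier A" "w \<in> carrier A" for g v w
    using H_add[OF P_snd] that by simp
  show "snd \<one>\<^bsub>P k\<^esub> v = v" if "v \<in> carrier A" for v using that by (simp add: P_one)
  show "snd (g \<otimes>\<^bsub>P k\<^esub> h) v = snd g (snd h v)"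
    if "g \<in> carrier (P k)" "h \<in> carrier (P k)" "v \<in> carrier A" for g h v
    using that by (simp add: P_mult_snd compose_eq)
  show "carrier A \<noteq> {\<one>\<^bsub>A\<^esub>}" using H_irr by (simp add: irreducible_linear_def)
  show "W = {\<one>\<^bsub>A\<^esub>} \<or> W = carrier A"
    if W: "subgroup W A" and inv: "\<And>g w. \<lbrakk>g \<in> carrier (P k); w \<in> W\<rbrakk> \<Longrightarrow> snd g w \<in> W" for W
  proof -
    have "h ` W \<subseteq> W" if h: "h \<in> H" for h
    proof -
      have "(\<lambda>i\<in>{..<k}. \<zero>\<^bsub>V\<^esub>, h) \<in> carrier (P k)" using h zero_PiE by (simp add: P_carrier)
      from inv[OF this] show ?thesis by auto
    qed
    then show ?thesis using H_irr subspaceI[OF W] by (simp add: irreducible_linear_def)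
  qed
  show "H = (\<lambda>g. \<lambda>v\<in>carrier V. snd g v) ` carrier (P k)"
  proof
    show "H \<subseteq> (\<lambda>g. \<lambda>v\<in>carrier V. snd g v) ` carrier (P k)"
    proof
      fix h assume h: "h \<in> H"
      then have "(\<lambda>i\<in>{..<k}. \<zero>\<^bsub>V\<^esub>, h) \<in> carrier (P k)" using zero_PiE by (simp add: P_carrier)
      moreover have "h = (\<lambda>v\<in>carrier V. snd (\<lambda>i\<in>{..<k}. \<zero>\<^bsub>V\<^esub>, h) v)" using H_ext[OF h] by simp
      ultimately show "h \<in> (\<lambda>g. \<lambda>v\<in>carrier V. snd g v) ` carrier (P k)" by (rule rev_image_eqI)
    qed
    show "(\<lambda>g. \<lambda>v\<in>carrier V. snd g v) ` carrier (P k) \<subseteq> H" using H_ext by (auto simp: P_carrier)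
  qed
qed

lemma P_actker:
  "gmod.actker (P k) A (\<lambda>x. snd x) = ({..<k} \<rightarrow>\<^sub>E carrier V) \<times> {\<lambda>v\<in>carrier V. v}"
proof -
  interpret L: linear_action p V "P k" "\<lambda>x. snd x" H by (rule P_linear_action)
  have fixes_all: "h = (\<lambda>v\<in>carrier V. v)" if h: "h \<in> H" "\<forall>v\<in>carrier V. h v = v" for h
  proof -
    have "(\<lambda>v\<in>carrier V. h v) = (\<lambda>v\<in>carrier V. v)" by (rule restrict_ext) (use h in simp)
    then show ?thesis using H_ext[OF h(1)] by simp
  qed
  have id_fixes: "h \<in> H \<and> (\<forall>v\<in>carrier V. h v = v)" if "h = (\<lambda>v\<in>carrier V. v)" for h
    unfolding that using H_id by simp
  have iff: "h \<in> H \<and> (\<forall>v\<in>carrier V. h v = v) \<longleftrightarrow> h = (\<lambda>v\<in>carrier V. v)" for h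
  proof
    assume "h \<in> H \<and> (\<forall>v\<in>carrier V. h v = v)"
    then show "h = (\<lambda>v\<in>carrier V. v)" using fixes_all[of h] by (elim conjE)
  qed (rule id_fixes)
  have "x \<in> L.actker \<longleftrightarrow> x \<in> ({..<k} \<rightarrow>\<^sub>E carrier V) \<times> {\<lambda>v\<in>carrier V. v}" for x
  proof -
    have "x \<in> L.actker \<longleftrightarrow> fst x \<in> {..<k} \<rightarrow>\<^sub>E carrier V \<and> (snd x \<in> H \<and> (\<forall>v\<in>carrier V. snd x v = v))"
      by (cases x) (simp add: L.actker_def P_carrier)
    then show ?thesis unfolding iff by (cases x) simp
  qed
  then show ?thesis by blast
qed

text \<open>The components of the vector part are derivations by the very multiplication rule of the
  semidirect product. Solubility is needed for the cohomological condition.\<close>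

lemma P_crown:
  assumes sol: "solvable (P k)"
  shows "crown (P k) A (\<lambda>x. snd x) k (\<lambda>i. \<lambda>g\<in>carrier (P k). fst g i)"
proof -
  interpret L: linear_action p V "P k" "\<lambda>x. snd x" H by (rule P_linear_action)
  have nt: "L.actker \<noteq> carrier (P k)"
  proof
    assume eq: "L.actker = carrier (P k)"
    have "h = (\<lambda>v\<in>carrier V. v)" if "h \<in> H" for h
    proof -
      have "(\<lambda>i\<in>{..<k}. \<zero>\<^bsub>V\<^esub>, h) \<in> L.actker" unfolding eq using that zero_PiE by (simp add: P_carrier)
      then show ?thesis unfolding P_actker by simp
    qed
    then have "H = {\<lambda>v\<in>carrier V. v}" using H_id by blast
    then show False using H_nontriv by (simp add: Aut_space_eq BijGroup_simps)
  qed
  show ?thesis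
  proof (rule crown.intro[OF L.irr_gmod_axioms], rule crown_axioms.intro)
    show "(\<lambda>g\<in>carrier (P k). fst g i) \<in> L.Z1" if "i < k" for i
      by (rule L.Z1I) (use that in \<open>simp_all add: P_fst P_mult_fst\<close>)
    show "a = \<one>\<^bsub>P k\<^esub>"
      if a: "a \<in> L.actker" and D: "\<And>i. i < k \<Longrightarrow> (\<lambda>g\<in>carrier (P k). fst g i) a = \<one>\<^bsub>A\<^esub>" for a
    proof -
      obtain n where n: "a = (n, \<lambda>v\<in>carrier V. v)" "n \<in> {..<k} \<rightarrow>\<^sub>E carrier V"
        using a P_actker by auto
      have "n i = \<zero>\<^bsub>V\<^esub>" if "i < k" for i using D[OF that] L.actker_carrier[OF a] n by simp
      then have "n = (\<lambda>i\<in>{..<k}. \<zero>\<^bsub>V\<^esub>)" by (intro PiE_ext[OF n(2) zero_PiE]) simp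
      then show ?thesis using n P_one by simp
    qed
    show "\<exists>a\<in>L.actker. \<forall>i<k. (\<lambda>g\<in>carrier (P k). fst g i) a = u i"
      if u: "\<And>i. i < k \<Longrightarrow> u i \<in> carrier A" for u
    proof (intro bexI allI impI)
      show a: "(\<lambda>i\<in>{..<k}. u i, \<lambda>v\<in>carrier V. v) \<in> L.actker" unfolding P_actker using u by auto
      show "(\<lambda>g\<in>carrier (P k). fst g i) (\<lambda>i\<in>{..<k}. u i, \<lambda>v\<in>carrier V. v) = u i" if "i < k" for i
        using L.actker_carrier[OF a] that by simp
    qed
    show "\<exists>v\<in>carrier A. \<forall>g\<in>carrier (P k). \<delta> g = v \<otimes>\<^bsub>A\<^esub> inv\<^bsub>A\<^esub> snd g v"
      if d: "\<delta> \<in> L.Z1" "\<And>a. a \<in> L.actker \<Longrightarrow> \<delta> a = \<one>\<^bsub>A\<^esub>" for \<delta>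
      by (rule L.derivation_inner_if_trivial_on_actker[OF sol prime _ nt d]) (use exponent_p in simp_all)
  qed (rule nt)
qed

text \<open>Generators of \<open>H\<close>, lifted with zero vector part, generate modulo the kernel
  of the projection, and that kernel is \<open>actker\<close>.\<close>

lemma P_generators:
  assumes n: "min_gens HG \<le> n"
  shows "\<exists>ys. set ys \<subseteq> carrier (P k) \<and> length ys = n \<and>
    generate (P k) (set ys \<union> gmod.actker (P k) A (\<lambda>x. snd x)) = carrier (P k)"
proof -
  obtain hs where hs: "set hs \<subseteq> H" "length hs = n" "generate HG (set hs) = H"
    using group.min_gens_le_iff[OF HG_group, of n] n finite_H HG_simps(1) by auto
  let ?ys = "map (\<lambda>h. (\<lambda>i\<in>{..<k}. \<zero>\<^bsub>V\<^esub>, h)) hs"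
  interpret S: group_hom "P k" HG snd
  proof (intro group_hom.intro P_group HG_group, unfold group_hom_axioms_def, rule homI)
    show "snd (x \<otimes>\<^bsub>P k\<^esub> y) = snd x \<otimes>\<^bsub>HG\<^esub> snd y" if "x \<in> carrier (P k)" "y \<in> carrier (P k)" for x y
      using that HG_simps(3)[OF P_snd P_snd] by (simp add: P_mult_snd)
    show "snd x \<in> carrier HG" if "x \<in> carrier (P k)" for x using P_snd[OF that] by simp
  qed
  have yc: "set ?ys \<subseteq> carrier (P k)" 
  proof
    fix x assume "x \<in> set ?ys"
    then obtain h where h: "h \<in> set hs" and x: "x = (\<lambda>i\<in>{..<k}. \<zero>\<^bsub>V\<^esub>, h)"
      unfolding set_map by (rule imageE)
    show "x \<in> carrier (P k)" unfolding P_carrier x by (intro SigmaI zero_PiE subsetD[OF hs(1)] h)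
  qed
  have surj: "snd ` carrier (P k) = carrier HG"
  proof
    show "carrier HG \<subseteq> snd ` carrier (P k)"
    proof
      fix h assume "h \<in> carrier HG"
      then have "(\<lambda>i\<in>{..<k}. \<zero>\<^bsub>V\<^esub>, h) \<in> carrier (P k)"
        using zero_PiE unfolding P_carrier by simp
      then show "h \<in> snd ` carrier (P k)" by (rule rev_image_eqI) simp
    qed
  qed (use S.hom_closed in blast)
  have "snd ` set ?ys = set hs" by (simp add: image_image)
  then have "generate HG (snd ` set ?ys) = carrier HG" using hs(3) HG_simps(1) by simp
  then have "generate (P k) (set ?ys \<union> kernel (P k) HG snd) = carrier (P k)"
    by (rule S.generate_Un_kernel[OF yc surj])
  moreover have "kernel (P k) HG snd = gmod.actker (P k) A (\<lambda>x. snd x)"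
    
  proof -
    have "x \<in> kernel (P k) HG snd \<longleftrightarrow> x \<in> ({..<k} \<rightarrow>\<^sub>E carrier V) \<times> {\<lambda>v\<in>carrier V. v}" for x
      unfolding kernel_def P_carrier HG_simps(2) using H_id by (cases x) (simp, blast)
    then show ?thesis unfolding P_actker by blast
  qed
  ultimately show ?thesis using yc hs(2) by (intro exI[of _ ?ys]) simp
qed

theorem P_psi:
  assumes sol: "solvable (P k)" and d: "min_gens HG < d" and k: "k = End_dim K V H * (d - 2) + 1"
  shows "gen_over_maximal (P k) (d - 1)" "min_gens (P k) = d"
proof -
  interpret L: linear_action p V "P k" "\<lambda>x. snd x" H by (rule P_linear_action)
  interpret C: crown "P k" A "\<lambda>x. snd x" k "\<lambda>i. \<lambda>g\<in>carrier (P k). fst g i" by (rule P_crown[OF sol])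
  \<comment> \<open>A nontrivial \<open>H\<close> needs a generator, so \<open>d \<ge> 2\<close> and
    the subtraction \<open>d - 2\<close> is not truncated.\<close>
  have "carrier HG \<noteq> {\<one>\<^bsub>HG\<^esub>}" using H_nontriv by simp
  then have "min_gens HG \<noteq> 0"
    using group.min_gens_eq_0_iff[OF HG_group] finite_H HG_simps(1) by simp
  then obtain e where e: "d = e + 2" using d by (metis add.commute less_iff_Suc_add add_2_eq_Suc' not0_implies_Suc add_Suc_right add_Suc)
  obtain ys where ys: "set ys \<subseteq> carrier (P k)" "length ys = d - 1"
      "generate (P k) (set ys \<union> L.actker) = carrier (P k)"
  proof -
    have "min_gens HG \<le> d - 1" using d by simp
    from P_generators[OF this, of k] show ?thesis using that by blast
  qed
  let ?r = "End_dim K V H"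
  have "card L.Z1 = card L.Endo ^ k * card (carrier V)" using C.card_Z1 by simp
  also have "\<dots> = card L.Endo ^ (k + ?r)" using L.card_eq_power_End_dim by (simp add: power_add)
  \<comment> \<open>Here the exponent of the theorem is used: with
    \<open>card V = card Endo ^ r\<close>, the factor \<open>card V\<close> in the count of
    derivations adds \<open>r\<close> to \<open>r * (d - 2) + 1\<close>.\<close>
  also have "k + ?r = ?r * (d - 1) + 1" using k e by simp
  also have "card L.Endo ^ (?r * (d - 1) + 1) = card (carrier V) ^ (d - 1) * card L.Endo"
    using L.card_eq_power_End_dim by (simp add: power_mult)
  finally have Z: "card L.Z1 = card (carrier A) ^ (d - 1) * card L.Endo" by simp
  show "gen_over_maximal (P k) (d - 1)" by (rule C.crown_gen_over_maximal[OF sol _ ys]) (simp add: Z)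
  show "min_gens (P k) = d" using C.crown_min_gens[OF sol Z ys] e by simp
qed

theorem psi_eq_min_gens_if_quotient_iso:
  fixes G :: "('g, 'b) monoid_scheme"
  assumes G: "group G" "finite (carrier G)" "solvable G" and d: "min_gens HG < d"
    and iso: "(G Mod frattini G) \<cong> P (End_dim K V H * (d - 2) + 1)"
  shows "psi G = min_gens G"
proof -
  interpret G: group G by (rule G(1))
  let ?k = "End_dim K V H * (d - 2) + 1"
  obtain f where f: "f \<in> iso (G Mod frattini G) (P ?k)" using iso unfolding is_iso_def by blast
  let ?h = "\<lambda>g. f (frattini G #>\<^bsub>G\<^esub> g)"
  interpret Q: group_hom G "G Mod frattini G" "\<lambda>g. frattini G #>\<^bsub>G\<^esub> g"
    by (rule G.r_coset_group_hom[OF G.frattini_normal])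
  have fh: "group_hom (G Mod frattini G) (P ?k) f"
    using f Q.H.is_group P_group by (auto simp: group_hom_def group_hom_axioms_def iso_def)
  interpret f: group_hom "G Mod frattini G" "P ?k" f by (rule fh)
  have Qc: "carrier (G Mod frattini G) = (\<lambda>g. frattini G #>\<^bsub>G\<^esub> g) ` carrier G" by (rule carrier_FactGroup)
  have bij: "bij_betw f (carrier (G Mod frattini G)) (carrier (P ?k))" using f by (simp add: iso_def)
  have hom: "?h \<in> hom G (P ?k)"
  proof (rule homI)
    show "?h (x \<otimes>\<^bsub>G\<^esub> y) = ?h x \<otimes>\<^bsub>P ?k\<^esub> ?h y" if xy: "x \<in> carrier G" "y \<in> carrier G" for x y
      using Q.hom_mult[OF xy] f.hom_mult[OF Q.hom_closed[OF xy(1)] Q.hom_closed[OF xy(2)]] by simp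
  qed (use f.hom_closed Q.hom_closed in blast)
  interpret h: group_hom G "P ?k" ?h
    by (intro group_hom.intro G(1) P_group, unfold group_hom_axioms_def) (rule hom)
  have surj: "?h ` carrier G = carrier (P ?k)"
    using bij Qc by (auto simp: bij_betw_def image_image)
  have ker: "kernel G (P ?k) ?h \<subseteq> frattini G"
  proof
    fix g assume "g \<in> kernel G (P ?k) ?h"
    then have g: "g \<in> carrier G" "?h g = \<one>\<^bsub>P ?k\<^esub>" by (auto simp: kernel_def)
    have "f (frattini G #>\<^bsub>G\<^esub> g) = f \<one>\<^bsub>G Mod frattini G\<^esub>" using g(2) f.hom_one by simp
    then have "frattini G #>\<^bsub>G\<^esub> g = \<one>\<^bsub>G Mod frattini G\<^esub>"
      
      by (rule inj_onD[OF bij_betw_imp_inj_on[OF bij]]) (use Q.hom_closed[OF g(1)] Q.H.one_closed in blast)+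
    then have "frattini G #>\<^bsub>G\<^esub> g = frattini G" by simp
    then show "g \<in> frattini G" using G.rcos_self[OF g(1) G.frattini_subgroup] by simp
  qed
  have sol: "solvable (P ?k)"
    using h.solvable_imp_solvable_img[of "carrier G"] G(3) surj unfolding solvable_def by simp
  have mg: "min_gens G = d" using h.min_gens_image_eq[OF G(2) surj ker] P_psi(2)[OF sol d refl] by simp
  have "gen_over_maximal G (min_gens G - 1)"
    unfolding mg by (rule h.gen_over_maximal_lift[OF G(2) surj ker P_psi(1)[OF sol d refl]])
  moreover have "carrier G \<noteq> {\<one>\<^bsub>G\<^esub>}" using mg d G.min_gens_eq_0_iff[OF G(2)] by auto
  ultimately show ?thesis using G.psi_eq_min_gensI[OF G(2)] by blast
qed

end

section \<open>Groups satisfying psi = d\<close>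

text \<open>\<open>K\<close> is a minimal normal subgroup, viewed as the module \<open>V\<close>.\<close>

locale extendable = irr_gmod_chief +
  fixes n :: nat
  assumes pi_ker: "\<lbrakk>a \<in> K; \<pi> a = \<one>\<^bsub>V\<^esub>\<rbrakk> \<Longrightarrow> a = \<one>"
    and extend: "\<lbrakk>x \<in> carrier G; x \<noteq> \<one>\<rbrakk> \<Longrightarrow>
      \<exists>zs. set zs \<subseteq> carrier G \<and> length zs = n \<and> generate G (insert x (set zs)) = carrier G"
    and not_gen: "\<lbrakk>set zs \<subseteq> carrier G; length zs = n\<rbrakk> \<Longrightarrow> generate G (set zs) \<noteq> carrier G"
begin

lemma K_actker: "K \<subseteq> actker"
  using K_act K_carrier by (auto simp: actker_def)

lemma card_V_power_pos: "card (carrier V) ^ m > 0"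
  using finV V.one_closed by (auto simp: card_gt_0_iff)

text \<open>Any nontrivial element of \<open>K\<close> extends by \<open>n\<close> elements to a
  generating tuple, and modulo \<open>K\<close> that element disappears.\<close>

lemma K_generators: "\<exists>ys. set ys \<subseteq> carrier G \<and> length ys = n \<and> generate G (set ys \<union> K) = carrier G"
proof -
  have "\<exists>v\<in>carrier V. v \<noteq> \<one>\<^bsub>V\<^esub>" using V_nontriv V.one_closed by blast
  then obtain v where v: "v \<in> carrier V" "v \<noteq> \<one>\<^bsub>V\<^esub>" by blast
  then have "v \<in> \<pi> ` K" using pi_surj by simp
  then obtain k where k: "k \<in> K" "v = \<pi> k" by blast
  then have "k \<noteq> \<one>" using pi_one v by metis
  from extend[OF K_carrier[OF k(1)] this]
  obtain ys where ys: "set ys \<subseteq> carrier G" "length ys = n" "generate G (insert k (set ys)) = carrier G"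
    by (elim exE conjE)
  have sub: "set ys \<union> K \<subseteq> carrier G" using ys(1) K_carrier by blast
  have "generate G (insert k (set ys)) \<subseteq> generate G (set ys \<union> K)"
    by (rule mono_generate) (use k(1) in blast)
  then have "generate G (set ys \<union> K) = carrier G"
    using ys(3) generate_in_carrier[OF sub] by blast
  then show ?thesis using ys by blast
qed

text \<open>Here \<pi> is an isomorphism, so a derivation, being an equivariant homomorphism on
  \<open>K\<close>, can be carried over to \<open>V\<close>.\<close>

lemma Z1_restrict_K:
  assumes d: "\<delta> \<in> Z1"
  shows "\<exists>f\<in>Endo. \<forall>k\<in>K. \<delta> k = f (\<pi> k)"
proof -
  let ?s = "inv_into K \<pi>"
  have s: "?s v \<in> K" "\<pi> (?s v) = v" if "v \<in> carrier V" for v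
    using that pi_surj inv_into_into[of v \<pi> K] f_inv_into_f[of v \<pi> K] by auto
  have inj: "a = b" if ab: "a \<in> K" "b \<in> K" "\<pi> a = \<pi> b" for a b
  proof -
    have "\<pi> (a \<otimes> inv b) = \<one>\<^bsub>V\<^esub>"
      using pi_mult[OF ab(1) K_closed(2)[OF ab(2)]] pi_inv[OF ab(2)] ab pi_closed by simp
    then have "a \<otimes> inv b = \<one>" by (rule pi_ker[OF K_closed(1)[OF ab(1) K_closed(2)[OF ab(2)]]])
    then show ?thesis using inv_solve_right'[of \<one> a b] K_carrier ab by simp
  qed
  have s_pi: "?s (\<pi> k) = k" if "k \<in> K" for k
    by (rule inj) (use s[OF pi_closed[OF that]] that in auto)
  have mult: "\<delta> (a \<otimes> b) = \<delta> a \<otimes>\<^bsub>V\<^esub> \<delta> b" if "a \<in> K" "b \<in> K" for a b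
    by (rule Z1_actker_mult[OF d subsetD[OF K_actker that(1)] K_carrier[OF that(2)]])
  have "(\<lambda>v\<in>carrier V. \<delta> (?s v)) \<in> Endo"
  proof (rule EndoI)
    show "\<delta> (?s v) \<in> carrier V" if "v \<in> carrier V" for v using d K_carrier[OF s(1)[OF that]] by simp
    show "\<delta> (?s (v \<otimes>\<^bsub>V\<^esub> w)) = \<delta> (?s v) \<otimes>\<^bsub>V\<^esub> \<delta> (?s w)" if v: "v \<in> carrier V" and w: "w \<in> carrier V" for v w
    proof -
      have "v \<otimes>\<^bsub>V\<^esub> w = \<pi> (?s v \<otimes> ?s w)" using pi_mult[OF s(1)[OF v] s(1)[OF w]] s v w by simp
      then have "?s (v \<otimes>\<^bsub>V\<^esub> w) = ?s v \<otimes> ?s w"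
        using s_pi[OF K_closed(1)[OF s(1)[OF v] s(1)[OF w]]] by simp
      then show ?thesis using mult[OF s(1)[OF v] s(1)[OF w]] by simp
    qed
    show "\<delta> (?s (act g v)) = act g (\<delta> (?s v))" if g: "g \<in> carrier G" and v: "v \<in> carrier V" for g v
    proof -
      have "act g v = \<pi> (g \<otimes> ?s v \<otimes> inv g)" using pi_conj[OF g s(1)[OF v]] s(2)[OF v] by simp
      then have "?s (act g v) = g \<otimes> ?s v \<otimes> inv g"
        using s_pi[OF K_conj[OF g s(1)[OF v]]] by simp
      then show ?thesis using Z1_actker_conj[OF d g subsetD[OF K_actker s(1)[OF v]]] by simp
    qed
  qed
  then show ?thesis by (rule bexI[rotated]) (use s_pi in simp)
qed

text \<open>If there were fewer, averaging over \<open>K\<close> would lift \<open>n\<close>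
  generators modulo \<open>K\<close> to elements avoiding all of them. By the dichotomy these would
  generate \<open>G\<close>, although \<open>n\<close> elements never do.\<close>

lemma card_derivations_extending_pi:
  "card (carrier V) ^ n \<le> card {\<delta> \<in> Z1. \<forall>k\<in>K. \<delta> k = \<pi> k}" (is "_ \<le> card ?D")
proof (rule ccontr)
  assume "\<not> ?thesis"
  then have less: "card ?D < card (carrier V) ^ n" by simp
  obtain ys where ys: "set ys \<subseteq> carrier G" "length ys = n" "generate G (set ys \<union> K) = carrier G"
    using K_generators by blast
  have "\<exists>zs. list_all2 (\<lambda>y z. \<exists>b\<in>K. z = b \<otimes> y) ys zs \<and> (\<forall>\<delta>\<in>?D. \<exists>z\<in>set zs. \<delta> z \<noteq> \<one>\<^bsub>V\<^esub>)"
  proof (rule avoid_derivations[OF K_subgroup K_actker _ _ _ _ ys(1)])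
    show "finite ?D" using finite_Z1 by simp
    show "\<delta> ` K = carrier V" if "\<delta> \<in> ?D" for \<delta>
    proof -
      have "\<delta> ` K = \<pi> ` K" by (rule image_cong[OF refl]) (use that in blast)
      then show ?thesis using pi_surj by simp
    qed
    show "card ?D < card (carrier V) ^ length ys" using less ys(2) by simp
  qed blast
  then obtain zs where zs: "list_all2 (\<lambda>y z. \<exists>b\<in>K. z = b \<otimes> y) ys zs"
      "\<forall>\<delta>\<in>?D. \<exists>z\<in>set zs. \<delta> z \<noteq> \<one>\<^bsub>V\<^esub>" by blast
  have zc: "set zs \<subseteq> carrier G"
    by (rule list_all2_left_mult_closed[OF subgroup_self subgroup.subset[OF K_subgroup] ys(1) zs(1)])
  have len: "length zs = n" using list_all2_lengthD[OF zs(1)] ys(2) by simp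
  let ?L = "generate G (set zs)"
  have L: "subgroup ?L G" by (rule generate_is_subgroup[OF zc])
  have "\<exists>k\<in>K. \<exists>l\<in>?L. g = k \<otimes> l" if g: "g \<in> carrier G" for g
  proof (rule normal_supplementI[OF K_normal L ys(3) _ g])
    fix s assume "s \<in> set ys \<union> K"
    then show "\<exists>k\<in>K. \<exists>l\<in>?L. s = k \<otimes> l"
    proof
      assume "s \<in> set ys"
      from list_all2_left_mult_supplement[OF K_subgroup ys(1) zs(1) this]
      show ?thesis using generate_sincl[of "set zs"] by blast
    next
      assume s: "s \<in> K"
      then have "s = s \<otimes> \<one>" using K_carrier by simp
      then show ?thesis using s subgroup.one_closed[OF L] by blast
    qed
  qed
  from supplement_dichotomy[OF L this]
  show False
  proof
    assume *: "\<forall>g\<in>carrier G. \<exists>k\<in>K. \<exists>l\<in>?L. \<pi> k = \<one>\<^bsub>V\<^esub> \<and> g = k \<otimes> l"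
    have "g \<in> ?L" if g: "g \<in> carrier G" for g
    proof -
      obtain k l where kl: "k \<in> K" "l \<in> ?L" "\<pi> k = \<one>\<^bsub>V\<^esub>" "g = k \<otimes> l" using * g by blast
      then show ?thesis using pi_ker[OF kl(1,3)] subgroup.mem_carrier[OF L kl(2)] by simp
    qed
    then have "?L = carrier G" using subgroup.subset[OF L] by blast
    then show False using not_gen[OF zc len] by blast
  next
    assume "\<exists>\<delta>\<in>Z1. (\<forall>l\<in>?L. \<delta> l = \<one>\<^bsub>V\<^esub>) \<and> (\<forall>k\<in>K. \<delta> k = \<pi> k)"
    then obtain \<delta> where "\<delta> \<in> ?D" "\<forall>l\<in>?L. \<delta> l = \<one>\<^bsub>V\<^esub>" by blast
    then show False using zs(2) generate_sincl[of "set zs"] by blast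
  qed
qed

text \<open>Restriction to \<open>K\<close> maps derivations to endomorphisms. Its kernel has at
  most \<open>card V ^ n\<close> elements, since \<open>K\<close> and \<open>n\<close> further
  elements generate; the fibre over the identity has at least that many and is a translate of the
  kernel. Composing one extension of \<pi> with endomorphisms shows that restriction is
  onto.\<close>

lemma card_Z1_eq: "card Z1 = card Endo * card (carrier V) ^ n"
proof -
  let ?D = "{\<delta> \<in> Z1. \<forall>k\<in>K. \<delta> k = \<pi> k}" and ?Z = "{\<delta> \<in> Z1. \<forall>k\<in>K. \<delta> k = \<one>\<^bsub>V\<^esub>}"
  have finZ: "finite ?Z" using finite_Z1 by simp
  have "0 < card ?D" by (rule less_le_trans[OF card_V_power_pos card_derivations_extending_pi])
  then have "?D \<noteq> {}" by (rule_tac notI) (simp only: card.empty)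
  then obtain \<delta>0 where "\<delta>0 \<in> ?D" by blast
  then have d0: "\<delta>0 \<in> Z1" "\<And>k. k \<in> K \<Longrightarrow> \<delta>0 k = \<pi> k" by auto
  obtain ys where ys: "set ys \<subseteq> carrier G" "length ys = n" "generate G (set ys \<union> K) = carrier G"
    using K_generators by blast
  have "card ?Z \<le> card (carrier V) ^ length ys"
    by (rule card_Z1_le_power[OF _ subgroup.subset[OF K_subgroup] _ ys(1,3)]) auto
  moreover have "card ?D \<le> card ?Z"
  proof (rule card_inj_on_le[OF _ _ finZ])
    let ?h = "\<lambda>\<delta>. \<lambda>g\<in>carrier G. \<delta> g \<otimes>\<^bsub>V\<^esub> inv\<^bsub>V\<^esub> \<delta>0 g"
    show "inj_on ?h ?D"
    proof (rule inj_onI)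
      fix \<delta> \<epsilon> assume de: "\<delta> \<in> ?D" "\<epsilon> \<in> ?D" and eq: "?h \<delta> = ?h \<epsilon>"
      show "\<delta> = \<epsilon>"
      proof (rule Z1_ext)
        show "\<delta> g = \<epsilon> g" if g: "g \<in> carrier G" for g
          using fun_cong[OF eq, of g] g de d0(1) by (simp add: V.r_cancel)
      qed (use de in auto)
    qed
    show "?h ` ?D \<subseteq> ?Z"
    proof (intro image_subsetI CollectI conjI ballI)
      fix \<delta> assume d: "\<delta> \<in> ?D"
      then show "?h \<delta> \<in> Z1" by (intro Z1_diff d0(1)) simp
      show "?h \<delta> k = \<one>\<^bsub>V\<^esub>" if "k \<in> K" for k using d d0(2)[OF that] that K_carrier[OF that] by simp
    qed
  qed
  ultimately have cZ: "card ?Z = card (carrier V) ^ n"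
    using card_derivations_extending_pi ys(2) by simp
  let ?f = "\<lambda>(f, \<epsilon>). \<lambda>g\<in>carrier G. f (\<delta>0 g) \<otimes>\<^bsub>V\<^esub> \<epsilon> g"
  have "bij_betw ?f (Endo \<times> ?Z) Z1"
    unfolding bij_betw_def
  proof
    show "inj_on ?f (Endo \<times> ?Z)"
    proof (rule inj_onI, clarify)
      fix f \<epsilon> f' \<epsilon>'
      assume f: "f \<in> Endo" "f' \<in> Endo" and e: "\<epsilon> \<in> Z1" "\<forall>k\<in>K. \<epsilon> k = \<one>\<^bsub>V\<^esub>" "\<epsilon>' \<in> Z1" "\<forall>k\<in>K. \<epsilon>' k = \<one>\<^bsub>V\<^esub>"
        and eq: "(\<lambda>g\<in>carrier G. f (\<delta>0 g) \<otimes>\<^bsub>V\<^esub> \<epsilon> g) = (\<lambda>g\<in>carrier G. f' (\<delta>0 g) \<otimes>\<^bsub>V\<^esub> \<epsilon>' g)"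
      have eq': "f (\<delta>0 g) \<otimes>\<^bsub>V\<^esub> \<epsilon> g = f' (\<delta>0 g) \<otimes>\<^bsub>V\<^esub> \<epsilon>' g" if "g \<in> carrier G" for g
        using fun_cong[OF eq, of g] that by simp
      have ff: "f = f'"
      proof (rule Endo_ext[OF f])
        fix v assume "v \<in> carrier V"
        then obtain k where k: "k \<in> K" "v = \<pi> k" using pi_surj by blast
        show "f v = f' v"
          using eq'[OF K_carrier[OF k(1)]] d0(2)[OF k(1)] k e f by simp
      qed
      moreover have "\<epsilon> = \<epsilon>'"
        by (rule Z1_ext[OF e(1,3)]) (use eq' e f d0(1) in \<open>simp add: ff\<close>)
      ultimately show "f = f' \<and> \<epsilon> = \<epsilon>'" by blast
    qed
    show "?f ` (Endo \<times> ?Z) = Z1"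
    proof
      show "?f ` (Endo \<times> ?Z) \<subseteq> Z1"
      proof (rule image_subsetI, clarify)
        fix f \<epsilon> assume f: "f \<in> Endo" and e: "\<epsilon> \<in> Z1"
        have "(\<lambda>g\<in>carrier G. (\<lambda>g\<in>carrier G. f (\<delta>0 g)) g \<otimes>\<^bsub>V\<^esub> \<epsilon> g) \<in> Z1"
          by (rule Z1_add[OF Endo_Z1[OF f d0(1)] e])
        moreover have "(\<lambda>g\<in>carrier G. (\<lambda>g\<in>carrier G. f (\<delta>0 g)) g \<otimes>\<^bsub>V\<^esub> \<epsilon> g) =
            (\<lambda>g\<in>carrier G. f (\<delta>0 g) \<otimes>\<^bsub>V\<^esub> \<epsilon> g)" by (rule restrict_ext) simp
        ultimately show "(\<lambda>g\<in>carrier G. f (\<delta>0 g) \<otimes>\<^bsub>V\<^esub> \<epsilon> g) \<in> Z1" by simp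
      qed
      show "Z1 \<subseteq> ?f ` (Endo \<times> ?Z)"
      proof
        fix \<delta> assume d: "\<delta> \<in> Z1"
        then obtain f where f: "f \<in> Endo" "\<And>k. k \<in> K \<Longrightarrow> \<delta> k = f (\<pi> k)" using Z1_restrict_K by blast
        let ?e = "\<lambda>g\<in>carrier G. \<delta> g \<otimes>\<^bsub>V\<^esub> inv\<^bsub>V\<^esub> (\<lambda>g\<in>carrier G. f (\<delta>0 g)) g"
        have e: "?e \<in> Z1" by (rule Z1_diff[OF d Endo_Z1[OF f(1) d0(1)]])
        have "?e k = \<one>\<^bsub>V\<^esub>" if "k \<in> K" for k
          using f(2)[OF that] d0(2)[OF that] K_carrier[OF that] Endo_closed[OF f(1) pi_closed[OF that]] by simp
        then have eZ: "?e \<in> ?Z" using e by blast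
        have "\<delta> = ?f (f, ?e)"
        proof (rule Z1_ext[OF d])
          have "?f (f, ?e) \<in> ?f ` (Endo \<times> ?Z)" using f(1) eZ by blast
          then show "?f (f, ?e) \<in> Z1" using \<open>?f ` (Endo \<times> ?Z) \<subseteq> Z1\<close> by blast
          fix g assume g: "g \<in> carrier G"
          have c: "\<delta> g \<in> carrier V" "f (\<delta>0 g) \<in> carrier V" using d f(1) d0(1) g by simp_all
          then have "\<delta> g = f (\<delta>0 g) \<otimes>\<^bsub>V\<^esub> (\<delta> g \<otimes>\<^bsub>V\<^esub> inv\<^bsub>V\<^esub> f (\<delta>0 g))"
            by (simp add: V.m_lcomm)
          then show "\<delta> g = ?f (f, ?e) g" using g by simp
        qed
        then show "\<delta> \<in> ?f ` (Endo \<times> ?Z)" using f(1) eZ by blast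
      qed
    qed
  qed
  then have "card (Endo \<times> ?Z) = card Z1" by (rule bij_betw_same_card)
  then show ?thesis using cZ by (simp add: card_cartesian_product)
qed

text \<open>If all derivations vanished at some nontrivial \<open>x\<close>, the other
  \<open>n\<close> entries of a generating tuple through \<open>x\<close> would determine them, and
  there would be at most \<open>card V ^ n\<close> of them.\<close>

lemma Z1_separates:
  assumes x: "x \<in> carrier G" "\<And>\<delta>. \<delta> \<in> Z1 \<Longrightarrow> \<delta> x = \<one>\<^bsub>V\<^esub>" shows "x = \<one>"
proof (rule ccontr)
  assume "x \<noteq> \<one>"
  then obtain zs where zs: "set zs \<subseteq> carrier G" "length zs = n" "generate G (insert x (set zs)) = carrier G"
    using extend x(1) by blast
  have "card Z1 \<le> card (carrier V) ^ length zs"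
    by (rule card_Z1_le_power[of _ "{x}"]) (use x zs in simp_all)
  moreover have "card (carrier V) ^ n > 0" by (rule card_V_power_pos)
  moreover have "2 * card (carrier V) ^ n \<le> card Endo * card (carrier V) ^ n"
    by (rule mult_le_mono1[OF card_Endo_ge_2])
  ultimately show False unfolding card_Z1_eq zs(2) by linarith
qed

lemma common_zeros_normal:
  assumes S: "S \<subseteq> Z1" shows "{a \<in> actker. \<forall>\<delta>\<in>S. \<delta> a = \<one>\<^bsub>V\<^esub>} \<lhd> G" (is "?B \<lhd> G")
proof (rule normal_invI)
  have Z: "\<delta> \<in> Z1" if "\<delta> \<in> S" for \<delta> using S that by blast
  show "subgroup ?B G"
  proof (rule subgroupI)
    show "?B \<subseteq> carrier G" using actker_carrier by blast
    have "\<one> \<in> ?B" using Z actker_closed by simp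
    then show "?B \<noteq> {}" by blast
    fix a assume a: "a \<in> ?B"
    have "\<delta> (inv a) = \<one>\<^bsub>V\<^esub>" if d: "\<delta> \<in> S" for \<delta>
    proof -
      have "\<delta> a = \<one>\<^bsub>V\<^esub>" using a d by blast
      then show ?thesis using Z1_inv[OF Z[OF d] actker_carrier[of a]] actker_carrier[of a] a by simp
    qed
    then show "inv a \<in> ?B" using a actker_closed by blast
    fix b assume "b \<in> ?B"
    then have b: "b \<in> actker" "\<And>\<delta>. \<delta> \<in> S \<Longrightarrow> \<delta> b = \<one>\<^bsub>V\<^esub>" by auto
    have "\<delta> (a \<otimes> b) = \<one>\<^bsub>V\<^esub>" if d: "\<delta> \<in> S" for \<delta>
    proof -
      have "\<delta> a = \<one>\<^bsub>V\<^esub>" using a d by blast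
      then show ?thesis using Z1_actker_mult[OF Z[OF d] _ actker_carrier[OF b(1)], of a] a b(2)[OF d] by simp
    qed
    then show "a \<otimes> b \<in> ?B" using a b actker_closed by blast
  qed
  fix x h assume x: "x \<in> carrier G" and h: "h \<in> ?B"
  have "\<delta> (x \<otimes> h \<otimes> inv x) = \<one>\<^bsub>V\<^esub>" if d: "\<delta> \<in> S" for \<delta>
  proof -
    have "\<delta> h = \<one>\<^bsub>V\<^esub>" using h d by blast
    then show ?thesis using Z1_actker_conj[OF Z[OF d] x, of h] h x by simp
  qed
  then show "x \<otimes> h \<otimes> inv x \<in> ?B" using actker_conj[OF x] h by blast
qed

text \<open>\<open>D\<close> enumerates a minimal family of derivations separating the points of \<open>actker\<close>;
  minimality yields the surjectivity.\<close>

lemma ex_coordinates: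
  "\<exists>(k::nat) D. (\<forall>i<k. D i \<in> Z1) \<and> (\<forall>a\<in>actker. (\<forall>i<k. D i a = \<one>\<^bsub>V\<^esub>) \<longrightarrow> a = \<one>) \<and>
    (\<forall>u. (\<forall>i<k. u i \<in> carrier V) \<longrightarrow> (\<exists>a\<in>actker. \<forall>i<k. D i a = u i))"
proof -
  let ?P = "\<lambda>S. S \<subseteq> Z1 \<and> (\<forall>a\<in>actker. (\<forall>\<delta>\<in>S. \<delta> a = \<one>\<^bsub>V\<^esub>) \<longrightarrow> a = \<one>)"
  have "?P Z1" using Z1_separates actker_carrier by blast
  from ex_has_least_nat[of ?P, OF this, of card]
  obtain S where S: "?P S" and min: "\<And>T. ?P T \<Longrightarrow> card S \<le> card T" by blast
  have finS: "finite S" using S finite_subset[OF _ finite_Z1] by blast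
  let ?B = "\<lambda>\<delta>. {a \<in> actker. \<forall>\<epsilon>\<in>S - {\<delta>}. \<epsilon> a = \<one>\<^bsub>V\<^esub>}"
  \<comment> \<open>Without \<delta> the family no longer separates, so some nontrivial element is
    killed by all other members. It is not killed by \<delta>, whose image on the common kernel of
    the others is therefore everything.\<close>
  have full: "\<delta> ` ?B \<delta> = carrier V" if d: "\<delta> \<in> S" for \<delta>
  proof -
    have "card (S - {\<delta>}) < card S" using finS d by (rule card_Diff1_less)
    then have "\<not> ?P (S - {\<delta>})" using min leD by blast
    then obtain b where b: "b \<in> actker" "\<forall>\<epsilon>\<in>S - {\<delta>}. \<epsilon> b = \<one>\<^bsub>V\<^esub>" "b \<noteq> \<one>" using S by blast
    then have "\<delta> b \<noteq> \<one>\<^bsub>V\<^esub>" using S by blast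
    moreover have "b \<in> ?B \<delta>" using b by blast
    moreover have "?B \<delta> \<lhd> G" by (rule common_zeros_normal) (use S in blast)
    ultimately show ?thesis using Z1_image_full[of "?B \<delta>" \<delta> b] S d by blast
  qed
  have surj: "\<exists>a\<in>actker. \<forall>\<delta>\<in>S. \<delta> a = (if \<delta> \<in> T then u \<delta> else \<one>\<^bsub>V\<^esub>)"
    if T: "T \<subseteq> S" and u: "\<And>\<delta>. \<delta> \<in> S \<Longrightarrow> u \<delta> \<in> carrier V" for T u
    using finite_subset[OF T finS] T
  proof (induction T rule: finite_induct)
    case empty
    have "\<forall>\<delta>\<in>S. \<delta> \<one> = \<one>\<^bsub>V\<^esub>" using S Z1_one by blast
    then show ?case using actker_closed(3) by auto
  next
    case (insert \<tau> T)
    then obtain a where a: "a \<in> actker" "\<forall>\<delta>\<in>S. \<delta> a = (if \<delta> \<in> T then u \<delta> else \<one>\<^bsub>V\<^esub>)" by blast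
    have t: "\<tau> \<in> S" using insert by blast
    have "u \<tau> \<in> \<tau> ` ?B \<tau>" using full[OF t] u[OF t] by blast
    then obtain b where b: "b \<in> actker" "\<forall>\<epsilon>\<in>S - {\<tau>}. \<epsilon> b = \<one>\<^bsub>V\<^esub>" "\<tau> b = u \<tau>"
    proof (elim imageE CollectE conjE)
      fix x assume "u \<tau> = \<tau> x" "x \<in> actker" "\<forall>\<epsilon>\<in>S - {\<tau>}. \<epsilon> x = \<one>\<^bsub>V\<^esub>"
      then show thesis by (intro that[of x]) (assumption, assumption, rule sym)
    qed
    have "\<delta> (a \<otimes> b) = (if \<delta> \<in> insert \<tau> T then u \<delta> else \<one>\<^bsub>V\<^esub>)" if d: "\<delta> \<in> S" for \<delta>
    proof -
      have dZ: "\<delta> \<in> Z1" using S d by blast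
      have eq: "\<delta> (a \<otimes> b) = \<delta> a \<otimes>\<^bsub>V\<^esub> \<delta> b" by (rule Z1_actker_mult[OF dZ a(1) actker_carrier[OF b(1)]])
      show ?thesis
      proof (cases "\<delta> = \<tau>")
        case True
        then have "\<delta> a = \<one>\<^bsub>V\<^esub>" using bspec[OF a(2) t] insert.hyps(2) by simp
        then show ?thesis using eq True b(3) u[OF t] by simp
      next
        case False
        then have "\<delta> b = \<one>\<^bsub>V\<^esub>" using b(2) d by blast
        moreover have "\<delta> a = (if \<delta> \<in> T then u \<delta> else \<one>\<^bsub>V\<^esub>)" using a(2) d by blast
        ultimately show ?thesis using eq False u[OF d] by simp
      qed
    qed
    then show ?case using actker_closed(1)[OF a(1) b(1)] by blast
  qed
  obtain D where D: "bij_betw D {..<card S} S"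
    using ex_bij_betw_nat_finite[OF finS] by (auto simp: lessThan_atLeast0)
  let ?i = "inv_into {..<card S} D"
  have DS: "D i \<in> S" if "i < card S" for i using bij_betwE[OF D] that by blast
  have Di: "?i (D i) = i" if "i < card S" for i using bij_betw_inv_into_left[OF D] that by simp
  have iS: "?i \<delta> < card S" "D (?i \<delta>) = \<delta>" if "\<delta> \<in> S" for \<delta>
    using bij_betwE[OF bij_betw_inv_into[OF D]] bij_betw_inv_into_right[OF D] that by auto
  have "a = \<one>" if a: "a \<in> actker" and z: "\<forall>i<card S. D i a = \<one>\<^bsub>V\<^esub>" for a
  proof -
    have "\<delta> a = \<one>\<^bsub>V\<^esub>" if d: "\<delta> \<in> S" for \<delta> using z iS[OF d] by metis
    then show ?thesis using S a by blast
  qed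
  then have inj: "\<forall>a\<in>actker. (\<forall>i<card S. D i a = \<one>\<^bsub>V\<^esub>) \<longrightarrow> a = \<one>" by blast
  have "\<exists>a\<in>actker. \<forall>i<card S. D i a = u i" if u: "\<forall>i<card S. u i \<in> carrier V" for u
  proof -
    have "\<exists>a\<in>actker. \<forall>\<delta>\<in>S. \<delta> a = (if \<delta> \<in> S then u (?i \<delta>) else \<one>\<^bsub>V\<^esub>)"
      by (rule surj[OF subset_refl]) (use u iS in blast)
    then obtain a where a: "a \<in> actker" "\<forall>\<delta>\<in>S. \<delta> a = (if \<delta> \<in> S then u (?i \<delta>) else \<one>\<^bsub>V\<^esub>)" by blast
    have "D i a = u i" if i: "i < card S" for i using bspec[OF a(2) DS[OF i]] DS[OF i] Di[OF i] by simp
    then show ?thesis using a(1) by blast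
  qed
  moreover have "\<forall>i<card S. D i \<in> Z1" using DS S by blast
  ultimately show ?thesis using inj by (intro exI[of _ "card S"] exI[of _ D]) blast
qed

lemma ex_crown:
  fixes p :: nat
  assumes sol: "solvable G" and p: "Factorial_Ring.prime p"
    and exp: "\<And>v. v \<in> carrier V \<Longrightarrow> v [^]\<^bsub>V\<^esub> p = \<one>\<^bsub>V\<^esub>" and nt: "actker \<noteq> carrier G"
  shows "\<exists>k D. crown G V act k D"
proof -
  obtain k :: nat and D where D: "\<forall>i<k. D i \<in> Z1" "\<forall>a\<in>actker. (\<forall>i<k. D i a = \<one>\<^bsub>V\<^esub>) \<longrightarrow> a = \<one>"
      "\<forall>u. (\<forall>i<k. u i \<in> carrier V) \<longrightarrow> (\<exists>a\<in>actker. \<forall>i<k. D i a = u i)"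
    using ex_coordinates by blast
  have "crown G V act k D"
  proof (rule crown.intro[OF irr_gmod_axioms], rule crown_axioms.intro)
    show "D i \<in> Z1" if "i < k" for i using D(1) that by blast
    show "a = \<one>" if "a \<in> actker" "\<And>i. i < k \<Longrightarrow> D i a = \<one>\<^bsub>V\<^esub>" for a using D(2) that by blast
    show "\<exists>a\<in>actker. \<forall>i<k. D i a = u i" if "\<And>i. i < k \<Longrightarrow> u i \<in> carrier V" for u using D(3) that by blast
    show "actker \<noteq> carrier G" by (rule nt)
    show "\<exists>v\<in>carrier V. \<forall>g\<in>carrier G. \<delta> g = v \<otimes>\<^bsub>V\<^esub> inv\<^bsub>V\<^esub> act g v"
      if "\<delta> \<in> Z1" "\<And>a. a \<in> actker \<Longrightarrow> \<delta> a = \<one>\<^bsub>V\<^esub>" for \<delta>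
      by (rule derivation_inner_if_trivial_on_actker[OF sol p exp nt that])
  qed
  then show ?thesis by blast
qed

text \<open>With trivial action, derivations are homomorphisms into a group of exponent
  \<open>p\<close>. They all kill p-th powers, and since they separate points, \<open>G\<close>
  itself has exponent \<open>p\<close>.\<close>

lemma order_prime_power_if_central:
  fixes p :: nat
  assumes p: "Factorial_Ring.prime p"
    and exp: "\<And>v. v \<in> carrier V \<Longrightarrow> v [^]\<^bsub>V\<^esub> p = \<one>\<^bsub>V\<^esub>" and tr: "actker = carrier G"
  shows "\<exists>m. order G = p ^ m"
proof (rule order_prime_power_if_exponent[OF finG p])
  fix x assume x: "x \<in> carrier G"
  show "x [^] p = \<one>"
  proof (rule Z1_separates)
    fix \<delta> assume d: "\<delta> \<in> Z1"
    have "\<delta> (x [^] m) = \<delta> x [^]\<^bsub>V\<^esub> m" for m :: nat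
    proof (induction m)
      case (Suc m)
      have "\<delta> (x [^] m \<otimes> x) = \<delta> (x [^] m) \<otimes>\<^bsub>V\<^esub> \<delta> x"
        by (rule Z1_actker_mult[OF d _ x]) (use x tr in simp)
      then show ?case using Suc by simp
    qed (use d in simp)
    then show "\<delta> (x [^] p) = \<one>\<^bsub>V\<^esub>" using exp d x by simp
  qed (use x in simp)
qed

end

section \<open>Prime exponent and a standard copy of an irreducible module\<close>

context irr_gmod begin

text \<open>For a prime divisor of the order, the vectors of exponent \<open>p\<close> form a
  submodule, nontrivial by Cauchy's theorem.\<close>

lemma ex_exponent_prime:
  "\<exists>p::nat. Factorial_Ring.prime p \<and> (\<forall>v\<in>carrier V. v [^]\<^bsub>V\<^esub> p = \<one>\<^bsub>V\<^esub>)"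
proof -
  have "card (carrier V) \<noteq> 1"
  proof
    assume "card (carrier V) = 1"
    then obtain v where v: "carrier V = {v}" by (rule card_1_singletonE)
    then show False using V.one_closed V_nontriv by simp
  qed
  then obtain p :: nat where p: "Factorial_Ring.prime p" "p dvd order V"
    using prime_factor_nat[of "card (carrier V)"] unfolding Coset.order_def by blast
  obtain v where v: "v \<in> carrier V" "v \<noteq> \<one>\<^bsub>V\<^esub>" "v [^]\<^bsub>V\<^esub> p = \<one>\<^bsub>V\<^esub>"
    using V.cauchy_prime_order[OF finV p] by blast
  let ?W = "{v \<in> carrier V. v [^]\<^bsub>V\<^esub> p = \<one>\<^bsub>V\<^esub>}"
  have "subgroup ?W V"
  proof (rule V.subgroupI)
    show "?W \<noteq> {}" using v by blast
    show "inv\<^bsub>V\<^esub> a \<in> ?W" if "a \<in> ?W" for a using that V.nat_pow_inv[of a p] by simp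
    show "a \<otimes>\<^bsub>V\<^esub> b \<in> ?W" if "a \<in> ?W" "b \<in> ?W" for a b using that by (simp add: V.nat_pow_distrib)
  qed blast
  then have "?W = {\<one>\<^bsub>V\<^esub>} \<or> ?W = carrier V"
  proof (rule irreducible)
    fix g w assume g: "g \<in> carrier G" and w: "w \<in> ?W"
    then have "act g (w [^]\<^bsub>V\<^esub> p) = act g w [^]\<^bsub>V\<^esub> p" using group_hom.hom_nat_pow[OF act_hom[OF g]] by blast
    then show "act g w \<in> ?W" using g w by simp
  qed
  then have "?W = carrier V" using v by blast
  then show ?thesis using p(1) by blast
qed

end

context irr_gmod begin

text \<open>The theorem asks for a vector space over a residue ring whose vectors are natural
  numbers, whereas a chief factor consists of cosets. The structure is transported along an
  enumeration, with repeated addition as scalar multiplication.\<close>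

lemma ex_nat_copy:
  fixes p :: nat
  assumes p: "Factorial_Ring.prime p" and exp: "\<And>v. v \<in> carrier V \<Longrightarrow> v [^]\<^bsub>V\<^esub> p = \<one>\<^bsub>V\<^esub>"
  shows "\<exists>(W :: (int, nat) module) act' \<tau>. prime_space p W \<and> irr_gmod G (add_monoid W) act' \<and>
    bij_betw \<tau> (carrier V) (carrier W) \<and>
    (\<forall>v\<in>carrier V. \<forall>w\<in>carrier V. \<tau> (v \<otimes>\<^bsub>V\<^esub> w) = \<tau> v \<oplus>\<^bsub>W\<^esub> \<tau> w) \<and>
    (\<forall>g\<in>carrier G. \<forall>v\<in>carrier V. \<tau> (act g v) = act' g (\<tau> v))"
proof -
  obtain \<tau> :: "'c \<Rightarrow> nat" where \<tau>: "bij_betw \<tau> (carrier V) {0..<card (carrier V)}"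
    using ex_bij_betw_finite_nat[OF finV] by blast
  define \<sigma> where "\<sigma> = inv_into (carrier V) \<tau>"
  have st: "\<sigma> (\<tau> v) = v" if "v \<in> carrier V" for v
    unfolding \<sigma>_def using bij_betw_inv_into_left[OF \<tau> that] .
  define W :: "(int, nat) module" where
    "W = \<lparr>carrier = \<tau> ` carrier V, monoid.mult = (\<lambda>a b. a), one = \<tau> \<one>\<^bsub>V\<^esub>, ring.zero = \<tau> \<one>\<^bsub>V\<^esub>,
      ring.add = (\<lambda>a b. \<tau> (\<sigma> a \<otimes>\<^bsub>V\<^esub> \<sigma> b)), smult = (\<lambda>r a. \<tau> (\<sigma> a [^]\<^bsub>V\<^esub> nat r))\<rparr>"
  have Wc: "carrier W = \<tau> ` carrier V" and Wz: "\<zero>\<^bsub>W\<^esub> = \<tau> \<one>\<^bsub>V\<^esub>" by (simp_all add: W_def)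
  have Wadd: "\<tau> v \<oplus>\<^bsub>W\<^esub> \<tau> w = \<tau> (v \<otimes>\<^bsub>V\<^esub> w)" if "v \<in> carrier V" "w \<in> carrier V" for v w
    using that by (simp add: W_def st)
  have Wsm: "r \<odot>\<^bsub>W\<^esub> \<tau> v = \<tau> (v [^]\<^bsub>V\<^esub> nat r)" if "v \<in> carrier V" for r v
    using that by (simp add: W_def st)
  have Win: "\<tau> v \<in> carrier W" if "v \<in> carrier V" for v using that Wc by blast
  have p1: "1 < p" by (rule prime_gt_1_nat[OF p])
  \<comment> \<open>Since \<open>V\<close> has exponent \<open>p\<close>, powers depend on the
    exponent modulo \<open>p\<close> only. This reconciles reduction in the residue ring with powers
    in \<open>V\<close>.\<close>
  have pmod: "v [^]\<^bsub>V\<^esub> (m mod p) = v [^]\<^bsub>V\<^esub> m" if v: "v \<in> carrier V" for v and m :: nat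
  proof -
    have "v [^]\<^bsub>V\<^esub> m = v [^]\<^bsub>V\<^esub> (p * (m div p) + m mod p)" by simp
    also have "\<dots> = v [^]\<^bsub>V\<^esub> (p * (m div p)) \<otimes>\<^bsub>V\<^esub> v [^]\<^bsub>V\<^esub> (m mod p)"
      by (rule V.nat_pow_mult[OF v, symmetric])
    also have "v [^]\<^bsub>V\<^esub> (p * (m div p)) = \<one>\<^bsub>V\<^esub>"
      using V.nat_pow_pow[OF v, of p "m div p"] exp[OF v] by simp
    finally show ?thesis using v by simp
  qed
  have "residues_prime p" using p by unfold_locales
  then have K: "field (residue_ring (int p))" by (rule residues_prime.is_field)
  have "vectorspace (residue_ring (int p)) W"
  proof (rule vs_criteria[OF K])
    show "\<zero>\<^bsub>W\<^esub> \<in> carrier W" by (simp add: Wz Win)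
    show "\<forall>a b. a \<in> carrier W \<and> b \<in> carrier W \<longrightarrow> a \<oplus>\<^bsub>W\<^esub> b \<in> carrier W"
      unfolding Wc by (auto simp: Wadd)
    show "\<forall>a\<in>carrier W. \<exists>b\<in>carrier W. a \<oplus>\<^bsub>W\<^esub> b = \<zero>\<^bsub>W\<^esub>"
    proof
      fix a assume "a \<in> carrier W"
      then obtain v where v: "v \<in> carrier V" "a = \<tau> v" unfolding Wc by blast
      have "a \<oplus>\<^bsub>W\<^esub> \<tau> (inv\<^bsub>V\<^esub> v) = \<zero>\<^bsub>W\<^esub>" using v by (simp add: Wadd Wz)
      then show "\<exists>b\<in>carrier W. a \<oplus>\<^bsub>W\<^esub> b = \<zero>\<^bsub>W\<^esub>" using Win[of "inv\<^bsub>V\<^esub> v"] v(1) by blast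
    qed
    show "\<forall>c a. c \<in> carrier (residue_ring (int p)) \<and> a \<in> carrier W \<longrightarrow> c \<odot>\<^bsub>W\<^esub> a \<in> carrier W"
      unfolding Wc by (auto simp: Wsm)
    show "\<forall>a b. a \<in> carrier W \<and> b \<in> carrier W \<longrightarrow> a \<oplus>\<^bsub>W\<^esub> b = b \<oplus>\<^bsub>W\<^esub> a"
      unfolding Wc by (auto simp: Wadd V.m_comm)
    show "\<forall>a b c. a \<in> carrier W \<and> b \<in> carrier W \<and> c \<in> carrier W \<longrightarrow>
        a \<oplus>\<^bsub>W\<^esub> b \<oplus>\<^bsub>W\<^esub> c = a \<oplus>\<^bsub>W\<^esub> (b \<oplus>\<^bsub>W\<^esub> c)"
      unfolding Wc by (auto simp: Wadd V.m_assoc)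
    show "\<forall>a\<in>carrier W. a \<oplus>\<^bsub>W\<^esub> \<zero>\<^bsub>W\<^esub> = a" unfolding Wc by (auto simp: Wadd Wz)
    show "\<forall>a\<in>carrier W. \<one>\<^bsub>residue_ring (int p)\<^esub> \<odot>\<^bsub>W\<^esub> a = a"
      unfolding Wc by (auto simp: Wsm residue_ring_def)
    show "\<forall>a b c. a \<in> carrier (residue_ring (int p)) \<and> b \<in> carrier (residue_ring (int p)) \<and> c \<in> carrier W \<longrightarrow>
        (a \<otimes>\<^bsub>residue_ring (int p)\<^esub> b) \<odot>\<^bsub>W\<^esub> c = a \<odot>\<^bsub>W\<^esub> (b \<odot>\<^bsub>W\<^esub> c)"
    proof (intro allI impI, elim conjE)
      fix a b c assume ab: "a \<in> carrier (residue_ring (int p))" "b \<in> carrier (residue_ring (int p))"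
        and "c \<in> carrier W"
      then obtain v where v: "v \<in> carrier V" "c = \<tau> v" unfolding Wc by blast
      have nn: "0 \<le> a" "0 \<le> b" using ab by (simp_all add: residue_ring_def)
      have "nat (a * b mod int p) = (nat b * nat a) mod p"
        using nn by (simp add: nat_mod_distrib nat_mult_distrib mult.commute)
      then show "(a \<otimes>\<^bsub>residue_ring (int p)\<^esub> b) \<odot>\<^bsub>W\<^esub> c = a \<odot>\<^bsub>W\<^esub> (b \<odot>\<^bsub>W\<^esub> c)"
        using v by (simp add: residue_ring_def Wsm pmod V.nat_pow_pow)
    qed
    show "\<forall>a b c. a \<in> carrier (residue_ring (int p)) \<and> b \<in> carrier (residue_ring (int p)) \<and> c \<in> carrier W \<longrightarrow>
        (a \<oplus>\<^bsub>residue_ring (int p)\<^esub> b) \<odot>\<^bsub>W\<^esub> c = a \<odot>\<^bsub>W\<^esub> c \<oplus>\<^bsub>W\<^esub> b \<odot>\<^bsub>W\<^esub> c"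
    proof (intro allI impI, elim conjE)
      fix a b c assume ab: "a \<in> carrier (residue_ring (int p))" "b \<in> carrier (residue_ring (int p))"
        and "c \<in> carrier W"
      then obtain v where v: "v \<in> carrier V" "c = \<tau> v" unfolding Wc by blast
      have nn: "0 \<le> a" "0 \<le> b" using ab by (simp_all add: residue_ring_def)
      have "nat ((a + b) mod int p) = (nat a + nat b) mod p"
        using nn by (simp add: nat_mod_distrib nat_add_distrib)
      then show "(a \<oplus>\<^bsub>residue_ring (int p)\<^esub> b) \<odot>\<^bsub>W\<^esub> c = a \<odot>\<^bsub>W\<^esub> c \<oplus>\<^bsub>W\<^esub> b \<odot>\<^bsub>W\<^esub> c"
        using v by (simp add: residue_ring_def Wsm Wadd pmod V.nat_pow_mult)
    qed
    show "\<forall>c a b. c \<in> carrier (residue_ring (int p)) \<and> a \<in> carrier W \<and> b \<in> carrier W \<longrightarrow>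
        c \<odot>\<^bsub>W\<^esub> (a \<oplus>\<^bsub>W\<^esub> b) = c \<odot>\<^bsub>W\<^esub> a \<oplus>\<^bsub>W\<^esub> c \<odot>\<^bsub>W\<^esub> b"
      unfolding Wc by (auto simp: Wadd Wsm V.nat_pow_distrib)
  qed
  then have ps: "prime_space p W" using p finV by (intro prime_space.intro) (simp_all add: Wc)
  interpret S: prime_space p W by (rule ps)
  have th: "group_hom V (add_monoid W) \<tau>"
    by (intro group_hom.intro V.is_group S.M.add.is_group, unfold group_hom_axioms_def, rule homI)
      (simp_all add: Wadd Win)
  define act' where "act' = (\<lambda>g a. \<tau> (act g (\<sigma> a)))"
  have act': "act' g (\<tau> v) = \<tau> (act g v)" if "v \<in> carrier V" for g v
    using that by (simp add: act'_def st)
  have "irr_gmod G (add_monoid W) act'"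
  proof (intro irr_gmod.intro gmod.intro gmod_axioms.intro irr_gmod_axioms.intro is_group S.A_comm_group finG)
    have el: "\<exists>v\<in>carrier V. a = \<tau> v" if "a \<in> carrier (add_monoid W)" for a using that Wc by auto
    show "finite (carrier (add_monoid W))" using S.fin by simp
    fix g a assume g: "g \<in> carrier G" and a: "a \<in> carrier (add_monoid W)"
    obtain v where v: "v \<in> carrier V" "a = \<tau> v" using el[OF a] by blast
    show "act' g a \<in> carrier (add_monoid W)" using v g by (simp add: act' Win)
    show "act' (g \<otimes> h) a = act' g (act' h a)" if h: "h \<in> carrier G" for h
      using v g h by (simp add: act' act_comp)
    fix b assume "b \<in> carrier (add_monoid W)"
    then obtain w where w: "w \<in> carrier V" "b = \<tau> w" using el by blast
    show "act' g (a \<otimes>\<^bsub>add_monoid W\<^esub> b) = act' g a \<otimes>\<^bsub>add_monoid W\<^esub> act' g b"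
      using v w g by (simp add: act' Wadd act_mult)
  next
    show "act' \<one> a = a" if a: "a \<in> carrier (add_monoid W)" for a
    proof -
      obtain v where "v \<in> carrier V" "a = \<tau> v" using a Wc by auto
      then show ?thesis by (simp add: act')
    qed
  next
    obtain v where v: "v \<in> carrier V" "v \<noteq> \<one>\<^bsub>V\<^esub>" using V_nontriv V.one_closed by blast
    have "\<tau> v \<noteq> \<tau> \<one>\<^bsub>V\<^esub>" using st[OF v(1)] st[OF V.one_closed] v(2) by metis
    then show "carrier (add_monoid W) \<noteq> {\<one>\<^bsub>add_monoid W\<^esub>}" using Win[OF v(1)] by (auto simp: Wz)
  next
    fix U assume U: "subgroup U (add_monoid W)"
      and inv: "\<And>g w. \<lbrakk>g \<in> carrier G; w \<in> U\<rbrakk> \<Longrightarrow> act' g w \<in> U"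
    have U_eq: "U = \<tau> ` {v \<in> carrier V. \<tau> v \<in> U}" using subgroup.subset[OF U] Wc by auto
    have "subgroup {v \<in> carrier V. \<tau> v \<in> U} V"
    proof (rule V.subgroupI)
      have "\<tau> \<one>\<^bsub>V\<^esub> \<in> U" using subgroup.one_closed[OF U] Wz by simp
      then show "{v \<in> carrier V. \<tau> v \<in> U} \<noteq> {}" by blast
      show "inv\<^bsub>V\<^esub> a \<in> {v \<in> carrier V. \<tau> v \<in> U}" if "a \<in> {v \<in> carrier V. \<tau> v \<in> U}" for a
        using group_hom.hom_inv[OF th, of a] subgroup.m_inv_closed[OF U, of "\<tau> a"] that by simp
      show "a \<otimes>\<^bsub>V\<^esub> b \<in> {v \<in> carrier V. \<tau> v \<in> U}"
        if "a \<in> {v \<in> carrier V. \<tau> v \<in> U}" "b \<in> {v \<in> carrier V. \<tau> v \<in> U}" for a b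
        using subgroup.m_closed[OF U, of "\<tau> a" "\<tau> b"] that by (simp add: Wadd)
    qed blast
    then have "{v \<in> carrier V. \<tau> v \<in> U} = {\<one>\<^bsub>V\<^esub>} \<or> {v \<in> carrier V. \<tau> v \<in> U} = carrier V"
    proof (rule irreducible)
      fix g w assume "g \<in> carrier G" "w \<in> {v \<in> carrier V. \<tau> v \<in> U}"
      then show "act g w \<in> {v \<in> carrier V. \<tau> v \<in> U}" using inv[of g "\<tau> w"] by (simp add: act')
    qed
    then show "U = {\<one>\<^bsub>add_monoid W\<^esub>} \<or> U = carrier (add_monoid W)"
    proof
      assume "{v \<in> carrier V. \<tau> v \<in> U} = {\<one>\<^bsub>V\<^esub>}"
      then show ?thesis using U_eq by (simp add: Wz)
    next
      assume "{v \<in> carrier V. \<tau> v \<in> U} = carrier V"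
      then show ?thesis using U_eq by (simp add: Wc)
    qed
  qed
  moreover have "bij_betw \<tau> (carrier V) (carrier W)"
    using \<tau> by (auto simp: bij_betw_def Wc)
  ultimately show ?thesis using ps Wadd act' by (intro exI[of _ W] exI[of _ act'] exI[of _ \<tau>]) simp
qed

end

section \<open>From a crown to the group V^k : H\<close>

context linear_action begin

definition rho :: "'g \<Rightarrow> 'v \<Rightarrow> 'v" where "rho g = (\<lambda>v\<in>carrier V. act g v)"

lemma rho_image: "rho ` carrier G = H" by (simp add: H_eq rho_def[abs_def])

lemma rho_Bij: assumes g: "g \<in> carrier G" shows "rho g \<in> Bij (carrier V)"
proof -
  have "bij_betw (rho g) (carrier V) (carrier V)"
    by (rule bij_betw_byWitness[where f' = "act (inv g)"])
      (use g act_closed act_inv_act act_act_inv in \<open>auto simp: rho_def\<close>)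
  then show ?thesis by (simp add: Bij_def rho_def)
qed

lemma rho_mult:
  assumes g: "g \<in> carrier G" and h: "h \<in> carrier G"
  shows "rho (g \<otimes> h) = compose (carrier V) (rho g) (rho h)"
  unfolding rho_def compose_def by (rule restrict_ext) (use g h act_comp act_closed in simp)

lemma rho_hom: "group_hom G (BijGroup (carrier V)) rho"
  by (intro group_hom.intro is_group group_BijGroup, unfold group_hom_axioms_def, rule homI)
    (simp_all add: BijGroup_simps rho_Bij rho_mult)

lemma rho_eq_id_iff: "g \<in> carrier G \<Longrightarrow> rho g = (\<lambda>v\<in>carrier V. v) \<longleftrightarrow> g \<in> actker"
proof
  assume "g \<in> carrier G" and eq: "rho g = (\<lambda>v\<in>carrier V. v)"
  have "act g v = v" if "v \<in> carrier V" for v using fun_cong[OF eq, of v] that by (simp add: rho_def)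
  then show "g \<in> actker" using \<open>g \<in> carrier G\<close> by (simp add: actker_def)
next
  assume "g \<in> actker"
  then show "rho g = (\<lambda>v\<in>carrier V. v)"
    unfolding rho_def by (intro restrict_ext) (simp add: actker_def)
qed

lemma irreducible_linear_group:
  assumes nt: "actker \<noteq> carrier G" shows "irreducible_linear_group p V H"
proof (intro irreducible_linear_group.intro prime_space_axioms irreducible_linear_group_axioms.intro)
  have sub: "subgroup H (BijGroup (carrier V))"
    using group_hom.img_is_subgroup[OF rho_hom] rho_image by simp
  have lin: "H \<subseteq> linear_bij K V"
  proof
    fix h assume "h \<in> H"
    then obtain g where g: "g \<in> carrier G" "h = rho g" using rho_image by blast
    have "rho g \<in> module_hom K V V"
      by (rule additive_imp_linear) (use g act_closed act_mult in \<open>simp_all add: rho_def\<close>)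
    then show "h \<in> linear_bij K V" using g rho_Bij by (simp add: linear_bij_def)
  qed
  show "subgroup H (Aut_space K V)" unfolding Aut_space_eq
    by (rule group.subgroup_incl[OF group_BijGroup sub linear_bij_subgroup[OF fin] lin])
  show "H \<noteq> {\<one>\<^bsub>Aut_space K V\<^esub>}"
  proof
    assume H1: "H = {\<one>\<^bsub>Aut_space K V\<^esub>}"
    have "g \<in> actker" if g: "g \<in> carrier G" for g
    proof -
      have "rho g \<in> H" using rho_image g by blast
      then have "rho g = (\<lambda>v\<in>carrier V. v)" unfolding H1 by (simp add: Aut_space_eq BijGroup_simps)
      then show ?thesis using rho_eq_id_iff[OF g] by simp
    qed
    then show False using nt actker_carrier by blast
  qed
  show "irreducible_linear K V H"
    unfolding irreducible_linear_def
  proof (intro conjI allI impI; (elim conjE)?)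
    show "carrier V \<noteq> {\<zero>\<^bsub>V\<^esub>}" using V_nontriv by simp
    fix W assume W: "VectorSpace.subspace K W V" and inv: "\<forall>h\<in>H. h ` W \<subseteq> W"
    have Wm: "W \<subseteq> carrier V" "\<zero>\<^bsub>V\<^esub> \<in> W" "\<And>v w. \<lbrakk>v \<in> W; w \<in> W\<rbrakk> \<Longrightarrow> v \<oplus>\<^bsub>V\<^esub> w \<in> W"
      using W by (auto simp: VectorSpace.subspace_def LinearCombinations.submodule_def)
    have "subgroup W A"
      by (rule M.add.finite_closed_imp_subgroup) (use fin Wm in simp_all)
    moreover have "act g w \<in> W" if g: "g \<in> carrier G" and w: "w \<in> W" for g w
    proof -
      have "rho g w \<in> W" using inv rho_image g w by blast
      then show ?thesis using w Wm(1) by (simp add: rho_def subsetD)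
    qed
    ultimately show "W = {\<zero>\<^bsub>V\<^esub>} \<or> W = carrier V" using irreducible[of W] by simp
  qed
qed

text \<open>An element is sent to its \<open>k\<close> coordinates together with its action on
  \<open>V\<close>. The derivation rule for the coordinates is the multiplication rule of the
  semidirect product.\<close>

lemma iso_power_split:
  assumes cr: "crown G A act k D"
  shows "G \<cong> power_split K V H k"
proof -
  interpret C: crown G A act k D by (rule cr)
  interpret I: irreducible_linear_group p V H by (rule irreducible_linear_group[OF C.act_nontriv])
  define f where "f = (\<lambda>g. (\<lambda>i\<in>{..<k}. D i g, rho g))"
  have rH: "rho g \<in> H" if "g \<in> carrier G" for g using rho_image that by blast
  have A_group: "group A" by (rule comm_group.axioms(2)[OF A_comm_group])
  have Dc: "D i g \<in> carrier V" if "i < k" "g \<in> carrier G" for i g using C.D_closed[OF that] by simp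
  have hom: "f \<in> hom G (I.P k)"
  proof (rule homI)
    show "f g \<in> carrier (I.P k)" if g: "g \<in> carrier G" for g
      using rH[OF g] Dc[OF _ g] by (simp add: f_def I.P_carrier)
    fix g h assume g: "g \<in> carrier G" and h: "h \<in> carrier G"
    have "(\<lambda>i\<in>{..<k}. D i (g \<otimes> h)) = (\<lambda>i\<in>{..<k}. (\<lambda>i\<in>{..<k}. D i g) i \<oplus>\<^bsub>V\<^esub> rho g ((\<lambda>i\<in>{..<k}. D i h) i))"
      by (rule restrict_ext) (use g h Dc Z1_mult[OF C.D_Z1 g h] in \<open>simp add: rho_def\<close>)
    then show "f (g \<otimes> h) = f g \<otimes>\<^bsub>I.P k\<^esub> f h"
      unfolding f_def I.P_mult[OF rH[OF g] rH[OF h]] rho_mult[OF g h] by simp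
  qed
  have gh: "group_hom G (I.P k) f"
    by (intro group_hom.intro is_group I.P_group, unfold group_hom_axioms_def) (rule hom)
  have "inj_on f (carrier G)"
    unfolding group_hom.inj_on_one_iff[OF gh]
  proof (intro allI impI)
    fix g assume g: "g \<in> carrier G" and "f g = \<one>\<^bsub>I.P k\<^esub>"
    then have eq: "(\<lambda>i\<in>{..<k}. D i g) = (\<lambda>i\<in>{..<k}. \<zero>\<^bsub>V\<^esub>)" "rho g = (\<lambda>v\<in>carrier V. v)"
      by (simp_all add: f_def I.P_one)
    have "D i g = \<one>\<^bsub>A\<^esub>" if "i < k" for i using fun_cong[OF eq(1), of i] that by simp
    then show "g = \<one>" using C.D_inj[of g] eq(2) rho_eq_id_iff[OF g] by blast
  qed
  moreover have "f ` carrier G = carrier (I.P k)"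
  proof
    show "f ` carrier G \<subseteq> carrier (I.P k)" using hom by (auto simp: hom_def)
    show "carrier (I.P k) \<subseteq> f ` carrier G"
    proof
      fix x assume "x \<in> carrier (I.P k)"
      then obtain u h where x: "x = (u, h)" "u \<in> {..<k} \<rightarrow>\<^sub>E carrier V" "h \<in> H"
        unfolding I.P_carrier by blast
      then obtain g where g: "g \<in> carrier G" "h = rho g" using rho_image by blast
      have uc: "u i \<in> carrier V" if "i < k" for i using x(2) that by (simp add: PiE_iff)
      \<comment> \<open>The element \<open>g\<close> already has the prescribed action;
        \<open>a\<close> supplies the missing difference of coordinates without altering that
        action.\<close>
      have "\<exists>a\<in>actker. \<forall>i<k. D i a = u i \<otimes>\<^bsub>A\<^esub> inv\<^bsub>A\<^esub> D i g"
        by (rule C.D_surj) (use uc Dc g in simp)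
      then obtain a where a: "a \<in> actker" "\<forall>i<k. D i a = u i \<otimes>\<^bsub>A\<^esub> inv\<^bsub>A\<^esub> D i g" by blast
      have ac: "a \<in> carrier G" by (rule actker_carrier[OF a(1)])
      have "(\<lambda>i\<in>{..<k}. D i (a \<otimes> g)) = restrict u {..<k}"
      proof (rule restrict_ext)
        fix i assume "i \<in> {..<k}"
        then have i: "i < k" by simp
        have "D i (a \<otimes> g) = u i \<otimes>\<^bsub>A\<^esub> inv\<^bsub>A\<^esub> D i g \<otimes>\<^bsub>A\<^esub> D i g"
          using Z1_actker_mult[OF C.D_Z1[OF i] a(1) g(1)] a(2) i by simp
        also have "\<dots> = u i \<otimes>\<^bsub>A\<^esub> (inv\<^bsub>A\<^esub> D i g \<otimes>\<^bsub>A\<^esub> D i g)"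
          by (rule group.is_monoid[OF A_group, THEN monoid.m_assoc]) (use uc[OF i] Dc[OF i g(1)] in simp_all)
        also have "\<dots> = u i" using uc[OF i] Dc[OF i g(1)] group.l_inv[OF A_group, of "D i g"] by simp
        finally show "D i (a \<otimes> g) = u i" .
      qed
      moreover have "restrict u {..<k} = u" by (rule PiE_restrict[OF x(2)])
      moreover have "rho (a \<otimes> g) = rho g"
        unfolding rho_def
        by (rule restrict_ext) (use act_comp[OF ac g(1)] actker_act[OF a(1)] act_closed[OF g(1)] in simp)
      ultimately have "x = f (a \<otimes> g)" using x(1) g(2) by (simp add: f_def)
      then show "x \<in> f ` carrier G" using m_closed[OF ac g(1)] by blast
    qed
  qed
  ultimately have "f \<in> iso G (I.P k)" using hom by (simp add: iso_def bij_betw_def)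
  then show ?thesis unfolding is_iso_def by blast
qed

end

locale extendable_linear = linear_action p V G act H + extendable G "add_monoid V" act N \<pi> n
  for p :: nat and V :: "(int, 'v, 'e) module_scheme"
    and G :: "('g, 'x) monoid_scheme" (structure) and act :: "'g \<Rightarrow> 'v \<Rightarrow> 'v" and H :: "('v \<Rightarrow> 'v) set"
    and N :: "'g set" and \<pi> :: "'g \<Rightarrow> 'v" and n :: nat
begin

lemma rho_hom_image:
  assumes nt: "actker \<noteq> carrier G" shows "group_hom G (Aut_space K V\<lparr>carrier := H\<rparr>) rho"
proof -
  interpret I: irreducible_linear_group p V H by (rule irreducible_linear_group[OF nt])
  have rH: "rho g \<in> H" if "g \<in> carrier G" for g using rho_image that by blast
  show "group_hom G I.HG rho"
  proof (intro group_hom.intro is_group I.HG_group, unfold group_hom_axioms_def, rule homI)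
    show "rho g \<in> carrier I.HG" if "g \<in> carrier G" for g using rH[OF that] by simp
    show "rho (g \<otimes> h) = rho g \<otimes>\<^bsub>I.HG\<^esub> rho h" if "g \<in> carrier G" "h \<in> carrier G" for g h
      using rho_mult[OF that] I.HG_simps(3)[OF rH[OF that(1)] rH[OF that(2)]] by simp
  qed
qed

text \<open>The normal subgroup \<open>N\<close> acts trivially, so \<open>n\<close> elements
  generating \<open>G\<close> modulo \<open>N\<close> have images that generate
  \<open>H\<close>.\<close>

lemma min_gens_image_le:
  assumes nt: "actker \<noteq> carrier G"
  shows "min_gens (Aut_space K V\<lparr>carrier := H\<rparr>) \<le> n"
proof -
  interpret I: irreducible_linear_group p V H by (rule irreducible_linear_group[OF nt])
  interpret R: group_hom G I.HG rho by (rule rho_hom_image[OF nt])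
  obtain ys where ys: "set ys \<subseteq> carrier G" "length ys = n" "generate G (set ys \<union> N) = carrier G"
    using K_generators by blast
  let ?L = "generate I.HG (rho ` set ys)"
  have yH: "rho ` set ys \<subseteq> carrier I.HG" using ys(1) R.hom_closed by blast
  have L: "subgroup ?L I.HG" by (rule R.H.generate_is_subgroup[OF yH])
  have sub: "set ys \<union> N \<subseteq> carrier G" using ys(1) K_carrier by blast
  have "rho ` (set ys \<union> N) \<subseteq> ?L"
  proof
    fix x assume "x \<in> rho ` (set ys \<union> N)"
    then consider "x \<in> rho ` set ys" | a where "a \<in> N" "x = rho a" by blast
    then show "x \<in> ?L"
    proof cases
      case 1
      then show ?thesis by (rule generate.incl)
    next
      case 2
      then have "x = \<one>\<^bsub>I.HG\<^esub>"
        using rho_eq_id_iff[OF K_carrier[OF 2(1)]] K_actker I.HG_simps(2) by auto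
      then show ?thesis using subgroup.one_closed[OF L] by simp
    qed
  qed
  then have "generate I.HG (rho ` (set ys \<union> N)) \<subseteq> ?L"
    by (rule R.H.generate_subgroup_incl[OF _ L])
  then have "carrier I.HG \<subseteq> ?L"
    using R.generate_img[OF sub] ys(3) rho_image by simp
  then have "?L = carrier I.HG" using subgroup.subset[OF L] by (rule_tac subset_antisym)
  then have "set (map rho ys) \<subseteq> carrier I.HG \<and> length (map rho ys) = n \<and>
      generate I.HG (set (map rho ys)) = carrier I.HG"
    using yH ys(2) by simp
  moreover have "finite (carrier I.HG)" using I.finite_H by simp
  ultimately show ?thesis using R.H.min_gens_le_iff by blast
qed

lemma solvable_image:
  assumes nt: "actker \<noteq> carrier G" and sol: "solvable G"
  shows "solvable (Aut_space K V\<lparr>carrier := H\<rparr>)"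
proof -
  interpret I: irreducible_linear_group p V H by (rule irreducible_linear_group[OF nt])
  interpret R: group_hom G I.HG rho by (rule rho_hom_image[OF nt])
  show ?thesis
    using R.solvable_imp_solvable_img[of "carrier G"] sol rho_image unfolding solvable_def by simp
qed

theorem quotient_power_split:
  assumes nt: "actker \<noteq> carrier G" and sol: "solvable G"
  shows "G \<cong> power_split K V H (End_dim K V H * (Suc n - 2) + 1)"
proof -
  interpret I: irreducible_linear_group p V H by (rule irreducible_linear_group[OF nt])
  obtain k D where cr: "crown G A act k D"
    using ex_crown[OF sol prime _ nt] exponent_p by auto
  interpret C: crown G A act k D by (rule cr)
  let ?r = "End_dim K V H"
  \<comment> \<open>Nontriviality of \<open>H\<close> gives \<open>n \<ge> 1\<close>, so
    \<open>Suc n - 2\<close> is \<open>n - 1\<close> without truncation.\<close>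
  have "min_gens I.HG \<noteq> 0"
    using group.min_gens_eq_0_iff[OF I.HG_group] I.finite_H I.H_nontriv by simp
  then obtain m where m: "n = Suc m" using min_gens_image_le[OF nt] by (cases n) auto
  have "card Endo ^ k * card (carrier A) = card Endo * card (carrier A) ^ n"
    using C.card_Z1 card_Z1_eq by simp
  then have "card Endo ^ (k + ?r) = card Endo ^ (1 + ?r * n)"
    using card_eq_power_End_dim by (simp add: power_add power_mult)
  then have "k + ?r = 1 + ?r * n" 
    by (rule power_inject_exp[THEN iffD1, rotated]) (use card_Endo_ge_2 in simp)
  then have "k = ?r * (Suc n - 2) + 1" unfolding m by simp
  then show ?thesis using iso_power_split[OF cr] by simp
qed

end

text \<open>The witness for \<open>d\<close> is \<open>min_gens G\<close> itself. It exceeds the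
  number of generators of \<open>H\<close>, because one entry of a generating tuple may be chosen in
  a minimal normal subgroup acting trivially.\<close>

theorem (in group) psi_eq_min_gens_imp:
  assumes finG: "finite (carrier G)" and sol: "solvable G" and eq: "psi G = min_gens G"
  shows "(\<exists>p n. Factorial_Ring.prime (p::nat) \<and> n \<ge> 1 \<and> order G = p ^ n) \<or>
    (\<exists>(p::nat) (V :: (int, nat) module) H d.
       Factorial_Ring.prime p \<and>
       vectorspace (residue_ring (int p)) V \<and> finite (carrier V) \<and>
       subgroup H (Aut_space (residue_ring (int p)) V) \<and>
       H \<noteq> {\<one>\<^bsub>Aut_space (residue_ring (int p)) V\<^esub>} \<and>
       irreducible_linear (residue_ring (int p)) V H \<and>
       solvable (Aut_space (residue_ring (int p)) V \<lparr>carrier := H\<rparr>) \<and>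
       d > min_gens (Aut_space (residue_ring (int p)) V \<lparr>carrier := H\<rparr>) \<and>
       (G Mod frattini G) \<cong>
         power_split (residue_ring (int p)) V H
           (End_dim (residue_ring (int p)) V H * (d - 2) + 1))"
proof -
  let ?Q = "G Mod frattini G" and ?\<phi> = "\<lambda>g. frattini G #> g"
  interpret Q: group_hom G ?Q ?\<phi> by (rule r_coset_group_hom[OF frattini_normal])
  have Qc: "?\<phi> ` carrier G = carrier ?Q" by (rule carrier_FactGroup[symmetric])
  have finQ: "finite (carrier ?Q)" unfolding Qc[symmetric] using finG by (rule finite_imageI)
  have ker: "kernel G ?Q ?\<phi> \<subseteq> frattini G"
    using rcos_self[OF _ frattini_subgroup] by (auto simp: kernel_def)
  define n where "n = min_gens G - 1"
  have "min_gens G \<ge> 1" by (rule psi_eq_min_gensD(1)[OF finG eq])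
  then have mG: "min_gens G = Suc n" by (simp add: n_def)
  have mQ: "min_gens ?Q = Suc n" using Q.min_gens_image_eq[OF finG Qc ker] mG by simp
  have solQ: "solvable ?Q"
    using Q.solvable_imp_solvable_img[of "carrier G"] sol Qc unfolding solvable_def by simp
  have nt: "{\<one>\<^bsub>?Q\<^esub>} \<noteq> carrier ?Q" using Q.H.min_gens_eq_0_iff[OF finQ] mQ by auto
  have ext: "\<exists>zs. set zs \<subseteq> carrier ?Q \<and> length zs = n \<and> generate ?Q (insert x (set zs)) = carrier ?Q"
    if x: "x \<in> carrier ?Q" "x \<noteq> \<one>\<^bsub>?Q\<^esub>" for x
  proof -
    have "x \<in> ?\<phi> ` carrier G" unfolding Qc by (rule x(1))
    then obtain g where g: "g \<in> carrier G" "x = ?\<phi> g" by blast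
    have "g \<notin> frattini G"
    proof
      assume "g \<in> frattini G"
      then have "?\<phi> g = \<one>\<^bsub>?Q\<^esub>" using coset_join2[OF g(1) frattini_subgroup] by simp
      then show False using x(2) g(2) by simp
    qed
    from psi_eq_min_gensD(2)[OF finG eq g(1) this]
    obtain zs where zs: "set zs \<subseteq> carrier G" "length zs = n" "generate G (insert g (set zs)) = carrier G"
      unfolding n_def by (elim exE conjE)
    have sub: "insert g (set zs) \<subseteq> carrier G" using g(1) zs(1) by blast
    have "generate ?Q (?\<phi> ` insert g (set zs)) = carrier ?Q"
      using Q.generate_image_eq_iff[OF finG Qc ker sub] zs(3) by simp
    moreover have "set (map ?\<phi> zs) \<subseteq> carrier ?Q" unfolding Qc[symmetric] using zs(1) by auto
    ultimately show ?thesis using zs(2) g(2) by (intro exI[of _ "map ?\<phi> zs"]) simp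
  qed
  have ng: "generate ?Q (set zs) \<noteq> carrier ?Q" if "set zs \<subseteq> carrier ?Q" "length zs = n" for zs
  proof
    assume "generate ?Q (set zs) = carrier ?Q"
    then have "min_gens ?Q \<le> n" using Q.H.min_gens_le_iff[OF finQ, of n] that by blast
    then show False using mQ by simp
  qed
  \<comment> \<open>A chief factor above the trivial subgroup is a minimal normal subgroup. Cosets
    of the trivial subgroup are singletons, so the coset map is injective, as
    \<open>extendable\<close> demands.\<close>
  obtain N where N: "N \<lhd> ?Q" "{\<one>\<^bsub>?Q\<^esub>} \<subset> N"
      "\<forall>a\<in>N. \<forall>b\<in>N. {\<one>\<^bsub>?Q\<^esub>} #>\<^bsub>?Q\<^esub> (a \<otimes>\<^bsub>?Q\<^esub> b) = {\<one>\<^bsub>?Q\<^esub>} #>\<^bsub>?Q\<^esub> (b \<otimes>\<^bsub>?Q\<^esub> a)"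
      "\<forall>N'. N' \<lhd> ?Q \<and> {\<one>\<^bsub>?Q\<^esub>} \<subseteq> N' \<and> N' \<subseteq> N \<longrightarrow> N' = {\<one>\<^bsub>?Q\<^esub>} \<or> N' = N"
    using Q.H.exists_abelian_chief_factor[OF finQ solQ Q.H.one_is_normal nt] by (elim exE conjE)
  have "\<exists>(V :: 'a set set monoid) act. irr_gmod_chief ?Q V act N (\<lambda>a. {\<one>\<^bsub>?Q\<^esub>} #>\<^bsub>?Q\<^esub> a) \<and>
      (\<forall>k\<in>N. {\<one>\<^bsub>?Q\<^esub>} #>\<^bsub>?Q\<^esub> k = \<one>\<^bsub>V\<^esub> \<longleftrightarrow> k \<in> {\<one>\<^bsub>?Q\<^esub>})"
    by (rule Q.H.chief_factor_module[OF finQ Q.H.one_is_normal N(1,2)]) (use N(3) in blast, use N(4) in blast)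
  then obtain V :: "'a set set monoid" and act where
    ch: "irr_gmod_chief ?Q V act N (\<lambda>a. {\<one>\<^bsub>?Q\<^esub>} #>\<^bsub>?Q\<^esub> a)"
    and pk: "\<forall>k\<in>N. {\<one>\<^bsub>?Q\<^esub>} #>\<^bsub>?Q\<^esub> k = \<one>\<^bsub>V\<^esub> \<longleftrightarrow> k \<in> {\<one>\<^bsub>?Q\<^esub>}" by (elim exE conjE)
  define \<pi> where "\<pi> = (\<lambda>a. {\<one>\<^bsub>?Q\<^esub>} #>\<^bsub>?Q\<^esub> a)"
  interpret M: irr_gmod_chief ?Q V act N \<pi> unfolding \<pi>_def by (rule ch)
  obtain p :: nat where p: "Factorial_Ring.prime p" "\<And>v. v \<in> carrier V \<Longrightarrow> v [^]\<^bsub>V\<^esub> p = \<one>\<^bsub>V\<^esub>"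
    using M.ex_exponent_prime by blast
  obtain W :: "(int, nat) module" and act' \<tau> where W: "prime_space p W" "irr_gmod ?Q (add_monoid W) act'"
      "bij_betw \<tau> (carrier V) (carrier W)"
    and \<tau>_add: "\<And>v w. \<lbrakk>v \<in> carrier V; w \<in> carrier V\<rbrakk> \<Longrightarrow> \<tau> (v \<otimes>\<^bsub>V\<^esub> w) = \<tau> v \<oplus>\<^bsub>W\<^esub> \<tau> w"
    and \<tau>_act: "\<And>g v. \<lbrakk>g \<in> carrier ?Q; v \<in> carrier V\<rbrakk> \<Longrightarrow> \<tau> (act g v) = act' g (\<tau> v)"
    using M.ex_nat_copy[OF p] by blast
  interpret S: prime_space p W by (rule W(1))
  interpret I: irr_gmod ?Q "add_monoid W" act' by (rule W(2))
  define H where "H = (\<lambda>g. \<lambda>v\<in>carrier W. act' g v) ` carrier ?Q"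
  have \<tau>_hom: "group_hom V (add_monoid W) \<tau>"
    by (intro group_hom.intro M.V.is_group comm_group.axioms(2)[OF S.A_comm_group], unfold group_hom_axioms_def, rule homI)
      (use \<tau>_add bij_betwE[OF W(3)] in simp_all)
  have lin: "linear_action p W ?Q act' H"
    by (intro linear_action.intro W(1,2) linear_action_axioms.intro) (rule H_def)
  have chief: "irr_gmod_chief ?Q (add_monoid W) act' N (\<lambda>a. \<tau> (\<pi> a))"
  proof (intro irr_gmod_chief.intro gmod_chief.intro W(2) I.gmod_axioms gmod_chief_axioms.intro M.K_normal)
    show "\<tau> (\<pi> (a \<otimes>\<^bsub>?Q\<^esub> b)) = \<tau> (\<pi> a) \<otimes>\<^bsub>add_monoid W\<^esub> \<tau> (\<pi> b)" if "a \<in> N" "b \<in> N" for a b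
      using M.pi_mult[OF that] \<tau>_add[OF M.pi_closed[OF that(1)] M.pi_closed[OF that(2)]] by simp
    show "(\<lambda>a. \<tau> (\<pi> a)) ` N = carrier (add_monoid W)"
      using M.pi_surj bij_betw_imp_surj_on[OF W(3)] by (simp add: image_image[symmetric])
    show "\<tau> (\<pi> (g \<otimes>\<^bsub>?Q\<^esub> k \<otimes>\<^bsub>?Q\<^esub> inv\<^bsub>?Q\<^esub> g)) = act' g (\<tau> (\<pi> k))" if "g \<in> carrier ?Q" "k \<in> N" for g k
      using M.pi_conj[OF that] \<tau>_act[OF that(1) M.pi_closed[OF that(2)]] by simp
  qed
  have exl: "extendable ?Q (add_monoid W) act' N (\<lambda>a. \<tau> (\<pi> a)) n"
  proof (intro extendable.intro chief extendable_axioms.intro ext ng)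
    fix a assume a: "a \<in> N" and "\<tau> (\<pi> a) = \<one>\<^bsub>add_monoid W\<^esub>"
    then have "\<tau> (\<pi> a) = \<tau> \<one>\<^bsub>V\<^esub>" using group_hom.hom_one[OF \<tau>_hom] by simp
    then have "\<pi> a = \<one>\<^bsub>V\<^esub>"
      by (rule inj_onD[OF bij_betw_imp_inj_on[OF W(3)] _ M.pi_closed[OF a] M.V.one_closed])
    then show "a = \<one>\<^bsub>?Q\<^esub>" using bspec[OF pk a] unfolding \<pi>_def by blast
  qed
  interpret E: extendable_linear p W ?Q act' H N "\<lambda>a. \<tau> (\<pi> a)" n
    by (intro extendable_linear.intro lin exl)
  show ?thesis
  proof (cases "I.actker = carrier ?Q")
    case True
    obtain m where "order ?Q = p ^ m"
      using E.order_prime_power_if_central[OF p(1) _ True] S.exponent_p by auto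
    then obtain l where l: "order G = p ^ l" using p_group_if_frattini_quotient[OF finG p(1)] by blast
    \<comment> \<open>The trivial group is excluded because \<open>psi\<close>, and with it
      \<open>min_gens G\<close>, is at least 1.\<close>
    have "l \<noteq> 0"
    proof
      assume "l = 0"
      then have "card (carrier G) = 1" using l by (simp add: Coset.order_def)
      then obtain z where "carrier G = {z}" by (rule card_1_singletonE)
      then have "carrier G = {\<one>}" using one_closed by simp
      then show False using min_gens_eq_0_iff[OF finG] mG by simp
    qed
    then show ?thesis using l p(1) by (intro disjI1 exI[of _ p] exI[of _ l]) simp
  next
    case False
    interpret L: irreducible_linear_group p W H by (rule E.irreducible_linear_group[OF False])
    show ?thesis
    proof (rule disjI2, intro exI conjI)
      show "Factorial_Ring.prime p" by (rule p(1))
      show "vectorspace (residue_ring (int p)) W" by (rule S.vs)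
      show "finite (carrier W)" by (rule S.fin)
      show "subgroup H (Aut_space (residue_ring (int p)) W)" by (rule L.H_subgroup)
      show "H \<noteq> {\<one>\<^bsub>Aut_space (residue_ring (int p)) W\<^esub>}" by (rule L.H_nontriv)
      show "irreducible_linear (residue_ring (int p)) W H" by (rule L.H_irr)
      show "solvable (Aut_space (residue_ring (int p)) W\<lparr>carrier := H\<rparr>)"
        by (rule E.solvable_image[OF False solQ])
      show "min_gens (Aut_space (residue_ring (int p)) W\<lparr>carrier := H\<rparr>) < Suc n"
        using E.min_gens_image_le[OF False] by (rule le_imp_less_Suc)
      show "?Q \<cong> power_split (residue_ring (int p)) W H
          (End_dim (residue_ring (int p)) W H * (Suc n - 2) + 1)"
        by (rule E.quotient_power_split[OF False solQ])
    qed
  qed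
qed

theorem theorem2p21:
  fixes G :: "('a, 'b) monoid_scheme"
  assumes "group G" and "finite (carrier G)" and "solvable G"
  shows "psi G = min_gens G \<longleftrightarrow>
    (\<exists>p n. Factorial_Ring.prime (p::nat) \<and> n \<ge> 1 \<and> order G = p ^ n) \<or>
    (\<exists>(p::nat) (V :: (int, nat) module) H d.
       Factorial_Ring.prime p \<and>
       vectorspace (residue_ring (int p)) V \<and> finite (carrier V) \<and>
       subgroup H (Aut_space (residue_ring (int p)) V) \<and>
       H \<noteq> {\<one>\<^bsub>Aut_space (residue_ring (int p)) V\<^esub>} \<and>
       irreducible_linear (residue_ring (int p)) V H \<and>
       solvable (Aut_space (residue_ring (int p)) V \<lparr>carrier := H\<rparr>) \<and>
       d > min_gens (Aut_space (residue_ring (int p)) V \<lparr>carrier := H\<rparr>) \<and>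
       (G Mod frattini G) \<cong>
         power_split (residue_ring (int p)) V H
           (End_dim (residue_ring (int p)) V H * (d - 2) + 1))"
    (is "_ \<longleftrightarrow> ?p_group \<or> ?split")
proof
  interpret group G by (rule assms(1))
  assume "psi G = min_gens G"
  then show "?p_group \<or> ?split" by (rule psi_eq_min_gens_imp[OF assms(2,3)])
next
  interpret group G by (rule assms(1))
  assume "?p_group \<or> ?split"
  then show "psi G = min_gens G"
  proof (elim disjE)
    assume ?p_group
    then obtain p n where pn: "Factorial_Ring.prime (p::nat)" "n \<ge> 1" "order G = p ^ n" by blast
    \<comment> \<open>The condition \<open>n \<ge> 1\<close> keeps out the trivial group, for which
      \<open>psi\<close> and \<open>min_gens\<close> differ.\<close>
    have "1 < order G" unfolding pn(3) using pn(2) by (intro one_less_power prime_gt_1_nat[OF pn(1)]) simp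
    then have "carrier G \<noteq> {\<one>\<^bsub>G\<^esub>}" by (auto simp: Coset.order_def)
    then show ?thesis
      using psi_eq_min_gensI[OF assms(2)] p_group_gen_over_maximal[OF pn(1,3)] by blast
  next
    assume ?split
    then obtain p :: nat and V :: "(int, nat) module" and H d where
      ps: "Factorial_Ring.prime p" "vectorspace (residue_ring (int p)) V" "finite (carrier V)"
      and H: "subgroup H (Aut_space (residue_ring (int p)) V)"
        "H \<noteq> {\<one>\<^bsub>Aut_space (residue_ring (int p)) V\<^esub>}" "irreducible_linear (residue_ring (int p)) V H"
      and d: "min_gens (Aut_space (residue_ring (int p)) V \<lparr>carrier := H\<rparr>) < d"
      and iso: "(G Mod frattini G) \<cong> power_split (residue_ring (int p)) V H
           (End_dim (residue_ring (int p)) V H * (d - 2) + 1)"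
      by (elim exE conjE)
    interpret L: irreducible_linear_group p V H
      by (intro irreducible_linear_group.intro prime_space.intro irreducible_linear_group_axioms.intro ps H)
    show ?thesis by (rule L.psi_eq_min_gens_if_quotient_iso[OF assms d iso])
  qed
qed

end
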